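(* Let $(f_\alpha,E,B)$, $1\le\alpha\le N$, be an admissible solution of the relativistic Vlasov–Maxwell system (as defined in the context), and let $Q_\infty=\sum_{1\le\alpha\le N}e_\alpha m_\alpha^3Q^\alpha_\infty$ be its asymptotic charge function. Assume that $Q_\infty$ is not identically zero. Then there exists $\alpha\in\{1,\dots,N\}$ such that $f_\alpha$ does not satisfy a linear scattering dynamic; that is, for this $\alpha$ there exists no function $g_{\alpha\infty}\in L^1(\mathbb{R}^3_x\times\mathbb{R}^3_v)$ such that $$\lim_{t\to+\infty}\int_{\mathbb{R}^3_x\times\mathbb{R}^3_v}\big|f_\alpha(tv^0_\alpha,\,x+tv,\,v)-g_{\alpha\infty}(x,v)\big|\,\mathrm{d}x\,\mathrm{d}v=0 .$$
   Context: **System.** Fix $N\ge2$, masses $m_\alpha>0$ and charges $e_\alpha\in\mathbb{R}\setminus\{0\}$, $1\le\alpha\le N$. For $v\in\mathbb{R}^3$ write $v_\alpha:=v/m_\alpha$, $v^0_\alpha:=\sqrt{m_\alpha^2+|v|^2}$, $\widehat{v_\alpha}:=v/v^0_\alpha$. The relativistic Vlasov–Maxwell system for $f_\alpha(t,x,v)$, $E(t,x)\in\mathbb{R}^3$, $B(t,x)\in\mathbb{R}^3$ is $$\partial_tf_\alpha+\widehat{v_\alpha}\cdot\nabla_xf_\alpha+e_\alpha(E+\widehat{v_\alpha}\times B)\cdot\nabla_vf_\alpha=0\quad(1\le\alpha\le N),$$ $$\partial_tE=\nabla\times B-4\pi j,\quad\nabla\cdot E=4\pi\rho,\quad\partial_tB=-\nabla\times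 E,\quad\nabla\cdot B=0,$$ with $\rho=\sum_\alpha e_\alpha\int_{\mathbb{R}^3}f_\alpha\,\mathrm{d}v$ and $j=\sum_\alpha e_\alpha\int_{\mathbb{R}^3}\widehat{v_\alpha}f_\alpha\,\mathrm{d}v$. **Admissible solution.** A $C^1$ solution $(f_\alpha,E,B)$ on $t\ge0$, with initial data $f_{\alpha0}=f_\alpha(0,\cdot)$, $(E_0,B_0)=(E,B)(0,\cdot)$, is called admissible if there are $k>0$ and $C_0>0$ such that: (i) the $f_{\alpha0}$ are nonnegative $C^1$ functions supported in $\{|x|\le k,\ |v|\le k\}$; $E_0,B_0$ are $C^1$, supported in $\{|x|\le k\}$, and $\nabla\cdot E_0=4\pi\sum_\alpha e_\alpha\int f_{\alpha0}\,\mathrm{d}v$, $\nabla\cdot B_0=0$, $\sum_\alpha e_\alpha\int_{\mathbb{R}^3_x\times\mathbb{R}^3_v}f_{\alpha0}\,\mathrm{d}v\,\mathrm{d}x=0$; (ii) for all $t\ge0$ and all $x$ with $|x|\le t+k$ (the fields vanish for $|x|>t+k$ by finite speed of propagation), $$|(E,B)(t,x)|\le\frac{C_0}{(t+|x|+2k)(t-|x|+2k)},\qquad|\nabla_x(E,B)(t,x)|\le\frac{C_0\log(t+|x|+2k)}{(t+|x|+2k)(t-|x|+2k)^2}.$$ **Asymptotic charge.** It is known that for any admissible solution and any $\alpha$ there is a (unique) $Q^\alpha_\infty\in C^0_c(\mathbb{R}^3)$ and a constant $C>0$ such that for all $t\ge0$, $v\in\mathbb{R}^3$, $$\Big|\int_{\mathbb{R}^3_x}f_\alpha(t,x,v)\,\mathrm{d}x-Q^\alpha_\infty(v/m_\alpha)\Big|\le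 C\,\frac{\log^5(2+t)}{2+t}.$$ The asymptotic charge function is $Q_\infty:=\sum_{1\le\alpha\le N}e_\alpha m_\alpha^3Q^\alpha_\infty$. *)

theory Defs
  imports "HOL-Analysis.Analysis"
begin

section \<open>Vector calculus\<close>

text \<open>
  Intended for sets such as \<open>{0..} \<times> UNIV\<close>, on which the derivative within \<open>S\<close> is unique
  (one-sided in time on the boundary).
\<close>
definition C1_on :: "'a::real_normed_vector set \<Rightarrow> ('a \<Rightarrow> 'b::real_normed_vector) \<Rightarrow> bool" where
  "C1_on S F \<longleftrightarrow> (\<exists>F' :: 'a \<Rightarrow> 'a \<Rightarrow>\<^sub>L 'b.
     (\<forall>z\<in>S. (F has_derivative blinfun_apply (F' z)) (at z within S)) \<and> continuous_on S F')"

definition time_deriv :: "(real \<Rightarrow> 'a::real_normed_vector) \<Rightarrow> real \<Rightarrow> 'a" where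
  "time_deriv h t = vector_derivative h (at t within {0..})"

definition grad :: "(real^3 \<Rightarrow> real) \<Rightarrow> real^3 \<Rightarrow> real^3" where
  "grad h x = (\<chi> i. frechet_derivative h (at x) (axis i 1))"

text \<open>\<open>jacobian F (at x) $ i $ j\<close> is the derivative of the \<open>i\<close>-th component of \<open>F\<close> in direction \<open>j\<close>.\<close>

definition divergence :: "(real^3 \<Rightarrow> real^3) \<Rightarrow> real^3 \<Rightarrow> real" where
  "divergence F x = trace (jacobian F (at x))"

definition curl :: "(real^3 \<Rightarrow> real^3) \<Rightarrow> real^3 \<Rightarrow> real^3" where
  "curl F x = (let J = jacobian F (at x) in
     vector [J$3$2 - J$2$3, J$1$3 - J$3$1, J$2$1 - J$1$2])"


section \<open>The relativistic Vlasov--Maxwell system\<close>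

text \<open>
  Species are indexed by \<open>{1..N}\<close>. The functions \<open>f \<alpha>\<close>, \<open>E\<close>, \<open>B\<close> take the time as first argument;
  their values at negative times are irrelevant.
\<close>

definition energy :: "real \<Rightarrow> real^3 \<Rightarrow> real" where
  "energy \<mu> v = sqrt (\<mu>\<^sup>2 + (norm v)\<^sup>2)"

definition velocity :: "real \<Rightarrow> real^3 \<Rightarrow> real^3" where
  "velocity \<mu> v = v /\<^sub>R energy \<mu> v"

definition charge_density ::
  "nat \<Rightarrow> (nat \<Rightarrow> real) \<Rightarrow> (nat \<Rightarrow> real \<Rightarrow> real^3 \<Rightarrow> real^3 \<Rightarrow> real) \<Rightarrow> real \<Rightarrow> real^3 \<Rightarrow> real" where
  "charge_density N e f t x = (\<Sum>\<alpha>=1..N. e \<alpha> * (LINT v|lborel. f \<alpha> t x v))"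

definition current_density ::
  "nat \<Rightarrow> (nat \<Rightarrow> real) \<Rightarrow> (nat \<Rightarrow> real) \<Rightarrow> (nat \<Rightarrow> real \<Rightarrow> real^3 \<Rightarrow> real^3 \<Rightarrow> real)
    \<Rightarrow> real \<Rightarrow> real^3 \<Rightarrow> real^3" where
  "current_density N m e f t x =
     (\<Sum>\<alpha>=1..N. e \<alpha> *\<^sub>R (LINT v|lborel. f \<alpha> t x v *\<^sub>R velocity (m \<alpha>) v))"

definition vlasov_maxwell_solution ::
  "nat \<Rightarrow> (nat \<Rightarrow> real) \<Rightarrow> (nat \<Rightarrow> real) \<Rightarrow> (nat \<Rightarrow> real \<Rightarrow> real^3 \<Rightarrow> real^3 \<Rightarrow> real)
    \<Rightarrow> (real \<Rightarrow> real^3 \<Rightarrow> real^3) \<Rightarrow> (real \<Rightarrow> real^3 \<Rightarrow> real^3) \<Rightarrow> bool" where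
  "vlasov_maxwell_solution N m e f E B \<longleftrightarrow>
     (\<forall>\<alpha>\<in>{1..N}. C1_on ({0..} \<times> UNIV) (\<lambda>(t, x, v). f \<alpha> t x v)) \<and>
     C1_on ({0..} \<times> UNIV) (\<lambda>(t, x). E t x) \<and>
     C1_on ({0..} \<times> UNIV) (\<lambda>(t, x). B t x) \<and>
     (\<forall>\<alpha>\<in>{1..N}. \<forall>t\<ge>0. \<forall>x v.
        time_deriv (\<lambda>s. f \<alpha> s x v) t
        + velocity (m \<alpha>) v \<bullet> grad (\<lambda>y. f \<alpha> t y v) x
        + e \<alpha> * ((E t x + cross3 (velocity (m \<alpha>) v) (B t x)) \<bullet> grad (f \<alpha> t x) v) = 0) \<and>
     (\<forall>t\<ge>0. \<forall>x.
        time_deriv (\<lambda>s. E s x) t = curl (B t) x - (4 * pi) *\<^sub>R current_density N m e f t x \<and>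
        divergence (E t) x = 4 * pi * charge_density N e f t x \<and>
        time_deriv (\<lambda>s. B s x) t = - curl (E t) x \<and>
        divergence (B t) x = 0)"


section \<open>Admissible solutions\<close>

definition admissible_data ::
  "nat \<Rightarrow> (nat \<Rightarrow> real) \<Rightarrow> real \<Rightarrow> (nat \<Rightarrow> real \<Rightarrow> real^3 \<Rightarrow> real^3 \<Rightarrow> real)
    \<Rightarrow> (real \<Rightarrow> real^3 \<Rightarrow> real^3) \<Rightarrow> (real \<Rightarrow> real^3 \<Rightarrow> real^3) \<Rightarrow> bool" where
  "admissible_data N e k f E B \<longleftrightarrow>
     (\<forall>\<alpha>\<in>{1..N}.
        C1_on UNIV (\<lambda>(x, v). f \<alpha> 0 x v) \<and>
        (\<forall>x v. 0 \<le> f \<alpha> 0 x v) \<and>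
        (\<forall>x v. f \<alpha> 0 x v \<noteq> 0 \<longrightarrow> norm x \<le> k \<and> norm v \<le> k)) \<and>
     C1_on UNIV (E 0) \<and> C1_on UNIV (B 0) \<and>
     (\<forall>x. E 0 x \<noteq> 0 \<or> B 0 x \<noteq> 0 \<longrightarrow> norm x \<le> k) \<and>
     (\<forall>x. divergence (E 0) x = 4 * pi * charge_density N e f 0 x) \<and>
     (\<forall>x. divergence (B 0) x = 0) \<and>
     (\<Sum>\<alpha>=1..N. e \<alpha> * (LINT (x, v)|lborel. f \<alpha> 0 x v)) = 0"

text \<open>
  The norm of a pair is Euclidean, and so is the norm of a matrix (Frobenius norm).
  For \<open>norm x \<le> t + k\<close> all factors in the denominators are positive.
\<close>
definition field_decay ::
  "real \<Rightarrow> real \<Rightarrow> (real \<Rightarrow> real^3 \<Rightarrow> real^3) \<Rightarrow> (real \<Rightarrow> real^3 \<Rightarrow> real^3) \<Rightarrow> bool" where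
  "field_decay k C\<^sub>0 E B \<longleftrightarrow>
     (\<forall>t\<ge>0. \<forall>x. norm x \<le> t + k \<longrightarrow>
        norm (E t x, B t x)
          \<le> C\<^sub>0 / ((t + norm x + 2 * k) * (t - norm x + 2 * k)) \<and>
        norm (jacobian (E t) (at x), jacobian (B t) (at x))
          \<le> C\<^sub>0 * ln (t + norm x + 2 * k) / ((t + norm x + 2 * k) * (t - norm x + 2 * k)\<^sup>2))"

definition admissible_solution ::
  "nat \<Rightarrow> (nat \<Rightarrow> real) \<Rightarrow> (nat \<Rightarrow> real) \<Rightarrow> (nat \<Rightarrow> real \<Rightarrow> real^3 \<Rightarrow> real^3 \<Rightarrow> real)
    \<Rightarrow> (real \<Rightarrow> real^3 \<Rightarrow> real^3) \<Rightarrow> (real \<Rightarrow> real^3 \<Rightarrow> real^3) \<Rightarrow> bool" where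
  "admissible_solution N m e f E B \<longleftrightarrow>
     vlasov_maxwell_solution N m e f E B \<and>
     (\<exists>k>0. \<exists>C\<^sub>0>0. admissible_data N e k f E B \<and> field_decay k C\<^sub>0 E B)"


section \<open>Asymptotic charge and linear scattering\<close>

text \<open>
  \<open>is_asymptotic_charge \<mu> h q\<close>: \<open>q\<close> is the asymptotic charge of the distribution function \<open>h\<close> of a
  species of mass \<open>\<mu>\<close>. The estimate determines \<open>q\<close> uniquely.
\<close>
definition is_asymptotic_charge ::
  "real \<Rightarrow> (real \<Rightarrow> real^3 \<Rightarrow> real^3 \<Rightarrow> real) \<Rightarrow> (real^3 \<Rightarrow> real) \<Rightarrow> bool" where
  "is_asymptotic_charge \<mu> h q \<longleftrightarrow>
     continuous_on UNIV q \<and> compact (closure {u. q u \<noteq> 0}) \<and>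
     (\<exists>C>0. \<forall>t\<ge>0. \<forall>v.
        \<bar>(LINT x|lborel. h t x v) - q (v /\<^sub>R \<mu>)\<bar> \<le> C * (ln (2 + t)) ^ 5 / (2 + t))"

definition total_asymptotic_charge ::
  "nat \<Rightarrow> (nat \<Rightarrow> real) \<Rightarrow> (nat \<Rightarrow> real) \<Rightarrow> (nat \<Rightarrow> real^3 \<Rightarrow> real) \<Rightarrow> real^3 \<Rightarrow> real" where
  "total_asymptotic_charge N m e Q u = (\<Sum>\<alpha>=1..N. e \<alpha> * m \<alpha> ^ 3 * Q \<alpha> u)"

text \<open>
  The distance in \<open>L\<^sup>1\<close> is taken as a nonnegative integral, so that a non-integrable difference
  has distance infinity rather than the default value 0 of the Bochner integral.
\<close>
definition linear_scattering :: "real \<Rightarrow> (real \<Rightarrow> real^3 \<Rightarrow> real^3 \<Rightarrow> real) \<Rightarrow> bool" where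
  "linear_scattering \<mu> h \<longleftrightarrow>
     (\<exists>g :: (real^3) \<times> (real^3) \<Rightarrow> real. integrable lborel g \<and>
        ((\<lambda>t. \<integral>\<^sup>+ (x, v). ennreal \<bar>h (t * energy \<mu> v) (x + t *\<^sub>R v) v - g (x, v)\<bar> \<partial>lborel)
          \<longlongrightarrow> 0) at_top)"

end

theory Submission
  imports Defs "HOL-Real_Asymp.Real_Asymp"
begin

text \<open>
  Suppose that every species scatters linearly. The proof plays the motion of single particles off against
  the field that all of them generate, and compares the two along the rays \<open>x = t u\<close>, \<open>\<bar>u\<bar> < 1\<close>.

  Let \<open>L(t,x,u) = E + u \<times> B\<close> be the Lorentz field felt at velocity \<open>u\<close>. It decays like \<open>t\<^sup>-\<^sup>2\<close>
  inside the light cone. In the coordinate \<open>y = x - t v/v\<^sup>0\<close>, which the free flow preserves, a particle drifts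
  with speed \<open>e t Dv\<^sub>h(L)\<close>, where \<open>Dv\<^sub>h\<close> is the derivative of the relativistic velocity \<open>v\<^sub>h = v/v\<^sup>0\<close>. This is of order \<open>1/t\<close>,
  so the displacement grows logarithmically unless \<open>t\<^sup>2 L(t, t u, u)\<close> vanishes in the mean with respect to \<open>dt/t\<close>.
  Convergence along the free flow leaves no room for such a growth. Accordingly, the Vlasov equation tested
  with a truncation of the first moment \<open>y \<bullet> \<theta>(v)\<close> and averaged over \<open>[e\<^sup>n, e\<^sup>2\<^sup>n]\<close> shows that
  \<open>\<integral> q(v) \<theta>(v) \<bullet> Dv\<^sub>h(T\<^sub>n(v\<^sub>h)) dv \<rightarrow> 0\<close> for every continuous \<open>\<theta>\<close> of compact support. Here \<open>T\<^sub>n\<close> is the average of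
  \<open>t\<^sup>2 L(t, t u, u)\<close> (\<open>avg_lorentz\<close>) and \<open>q\<close> is the asymptotic charge of the species (\<open>mean_force_vanishes\<close>).

  The vector field \<open>(x \<bullet> E, t E + x \<times> B)\<close> on space-time is the contraction of the electromagnetic
  field with the generator of the dilations. By the Gauss and Ampere laws its divergence is
  \<open>4\<pi>(t \<rho> - x \<bullet> j)\<close>, and at \<open>x = t u\<close> it equals \<open>t (u \<bullet> L, L)\<close>. Tested with functions of the form
  \<open>t\<^sup>-\<^sup>2 \<chi>(t) \<eta>(x/t)\<close>, this yields an identity between \<open>T\<^sub>n\<close> and the averaged charge (\<open>averaged_gauss_law\<close>). Since
  scattering densities concentrate on \<open>x = t v\<^sub>h\<close>, the charge term tends to \<open>4\<pi> \<integral> (1 - \<bar>w\<^sub>h\<bar>\<^sup>2) \<eta>(w\<^sub>h) Q\<^sub>\<infinity>(w) dw\<close>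
  (\<open>charge_current_limit\<close>), with \<open>w\<^sub>h\<close> the velocity of momentum \<open>w\<close> at mass 1.

  If \<open>Q\<^sub>\<infinity>(w\<^sub>0) \<noteq> 0\<close>, then some species has nonzero charge near \<open>w\<^sub>0\<close>. For this species the vanishing of
  the mean force, rewritten in the variable \<open>u = v\<^sub>h\<close>, says that \<open>T\<^sub>n\<close> tends to 0 weakly near the velocity of
  \<open>w\<^sub>0\<close>. So for a bump \<open>\<eta>\<close> at that velocity the field term of the identity tends to 0, whereas the charge term has a
  nonzero limit because \<open>Q\<^sub>\<infinity>\<close> keeps its sign on the support (\<open>asymptotic_charge_zero_if_scattering\<close>).

  Sign and support of the densities follow from a maximum principle on backward cones, which avoids the
  characteristic flow. Charge cannot leak to large momenta: at time \<open>t\<close> the momenta are \<open>O(log t)\<close>, and the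
  convergence to the asymptotic charge is uniform in \<open>v\<close> with a rate that beats every power of \<open>log t\<close>
  (\<open>tail_tendsto\<close>).
\<close>

type_synonym R3 = "real^3"

section \<open>Lebesgue integrals\<close>

lemma lborel_integral_shift:
  fixes h :: "'a::euclidean_space \<Rightarrow> 'b::{banach,second_countable_topology}"
  assumes "h \<in> borel_measurable borel"
  shows "(LINT x|lborel. h (c + x)) = (LINT x|lborel. h x)"
proof -
  have "(LINT x|lborel. h x) = (LINT x|distr lborel borel ((+) c). h x)"
    by (simp add: lborel_distr_plus)
  also have "\<dots> = (LINT x|lborel. h (c + x))"
    by (intro integral_distr) (use assms in auto)
  finally show ?thesis by simp
qed

lemma lborel_integrable_shift:
  fixes h :: "'a::euclidean_space \<Rightarrow> 'b::{banach,second_countable_topology}"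
  assumes "integrable lborel h"
  shows "integrable lborel (\<lambda>x. h (c + x))"
proof -
  have "integrable (distr lborel borel ((+) c)) h"
    using assms by (simp add: lborel_distr_plus)
  then show ?thesis
    by (subst (asm) integrable_distr_eq) (use assms in auto)
qed

lemma nn_integral_lborel_shift:
  fixes h :: "'a::euclidean_space \<Rightarrow> ennreal"
  assumes "h \<in> borel_measurable borel"
  shows "(\<integral>\<^sup>+x. h (x + c) \<partial>lborel) = (\<integral>\<^sup>+x. h x \<partial>lborel)"
proof -
  have "(\<integral>\<^sup>+x. h x \<partial>lborel) = (\<integral>\<^sup>+x. h x \<partial>distr lborel borel ((+) c))"
    by (simp add: lborel_distr_plus)
  also have "\<dots> = (\<integral>\<^sup>+x. h (c + x) \<partial>lborel)"
    by (intro nn_integral_distr) (use assms in auto)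
  finally show ?thesis by (simp add: add.commute)
qed

lemma lborel_integral_scale:
  fixes h :: "R3 \<Rightarrow> real"
  assumes h: "h \<in> borel_measurable borel" and c: "c > 0"
  shows "(LINT x|lborel. h x) = c ^ 3 * (LINT u|lborel. h (c *\<^sub>R u))"
proof -
  have "(LINT x|lborel. h x) = (LINT x|density (distr lborel borel (\<lambda>x. 0 + c *\<^sub>R x)) (\<lambda>_. ennreal (\<bar>c\<bar> ^ DIM(R3))). h x)"
    using lborel_affine[of c "0 :: R3"] c by simp
  also have "\<dots> = (LINT x|distr lborel borel (\<lambda>x. 0 + c *\<^sub>R x). (\<bar>c\<bar> ^ DIM(R3)) *\<^sub>R h x)"
    by (intro integral_density) (use h in auto)
  also have "\<dots> = (LINT u|lborel. (\<bar>c\<bar> ^ DIM(R3)) *\<^sub>R h (0 + c *\<^sub>R u))"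
    by (intro integral_distr) (use h in auto)
  finally show ?thesis using c by simp
qed

lemma integrable_continuous_compact_support:
  fixes h :: "'a::euclidean_space \<Rightarrow> 'b::{banach,second_countable_topology}"
  assumes "continuous_on UNIV h" "compact K" "\<And>z. z \<notin> K \<Longrightarrow> h z = 0"
  shows "integrable lborel h"
proof -
  have "integrable lborel (\<lambda>z. indicator K z *\<^sub>R h z)"
    by (rule borel_integrable_compact) (use assms in \<open>auto intro: continuous_on_subset\<close>)
  moreover have "(\<lambda>z. indicator K z *\<^sub>R h z) = h"
    using assms(3) by (auto simp: indicator_def)
  ultimately show ?thesis by simp
qed

lemma continuous_integral_pos:
  fixes h :: "R3 \<Rightarrow> real"
  assumes i: "integrable lborel h" and c: "continuous_on UNIV h" and nn: "\<And>x. h x \<ge> 0" and p: "h x0 > 0"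
  shows "(LINT x|lborel. h x) > 0"
proof -
  have "isCont h x0" using c by (simp add: continuous_on_eq_continuous_at)
  then have "\<forall>\<^sub>F x in nhds x0. h x > h x0 / 2"
    using p tendsto_at_iff_tendsto_nhds[of h x0] by (intro order_tendstoD(1)[of h "h x0"]) (auto simp: isCont_def)
  then obtain d where d: "d > 0" "\<And>x. dist x x0 < d \<Longrightarrow> h x > h x0 / 2"
    by (auto simp: eventually_nhds_metric)
  have "0 < (h x0 / 2) * measure lborel (ball x0 d)"
    using p d content_ball_pos[of d x0] by (intro mult_pos_pos) auto
  also have "\<dots> = (LINT x|lborel. indicator (ball x0 d) x * (h x0 / 2))" by simp
  also have "\<dots> \<le> (LINT x|lborel. h x)"
  proof (rule integral_mono[OF _ i])
    show "integrable lborel (\<lambda>x. indicator (ball x0 d) x * (h x0 / 2))"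
      using emeasure_lborel_ball_finite[of x0 d] by (intro integrable_mult_left integrable_real_indicator) auto
    show "indicator (ball x0 d) x * (h x0 / 2) \<le> h x" for x
      using d(2)[of x] nn[of x] by (auto simp: indicator_def dist_commute less_imp_le)
  qed
  finally show ?thesis .
qed

lemma integrable_bounded_mult:
  fixes c h :: "'a::euclidean_space \<Rightarrow> real"
  assumes h: "integrable lborel h" and m: "c \<in> borel_measurable borel" and b: "\<And>z. \<bar>c z\<bar> \<le> A"
  shows "integrable lborel (\<lambda>z. c z * h z)"
proof (rule Bochner_Integration.integrable_bound[of _ "\<lambda>z. A * h z"])
  show "integrable lborel (\<lambda>z. A * h z)" using h by simp
  show "(\<lambda>z. c z * h z) \<in> borel_measurable lborel" using h m by measurable
  have "\<bar>c z\<bar> * \<bar>h z\<bar> \<le> \<bar>A\<bar> * \<bar>h z\<bar>" for z using b[of z] by (intro mult_right_mono) auto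
  then show "AE z in lborel. norm (c z * h z) \<le> norm (A * h z)" by (simp add: abs_mult)
qed

lemma nn_integral_lborel_fst:
  fixes H :: "'a::euclidean_space \<times> 'b::euclidean_space \<Rightarrow> ennreal"
  assumes "H \<in> borel_measurable borel"
  shows "(\<integral>\<^sup>+z. H z \<partial>lborel) = (\<integral>\<^sup>+x. \<integral>\<^sup>+y. H (x, y) \<partial>lborel \<partial>lborel)"
  using lborel.nn_integral_fst[of H lborel] assms by (simp add: lborel_prod)

lemma nn_integral_lborel_snd:
  fixes H :: "'a::euclidean_space \<times> 'b::euclidean_space \<Rightarrow> ennreal"
  assumes "H \<in> borel_measurable borel"
  shows "(\<integral>\<^sup>+z. H z \<partial>lborel) = (\<integral>\<^sup>+y. \<integral>\<^sup>+x. H (x, y) \<partial>lborel \<partial>lborel)"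
  using lborel_pair.nn_integral_snd[of H] assms by (simp add: lborel_prod)

lemma integral_lborel_fst:
  fixes H :: "'a::euclidean_space \<times> 'b::euclidean_space \<Rightarrow> 'c::{banach,second_countable_topology}"
  assumes "integrable lborel H"
  shows "(LINT z|lborel. H z) = (LINT x|lborel. LINT y|lborel. H (x, y))"
  using lborel_pair.integral_fst'[of H] assms by (simp add: lborel_prod)

lemma integral_lborel_snd:
  fixes H :: "'a::euclidean_space \<times> 'b::euclidean_space \<Rightarrow> 'c::{banach,second_countable_topology}"
  assumes "integrable lborel H"
  shows "(LINT z|lborel. H z) = (LINT y|lborel. LINT x|lborel. H (x, y))"
  using lborel_pair.integral_snd[of "\<lambda>x y. H (x, y)"] assms by (simp add: lborel_prod)

lemma integrable_lborel_mult:
  fixes a :: "'a::euclidean_space \<Rightarrow> real" and b :: "'b::euclidean_space \<Rightarrow> real"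
  assumes a: "integrable lborel a" and b: "integrable lborel b"
  shows "integrable lborel (\<lambda>z. a (fst z) * b (snd z))"
proof -
  have [measurable]: "a \<in> borel_measurable borel" "b \<in> borel_measurable borel"
    using a b by auto
  have "integrable (lborel \<Otimes>\<^sub>M lborel) (\<lambda>z. a (fst z) * b (snd z))"
  proof (rule lborel_pair.Fubini_integrable)
    show "integrable lborel (\<lambda>x. LINT y|lborel. norm (a (fst (x, y)) * b (snd (x, y))))"
      using a by (simp add: abs_mult)
  qed (use b in auto)
  then show ?thesis by (simp add: lborel_prod)
qed

lemma measurable_slice_integral:
  fixes b :: "real \<times> R3 \<times> R3 \<Rightarrow> real"
  assumes m: "b \<in> borel_measurable borel"
  shows "(\<lambda>t. LINT w|lborel. b (t, w)) \<in> borel_measurable borel"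
proof -
  have [measurable]: "b \<in> borel_measurable (borel \<Otimes>\<^sub>M borel)" using m by (simp add: borel_prod)
  show ?thesis by (rule lborel.borel_measurable_lebesgue_integral) measurable
qed

section \<open>The divergence theorem for compactly supported fields\<close>

lemma linear_eq_sum_Basis:
  fixes L :: "'a::euclidean_space \<Rightarrow> 'b::real_vector"
  assumes "linear L"
  shows "L h = (\<Sum>b\<in>Basis. (h \<bullet> b) *\<^sub>R L b)"
proof -
  have "L h = L (\<Sum>b\<in>Basis. (h \<bullet> b) *\<^sub>R b)" by (simp add: euclidean_representation)
  then show ?thesis by (simp add: linear_sum[OF assms] linear_scale[OF assms])
qed

lemma sum_Basis_prod:
  fixes h :: "'a::euclidean_space \<times> 'b::euclidean_space \<Rightarrow> 'c::comm_monoid_add"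
  shows "(\<Sum>b\<in>Basis. h b) = (\<Sum>i\<in>Basis. h (i, 0)) + (\<Sum>i\<in>Basis. h (0, i))"
proof -
  have "inj_on (\<lambda>u. (u::'a, 0::'b)) Basis" "inj_on (\<lambda>u. (0::'a, u::'b)) Basis"
    by (auto intro!: inj_onI Pair_inject)
  then show ?thesis
    unfolding Basis_prod_def
    by (subst sum.union_disjoint) (auto simp: sum.reindex)
qed

text \<open>
  The integral is translation invariant, so the difference quotients of \<open>h\<close> have integral 0. They converge
  boundedly, with supports in a common compact set.
\<close>
lemma integral_directional_derivative_eq_0:
  fixes h :: "'a::euclidean_space \<Rightarrow> real"
  assumes d: "\<And>z. (h has_derivative h' z) (at z)"
    and c: "continuous_on UNIV (\<lambda>z. h' z e)"
    and K: "compact K" "\<And>z. z \<notin> K \<Longrightarrow> h z = 0"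
  shows "integrable lborel (\<lambda>z. h' z e)" "(LINT z|lborel. h' z e) = 0"
proof -
  have h'0: "h' z e = 0" if "z \<notin> K" for z
  proof -
    have "open (- K)" using K(1) by (simp add: compact_imp_closed open_Compl)
    then have "(h has_derivative (\<lambda>_. 0)) (at z)"
      using that K(2) by (intro has_derivative_transform_within_open[of "\<lambda>_. 0" _ z UNIV "- K" h]) auto
    then show ?thesis using d[of z] has_derivative_unique by metis
  qed
  show "integrable lborel (\<lambda>z. h' z e)"
    by (rule integrable_continuous_compact_support[OF c K(1)]) (rule h'0)
  have ch: "continuous_on UNIV h"
    using d has_derivative_continuous continuous_at_imp_continuous_on by blast
  obtain M where M: "\<And>z. \<bar>h' z e\<bar> \<le> M" "M \<ge> 0"
  proof -
    have "bounded ((\<lambda>z. h' z e) ` K)"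
      by (intro compact_imp_bounded compact_continuous_image continuous_on_subset[OF c] K(1)) auto
    then obtain M where "\<And>z. z \<in> K \<Longrightarrow> \<bar>h' z e\<bar> \<le> M"
      by (auto simp: bounded_iff)
    then have "\<bar>h' z e\<bar> \<le> max M 0" for z by (cases "z \<in> K") (auto simp: h'0 le_max_iff_disj)
    then show ?thesis using that[of "max M 0"] by auto
  qed
  have line: "((\<lambda>s. h (z + s *\<^sub>R e)) has_real_derivative h' (z + s *\<^sub>R e) e) (at s)" for z s
  proof -
    have "((\<lambda>s. h (z + s *\<^sub>R e)) has_derivative (\<lambda>r. h' (z + s *\<^sub>R e) (r *\<^sub>R e))) (at s)"
      by (rule has_derivative_compose[of "\<lambda>s. z + s *\<^sub>R e" _ s UNIV h, OF _ d])
         (auto intro!: derivative_eq_intros)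
    moreover have "h' (z + s *\<^sub>R e) (r *\<^sub>R e) = h' (z + s *\<^sub>R e) e * r" for r
      using linear_scale[OF has_derivative_linear[OF d]] by (simp add: mult.commute)
    ultimately show ?thesis by (simp add: has_field_derivative_def)
  qed
  define S where "S n = 1 / real (Suc n)" for n
  have S: "0 < S n" "S n \<le> 1" for n by (auto simp: S_def)
  define q where "q n z = (h (z + S n *\<^sub>R e) - h z) / S n" for n z
  have qb: "\<bar>q n z\<bar> \<le> M" for n z
  proof -
    have "\<exists>r. 0 < r \<and> r < S n \<and> h (z + S n *\<^sub>R e) - h (z + 0 *\<^sub>R e) = (S n - 0) * h' (z + r *\<^sub>R e) e"
      by (rule MVT2[OF S(1) line])
    then obtain r where "h (z + S n *\<^sub>R e) - h z = S n * h' (z + r *\<^sub>R e) e" by auto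
    then have "q n z = h' (z + r *\<^sub>R e) e" using S[of n] by (simp add: q_def)
    then show ?thesis using M by simp
  qed
  define K2 where "K2 = (\<lambda>(s, z). z - s *\<^sub>R e) ` ({0..1} \<times> K)"
  have K2: "compact K2" unfolding K2_def
    by (intro compact_continuous_image compact_Times K compact_Icc)
       (auto simp: case_prod_beta intro!: continuous_intros)
  have q0: "q n z = 0" if "z \<notin> K2" for n z
  proof -
    have "z + s *\<^sub>R e \<notin> K" if "s \<in> {0..1}" for s
    proof
      assume "z + s *\<^sub>R e \<in> K"
      then have "(\<lambda>(s, z). z - s *\<^sub>R e) (s, z + s *\<^sub>R e) \<in> K2" unfolding K2_def using that by blast
      then show False using \<open>z \<notin> K2\<close> by simp
    qed
    from this[of 0] this[of "S n"] show ?thesis using S[of n] K(2) by (simp add: q_def)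
  qed
  have cq: "continuous_on UNIV (q n)" for n
    unfolding q_def
    by (intro continuous_intros continuous_on_compose2[OF ch]) (use S[of n] in auto)
  have lim: "(\<lambda>n. q n z) \<longlonglongrightarrow> h' z e" for z
  proof -
    have 1: "((\<lambda>s. (h (z + s *\<^sub>R e) - h (z + 0 *\<^sub>R e)) / s) \<longlongrightarrow> h' (z + 0 *\<^sub>R e) e) (at 0)"
      using line[of z 0] unfolding has_field_derivative_iff by simp
    have 2: "filterlim S (at 0) sequentially"
      unfolding filterlim_at using S LIMSEQ_inverse_real_of_nat
      by (auto simp: S_def[abs_def] inverse_eq_divide)
    show ?thesis using filterlim_compose[OF 1 2] unfolding q_def by simp
  qed
  have "(\<lambda>n. LINT z|lborel. q n z) \<longlonglongrightarrow> (LINT z|lborel. h' z e)"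
  proof (rule integral_dominated_convergence[where w = "\<lambda>z. indicator K2 z *\<^sub>R M"])
    show "integrable lborel (\<lambda>z. indicator K2 z *\<^sub>R M)"
      by (rule borel_integrable_compact[OF K2]) auto
    show "(\<lambda>z. h' z e) \<in> borel_measurable lborel"
      using c borel_measurable_continuous_onI by auto
    show "q n \<in> borel_measurable lborel" for n
      using cq borel_measurable_continuous_onI by auto
    show "AE z in lborel. norm (q n z) \<le> indicator K2 z *\<^sub>R M" for n
      using qb q0 by (auto simp: indicator_def)
  qed (use lim in auto)
  moreover have "(LINT z|lborel. q n z) = 0" for n
  proof -
    have ih: "integrable lborel h" by (rule integrable_continuous_compact_support[OF ch K])
    have eq: "(\<lambda>z. h (z + S n *\<^sub>R e)) = (\<lambda>z. h (S n *\<^sub>R e + z))" by (simp add: add.commute)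
    have "(LINT z|lborel. h (z + S n *\<^sub>R e)) = (LINT z|lborel. h z)"
      unfolding eq by (rule lborel_integral_shift) (use ch borel_measurable_continuous_onI in auto)
    moreover have "integrable lborel (\<lambda>z. h (z + S n *\<^sub>R e))"
      unfolding eq by (rule lborel_integrable_shift[OF ih])
    ultimately show ?thesis using ih by (simp add: q_def)
  qed
  ultimately show "(LINT z|lborel. h' z e) = 0" using LIMSEQ_const_iff[of 0] by (simp add: LIMSEQ_unique)
qed

text \<open>
  The integrand is the divergence of \<open>\<phi> a\<close>, written out so that it reads as the weak form of a transport equation
  with coefficients \<open>a\<close>. The open set \<open>U\<close> admits coefficients that are differentiable only near the support, as
  the solutions of the system are only for positive times.
\<close>
lemma integral_divergence_eq_0:
  fixes \<phi> :: "'a::euclidean_space \<Rightarrow> real" and a :: "'a \<Rightarrow> 'a"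
  assumes U: "open U" and K: "compact K" "K \<subseteq> U"
    and d\<phi>: "\<And>z. z \<in> U \<Longrightarrow> (\<phi> has_derivative \<phi>' z) (at z)"
    and da: "\<And>z. z \<in> U \<Longrightarrow> (a has_derivative a' z) (at z)"
    and c\<phi>: "\<And>b. b \<in> Basis \<Longrightarrow> continuous_on U (\<lambda>z. \<phi>' z b)"
    and ca: "\<And>b. b \<in> Basis \<Longrightarrow> continuous_on U (\<lambda>z. a' z b)"
    and supp: "\<And>z. z \<notin> K \<Longrightarrow> \<phi> z = 0" "\<And>z h. z \<notin> K \<Longrightarrow> \<phi>' z h = 0"
  shows "integrable lborel (\<lambda>z. \<phi>' z (a z) + \<phi> z * (\<Sum>b\<in>Basis. a' z b \<bullet> b))"
    and "(LINT z|lborel. \<phi>' z (a z) + \<phi> z * (\<Sum>b\<in>Basis. a' z b \<bullet> b)) = 0"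
proof -
  define W' where "W' b z h = \<phi>' z h * (a z \<bullet> b) + \<phi> z * (a' z h \<bullet> b)" for b z h
  have oK: "open (- K)" using K(1) by (simp add: compact_imp_closed open_Compl)
  have UK: "z \<in> U \<or> z \<in> - K" for z using K(2) by auto
  have dW: "((\<lambda>z. \<phi> z * (a z \<bullet> b)) has_derivative W' b z) (at z)" for b z
  proof (cases "z \<in> U")
    case True
    then show ?thesis unfolding W'_def
      by (auto intro!: derivative_eq_intros d\<phi> da simp: algebra_simps)
  next
    case False
    then have z: "z \<in> - K" using UK by auto
    have "((\<lambda>z. \<phi> z * (a z \<bullet> b)) has_derivative (\<lambda>_. 0)) (at z)"
      using z oK supp(1)
      by (intro has_derivative_transform_within_open[of "\<lambda>_. 0" "\<lambda>_. 0" z UNIV "- K"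
            "\<lambda>z. \<phi> z * (a z \<bullet> b)"]) simp_all
    moreover have "W' b z = (\<lambda>_. 0)" using z supp by (auto simp: W'_def fun_eq_iff)
    ultimately show ?thesis by simp
  qed
  have ca0: "continuous_on U a"
    by (intro continuous_at_imp_continuous_on ballI has_derivative_continuous[OF da])
  have c\<phi>0: "continuous_on U \<phi>"
    by (intro continuous_at_imp_continuous_on ballI has_derivative_continuous[OF d\<phi>])
  have cW: "continuous_on UNIV (\<lambda>z. W' b z b)" if "b \<in> Basis" for b
  proof -
    have 1: "continuous_on U (\<lambda>z. W' b z b)" unfolding W'_def
      by (intro continuous_intros c\<phi> ca ca0 c\<phi>0 that)
    have 2: "continuous_on (- K) (\<lambda>z. W' b z b)"
      by (rule continuous_on_eq[of _ "\<lambda>_. 0"]) (auto simp: W'_def supp)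
    have "U \<union> - K = UNIV" using K(2) by auto
    then show ?thesis using continuous_on_open_Un[OF U oK 1 2] by simp
  qed
  have eq: "(\<Sum>b\<in>Basis. W' b z b) = \<phi>' z (a z) + \<phi> z * (\<Sum>b\<in>Basis. a' z b \<bullet> b)" for z
  proof (cases "z \<in> U")
    case True
    have lin: "linear (\<phi>' z)" using d\<phi>[OF True] has_derivative_linear by blast
    have "\<phi>' z (a z) = (\<Sum>b\<in>Basis. \<phi>' z b * (a z \<bullet> b))"
      using linear_eq_sum_Basis[OF lin, of "a z"] by (simp add: mult.commute)
    then show ?thesis by (simp add: W'_def sum.distrib sum_distrib_left)
  next
    case False
    then have "z \<notin> K" using UK by auto
    then show ?thesis by (simp add: W'_def supp)
  qed
  have s0: "z \<notin> K \<Longrightarrow> \<phi> z * (a z \<bullet> b) = 0" for z b using supp by simp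
  have I1: "integrable lborel (\<lambda>z. W' b z b)" if "b \<in> Basis" for b
    by (rule integral_directional_derivative_eq_0(1)[OF dW cW[OF that] K(1) s0])
  have I2: "(LINT z|lborel. W' b z b) = 0" if "b \<in> Basis" for b
    by (rule integral_directional_derivative_eq_0(2)[OF dW cW[OF that] K(1) s0])
  show "integrable lborel (\<lambda>z. \<phi>' z (a z) + \<phi> z * (\<Sum>b\<in>Basis. a' z b \<bullet> b))"
    unfolding eq[symmetric] by (intro Bochner_Integration.integrable_sum I1)
  show "(LINT z|lborel. \<phi>' z (a z) + \<phi> z * (\<Sum>b\<in>Basis. a' z b \<bullet> b)) = 0"
    unfolding eq[symmetric] by (simp add: Bochner_Integration.integral_sum I1 I2)
qed

section \<open>A maximum principle for transport equations\<close>

text \<open>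
  At a positive maximum of \<open>h - \<epsilon> t\<close> the derivative of \<open>h\<close> in the backward direction \<open>(-1, -a)\<close> would have to be
  at most \<open>-\<epsilon>\<close>, but it is 0. The domain must contain the backward segments; this replaces an integration along
  characteristics.
\<close>
lemma transport_maximum_principle:
  fixes h :: "real \<times> 'a::real_normed_vector \<Rightarrow> real"
  assumes D: "compact D" "D \<subseteq> {0..} \<times> UNIV" and ch: "continuous_on D h"
    and base: "\<And>y. (0, y) \<in> D \<Longrightarrow> h (0, y) \<le> 0"
    and step: "\<And>t y. (t, y) \<in> D \<Longrightarrow> t > 0 \<Longrightarrow> h (t, y) > 0 \<Longrightarrow>
       \<exists>a h'. (h has_derivative h') (at (t, y)) \<and> h' (1, a) = 0 \<and>
         (\<forall>s\<in>{0<..t}. (t - s, y - s *\<^sub>R a) \<in> D)"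
    and z: "z \<in> D"
  shows "h z \<le> 0"
proof (rule ccontr)
  assume "\<not> h z \<le> 0"
  then have hz: "h z > 0" by simp
  have z0: "fst z \<ge> 0" using z D(2) by auto
  define \<epsilon> where "\<epsilon> = h z / (2 * (1 + fst z))"
  have \<epsilon>: "\<epsilon> > 0" "h z - \<epsilon> * fst z > 0"
  proof -
    show "\<epsilon> > 0" using hz z0 by (simp add: \<epsilon>_def)
    have "h z * fst z / (2 * (1 + fst z)) < h z"
      using hz z0 by (simp add: divide_less_eq)
    then show "h z - \<epsilon> * fst z > 0" by (simp add: \<epsilon>_def)
  qed
  have cu: "continuous_on D (\<lambda>p. h p - \<epsilon> * fst p)"
    by (intro continuous_intros ch)
  obtain p where p: "p \<in> D" "\<And>p'. p' \<in> D \<Longrightarrow> h p' - \<epsilon> * fst p' \<le> h p - \<epsilon> * fst p"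
    using continuous_attains_sup[OF D(1) _ cu] z by blast
  obtain t y where ty: "p = (t, y)" by (cases p)
  have t0: "t \<ge> 0" using p(1) D(2) ty by auto
  have hp: "h (t, y) > 0" using p(2)[OF z] \<epsilon> t0 ty
    by (smt (verit, best) fst_conv mult_nonneg_nonneg)
  have t: "t > 0" using base[of y] hp p(1) ty t0 by (cases "t = 0") auto
  obtain a h' where a: "(h has_derivative h') (at (t, y))" "h' (1, a) = 0"
    "\<And>s. s \<in> {0<..t} \<Longrightarrow> (t - s, y - s *\<^sub>R a) \<in> D"
    using step[of t y] p(1) ty t hp by blast
  define \<phi> where "\<phi> s = h ((t, y) - s *\<^sub>R (1, a))" for s
  have "(\<phi> has_derivative (\<lambda>r. h' (- (r *\<^sub>R (1, a))))) (at 0)"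
    unfolding \<phi>_def
    by (rule has_derivative_compose[of "\<lambda>s. (t, y) - s *\<^sub>R (1, a)" _ 0 UNIV h])
       (use a(1) in \<open>auto intro!: derivative_eq_intros\<close>)
  moreover have "h' (- (r *\<^sub>R (1, a))) = 0" for r
    using linear_neg[OF has_derivative_linear[OF a(1)]] linear_scale[OF has_derivative_linear[OF a(1)]] a(2)
    by (metis neg_0_equal_iff_equal scaleR_zero_right)
  ultimately have "(\<phi> has_real_derivative 0) (at 0)"
    unfolding has_field_derivative_def by (simp only: lambda_zero)
  then have lim: "((\<lambda>s. (\<phi> s - \<phi> 0) / s) \<longlongrightarrow> 0) (at 0)" unfolding has_field_derivative_iff by simp
  have lim': "((\<lambda>s. (\<phi> s - \<phi> 0) / s) \<longlongrightarrow> 0) (at_right 0)"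
    using lim by (rule filterlim_mono) (auto simp: at_le)
  have "(\<phi> s - \<phi> 0) / s \<le> - \<epsilon>" if "s > 0" "s < t" for s
  proof -
    have "(t - s, y - s *\<^sub>R a) \<in> D" using a(3)[of s] that by auto
    from p(2)[OF this] have "\<phi> s - \<phi> 0 \<le> - \<epsilon> * s"
      by (simp add: \<phi>_def ty algebra_simps)
    then show ?thesis using that by (simp add: divide_le_eq)
  qed
  then have "\<forall>\<^sub>F s in at_right 0. (\<phi> s - \<phi> 0) / s \<le> - \<epsilon>"
    unfolding eventually_at_right_field using t by auto
  then have "0 \<le> - \<epsilon>" by (intro tendsto_upperbound[OF lim']) simp_all
  then show False using \<epsilon> by simp
qed

text \<open>
  The domain is a backward cone with unit speed in \<open>x\<close>. In \<open>v\<close> its width is governed by \<open>P\<close>, a bound for the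
  momentum that the force can transfer up to a given time. The bound on the force is only required where \<open>h\<close> is
  positive, so that known restrictions on the support of \<open>h\<close> may be used to verify it.
\<close>
lemma transport_cone:
  fixes h :: "real \<times> R3 \<times> R3 \<Rightarrow> real"
  assumes ch: "continuous_on UNIV h"
    and dh: "\<And>t x v. t > 0 \<Longrightarrow> (h has_derivative h' (t, x, v)) (at (t, x, v))"
    and tr: "\<And>t x v. t > 0 \<Longrightarrow> h' (t, x, v) (1, V v, L (t, x, v)) = 0"
    and V: "\<And>v. norm (V v) \<le> 1"
    and P: "continuous_on {0..t0} P" "\<And>t. 0 \<le> t \<Longrightarrow> t \<le> t0 \<Longrightarrow> P 0 \<le> P t"
    and t0: "t0 \<ge> 0"
    and base: "\<And>x v. norm (x - x0) \<le> t0 \<Longrightarrow> norm (v - v0) \<le> P t0 - P 0 \<Longrightarrow> h (0, x, v) \<le> 0"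
    and step: "\<And>t x v s. 0 < t \<Longrightarrow> t \<le> t0 \<Longrightarrow> norm (x - x0) \<le> t0 - t \<Longrightarrow>
       norm (v - v0) \<le> P t0 - P t \<Longrightarrow> h (t, x, v) > 0 \<Longrightarrow> 0 < s \<Longrightarrow> s \<le> t \<Longrightarrow>
       s * norm (L (t, x, v)) \<le> P t - P (t - s)"
  shows "h (t0, x0, v0) \<le> 0"
proof -
  define S where "S = {0..t0} \<times> cball x0 t0 \<times> cball v0 (P t0 - P 0)"
  have S: "compact S" unfolding S_def by (intro compact_Times compact_Icc compact_cball)
  define g1 where "g1 = (\<lambda>z :: real \<times> R3 \<times> R3. t0 - fst z - norm (fst (snd z) - x0))"
  define g2 where "g2 = (\<lambda>z :: real \<times> R3 \<times> R3. P t0 - P (fst z) - norm (snd (snd z) - v0))"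
  have g1: "continuous_on S g1" unfolding g1_def by (intro continuous_intros)
  have g2: "continuous_on S g2" unfolding g2_def
    by (intro continuous_intros continuous_on_compose2[OF P(1)]) (auto simp: S_def)
  define D where "D = (S \<inter> g1 -` {0..}) \<inter> (S \<inter> g2 -` {0..})"
  have "closed D" unfolding D_def
    by (intro closed_Int continuous_closed_preimage g1 g2 compact_imp_closed[OF S]) auto
  then have "compact (S \<inter> D)" by (rule compact_Int_closed[OF S])
  moreover have "S \<inter> D = D" by (auto simp: D_def)
  ultimately have D: "compact D" by simp
  have Dm: "(t, x, v) \<in> D \<longleftrightarrow> 0 \<le> t \<and> t \<le> t0 \<and> norm (x - x0) \<le> t0 - t \<and> norm (v - v0) \<le> P t0 - P t"
    for t x v
    using P(2)[of t]
    by (auto simp: D_def S_def g1_def g2_def dist_norm norm_minus_commute)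
  show ?thesis
  proof (rule transport_maximum_principle[OF D])
    show "D \<subseteq> {0..} \<times> UNIV" using Dm by auto
    show "continuous_on D h" using ch continuous_on_subset by blast
    show "h (0, y) \<le> 0" if "(0, y) \<in> D" for y
      using that base by (cases y) (auto simp: Dm)
    show "(t0, x0, v0) \<in> D" using t0 by (simp add: Dm)
    show "\<exists>a h'. (h has_derivative h') (at (t, y)) \<and> h' (1, a) = 0 \<and>
         (\<forall>s\<in>{0<..t}. (t - s, y - s *\<^sub>R a) \<in> D)"
      if y: "(t, y) \<in> D" "t > 0" "h (t, y) > 0" for t y
    proof -
      obtain x v where xv: "y = (x, v)" by (cases y)
      have b: "t \<le> t0" "norm (x - x0) \<le> t0 - t" "norm (v - v0) \<le> P t0 - P t"
        using y(1) by (auto simp: xv Dm)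
      have "(t - s, y - s *\<^sub>R (V v, L (t, x, v))) \<in> D" if s: "s \<in> {0<..t}" for s
      proof -
        have "norm ((x - s *\<^sub>R V v) - x0) \<le> norm (x - x0) + norm (s *\<^sub>R V v)"
          using norm_triangle_ineq4[of "x - x0" "s *\<^sub>R V v"] by (simp add: algebra_simps)
        also have "\<dots> \<le> (t0 - t) + s * 1"
          using b s V[of v] by (intro add_mono) (auto intro: mult_left_mono)
        finally have 1: "norm ((x - s *\<^sub>R V v) - x0) \<le> t0 - (t - s)" by simp
        have "norm ((v - s *\<^sub>R L (t, x, v)) - v0) \<le> norm (v - v0) + norm (s *\<^sub>R L (t, x, v))"
          using norm_triangle_ineq4[of "v - v0" "s *\<^sub>R L (t, x, v)"] by (simp add: algebra_simps)
        also have "\<dots> \<le> (P t0 - P t) + (P t - P (t - s))"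
          using b s y xv step[of t x v s] by (intro add_mono) auto
        finally have 2: "norm ((v - s *\<^sub>R L (t, x, v)) - v0) \<le> P t0 - P (t - s)" by simp
        show ?thesis using 1 2 s b y by (simp add: xv Dm)
      qed
      then show ?thesis using dh[OF y(2)] tr[OF y(2)] xv by blast
    qed
  qed
qed

section \<open>Relativistic velocities\<close>

lemma energy_pos: "\<mu> > 0 \<Longrightarrow> energy \<mu> v > 0"
  and mass_le_energy: "\<mu> > 0 \<Longrightarrow> \<mu> \<le> energy \<mu> v"
  and norm_less_energy: "\<mu> > 0 \<Longrightarrow> norm v < energy \<mu> v"
  and energy_power2: "(energy \<mu> v)\<^sup>2 = \<mu>\<^sup>2 + v \<bullet> v"
proof -
  show "\<mu> > 0 \<Longrightarrow> energy \<mu> v > 0"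
    by (simp add: energy_def add_pos_nonneg)
  show "\<mu> > 0 \<Longrightarrow> \<mu> \<le> energy \<mu> v"
    unfolding energy_def by (rule real_le_rsqrt) simp
  show "\<mu> > 0 \<Longrightarrow> norm v < energy \<mu> v"
    unfolding energy_def by (rule real_less_rsqrt) simp
  show "(energy \<mu> v)\<^sup>2 = \<mu>\<^sup>2 + v \<bullet> v"
    by (simp add: energy_def dot_square_norm)
qed

lemma norm_velocity_less_1: "\<mu> > 0 \<Longrightarrow> norm (velocity \<mu> v) < 1"
  using norm_less_energy[of \<mu> v] energy_pos[of \<mu> v]
  by (simp add: velocity_def divide_simps)

lemma energy_scale_velocity: "\<mu> > 0 \<Longrightarrow> energy \<mu> v *\<^sub>R velocity \<mu> v = v"
  using energy_pos[of \<mu> v] by (simp add: velocity_def)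

lemma continuous_on_energy [continuous_intros]:
  "continuous_on S g \<Longrightarrow> continuous_on S (\<lambda>x. energy \<mu> (g x))"
  unfolding energy_def by (intro continuous_intros)

lemma continuous_on_velocity [continuous_intros]:
  "\<mu> > 0 \<Longrightarrow> continuous_on S g \<Longrightarrow> continuous_on S (\<lambda>x. velocity \<mu> (g x))"
  unfolding velocity_def using energy_pos[of \<mu>]
  by (intro continuous_intros) (auto simp: less_imp_neq[symmetric])

lemma measurable_energy [measurable]: "energy \<mu> \<in> borel_measurable borel"
  by (intro borel_measurable_continuous_onI continuous_intros)

lemma measurable_velocity [measurable]: "velocity \<mu> \<in> borel_measurable borel"
proof -
  have "velocity \<mu> = (\<lambda>v. inverse (energy \<mu> v) *\<^sub>R v)" by (auto simp: velocity_def)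
  then show ?thesis by simp
qed

definition velocity_deriv :: "real \<Rightarrow> R3 \<Rightarrow> R3 \<Rightarrow> R3" where
  "velocity_deriv \<mu> v h = (h - (velocity \<mu> v \<bullet> h) *\<^sub>R velocity \<mu> v) /\<^sub>R energy \<mu> v"

lemma continuous_on_velocity_deriv [continuous_intros]:
  "\<mu> > 0 \<Longrightarrow> continuous_on S g \<Longrightarrow> continuous_on S h \<Longrightarrow>
   continuous_on S (\<lambda>x. velocity_deriv \<mu> (g x) (h x))"
  unfolding velocity_deriv_def using energy_pos[of \<mu>]
  by (intro continuous_intros) (auto simp: less_imp_neq[symmetric])

lemma linear_velocity_deriv: "linear (velocity_deriv \<mu> v)"
  by (rule linearI) (simp_all add: velocity_deriv_def inner_right_distrib scaleR_add_left algebra_simps)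

lemma energy_has_derivative:
  assumes "\<mu> > 0"
  shows "(energy \<mu> has_derivative (\<lambda>h. velocity \<mu> v \<bullet> h)) (at v)"
proof -
  have e: "energy \<mu> = (\<lambda>v. sqrt (\<mu>\<^sup>2 + v \<bullet> v))"
    by (simp add: energy_def dot_square_norm fun_eq_iff)
  have p: "\<mu>\<^sup>2 + v \<bullet> v > 0" using assms by (simp add: add_pos_nonneg)
  have "((\<lambda>v. sqrt (\<mu>\<^sup>2 + v \<bullet> v)) has_derivative
      (\<lambda>h. (h \<bullet> v + v \<bullet> h) * (inverse (sqrt (\<mu>\<^sup>2 + v \<bullet> v)) / 2))) (at v)"
    by (rule has_derivative_eq_rhs, (rule derivative_intros p)+)
       (simp add: fun_eq_iff algebra_simps)
  moreover have "(h \<bullet> v + v \<bullet> h) * (inverse (sqrt (\<mu>\<^sup>2 + v \<bullet> v)) / 2) = velocity \<mu> v \<bullet> h" for h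
    unfolding velocity_def e by (simp add: inner_commute)
  ultimately show ?thesis unfolding e by simp
qed

lemma velocity_has_derivative:
  assumes "\<mu> > 0"
  shows "(velocity \<mu> has_derivative velocity_deriv \<mu> v) (at v)"
proof -
  have p: "energy \<mu> v > 0" using energy_pos[OF assms] .
  have i: "((\<lambda>v. inverse (energy \<mu> v)) has_derivative
      (\<lambda>h. - (inverse (energy \<mu> v) * (velocity \<mu> v \<bullet> h) * inverse (energy \<mu> v)))) (at v)"
    using p by (intro Deriv.has_derivative_inverse[OF _ energy_has_derivative[OF assms]]) simp
  have "((\<lambda>v. inverse (energy \<mu> v) *\<^sub>R v) has_derivative
      (\<lambda>h. inverse (energy \<mu> v) *\<^sub>R h +
        (- (inverse (energy \<mu> v) * (velocity \<mu> v \<bullet> h) * inverse (energy \<mu> v))) *\<^sub>R v)) (at v)"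
    by (rule has_derivative_scaleR[OF i has_derivative_ident])
  moreover have "inverse (energy \<mu> v) *\<^sub>R h +
        (- (inverse (energy \<mu> v) * (velocity \<mu> v \<bullet> h) * inverse (energy \<mu> v))) *\<^sub>R v
      = velocity_deriv \<mu> v h" for h
    unfolding velocity_deriv_def by (simp add: velocity_def algebra_simps)
  moreover have "velocity \<mu> = (\<lambda>v. inverse (energy \<mu> v) *\<^sub>R v)"
    by (auto simp: velocity_def)
  ultimately show ?thesis by simp
qed

lemma velocity_deriv_inner_commute: "velocity_deriv \<mu> v a \<bullet> b = a \<bullet> velocity_deriv \<mu> v b"
  by (simp add: velocity_deriv_def inner_diff_left inner_diff_right inner_commute)

lemma norm_velocity_deriv_le:
  assumes "\<mu> > 0"
  shows "norm (velocity_deriv \<mu> v h) \<le> (2 / \<mu>) * norm h"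
proof -
  have n: "norm (velocity \<mu> v) \<le> 1" using norm_velocity_less_1[OF assms, of v] by simp
  have "norm (h - (velocity \<mu> v \<bullet> h) *\<^sub>R velocity \<mu> v)
      \<le> norm h + \<bar>velocity \<mu> v \<bullet> h\<bar> * norm (velocity \<mu> v)"
    using norm_triangle_ineq4[of h "(velocity \<mu> v \<bullet> h) *\<^sub>R velocity \<mu> v"] by simp
  also have "\<bar>velocity \<mu> v \<bullet> h\<bar> * norm (velocity \<mu> v) \<le> (1 * norm h) * 1"
    using Cauchy_Schwarz_ineq2[of "velocity \<mu> v" h] n
    by (intro mult_mono order_trans[OF Cauchy_Schwarz_ineq2]) auto
  finally have 1: "norm (h - (velocity \<mu> v \<bullet> h) *\<^sub>R velocity \<mu> v) \<le> 2 * norm h" by simp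
  have 2: "inverse (energy \<mu> v) \<le> inverse \<mu>"
    using mass_le_energy[OF assms, of v] assms by (intro le_imp_inverse_le) auto
  have "norm (velocity_deriv \<mu> v h) = inverse (energy \<mu> v) * norm (h - (velocity \<mu> v \<bullet> h) *\<^sub>R velocity \<mu> v)"
    using energy_pos[OF assms, of v] by (simp add: velocity_deriv_def)
  also have "\<dots> \<le> inverse \<mu> * (2 * norm h)"
    using 1 2 energy_pos[OF assms, of v] assms by (intro mult_mono) auto
  finally show ?thesis by (simp add: field_simps)
qed

text \<open>
  The inverse of the derivative of the velocity, from the Sherman--Morrison formula.
\<close>
definition velocity_deriv_inv :: "real \<Rightarrow> R3 \<Rightarrow> R3 \<Rightarrow> R3" where
  "velocity_deriv_inv \<mu> v h = energy \<mu> v *\<^sub>R (h + ((v \<bullet> h) / \<mu>\<^sup>2) *\<^sub>R v)"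

lemma continuous_on_velocity_deriv_inv [continuous_intros]:
  "continuous_on S g \<Longrightarrow> continuous_on S h \<Longrightarrow>
   continuous_on S (\<lambda>x. velocity_deriv_inv \<mu> (g x) (h x))"
  unfolding velocity_deriv_inv_def
  by (cases "\<mu> = 0") (auto intro!: continuous_intros)

lemma velocity_deriv_inverse:
  assumes "\<mu> > 0"
  shows "velocity_deriv \<mu> v (velocity_deriv_inv \<mu> v h) = h"
proof -
  have p: "energy \<mu> v > 0" using energy_pos[OF assms] .
  have e2: "(energy \<mu> v)\<^sup>2 = \<mu>\<^sup>2 + v \<bullet> v" by (rule energy_power2)
  define w where "w = h + ((v \<bullet> h) / \<mu>\<^sup>2) *\<^sub>R v"
  have "velocity_deriv \<mu> v (energy \<mu> v *\<^sub>R w) = w - (velocity \<mu> v \<bullet> w) *\<^sub>R velocity \<mu> v"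
    using linear_scale[OF linear_velocity_deriv, of \<mu> v "energy \<mu> v" w] p
    by (simp add: velocity_deriv_def)
  also have "(velocity \<mu> v \<bullet> w) *\<^sub>R velocity \<mu> v = ((v \<bullet> w) / (energy \<mu> v)\<^sup>2) *\<^sub>R v"
    by (simp add: velocity_def power2_eq_square field_simps)
  also have "v \<bullet> w = (v \<bullet> h) * (energy \<mu> v)\<^sup>2 / \<mu>\<^sup>2"
    using assms by (simp add: w_def inner_add_right e2 field_simps)
  finally show ?thesis using p assms by (simp add: velocity_deriv_inv_def w_def)
qed

lemma velocity_deriv_inner_inverse:
  assumes "\<mu> > 0"
  shows "velocity_deriv \<mu> v a \<bullet> velocity_deriv_inv \<mu> v b = a \<bullet> b"
  by (simp add: velocity_deriv_inner_commute velocity_deriv_inverse assms)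

lemma norm_cross3_le: "norm (cross3 a b) \<le> norm a * norm b"
proof (rule power2_le_imp_le)
  have "(norm (cross3 a b))\<^sup>2 + (a \<bullet> b)\<^sup>2 = (norm a * norm b)\<^sup>2" by (rule norm_cross_dot)
  then show "(norm (cross3 a b))\<^sup>2 \<le> (norm a * norm b)\<^sup>2" by (smt (verit) zero_le_power2)
qed simp

lemma bounded_bilinear_cross3: "bounded_bilinear cross3"
proof
  show "\<exists>K. \<forall>a b. norm (cross3 a b) \<le> norm a * norm b * K"
    using norm_cross3_le by (intro exI[of _ 1]) simp
qed (simp_all add: cross3_simps)

text \<open>
  The magnetic force is divergence free with respect to the momentum: the derivative of the velocity is
  symmetric, whereas the cross product with \<open>w\<close> is skew.
\<close>
lemma sum_velocity_deriv_cross3: "(\<Sum>i\<in>Basis. cross3 (velocity_deriv \<mu> v i) w \<bullet> i) = 0"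
proof -
  let ?u = "velocity \<mu> v"
  have "cross3 (velocity_deriv \<mu> v i) w \<bullet> i = - (inverse (energy \<mu> v) * ((?u \<bullet> i) * (cross3 ?u w \<bullet> i)))" for i
  proof -
    have "cross3 i w \<bullet> i = 0" by (simp add: inner_commute dot_cross_self)
    moreover have "cross3 (velocity_deriv \<mu> v i) w
        = inverse (energy \<mu> v) *\<^sub>R (cross3 i w - (?u \<bullet> i) *\<^sub>R cross3 ?u w)"
      unfolding velocity_deriv_def
      by (simp add: bounded_bilinear.scaleR_left[OF bounded_bilinear_cross3]
          bounded_bilinear.diff_left[OF bounded_bilinear_cross3])
    ultimately show ?thesis by (simp add: inner_diff_left)
  qed
  then have "(\<Sum>i\<in>Basis. cross3 (velocity_deriv \<mu> v i) w \<bullet> i)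
     = - (inverse (energy \<mu> v) * (\<Sum>i\<in>Basis. (?u \<bullet> i) * (cross3 ?u w \<bullet> i)))"
    by (simp add: sum_negf sum_distrib_left)
  also have "(\<Sum>i\<in>Basis. (?u \<bullet> i) * (cross3 ?u w \<bullet> i)) = ?u \<bullet> cross3 ?u w"
    by (rule euclidean_inner[symmetric])
  also have "\<dots> = 0" by (simp add: dot_cross_self)
  finally show ?thesis by simp
qed

lemma velocity_inverse:
  assumes \<mu>: "\<mu> > 0"
  shows "(\<mu> / sqrt (1 - velocity \<mu> v \<bullet> velocity \<mu> v)) *\<^sub>R velocity \<mu> v = v"
proof -
  have E: "energy \<mu> v > 0" by (rule energy_pos[OF \<mu>])
  have "velocity \<mu> v \<bullet> velocity \<mu> v = (v \<bullet> v) / (energy \<mu> v)\<^sup>2"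
    by (simp add: velocity_def power2_eq_square field_simps)
  also have "v \<bullet> v = (energy \<mu> v)\<^sup>2 - \<mu>\<^sup>2" by (simp add: energy_power2)
  finally have "1 - velocity \<mu> v \<bullet> velocity \<mu> v = (\<mu> / energy \<mu> v)\<^sup>2"
    using E by (simp add: power_divide diff_divide_distrib)
  then have "sqrt (1 - velocity \<mu> v \<bullet> velocity \<mu> v) = \<mu> / energy \<mu> v" using E \<mu> by simp
  then show ?thesis using E \<mu> energy_scale_velocity[OF \<mu>, of v] by simp
qed

lemma velocity_surj:
  assumes \<mu>: "\<mu> > 0" and u: "norm u < 1"
  shows "velocity \<mu> ((\<mu> / sqrt (1 - u \<bullet> u)) *\<^sub>R u) = u"
proof -
  have p: "1 - u \<bullet> u > 0" using u by (simp add: dot_square_norm abs_square_less_1)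
  define s where "s = sqrt (1 - u \<bullet> u)"
  have s: "s > 0" "s\<^sup>2 = 1 - u \<bullet> u" using p by (auto simp: s_def)
  have "(energy \<mu> ((\<mu> / s) *\<^sub>R u))\<^sup>2 = (\<mu> / s)\<^sup>2"
  proof -
    have uu: "u \<bullet> u = 1 - s\<^sup>2" using s(2) by simp
    have "(energy \<mu> ((\<mu> / s) *\<^sub>R u))\<^sup>2 = \<mu>\<^sup>2 + (\<mu> / s)\<^sup>2 * (1 - s\<^sup>2)"
      unfolding energy_power2 by (simp add: uu power2_eq_square)
    then show ?thesis using s(1) by (simp add: power_divide field_simps)
  qed
  then have "energy \<mu> ((\<mu> / s) *\<^sub>R u) = \<mu> / s"
    using s \<mu> energy_pos[OF \<mu>, of "(\<mu> / s) *\<^sub>R u"] by (simp add: power2_eq_iff_nonneg)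
  then show ?thesis using s \<mu> by (simp add: velocity_def s_def[symmetric])
qed

lemma velocity_range: "\<mu> > 0 \<Longrightarrow> range (velocity \<mu>) = ball 0 1"
  using velocity_surj norm_velocity_less_1 by (auto simp: image_iff) metis

definition velocity_jacobian :: "real \<Rightarrow> R3 \<Rightarrow> real" where
  "velocity_jacobian \<mu> v = \<bar>det (matrix (velocity_deriv \<mu> v))\<bar>"

lemma continuous_velocity_jacobian:
  assumes \<mu>: "\<mu> > 0"
  shows "continuous_on UNIV (velocity_jacobian \<mu>)"
proof -
  have cm: "continuous_on UNIV (\<lambda>v. matrix (velocity_deriv \<mu> v) $ i $ j)" for i j
    by (simp add: matrix_def) (intro continuous_intros \<mu>)
  show ?thesis unfolding velocity_jacobian_def[abs_def] det_3
    by (intro continuous_on_rabs continuous_on_add continuous_on_diff continuous_on_mult cm)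
qed

text \<open>
  The substitution \<open>u = velocity \<mu> v\<close> maps the momentum space onto the open unit ball.
\<close>
lemma velocity_change_of_variables:
  fixes F :: "R3 \<Rightarrow> real"
  assumes \<mu>: "\<mu> > 0" and F: "integrable lborel F" and F0: "\<And>u. norm u \<ge> 1 \<Longrightarrow> F u = 0"
  shows "(LINT u|lborel. F u) = (LINT v|lborel. velocity_jacobian \<mu> v * F (velocity \<mu> v))"
proof -
  \<comment> \<open>The substitution rule for Lebesgue integrals concerns functions into spaces \<open>real^'n\<close>, hence the constant vector.\<close>
  define a :: R3 where "a = axis 1 1"
  define Fv where "Fv u = F u *\<^sub>R a" for u
  define G where "G v = \<bar>det (matrix (velocity_deriv \<mu> v))\<bar> *\<^sub>R Fv (velocity \<mu> v)" for v
  have iFv: "integrable lborel Fv" unfolding Fv_def[abs_def] using F by simp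
  have aFv: "Fv absolutely_integrable_on UNIV"
    using iFv by (simp add: set_integrable_def integrable_completion)
  have res: "(\<lambda>u. if u \<in> range (velocity \<mu>) then Fv u else 0) = Fv"
    using F0 by (auto simp: velocity_range[OF \<mu>] Fv_def fun_eq_iff)
  have aR: "Fv absolutely_integrable_on range (velocity \<mu>)"
    by (rule set_integrable_subset[OF aFv]) (auto simp: velocity_range[OF \<mu>])
  have iR: "integral (range (velocity \<mu>)) Fv = (LINT u|lborel. F u) *\<^sub>R a"
  proof -
    have "integral (range (velocity \<mu>)) Fv = integral UNIV Fv"
      using integral_restrict_UNIV[of "range (velocity \<mu>)" Fv] by (simp add: res)
    also have "\<dots> = (LINT u|lborel. Fv u)" by (rule integral_lborel[OF iFv])
    finally show ?thesis by (simp add: Fv_def F)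
  qed
  have inj: "inj_on (velocity \<mu>) UNIV"
    by (rule inj_on_inverseI[of _ "\<lambda>u. (\<mu> / sqrt (1 - u \<bullet> u)) *\<^sub>R u"]) (rule velocity_inverse[OF \<mu>])
  have der: "(velocity \<mu> has_derivative velocity_deriv \<mu> v) (at v within UNIV)" if "v \<in> UNIV" for v
    by (rule velocity_has_derivative[OF \<mu>])
  have UNIV: "(UNIV :: R3 set) \<in> sets lebesgue" by simp
  have "G absolutely_integrable_on UNIV \<and> integral UNIV G = (LINT u|lborel. F u) *\<^sub>R a"
    unfolding G_def[abs_def]
    by (rule iffD2[OF has_absolute_integral_change_of_variables[OF UNIV der inj]]) (use aR iR in blast)+
  then have G: "G absolutely_integrable_on UNIV" "integral UNIV G = (LINT u|lborel. F u) *\<^sub>R a" by auto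
  have mJ: "velocity_jacobian \<mu> \<in> borel_measurable borel"
    by (intro borel_measurable_continuous_onI continuous_velocity_jacobian \<mu>)
  have mF: "(\<lambda>v. F (velocity \<mu> v)) \<in> borel_measurable borel"
    by (rule measurable_compose[OF measurable_velocity]) (use F in auto)
  have Geq: "G = (\<lambda>v. (velocity_jacobian \<mu> v * F (velocity \<mu> v)) *\<^sub>R a)"
    by (simp add: G_def[abs_def] velocity_jacobian_def Fv_def)
  have mG: "G \<in> borel_measurable lborel" unfolding Geq using mJ mF by measurable
  have iG: "integrable lborel G"
    using G(1) mG by (simp add: set_integrable_def integrable_completion)
  have "(LINT v|lborel. G v) = (LINT u|lborel. F u) *\<^sub>R a"
    using G(2) integral_lborel[OF iG] by simp
  then have "(LINT v|lborel. G v) \<bullet> a = LINT u|lborel. F u"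
    by (simp add: a_def inner_axis_axis)
  moreover have "(LINT v|lborel. G v) \<bullet> a = (LINT v|lborel. G v \<bullet> a)"
    using iG by simp
  ultimately show ?thesis by (simp add: Geq a_def inner_axis_axis)
qed

section \<open>Sign and support of a transported density\<close>

text \<open>
  The field bound is required only for \<open>norm x \<le> t + k\<close>, which suffices because the density will turn out to live there.
\<close>
locale transported_density =
  fixes \<mu> e k C :: real and E B :: "real \<times> R3 \<Rightarrow> R3"
    and f :: "real \<times> R3 \<times> R3 \<Rightarrow> real"
    and f' :: "real \<times> R3 \<times> R3 \<Rightarrow> real \<times> R3 \<times> R3 \<Rightarrow> real"
  assumes \<mu>: "\<mu> > 0" and k: "k > 0" and C: "C \<ge> 0"
    and contE: "continuous_on UNIV E" and contB: "continuous_on UNIV B"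
    and contf: "continuous_on UNIV f"
    and df: "\<And>t x v. t > 0 \<Longrightarrow> (f has_derivative f' (t, x, v)) (at (t, x, v))"
    and vlasov: "\<And>t x v. t > 0 \<Longrightarrow>
      f' (t, x, v) (1, velocity \<mu> v, e *\<^sub>R (E (t, x) + cross3 (velocity \<mu> v) (B (t, x)))) = 0"
    and init_nonneg: "\<And>x v. f (0, x, v) \<ge> 0"
    and init_supp: "\<And>x v. f (0, x, v) \<noteq> 0 \<Longrightarrow> norm x \<le> k \<and> norm v \<le> k"
    and field_bound: "\<And>t x. t \<ge> 0 \<Longrightarrow> norm x \<le> t + k \<Longrightarrow>
      norm (E (t, x)) \<le> C / (t + 2 * k) \<and> norm (B (t, x)) \<le> C / (t + 2 * k)"
begin

abbreviation "force t x v \<equiv> e *\<^sub>R (E (t, x) + cross3 (velocity \<mu> v) (B (t, x)))"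

lemma norm_force_le: "norm (force t x v) \<le> \<bar>e\<bar> * (norm (E (t, x)) + norm (B (t, x)))"
proof -
  have "norm (cross3 (velocity \<mu> v) (B (t, x))) \<le> 1 * norm (B (t, x))"
    using norm_velocity_less_1[OF \<mu>, of v]
    by (intro order_trans[OF norm_cross3_le] mult_right_mono) auto
  then show ?thesis
    using norm_triangle_ineq[of "E (t, x)" "cross3 (velocity \<mu> v) (B (t, x))"]
    by (auto intro!: mult_left_mono)
qed

lemma scaled_vlasov:
  assumes "t > 0"
  shows "((\<lambda>z. c * f z) has_derivative (\<lambda>h. c * f' (t, x, v) h)) (at (t, x, v))"
    and "c * f' (t, x, v) (1, velocity \<mu> v, force t x v) = 0"
  using df[OF assms] vlasov[OF assms] by (auto intro!: derivative_eq_intros)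

lemma continuous_scaled: "continuous_on UNIV (\<lambda>z. c * f z)"
  by (intro continuous_intros contf)

text \<open>
  On the cone, which is compact in space-time, the force is bounded, so the width in \<open>v\<close> may grow linearly. The factor \<open>c\<close> makes
  the statement applicable to both signs of \<open>f\<close>.
\<close>
lemma domain_of_dependence:
  assumes t0: "t0 \<ge> 0" and base: "\<And>x v. norm (x - x0) \<le> t0 \<Longrightarrow> c * f (0, x, v) \<le> 0"
  shows "c * f (t0, x0, v0) \<le> 0"
proof -
  have "compact ((\<lambda>z. norm (E z) + norm (B z)) ` ({0..t0} \<times> cball x0 t0))"
    by (intro compact_continuous_image compact_Times compact_Icc compact_cball continuous_intros)
       (use contE contB continuous_on_subset in blast)+
  then have "bounded ((\<lambda>z. norm (E z) + norm (B z)) ` ({0..t0} \<times> cball x0 t0))"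
    by (rule compact_imp_bounded)
  then obtain M where M: "\<And>z. z \<in> {0..t0} \<times> cball x0 t0 \<Longrightarrow> norm (norm (E z) + norm (B z)) \<le> M"
    unfolding bounded_iff by blast
  define P where "P s = \<bar>e\<bar> * max M 0 * s" for s :: real
  show ?thesis
  proof (rule transport_cone[where P = P and h = "\<lambda>z. c * f z" and V = "velocity \<mu>"
        and h' = "\<lambda>z h. c * f' z h" and L = "\<lambda>(t, x, v). force t x v",
        OF continuous_scaled scaled_vlasov(1)])
    show "continuous_on {0..t0} P" unfolding P_def by (intro continuous_intros)
    show "c * f' (t, x, v) (1, velocity \<mu> v, case (t, x, v) of (t, x, v) \<Rightarrow> force t x v) = 0" if "t > 0" for t x v
      using scaled_vlasov(2)[OF that] by simp
    show "norm (velocity \<mu> v) \<le> 1" for v using norm_velocity_less_1[OF \<mu>, of v] by simp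
    show "P 0 \<le> P t" if "0 \<le> t" for t using that by (simp add: P_def)
    show "c * f (0, x, v) \<le> 0" if "norm (x - x0) \<le> t0" for x v using base that .
    fix t s :: real and x v :: R3
    assume a: "0 < t" "t \<le> t0" "norm (x - x0) \<le> t0 - t" "0 < s"
    have "norm (E (t, x)) + norm (B (t, x)) \<le> max M 0"
      using M[of "(t, x)"] a by (auto simp: dist_norm norm_minus_commute)
    then have "norm (force t x v) \<le> \<bar>e\<bar> * max M 0"
      by (intro order_trans[OF norm_force_le] mult_left_mono) auto
    then have "s * norm (force t x v) \<le> s * (\<bar>e\<bar> * max M 0)" using a by (intro mult_left_mono) auto
    then show "s * norm (case (t, x, v) of (t, x, v) \<Rightarrow> force t x v) \<le> P t - P (t - s)"
      by (simp add: P_def algebra_simps)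
  qed (use t0 in auto)
qed

lemma nonneg: "t \<ge> 0 \<Longrightarrow> f (t, x, v) \<ge> 0"
  using domain_of_dependence[of t x "-1" v] init_nonneg by auto

lemma support_space:
  assumes t: "t \<ge> 0" and f: "f (t, x, v) \<noteq> 0"
  shows "norm x \<le> t + k"
proof (rule ccontr)
  assume "\<not> norm x \<le> t + k"
  then have "1 * f (0, y, w) \<le> 0" if "norm (y - x) \<le> t" for y w
    using init_supp[of y w] that norm_triangle_ineq2[of x y] norm_minus_commute[of x y]
    by (cases "f (0, y, w) = 0") auto
  from domain_of_dependence[OF t, of x 1 v, OF this] nonneg[OF t, of x v] f show False by simp
qed

definition "vmax t = k + 2 * \<bar>e\<bar> * C * (ln (t + 2 * k) - ln (2 * k))"

text \<open>
  A force of size \<open>1/t\<close> transfers at most logarithmic momentum. This is far from sharp, as the force decays like \<open>t\<^sup>-\<^sup>2\<close>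
  inside the light cone, but any bound that grows slower than a small power of \<open>t\<close> serves to control the charge
  at large momenta.
\<close>
lemma support_momentum:
  assumes t0: "t0 \<ge> 0" and f: "f (t0, x0, v0) \<noteq> 0"
  shows "norm v0 \<le> vmax t0"
proof (rule ccontr)
  assume v0: "\<not> norm v0 \<le> vmax t0"
  define P where "P s = 2 * \<bar>e\<bar> * C * ln (s + 2 * k)" for s :: real
  have Pd: "P t0 - P 0 = vmax t0 - k" by (simp add: vmax_def P_def algebra_simps)
  have "1 * f (t0, x0, v0) \<le> 0"
  proof (rule transport_cone[where P = P and h = "\<lambda>z. 1 * f z" and V = "velocity \<mu>"
        and h' = "\<lambda>z h. 1 * f' z h" and L = "\<lambda>(t, x, v). force t x v",
        OF continuous_scaled scaled_vlasov(1)])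
    show "continuous_on {0..t0} P" unfolding P_def using k by (intro continuous_intros) auto
    show "1 * f' (t, x, v) (1, velocity \<mu> v, case (t, x, v) of (t, x, v) \<Rightarrow> force t x v) = 0" if "t > 0" for t x v
      using scaled_vlasov(2)[OF that, of 1 x v] by simp
    show "norm (velocity \<mu> v) \<le> 1" for v using norm_velocity_less_1[OF \<mu>, of v] by simp
    show "P 0 \<le> P t" if "0 \<le> t" for t
      unfolding P_def using that k C by (intro mult_left_mono) auto
    show "1 * f (0, x, v) \<le> 0" if "norm (v - v0) \<le> P t0 - P 0" for x v
      using that v0 init_supp[of x v] norm_triangle_ineq2[of v0 v] norm_minus_commute[of v0 v] Pd
      by (cases "f (0, x, v) = 0") auto
    fix t s :: real and x v :: R3
    assume a: "0 < t" "t \<le> t0" "0 < s" "s \<le> t" "1 * f (t, x, v) > 0"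
    have "norm x \<le> t + k" using support_space[of t x v] a by auto
    then have "norm (E (t, x)) + norm (B (t, x)) \<le> 2 * (C / (t + 2 * k))"
      using field_bound[of t x] a by auto
    then have "norm (force t x v) \<le> \<bar>e\<bar> * (2 * (C / (t + 2 * k)))"
      by (intro order_trans[OF norm_force_le] mult_left_mono) auto
    then have "s * norm (force t x v) \<le> s * (\<bar>e\<bar> * (2 * (C / (t + 2 * k))))"
      using a by (intro mult_left_mono) auto
    also have "\<dots> = 2 * \<bar>e\<bar> * C * (s / (t + 2 * k))" by simp
    \<comment> \<open>The tangent to the logarithm at \<open>t + 2 * k\<close> lies above its graph.\<close>
    also have "s / (t + 2 * k) \<le> ln (t + 2 * k) - ln (t - s + 2 * k)"
    proof -
      have p: "t + 2 * k > 0" "t - s + 2 * k > 0" using a k by auto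
      have "ln ((t - s + 2 * k) / (t + 2 * k)) \<le> (t - s + 2 * k) / (t + 2 * k) - 1"
        using p by (intro ln_le_minus_one) auto
      also have "\<dots> = - (s / (t + 2 * k))" using p by (simp add: field_simps)
      finally show ?thesis using p by (simp add: ln_div)
    qed
    finally show "s * norm (case (t, x, v) of (t, x, v) \<Rightarrow> force t x v) \<le> P t - P (t - s)"
      using C by (auto simp: P_def right_diff_distrib mult_left_mono)
  qed (use t0 in auto)
  then show False using nonneg[OF t0, of x0 v0] f by simp
qed

end

section \<open>Free flow and proper time\<close>

text \<open>
  The time is kept as a coordinate, so that the free flow is a volume preserving map of the extended phase space.
\<close>
definition free_flow :: "real \<Rightarrow> real \<times> R3 \<times> R3 \<Rightarrow> real \<times> R3 \<times> R3" where
  "free_flow \<mu> = (\<lambda>(t, x, v). (t, x + t *\<^sub>R velocity \<mu> v, v))"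

lemma measurable_free_flow [measurable]: "free_flow \<mu> \<in> borel \<rightarrow>\<^sub>M borel"
  unfolding free_flow_def borel_prod[symmetric] by measurable

lemma nn_integral_free_flow:
  assumes H: "H \<in> borel_measurable borel"
  shows "(\<integral>\<^sup>+z. H (free_flow \<mu> z) \<partial>lborel) = (\<integral>\<^sup>+z. H z \<partial>lborel)"
proof -
  have [measurable]: "H \<in> borel_measurable (borel \<Otimes>\<^sub>M (borel \<Otimes>\<^sub>M borel))"
    using H by (simp add: borel_prod)
  have m1: "(\<lambda>y. H (t, y)) \<in> borel_measurable borel" for t
    unfolding borel_prod[symmetric] by measurable
  have m2: "(\<lambda>x. H (t, x, v)) \<in> borel_measurable borel" for t v by measurable
  have m4: "(\<lambda>z. H (free_flow \<mu> z)) \<in> borel_measurable borel"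
    using H by measurable
  have m3: "(\<lambda>y. H (free_flow \<mu> (t, y))) \<in> borel_measurable borel" for t
    by (rule measurable_compose[OF _ m4]) (intro borel_measurable_continuous_onI continuous_intros)
  have "(\<integral>\<^sup>+z. H (free_flow \<mu> z) \<partial>lborel)
      = (\<integral>\<^sup>+t. \<integral>\<^sup>+v. \<integral>\<^sup>+x. H (free_flow \<mu> (t, x, v)) \<partial>lborel \<partial>lborel \<partial>lborel)"
    by (simp add: nn_integral_lborel_fst[OF m4] nn_integral_lborel_snd[OF m3])
  also have "\<dots> = (\<integral>\<^sup>+t. \<integral>\<^sup>+v. \<integral>\<^sup>+x. H (t, x, v) \<partial>lborel \<partial>lborel \<partial>lborel)"
    by (simp add: free_flow_def nn_integral_lborel_shift[OF m2])
  also have "\<dots> = (\<integral>\<^sup>+z. H z \<partial>lborel)"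
    by (simp add: nn_integral_lborel_fst[OF H] nn_integral_lborel_snd[OF m1])
  finally show ?thesis .
qed

lemma distr_free_flow: "distr lborel borel (free_flow \<mu>) = lborel"
proof (rule measure_eqI)
  fix A assume "A \<in> sets (distr lborel borel (free_flow \<mu>))"
  then have A: "A \<in> sets borel" by simp
  have "emeasure (distr lborel borel (free_flow \<mu>)) A = (\<integral>\<^sup>+z. indicator A z \<partial>distr lborel borel (free_flow \<mu>))"
    using A by simp
  also have "\<dots> = (\<integral>\<^sup>+z. indicator A (free_flow \<mu> z) \<partial>lborel)"
    using A by (subst nn_integral_distr) auto
  also have "\<dots> = emeasure lborel A"
    using A by (subst nn_integral_free_flow) auto
  finally show "emeasure (distr lborel borel (free_flow \<mu>)) A = emeasure lborel A" .
qed simp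

lemma integral_free_flow:
  fixes H :: "real \<times> R3 \<times> R3 \<Rightarrow> 'b::{banach,second_countable_topology}"
  assumes H: "H \<in> borel_measurable borel"
  shows "(LINT z|lborel. H (free_flow \<mu> z)) = (LINT z|lborel. H z)"
    and "integrable lborel (\<lambda>z. H (free_flow \<mu> z)) \<longleftrightarrow> integrable lborel H"
proof -
  have "(LINT z|lborel. H z) = (LINT z|distr lborel borel (free_flow \<mu>). H z)"
    by (simp add: distr_free_flow)
  also have "\<dots> = (LINT z|lborel. H (free_flow \<mu> z))"
    by (intro integral_distr) (use H in auto)
  finally show "(LINT z|lborel. H (free_flow \<mu> z)) = (LINT z|lborel. H z)" by simp
  have "integrable lborel H \<longleftrightarrow> integrable (distr lborel borel (free_flow \<mu>)) H"
    by (simp add: distr_free_flow)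
  also have "\<dots> \<longleftrightarrow> integrable lborel (\<lambda>z. H (free_flow \<mu> z))"
    by (intro integrable_distr_eq) (use H in auto)
  finally show "integrable lborel (\<lambda>z. H (free_flow \<mu> z)) \<longleftrightarrow> integrable lborel H" by simp
qed

text \<open>
  Linear scattering compares \<open>f\<close> and its limit at a common \<open>s = t / energy \<mu> v\<close>, which is the proper time up to the
  factor \<open>\<mu>\<close>, while the Vlasov and Maxwell equations use the common time \<open>t\<close>. The factor \<open>energy \<mu> v\<close> is the Jacobian.
\<close>
lemma nn_integral_proper_time:
  assumes \<mu>: "\<mu> > 0" and H: "H \<in> borel_measurable borel"
  shows "(\<integral>\<^sup>+z. H z \<partial>lborel) =
    (\<integral>\<^sup>+s. \<integral>\<^sup>+w. ennreal (energy \<mu> (snd w)) * H (s * energy \<mu> (snd w), fst w + s *\<^sub>R snd w, snd w) \<partial>lborel \<partial>lborel)"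
proof -
  have [measurable]: "H \<in> borel_measurable (borel \<Otimes>\<^sub>M (borel \<Otimes>\<^sub>M borel))"
    using H by (simp add: borel_prod)
  have m1: "(\<lambda>z. H (free_flow \<mu> z)) \<in> borel_measurable borel"
    using H by measurable
  have m2: "(\<lambda>t. H (free_flow \<mu> (t, w))) \<in> borel_measurable borel" for w
    by (rule measurable_compose[OF _ m1]) (intro borel_measurable_continuous_onI continuous_intros)
  have m3: "(\<lambda>z. ennreal (energy \<mu> (snd (snd z))) *
      H (fst z * energy \<mu> (snd (snd z)), fst (snd z) + fst z *\<^sub>R snd (snd z), snd (snd z))) \<in> borel_measurable borel"
    unfolding borel_prod[symmetric] by measurable
  have "(\<integral>\<^sup>+z. H z \<partial>lborel) = (\<integral>\<^sup>+z. H (free_flow \<mu> z) \<partial>lborel)"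
    by (simp add: nn_integral_free_flow[OF H])
  also have "\<dots> = (\<integral>\<^sup>+w. \<integral>\<^sup>+t. H (free_flow \<mu> (t, w)) \<partial>lborel \<partial>lborel)"
    by (rule nn_integral_lborel_snd[OF m1])
  also have "\<dots> = (\<integral>\<^sup>+w. \<integral>\<^sup>+s. ennreal (energy \<mu> (snd w)) * H (s * energy \<mu> (snd w), fst w + s *\<^sub>R snd w, snd w) \<partial>lborel \<partial>lborel)"
  proof (rule nn_integral_cong)
    fix w :: "R3 \<times> R3"
    have p: "energy \<mu> (snd w) > 0" using energy_pos[OF \<mu>] .
    have "(\<integral>\<^sup>+t. H (free_flow \<mu> (t, w)) \<partial>lborel)
       = \<bar>energy \<mu> (snd w)\<bar> * (\<integral>\<^sup>+s. H (free_flow \<mu> (0 + energy \<mu> (snd w) * s, w)) \<partial>lborel)"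
      by (rule nn_integral_real_affine[OF m2]) (use p in simp)
    also have "\<dots> = \<bar>energy \<mu> (snd w)\<bar> *
        (\<integral>\<^sup>+s. H (s * energy \<mu> (snd w), fst w + s *\<^sub>R snd w, snd w) \<partial>lborel)"
    proof -
      have "(s * energy \<mu> (snd w)) *\<^sub>R velocity \<mu> (snd w) = s *\<^sub>R snd w" for s
        using energy_scale_velocity[OF \<mu>, of "snd w"] by (metis scaleR_scaleR)
      then show ?thesis by (simp add: free_flow_def case_prod_beta mult.commute)
    qed
    also have "\<bar>energy \<mu> (snd w)\<bar> * (\<integral>\<^sup>+s. H (s * energy \<mu> (snd w), fst w + s *\<^sub>R snd w, snd w) \<partial>lborel)
      = (\<integral>\<^sup>+s. ennreal (energy \<mu> (snd w)) * H (s * energy \<mu> (snd w), fst w + s *\<^sub>R snd w, snd w) \<partial>lborel)"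
      using p by (subst nn_integral_cmult) (auto simp: less_imp_le)
    finally show "(\<integral>\<^sup>+t. H (free_flow \<mu> (t, w)) \<partial>lborel) = \<dots>" .
  qed
  also have "\<dots> = (\<integral>\<^sup>+z. (ennreal (energy \<mu> (snd (snd z))) *
      H (fst z * energy \<mu> (snd (snd z)), fst (snd z) + fst z *\<^sub>R snd (snd z), snd (snd z))) \<partial>lborel)"
    by (subst nn_integral_lborel_snd[OF m3]) simp
  also have "\<dots> = (\<integral>\<^sup>+s. \<integral>\<^sup>+w. ennreal (energy \<mu> (snd w)) * H (s * energy \<mu> (snd w), fst w + s *\<^sub>R snd w, snd w) \<partial>lborel \<partial>lborel)"
    by (subst nn_integral_lborel_fst[OF m3]) simp
  finally show ?thesis .
qed

section \<open>Logarithmic time averages\<close>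

text \<open>
  The factor 30 normalises the integral.
\<close>
definition bump :: "real \<Rightarrow> real" where "bump r = 30 * (max 0 ((r - 1) * (2 - r)))\<^sup>2"
definition bump' :: "real \<Rightarrow> real" where "bump' r = 60 * max 0 ((r - 1) * (2 - r)) * (3 - 2 * r)"

lemma max0_power2_has_derivative:
  "((\<lambda>x::real. (max 0 x)\<^sup>2) has_real_derivative 2 * max 0 x) (at x)"
proof -
  consider "x < 0" | "x > 0" | "x = 0" by linarith
  then show ?thesis
  proof cases
    case 1
    have "((\<lambda>x::real. (max 0 x)\<^sup>2) has_real_derivative 0) (at x)"
      by (rule has_field_derivative_transform_within_open[of "\<lambda>_. 0" 0 x "{..<0}"]) (use 1 in auto)
    then show ?thesis using 1 by simp
  next
    case 2
    have "((\<lambda>x::real. (max 0 x)\<^sup>2) has_real_derivative 2 * x) (at x)"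
      by (rule has_field_derivative_transform_within_open[of "\<lambda>x. x\<^sup>2" "2 * x" x "{0<..}"])
         (use 2 in \<open>auto intro!: derivative_eq_intros\<close>)
    then show ?thesis using 2 by simp
  next
    case 3
    have b: "norm ((max 0 h)\<^sup>2 / h) \<le> norm h" for h :: real
      by (cases "h = 0") (auto simp: power2_eq_square max_def abs_mult divide_simps)
    have "((\<lambda>h::real. (max 0 h)\<^sup>2 / h) \<longlongrightarrow> 0) (at 0)"
      by (rule Lim_null_comparison[of _ norm])
         (auto simp del: real_norm_def intro!: always_eventually b tendsto_norm_zero tendsto_ident_at)
    then show ?thesis using 3 by (simp add: has_field_derivative_iff)
  qed
qed

lemma bump_has_derivative: "(bump has_real_derivative bump' r) (at r)"
proof -
  have "((\<lambda>r. 30 * (max 0 ((r - 1) * (2 - r)))\<^sup>2) has_real_derivative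
      30 * (2 * max 0 ((r - 1) * (2 - r)) * (3 - 2 * r))) (at r)"
    by (intro DERIV_cmult DERIV_chain2[OF max0_power2_has_derivative])
       (auto intro!: derivative_eq_intros)
  then show ?thesis by (simp add: bump_def[abs_def] bump'_def mult.assoc)
qed

lemma bump_parabola: "0 \<le> max 0 ((r - 1) * (2 - r))" "max 0 ((r - 1) * (2 - r)) \<le> (1/4::real)"
proof -
  have "(r - 1) * (2 - r) = 1/4 - (r - 3/2)\<^sup>2" by (simp add: power2_eq_square algebra_simps)
  then have "(r - 1) * (2 - r) \<le> 1/4" using zero_le_power2[of "r - 3/2"] by linarith
  then show "max 0 ((r - 1) * (2 - r)) \<le> (1/4::real)" by simp
qed simp

lemma bump_zero: "r < 1 \<or> r > 2 \<Longrightarrow> bump r = 0" "r < 1 \<or> r > 2 \<Longrightarrow> bump' r = 0"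
proof -
  assume "r < 1 \<or> r > 2"
  then have "(r - 1) * (2 - r) \<le> 0" by (auto simp: mult_le_0_iff)
  then show "bump r = 0" "bump' r = 0" by (auto simp: bump_def bump'_def)
qed

lemma bump_bounds: "0 \<le> bump r" "bump r \<le> 2" "\<bar>bump' r\<bar> \<le> 15"
proof -
  show "0 \<le> bump r" by (simp add: bump_def)
  have "(max 0 ((r - 1) * (2 - r)))\<^sup>2 \<le> (1/4)\<^sup>2" by (intro power_mono bump_parabola)
  then show "bump r \<le> 2" by (simp add: bump_def power2_eq_square)
  show "\<bar>bump' r\<bar> \<le> 15"
  proof (cases "r < 1 \<or> r > 2")
    case False
    then have "\<bar>3 - 2 * r\<bar> \<le> 1" by auto
    then have "(60 * max 0 ((r - 1) * (2 - r))) * \<bar>3 - 2 * r\<bar> \<le> (60 * (1/4)) * 1"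
      by (intro mult_mono mult_left_mono mult_nonneg_nonneg bump_parabola) auto
    then show ?thesis by (simp add: bump'_def abs_mult)
  qed (simp add: bump_zero)
qed

lemma continuous_bump: "continuous_on S bump" "continuous_on S bump'"
  unfolding bump_def[abs_def] bump'_def[abs_def] by (intro continuous_intros)+

text \<open>
  The interval has length \<open>n\<close> in logarithmic time. A cutoff at this scale
  costs only \<open>O(1/n)\<close> when it is differentiated.
\<close>
abbreviation log_interval :: "nat \<Rightarrow> real set" where
  "log_interval n \<equiv> {exp (real n)..exp (2 * real n)}"

text \<open>
  \<open>log_weight\<close> is the smooth probability density for the averages, \<open>time_cutoff\<close> its product with \<open>n t\<close>.
  \<open>log_window\<close> is the sharp density; up to constants it dominates \<open>log_weight\<close> and the derivative of \<open>time_cutoff\<close>.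
\<close>
definition time_cutoff :: "nat \<Rightarrow> real \<Rightarrow> real" where
  "time_cutoff n t = (if t > 0 then bump (ln t / n) else 0)"
definition time_cutoff' :: "nat \<Rightarrow> real \<Rightarrow> real" where
  "time_cutoff' n t = (if t > 0 then bump' (ln t / n) / (n * t) else 0)"
definition log_weight :: "nat \<Rightarrow> real \<Rightarrow> real" where
  "log_weight n t = time_cutoff n t / (n * t)"
definition log_window :: "nat \<Rightarrow> real \<Rightarrow> real" where
  "log_window n t = indicator (log_interval n) t / (n * t)"

lemma time_cutoff_zero:
  assumes n: "n > 0" and t: "t \<notin> log_interval n"
  shows "time_cutoff n t = 0" "time_cutoff' n t = 0" "log_weight n t = 0" "log_window n t = 0"
proof -
  have "t > 0 \<Longrightarrow> ln t / n < 1 \<or> ln t / n > 2"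
  proof -
    assume p: "t > 0"
    from t consider "t < exp (real n)" | "t > exp (2 * real n)" by force
    then show ?thesis
    proof cases
      case 1
      then have "ln t < n" using p ln_less_cancel_iff[of t "exp (real n)"] by simp
      then show ?thesis using n by (simp add: divide_simps)
    next
      case 2
      then have "2 * real n < ln t" using p ln_less_cancel_iff[of "exp (2 * real n)" t] by simp
      then show ?thesis using n by (simp add: divide_simps)
    qed
  qed
  then show "time_cutoff n t = 0" "time_cutoff' n t = 0" "log_weight n t = 0"
    by (auto simp: time_cutoff_def time_cutoff'_def log_weight_def bump_zero)
  show "log_window n t = 0" using t by (simp add: log_window_def)
qed

lemma exp_n_gt_1:
  assumes "n > 0" "t \<ge> exp (real n)"
  shows "t > 1"
proof -
  have "1 < exp (real n)" using assms(1) by simp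
  then show ?thesis using assms(2) by linarith
qed

lemma time_cutoff_has_derivative:
  assumes n: "n > 0"
  shows "(time_cutoff n has_real_derivative time_cutoff' n t) (at t)"
proof (cases "t > 0")
  case True
  have "((\<lambda>t. bump (ln t / n)) has_real_derivative bump' (ln t / n) * (1 / t / n)) (at t)"
    by (rule DERIV_chain2[OF bump_has_derivative])
       (use True n in \<open>auto intro!: derivative_eq_intros simp: divide_simps\<close>)
  then have "((\<lambda>t. bump (ln t / n)) has_real_derivative time_cutoff' n t) (at t)"
    using True by (simp add: time_cutoff'_def field_simps)
  then show ?thesis
    by (rule has_field_derivative_transform_within_open[of _ _ _ "{0<..}"])
       (use True in \<open>auto simp: time_cutoff_def\<close>)
next
  case False
  have t: "t \<in> {..<exp (real n)}" using False by (simp add: less_le_trans[of _ 1] not_less order_le_less_trans[of t 0])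
  have "(time_cutoff n has_real_derivative 0) (at t)"
    by (rule has_field_derivative_transform_within_open[of "\<lambda>_. 0" _ _ "{..<exp (real n)}"])
       (use t time_cutoff_zero(1)[OF n] in auto)
  then show ?thesis using False by (simp add: time_cutoff'_def)
qed

lemma continuous_time_weights:
  assumes n: "n > 0"
  shows "continuous_on UNIV (time_cutoff n)" "continuous_on UNIV (time_cutoff' n)"
    "continuous_on UNIV (log_weight n)"
proof -
  \<comment> \<open>Near \<open>t = 0\<close> the weights vanish, away from it they are given by one formula.\<close>
  have U: "{..<exp (real n)} \<union> {0<..} = UNIV"
  proof -
    have "t < exp (real n) \<or> 0 < t" for t
      using less_le_trans[OF exp_gt_zero[of "real n"], of t] by linarith
    then show ?thesis by auto
  qed
  have glue: "continuous_on UNIV h" if "\<And>t. t < exp (real n) \<Longrightarrow> h t = 0" "continuous_on {0<..} h" for h :: "real \<Rightarrow> real"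
  proof -
    have "continuous_on {..<exp (real n)} h"
      by (rule continuous_on_eq[of _ "\<lambda>_. 0"]) (use that in auto)
    then show ?thesis using continuous_on_open_Un[of "{..<exp (real n)}" "{0<..}" h] that(2) U by simp
  qed
  have b: "continuous_on {0<..} (\<lambda>t::real. bump (ln t / n))" "continuous_on {0<..} (\<lambda>t::real. bump' (ln t / n))"
    by (rule continuous_on_compose2[OF continuous_bump(1)[of UNIV]]
          continuous_on_compose2[OF continuous_bump(2)[of UNIV]];
        use n in \<open>auto intro!: continuous_intros\<close>)+
  show 1: "continuous_on UNIV (time_cutoff n)"
  proof (rule glue)
    show "continuous_on {0<..} (time_cutoff n)"
      by (rule continuous_on_eq[OF b(1)]) (auto simp: time_cutoff_def)
  qed (use time_cutoff_zero[OF n] in auto)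
  show "continuous_on UNIV (time_cutoff' n)"
  proof (rule glue)
    have "continuous_on {0<..} (\<lambda>t::real. bump' (ln t / n) / (n * t))"
      by (intro continuous_intros b(2)) (use n in auto)
    then show "continuous_on {0<..} (time_cutoff' n)"
      by (rule continuous_on_eq) (auto simp: time_cutoff'_def)
  qed (use time_cutoff_zero[OF n] in auto)
  show "continuous_on UNIV (log_weight n)"
  proof (rule glue)
    show "continuous_on {0<..} (log_weight n)" unfolding log_weight_def
      by (intro continuous_intros continuous_on_subset[OF 1]) (use n in auto)
  qed (use time_cutoff_zero[OF n] in auto)
qed

lemma log_window_nonneg: "0 \<le> log_window n t"
proof (cases "t > 0")
  case False
  then have "t \<notin> log_interval n"
    using less_le_trans[OF exp_gt_zero[of "real n"], of t] by auto
  then show ?thesis by (simp add: log_window_def)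
qed (simp add: log_window_def)

lemma time_weights_le:
  assumes n: "n > 0"
  shows "0 \<le> log_weight n t" "log_weight n t \<le> 2 * log_window n t"
    "\<bar>time_cutoff' n t\<bar> \<le> 15 * log_window n t"
proof -
  have "0 \<le> log_weight n t \<and> log_weight n t \<le> 2 * log_window n t \<and> \<bar>time_cutoff' n t\<bar> \<le> 15 * log_window n t"
  proof (cases "t \<in> log_interval n")
    case True
    then have t: "t > 0" using exp_n_gt_1[OF n] by force
    have "bump (ln t / n) / (n * t) \<le> 2 / (n * t)" "\<bar>bump' (ln t / n)\<bar> / (n * t) \<le> 15 / (n * t)"
      using t by (intro divide_right_mono bump_bounds; simp)+
    then show ?thesis using True t n bump_bounds(1)
      by (auto simp: log_weight_def time_cutoff_def time_cutoff'_def log_window_def abs_mult)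
  qed (use time_cutoff_zero[OF n] in auto)
  then show "0 \<le> log_weight n t" "log_weight n t \<le> 2 * log_window n t"
    "\<bar>time_cutoff' n t\<bar> \<le> 15 * log_window n t" by auto
qed

lemma measurable_time_weights [measurable]:
  "log_weight n \<in> borel_measurable borel" "log_window n \<in> borel_measurable borel"
  "time_cutoff n \<in> borel_measurable borel" "time_cutoff' n \<in> borel_measurable borel"
proof -
  have [measurable]: "bump \<in> borel_measurable borel" "bump' \<in> borel_measurable borel"
    using continuous_bump by (auto intro: borel_measurable_continuous_onI)
  show "time_cutoff n \<in> borel_measurable borel" "time_cutoff' n \<in> borel_measurable borel"
    unfolding time_cutoff_def[abs_def] time_cutoff'_def[abs_def] by measurable
  then show "log_weight n \<in> borel_measurable borel"
    unfolding log_weight_def[abs_def] by measurable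
  show "log_window n \<in> borel_measurable borel"
    unfolding log_window_def[abs_def] by measurable
qed

lemma nn_integral_reciprocal:
  assumes "0 < a" "a \<le> b" "0 < c"
  shows "(\<integral>\<^sup>+t. ennreal (1 / (c * t)) * indicator {a..b} t \<partial>lborel) = ennreal ((ln b - ln a) / c)"
proof -
  have "(\<integral>\<^sup>+t. ennreal (1 / (c * t)) * indicator {a..b} t \<partial>lborel) = ennreal (ln b / c - ln a / c)"
  proof (rule nn_integral_FTC_Icc)
    show "((\<lambda>t. ln t / c) has_real_derivative 1 / (c * x)) (at x)" if "x \<in> {a..b}" for x
      using that assms by (auto intro!: derivative_eq_intros simp: field_simps)
  qed (use assms in auto)
  then show ?thesis by (simp add: diff_divide_distrib)
qed

lemma log_window_integral:
  assumes n: "n > 0"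
  shows "integrable lborel (log_window n)" "(LINT t|lborel. log_window n t) = 1"
proof -
  have "has_bochner_integral lborel (\<lambda>t. 1 / (real n * t) * indicator (log_interval n) t)
     (ln (exp (2 * real n)) / n - ln (exp (real n)) / n)"
  proof (rule has_bochner_integral_FTC_Icc_nonneg[where F = "\<lambda>t. ln t / real n"])
    show "((\<lambda>t. ln t / real n) has_real_derivative 1 / (real n * x)) (at x)" if "x \<in> log_interval n" for x
      using exp_n_gt_1[OF n, of x] that n by (auto intro!: derivative_eq_intros simp: field_simps)
    show "0 \<le> 1 / (real n * x)" if "x \<in> log_interval n" for x
      using exp_n_gt_1[OF n, of x] that by simp
  qed auto
  moreover have "(\<lambda>t. 1 / (real n * t) * indicator (log_interval n) t) = log_window n"
    by (auto simp: log_window_def)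
  ultimately have "has_bochner_integral lborel (log_window n) 1" using n by (simp add: field_simps)
  then show "integrable lborel (log_window n)" "(LINT t|lborel. log_window n t) = 1"
    by (auto simp: has_bochner_integral_iff)
qed

lemma log_weight_integral:
  assumes n: "n > 0"
  shows "integrable lborel (log_weight n)" "(LINT t|lborel. log_weight n t) = 1"
proof -
  \<comment> \<open>The polynomial is the antiderivative of \<open>30 * (r * (1 - r))\<^sup>2\<close> that vanishes at 0; its value at 1 is 1.\<close>
  define F where "F t = (let r = ln t / n - 1 in 10 * r^3 - 15 * r^4 + 6 * r^5)" for t :: real
  have eq: "(\<lambda>t. log_weight n t * indicator (log_interval n) t) = log_weight n"
    using time_cutoff_zero(3)[OF n] by (auto simp: fun_eq_iff indicator_def)
  have "has_bochner_integral lborel (\<lambda>t. log_weight n t * indicator (log_interval n) t)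
     (F (exp (2 * real n)) - F (exp (real n)))"
  proof (rule has_bochner_integral_FTC_Icc_nonneg[where F = F])
    fix x assume "x \<in> log_interval n"
    then have x: "exp (real n) \<le> x" "x \<le> exp (2 * real n)" by auto
    have x0: "x > 0" using exp_n_gt_1[OF n x(1)] by simp
    have "real n \<le> ln x" "ln x \<le> 2 * real n"
      using x x0 ln_le_cancel_iff[of "exp (real n)" x] ln_le_cancel_iff[of x "exp (2 * real n)"] by auto
    then have r: "ln x / n \<ge> 1" "ln x / n \<le> 2" using n by (auto simp: divide_simps)
    then have "(ln x / n - 1) * (2 - ln x / n) \<ge> 0" by simp
    then have b: "bump (ln x / n) = 30 * ((ln x / n - 1) * (2 - ln x / n))\<^sup>2" by (simp add: bump_def)
    define r where "r = ln x / n - 1"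
    have d: "((\<lambda>t. ln t / n - 1) has_real_derivative 1 / (n * x)) (at x)"
      using x0 n by (auto intro!: derivative_eq_intros simp: field_simps)
    have "(F has_real_derivative (30 * r^2 - 60 * r^3 + 30 * r^4) * (1 / (n * x))) (at x)"
    proof -
      have "((\<lambda>r::real. 10 * r^3 - 15 * r^4 + 6 * r^5) has_real_derivative
          30 * r^2 - 60 * r^3 + 30 * r^4) (at r)"
        by (auto intro!: derivative_eq_intros)
      from DERIV_chain2[OF this[unfolded r_def] d] show ?thesis
        by (simp add: F_def[abs_def] Let_def r_def)
    qed
    moreover have "30 * r^2 - 60 * r^3 + 30 * r^4 = 30 * (r * (1 - r))\<^sup>2"
      by (simp add: power2_eq_square power3_eq_cube power4_eq_xxxx algebra_simps)
    moreover have "30 * (r * (1 - r))\<^sup>2 = bump (ln x / n)"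
      unfolding b r_def by (simp add: algebra_simps)
    ultimately show "(F has_real_derivative log_weight n x) (at x)"
      using x0 by (simp add: log_weight_def time_cutoff_def)
    show "0 \<le> log_weight n x" using time_weights_le[OF n] by simp
  qed (use n in auto)
  then have "has_bochner_integral lborel (log_weight n) 1"
    using n by (simp add: eq F_def Let_def)
  then show "integrable lborel (log_weight n)" "(LINT t|lborel. log_weight n t) = 1"
    by (auto simp: has_bochner_integral_iff)
qed

lemma log_average_tendsto:
  fixes a :: "real \<Rightarrow> real"
  assumes m: "a \<in> borel_measurable borel" and lim: "(a \<longlongrightarrow> l) at_top"
  shows "(\<lambda>n. LINT t|lborel. log_weight n t * a t) \<longlonglongrightarrow> l"
proof (rule LIMSEQ_I)
  fix r :: real assume r: "r > 0"
  then have "\<forall>\<^sub>F t in at_top. dist (a t) l < r / 2" using lim by (intro tendstoD) auto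
  then obtain T where T: "\<And>t. t \<ge> T \<Longrightarrow> \<bar>a t - l\<bar> < r / 2"
    by (auto simp: eventually_at_top_linorder dist_real_def)
  obtain n0 :: nat where n0: "real n0 > max 0 T" using reals_Archimedean2 by blast
  show "\<exists>no. \<forall>n\<ge>no. norm ((LINT t|lborel. log_weight n t * a t) - l) < r"
  proof (intro exI allI impI)
    fix n assume "n0 \<le> n"
    then have n: "n > 0" "real n > T" using n0 by (auto simp: order_less_le_trans)
    have b: "\<bar>log_weight n t * (a t - l)\<bar> \<le> log_weight n t * (r / 2)" for t
    proof (cases "t \<in> log_interval n")
      case True
      have "real n + 1 \<le> exp (real n)" using exp_ge_add_one_self[of "real n"] by linarith
      then have "T \<le> t" using True n by auto
      then have "\<bar>a t - l\<bar> \<le> r / 2" using T[of t] by simp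
      then have "log_weight n t * \<bar>a t - l\<bar> \<le> log_weight n t * (r / 2)"
        by (rule mult_left_mono) (rule time_weights_le(1)[OF n(1)])
      then show ?thesis using time_weights_le(1)[OF n(1), of t] by (simp add: abs_mult)
    qed (use time_cutoff_zero[OF n(1)] in simp)
    have iw: "integrable lborel (log_weight n)" by (rule log_weight_integral[OF n(1)])
    have id: "integrable lborel (\<lambda>t. log_weight n t * (a t - l))"
    proof (rule Bochner_Integration.integrable_bound[of _ "\<lambda>t. log_weight n t * (r / 2)"])
      show "integrable lborel (\<lambda>t. log_weight n t * (r / 2))" using iw by simp
      show "(\<lambda>t. log_weight n t * (a t - l)) \<in> borel_measurable lborel" using m by measurable
      have "norm (log_weight n t * (a t - l)) \<le> norm (log_weight n t * (r / 2))" for t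
        using b[of t] by (simp only: real_norm_def)
      then show "AE t in lborel. norm (log_weight n t * (a t - l)) \<le> norm (log_weight n t * (r / 2))" by simp
    qed
    have "(\<lambda>t. log_weight n t * a t) = (\<lambda>t. log_weight n t * (a t - l) + log_weight n t * l)"
      by (auto simp: algebra_simps)
    then have "(LINT t|lborel. log_weight n t * a t)
        = (LINT t|lborel. log_weight n t * (a t - l)) + l"
      using id iw log_weight_integral(2)[OF n(1)] by simp
    moreover have "\<bar>LINT t|lborel. log_weight n t * (a t - l)\<bar> \<le> (LINT t|lborel. log_weight n t * (r / 2))"
      using iw id b by (intro order_trans[OF integral_abs_bound] integral_mono) auto
    moreover have "(LINT t|lborel. log_weight n t * (r / 2)) = r / 2"
      using log_weight_integral(2)[OF n(1)] by simp
    ultimately show "norm ((LINT t|lborel. log_weight n t * a t) - l) < r" using r by simp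
  qed
qed

section \<open>Densities that scatter along the free flow\<close>

context transported_density begin

lemma vmax_mono: "0 \<le> s \<Longrightarrow> s \<le> t \<Longrightarrow> vmax s \<le> vmax t"
  unfolding vmax_def using k C by (intro add_mono mult_left_mono diff_mono) auto

definition slab :: "real \<Rightarrow> (real \<times> R3 \<times> R3) set" where
  "slab T = {0..T} \<times> cball 0 (T + k) \<times> cball 0 (vmax T)"

lemma compact_slab: "compact (slab T)"
  unfolding slab_def by (intro compact_Times compact_Icc compact_cball)

lemma zero_outside_slab:
  assumes "0 \<le> t" "t \<le> T" "(t, x, v) \<notin> slab T"
  shows "f (t, x, v) = 0"
proof (rule ccontr)
  assume f: "f (t, x, v) \<noteq> 0"
  have "norm x \<le> T + k" using support_space[OF assms(1) f] assms(2) by simp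
  moreover have "norm v \<le> vmax T"
    using support_momentum[OF assms(1) f] vmax_mono[OF assms(1,2)] by simp
  ultimately show False using assms by (simp add: slab_def)
qed

lemma measurable_f [measurable]: "f \<in> borel_measurable (borel \<Otimes>\<^sub>M (borel \<Otimes>\<^sub>M borel))"
  using borel_measurable_continuous_onI[OF contf] by (simp add: borel_prod)

text \<open>
  Up to any given time the density has compact support.
\<close>
lemma integrable_weighted_density:
  fixes c :: "real \<times> R3 \<times> R3 \<Rightarrow> real"
  assumes n: "n > 0" and m: "c \<in> borel_measurable borel"
    and b: "\<And>t x v. \<bar>c (t, x, v)\<bar> \<le> A * log_window n t"
  shows "integrable lborel (\<lambda>z. c z * f z)"
proof -
  have "bounded (f ` slab (exp (2 * real n)))"
    by (intro compact_imp_bounded compact_continuous_image compact_slab continuous_on_subset[OF contf]) auto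
  then obtain M where M: "\<And>z. z \<in> slab (exp (2 * real n)) \<Longrightarrow> norm (f z) \<le> M"
    unfolding bounded_iff by blast
  define S where "S = slab (exp (2 * real n))"
  have A: "A \<ge> 0"
  proof -
    have "0 \<le> A * log_window n (exp (real n))" using b[of "exp (real n)" 0 0] by linarith
    moreover have "log_window n (exp (real n)) > 0" using n by (simp add: log_window_def)
    ultimately show ?thesis by (simp add: zero_le_mult_iff)
  qed
  show ?thesis
  proof (rule Bochner_Integration.integrable_bound[of _ "\<lambda>z. indicator S z *\<^sub>R (A * \<bar>M\<bar>)"])
    show "integrable lborel (\<lambda>z. indicator S z *\<^sub>R (A * \<bar>M\<bar>))"
      by (rule borel_integrable_compact) (auto simp: S_def compact_slab)
    show "(\<lambda>z. c z * f z) \<in> borel_measurable lborel"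
      using m borel_measurable_continuous_onI[OF contf] by measurable
    have "norm (c z * f z) \<le> norm (indicator S z *\<^sub>R (A * \<bar>M\<bar>))" for z
    proof -
      obtain t x v where z: "z = (t, x, v)" by (cases z) auto
      show ?thesis
      proof (cases "t \<in> log_interval n")
        case False
        then have "c z = 0" using b[of t x v] time_cutoff_zero(4)[OF n False] by (simp add: z)
        then show ?thesis by simp
      next
        case True
        then have t: "t > 1" using exp_n_gt_1[OF n, of t] by simp
        show ?thesis
        proof (cases "z \<in> S")
          case False
          then have "f z = 0" using True t zero_outside_slab[of t "exp (2 * real n)" x v]
            by (simp add: z S_def)
          then show ?thesis by simp
        next
          case zS: True
          have "1 * 1 \<le> real n * t" using n t by (intro mult_mono) auto
          then have "log_window n t \<le> 1" using True t n by (simp add: log_window_def)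
          then have "\<bar>c z\<bar> \<le> A * 1" unfolding z by (intro order_trans[OF b] mult_left_mono A)
          moreover have "\<bar>f z\<bar> \<le> \<bar>M\<bar>" using M[of z] zS by (auto simp: S_def)
          ultimately have "\<bar>c z\<bar> * \<bar>f z\<bar> \<le> (A * 1) * \<bar>M\<bar>" using A by (intro mult_mono) auto
          then show ?thesis using zS A by (simp add: abs_mult)
        qed
      qed
    qed
    then show "AE z in lborel. norm (c z * f z) \<le> norm (indicator S z *\<^sub>R (A * \<bar>M\<bar>))" by simp
  qed
qed

end

text \<open>
  Integrated against a density, this kernel gives the combination \<open>\<rho> - (x/t) \<bullet> j\<close> of charge and current, localised
  by \<open>\<eta>\<close> in the similarity coordinate \<open>x/t\<close>.
\<close>
definition current_kernel :: "real \<Rightarrow> (R3 \<Rightarrow> real) \<Rightarrow> real \<times> R3 \<times> R3 \<Rightarrow> real" where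
  "current_kernel \<mu> \<eta> z =
     (1 - ((1 / fst z) *\<^sub>R fst (snd z)) \<bullet> velocity \<mu> (snd (snd z))) * \<eta> ((1 / fst z) *\<^sub>R fst (snd z))"

lemma current_kernel_bound:
  assumes \<mu>: "\<mu> > 0" and b\<eta>: "\<And>u. \<bar>\<eta> u\<bar> \<le> A" and s\<eta>: "\<And>u. \<eta> u \<noteq> 0 \<Longrightarrow> norm u \<le> 1"
  shows "\<bar>current_kernel \<mu> \<eta> z\<bar> \<le> 2 * A"
proof -
  define u where "u = (1 / fst z) *\<^sub>R fst (snd z)"
  define v where "v = snd (snd z)"
  have A: "A \<ge> 0" using b\<eta>[of 0] by linarith
  have "\<bar>(1 - u \<bullet> velocity \<mu> v) * \<eta> u\<bar> \<le> 2 * A"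
  proof (cases "\<eta> u = 0")
    case False
    have "\<bar>u \<bullet> velocity \<mu> v\<bar> \<le> 1 * 1"
      using s\<eta>[OF False] norm_velocity_less_1[OF \<mu>, of v]
      by (intro order_trans[OF Cauchy_Schwarz_ineq2] mult_mono) auto
    then have "\<bar>1 - u \<bullet> velocity \<mu> v\<bar> \<le> 2" by linarith
    then have "\<bar>1 - u \<bullet> velocity \<mu> v\<bar> * \<bar>\<eta> u\<bar> \<le> 2 * A" using b\<eta>[of u] by (intro mult_mono) auto
    then show ?thesis by (simp add: abs_mult)
  qed (use A in simp)
  then show ?thesis by (simp add: current_kernel_def u_def v_def)
qed

lemma measurable_current_kernel:
  assumes c\<eta>: "continuous_on UNIV \<eta>"
  shows "current_kernel \<mu> \<eta> \<in> borel_measurable borel"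
proof -
  have [measurable]: "\<eta> \<in> borel_measurable borel" by (rule borel_measurable_continuous_onI[OF c\<eta>])
  show ?thesis unfolding current_kernel_def[abs_def] borel_prod[symmetric] by measurable
qed

text \<open>
  \<open>g\<close> is the scattering state and \<open>q\<close> the asymptotic charge, as a function of the momentum \<open>v\<close> instead of \<open>v/\<mu>\<close>.
\<close>
locale scattering_density = transported_density +
  fixes g :: "R3 \<times> R3 \<Rightarrow> real" and q :: "R3 \<Rightarrow> real" and K0 C1 :: real
  assumes gint: "integrable lborel g"
    and scat: "((\<lambda>s. \<integral>\<^sup>+(x, v). ennreal \<bar>f (s * energy \<mu> v, x + s *\<^sub>R v, v) - g (x, v)\<bar> \<partial>lborel) \<longlongrightarrow> 0) at_top"
    and contq: "continuous_on UNIV q"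
    and q_supp: "\<And>v. norm v > K0 \<Longrightarrow> q v = 0"
    and charge: "\<And>t v. t \<ge> 0 \<Longrightarrow> \<bar>(LINT x|lborel. f (t, x, v)) - q v\<bar> \<le> C1 * (ln (2 + t)) ^ 5 / (2 + t)"
begin

text \<open>
  The free solution with scattering state \<open>g\<close>.
\<close>
definition drifted :: "real \<times> R3 \<times> R3 \<Rightarrow> real" where
  "drifted = (\<lambda>(t, x, v). g (x - t *\<^sub>R velocity \<mu> v, v))"

lemma drifted_free_flow: "drifted (free_flow \<mu> (t, w)) = g w"
  by (cases w) (simp add: drifted_def free_flow_def)

lemma measurable_g [measurable]: "g \<in> borel_measurable (borel \<Otimes>\<^sub>M borel)"
  using gint by (auto simp: borel_prod)

lemma measurable_drifted [measurable]: "drifted \<in> borel_measurable (borel \<Otimes>\<^sub>M (borel \<Otimes>\<^sub>M borel))"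
  unfolding drifted_def by measurable

lemma drifted_borel: "drifted \<in> borel_measurable borel"
  using measurable_drifted by (simp add: borel_prod)

lemma weighted_drifted:
  fixes c :: "real \<times> R3 \<times> R3 \<Rightarrow> real"
  assumes n: "n > 0" and m: "c \<in> borel_measurable borel"
    and b: "\<And>t x v. \<bar>c (t, x, v)\<bar> \<le> A * log_window n t"
  shows "integrable lborel (\<lambda>z. c (free_flow \<mu> z) * g (snd z))"
    and "integrable lborel (\<lambda>z. c z * drifted z)"
    and "(LINT z|lborel. c z * drifted z) = (LINT z|lborel. c (free_flow \<mu> z) * g (snd z))"
proof -
  have m': "(\<lambda>z. c z * drifted z) \<in> borel_measurable borel" using m drifted_borel by measurable
  have eq: "c (free_flow \<mu> z) * drifted (free_flow \<mu> z) = c (free_flow \<mu> z) * g (snd z)" for z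
    by (cases z) (simp add: drifted_free_flow)
  show 1: "integrable lborel (\<lambda>z. c (free_flow \<mu> z) * g (snd z))"
  proof (rule Bochner_Integration.integrable_bound[of _ "\<lambda>z. (A * log_window n (fst z)) * g (snd z)"])
    show "integrable lborel (\<lambda>z. (A * log_window n (fst z)) * g (snd z))"
      using integrable_lborel_mult[OF log_window_integral(1)[OF n] gint] by (simp add: mult.assoc)
    have "(\<lambda>z. c (free_flow \<mu> z) * drifted (free_flow \<mu> z)) \<in> borel_measurable borel"
      using measurable_compose[OF measurable_free_flow m'] by simp
    then show "(\<lambda>z. c (free_flow \<mu> z) * g (snd z)) \<in> borel_measurable lborel" by (simp add: eq)
    have "norm (c (free_flow \<mu> z) * g (snd z)) \<le> norm ((A * log_window n (fst z)) * g (snd z))" for z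
    proof -
      have "\<bar>c (free_flow \<mu> z)\<bar> \<le> \<bar>A * log_window n (fst z)\<bar>"
        using b[of "fst z" "fst (snd z) + fst z *\<^sub>R velocity \<mu> (snd (snd z))" "snd (snd z)"]
        by (simp add: free_flow_def case_prod_beta)
      then have "\<bar>c (free_flow \<mu> z)\<bar> * \<bar>g (snd z)\<bar> \<le> \<bar>A * log_window n (fst z)\<bar> * \<bar>g (snd z)\<bar>"
        by (rule mult_right_mono) simp
      then show ?thesis by (simp only: real_norm_def abs_mult)
    qed
    then show "AE z in lborel. norm (c (free_flow \<mu> z) * g (snd z)) \<le> norm ((A * log_window n (fst z)) * g (snd z))"
      by simp
  qed
  show "integrable lborel (\<lambda>z. c z * drifted z)"
    using integral_free_flow(2)[OF m', of \<mu>] 1 by (simp add: eq)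
  show "(LINT z|lborel. c z * drifted z) = (LINT z|lborel. c (free_flow \<mu> z) * g (snd z))"
    using integral_free_flow(1)[OF m', of \<mu>] by (simp add: eq)
qed

definition window :: "nat \<Rightarrow> real \<Rightarrow> real \<times> R3 \<times> R3 \<Rightarrow> real" where
  "window n K z = log_window n (fst z) * (if norm (snd (snd z)) \<le> K then 1 else 0)"

lemma window_le: "0 \<le> window n K z" "window n K (t, x, v) \<le> log_window n t"
  using log_window_nonneg[of n] by (auto simp: window_def)

lemma measurable_window [measurable]: "window n K \<in> borel_measurable (borel \<Otimes>\<^sub>M (borel \<Otimes>\<^sub>M borel))"
  unfolding window_def[abs_def] by measurable

lemma window_borel: "window n K \<in> borel_measurable borel"
  using measurable_window by (simp add: borel_prod)

text \<open>
  The distance of \<open>f\<close> to the free solution, averaged over times in \<open>log_interval n\<close> and restricted to momenta of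
  norm at most \<open>K\<close>. The restriction keeps the ratio of \<open>t\<close> to proper time bounded.
\<close>
definition mean_distance :: "nat \<Rightarrow> real \<Rightarrow> real" where
  "mean_distance n K = (LINT z|lborel. window n K z * \<bar>f z - drifted z\<bar>)"

lemma integrable_mean_distance:
  assumes n: "n > 0"
  shows "integrable lborel (\<lambda>z. window n K z * \<bar>f z - drifted z\<bar>)"
proof -
  have b: "\<bar>window n K (t, x, v)\<bar> \<le> 1 * log_window n t" for t x v using window_le[of n K] by simp
  have "integrable lborel (\<lambda>z. window n K z * f z - window n K z * drifted z)"
    by (intro Bochner_Integration.integrable_diff integrable_weighted_density[OF n window_borel b]
        weighted_drifted(2)[OF n window_borel b])
  then have "integrable lborel (\<lambda>z. \<bar>window n K z * f z - window n K z * drifted z\<bar>)" by (rule integrable_abs)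
  moreover have "\<bar>window n K z * f z - window n K z * drifted z\<bar> = window n K z * \<bar>f z - drifted z\<bar>" for z
    using window_le(1)[of n K z] by (simp add: right_diff_distrib[symmetric] abs_mult)
  ultimately show ?thesis by simp
qed

text \<open>
  The window of times \<open>t\<close> is contained in a window of proper times \<open>s\<close> that is longer only by \<open>ln (M/\<mu>)\<close> on the
  logarithmic scale, where \<open>M\<close> is the largest energy. Since \<open>dt/t = ds/s\<close> at fixed momentum, the average in \<open>t\<close>
  is bounded by an average in \<open>s\<close>.
\<close>
lemma mean_distance_bound:
  assumes n: "n > 0" and K: "K \<ge> 0" and \<epsilon>: "\<epsilon> > 0"
    and s0: "\<And>s. s \<ge> exp (real n) / sqrt (\<mu>\<^sup>2 + K\<^sup>2) \<Longrightarrow>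
      (\<integral>\<^sup>+(x, v). ennreal \<bar>f (s * energy \<mu> v, x + s *\<^sub>R v, v) - g (x, v)\<bar> \<partial>lborel) \<le> ennreal \<epsilon>"
  shows "mean_distance n K \<le> \<epsilon> * (1 + ln (sqrt (\<mu>\<^sup>2 + K\<^sup>2)) - ln \<mu>)"
proof -
  define M where "M = sqrt (\<mu>\<^sup>2 + K\<^sup>2)"
  have M: "\<mu> \<le> M" unfolding M_def by (rule real_le_rsqrt) simp
  have M0: "M > 0" using M \<mu> by simp
  define a where "a = exp (real n) / M"
  define b where "b = exp (2 * real n) / \<mu>"
  have ab: "0 < a" "a \<le> b"
  proof -
    show "0 < a" using M0 by (simp add: a_def)
    show "a \<le> b" unfolding a_def b_def using M \<mu> M0 by (intro frac_le) auto
  qed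
  define H where "H z = ennreal (window n K z * \<bar>f z - drifted z\<bar>)" for z
  have Hm: "H \<in> borel_measurable borel"
    unfolding H_def[abs_def] borel_prod[symmetric] by measurable
  \<comment> \<open>\<open>{a..b}\<close> contains all proper times that belong to times in the window.\<close>
  have "ennreal (mean_distance n K) = (\<integral>\<^sup>+z. H z \<partial>lborel)"
    unfolding mean_distance_def H_def
    by (rule nn_integral_eq_integral[symmetric])
       (use integrable_mean_distance[OF n] window_le(1) in auto)
  also have "\<dots> = (\<integral>\<^sup>+s. \<integral>\<^sup>+w. ennreal (energy \<mu> (snd w)) * H (s * energy \<mu> (snd w), fst w + s *\<^sub>R snd w, snd w) \<partial>lborel \<partial>lborel)"
    by (rule nn_integral_proper_time[OF \<mu> Hm])
  also have "\<dots> \<le> (\<integral>\<^sup>+s. (ennreal (1 / (n * s)) * indicator {a..b} s) * ennreal \<epsilon> \<partial>lborel)"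
  proof (rule nn_integral_mono)
    fix s :: real
    have pt: "ennreal (energy \<mu> (snd w)) * H (s * energy \<mu> (snd w), fst w + s *\<^sub>R snd w, snd w)
       \<le> (ennreal (1 / (n * s)) * indicator {a..b} s) *
         (case w of (x, v) \<Rightarrow> ennreal \<bar>f (s * energy \<mu> v, x + s *\<^sub>R v, v) - g (x, v)\<bar>)" for w
    proof -
      obtain x v where w: "w = (x, v)" by (cases w)
      have p: "energy \<mu> v > 0" using energy_pos[OF \<mu>] .
      have d: "drifted (s * energy \<mu> v, x + s *\<^sub>R v, v) = g (x, v)"
      proof -
        have "(s * energy \<mu> v) *\<^sub>R velocity \<mu> v = s *\<^sub>R v"
          using energy_scale_velocity[OF \<mu>, of v] by (metis scaleR_scaleR)
        then show ?thesis by (simp add: drifted_def)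
      qed
      show ?thesis
      proof (cases "norm v \<le> K \<and> s * energy \<mu> v \<in> log_interval n")
        case False
        then have "window n K (s * energy \<mu> v, x + s *\<^sub>R v, v) = 0"
          by (auto simp: window_def log_window_def)
        then show ?thesis by (simp add: w H_def)
      next
        case True
        have vM: "energy \<mu> v \<le> M" unfolding M_def energy_def using True
          by (intro real_sqrt_le_mono add_left_mono power_mono) auto
        have "0 < s * energy \<mu> v" using True less_le_trans[OF exp_gt_zero[of "real n"]] by auto
        then have s: "s > 0" using p by (simp add: zero_less_mult_iff)
        have "a \<le> s"
        proof -
          have "s * energy \<mu> v \<le> s * M" using vM s by simp
          then have "exp (real n) \<le> s * M" using True by simp
          then show ?thesis using M0 by (simp add: a_def divide_le_eq)
        qed
        moreover have "s \<le> b"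
        proof -
          have "s * \<mu> \<le> s * energy \<mu> v" using mass_le_energy[OF \<mu>, of v] s by simp
          then have "s * \<mu> \<le> exp (2 * real n)" using True by simp
          then show ?thesis using \<mu> by (simp add: b_def le_divide_eq)
        qed
        moreover have "energy \<mu> v * window n K (s * energy \<mu> v, x + s *\<^sub>R v, v) = 1 / (n * s)"
          using True p by (simp add: window_def log_window_def)
        ultimately show ?thesis using p s
          by (simp add: w H_def d ennreal_mult'[symmetric] mult.assoc[symmetric] less_imp_le)
      qed
    qed
    show "(\<integral>\<^sup>+w. ennreal (energy \<mu> (snd w)) * H (s * energy \<mu> (snd w), fst w + s *\<^sub>R snd w, snd w) \<partial>lborel)
      \<le> (ennreal (1 / (n * s)) * indicator {a..b} s) * ennreal \<epsilon>"
    proof (cases "s \<in> {a..b}")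
      case False
      then have "ennreal (energy \<mu> (snd w)) * H (s * energy \<mu> (snd w), fst w + s *\<^sub>R snd w, snd w) = 0" for w
        using pt[of w] False by simp
      then have "(\<integral>\<^sup>+w. ennreal (energy \<mu> (snd w)) * H (s * energy \<mu> (snd w), fst w + s *\<^sub>R snd w, snd w) \<partial>lborel)
          = (\<integral>\<^sup>+w. 0 \<partial>(lborel :: (R3 \<times> R3) measure))"
        by (intro nn_integral_cong) blast
      then show ?thesis by simp
    next
      case True
      have m: "(\<lambda>w. case w of (x, v) \<Rightarrow> ennreal \<bar>f (s * energy \<mu> v, x + s *\<^sub>R v, v) - g (x, v)\<bar>) \<in> borel_measurable borel"
        unfolding borel_prod[symmetric] by measurable
      have "(\<integral>\<^sup>+w. ennreal (energy \<mu> (snd w)) * H (s * energy \<mu> (snd w), fst w + s *\<^sub>R snd w, snd w) \<partial>lborel)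
        \<le> (\<integral>\<^sup>+w. (ennreal (1 / (n * s)) * indicator {a..b} s) *
         (case w of (x, v) \<Rightarrow> ennreal \<bar>f (s * energy \<mu> v, x + s *\<^sub>R v, v) - g (x, v)\<bar>) \<partial>lborel)"
        by (intro nn_integral_mono pt)
      also have "\<dots> = (ennreal (1 / (n * s)) * indicator {a..b} s) *
          (\<integral>\<^sup>+(x, v). ennreal \<bar>f (s * energy \<mu> v, x + s *\<^sub>R v, v) - g (x, v)\<bar> \<partial>lborel)"
        by (rule nn_integral_cmult) (use m in simp)
      also have "\<dots> \<le> (ennreal (1 / (n * s)) * indicator {a..b} s) * ennreal \<epsilon>"
        using True by (intro mult_left_mono s0) (auto simp: a_def M_def)
      finally show ?thesis .
    qed
  qed
  also have "\<dots> = (\<integral>\<^sup>+s. ennreal (1 / (n * s)) * indicator {a..b} s \<partial>lborel) * ennreal \<epsilon>"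
    by (rule nn_integral_multc) measurable
  also have "\<dots> = ennreal ((ln b - ln a) / n) * ennreal \<epsilon>"
    using nn_integral_reciprocal[OF ab, of "real n"] n by simp
  also have "\<dots> = ennreal ((ln b - ln a) / n * \<epsilon>)"
    using ab n \<epsilon> by (subst ennreal_mult') (auto intro!: divide_nonneg_nonneg)
  finally have "mean_distance n K \<le> (ln b - ln a) / n * \<epsilon>"
    using ab n \<epsilon> by (subst (asm) ennreal_le_iff) (auto intro!: mult_nonneg_nonneg divide_nonneg_nonneg)
  also have "(ln b - ln a) / n = 1 + (ln M - ln \<mu>) / n"
    using M0 \<mu> n by (simp add: a_def b_def ln_div field_simps)
  also have "\<dots> \<le> 1 + (ln M - ln \<mu>) / 1"
    using M M0 \<mu> n by (intro add_left_mono divide_left_mono) auto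
  finally show ?thesis using \<epsilon> by (simp add: M_def algebra_simps)
qed

lemma mean_distance_nonneg: "0 \<le> mean_distance n K"
  unfolding mean_distance_def using window_le(1) by (intro integral_nonneg_AE) auto

lemma mean_distance_tendsto:
  assumes K: "K \<ge> 0"
  shows "(\<lambda>n. mean_distance n K) \<longlonglongrightarrow> 0"
proof (rule LIMSEQ_I)
  fix r :: real assume r: "r > 0"
  define M where "M = sqrt (\<mu>\<^sup>2 + K\<^sup>2)"
  have M: "\<mu> \<le> M" unfolding M_def by (rule real_le_rsqrt) simp
  have M0: "M > 0" using M \<mu> by simp
  define c where "c = 1 + ln M - ln \<mu>"
  have "ln \<mu> \<le> ln M" using M \<mu> M0 by simp
  then have c: "c > 0" by (simp add: c_def)
  define \<epsilon> where "\<epsilon> = r / (2 * c)"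
  have \<epsilon>: "\<epsilon> > 0" using r c by (simp add: \<epsilon>_def)
  have "\<forall>\<^sub>F s in at_top. (\<integral>\<^sup>+(x, v). ennreal \<bar>f (s * energy \<mu> v, x + s *\<^sub>R v, v) - g (x, v)\<bar> \<partial>lborel) < ennreal \<epsilon>"
    using scat \<epsilon> by (intro order_tendstoD(2)[where y = 0]) auto
  then obtain T where T: "\<And>s. s \<ge> T \<Longrightarrow>
      (\<integral>\<^sup>+(x, v). ennreal \<bar>f (s * energy \<mu> v, x + s *\<^sub>R v, v) - g (x, v)\<bar> \<partial>lborel) < ennreal \<epsilon>"
    by (auto simp: eventually_at_top_linorder)
  obtain n0 :: nat where n0: "real n0 > max 0 (T * M)" using reals_Archimedean2 by blast
  show "\<exists>no. \<forall>n\<ge>no. norm (mean_distance n K - 0) < r"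
  proof (intro exI allI impI)
    fix n assume "n0 \<le> n"
    then have n: "n > 0" "real n > T * M" using n0 by (auto simp: order_less_le_trans)
    have "real n + 1 \<le> exp (real n)" using exp_ge_add_one_self[of "real n"] by linarith
    then have "T \<le> exp (real n) / M" using n M0 by (simp add: le_divide_eq)
    then have "mean_distance n K \<le> \<epsilon> * c"
      unfolding c_def M_def
      by (intro mean_distance_bound n K \<epsilon>) (use T in \<open>auto intro!: less_imp_le simp: M_def\<close>)
    also have "\<dots> < r" using c r by (simp add: \<epsilon>_def)
    finally show "norm (mean_distance n K - 0) < r" using mean_distance_nonneg[of n K] by simp
  qed
qed

text \<open>
  In averages with bounded weights, \<open>f\<close> may be replaced by the free solution at the cost of the mean distance.
\<close>
lemma replace_by_drifted:
  fixes c :: "real \<times> R3 \<times> R3 \<Rightarrow> real"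
  assumes n: "n > 0" and m: "c \<in> borel_measurable borel"
    and b: "\<And>z. \<bar>c z\<bar> \<le> A * window n K z" and A: "A \<ge> 0"
  shows "\<bar>(LINT z|lborel. c z * f z) - (LINT z|lborel. c z * drifted z)\<bar> \<le> A * mean_distance n K"
proof -
  have b': "\<bar>c (t, x, v)\<bar> \<le> A * log_window n t" for t x v
    by (rule order_trans[OF b mult_left_mono[OF window_le(2) A]])
  note i = integrable_weighted_density[OF n m b'] weighted_drifted(2)[OF n m b']
  have "(LINT z|lborel. c z * f z) - (LINT z|lborel. c z * drifted z) = (LINT z|lborel. c z * f z - c z * drifted z)"
    using i by simp
  also have "\<bar>\<dots>\<bar> \<le> (LINT z|lborel. A * (window n K z * \<bar>f z - drifted z\<bar>))"
  proof (intro order_trans[OF integral_abs_bound] integral_mono)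
    show "integrable lborel (\<lambda>z. \<bar>c z * f z - c z * drifted z\<bar>)"
      by (intro integrable_abs Bochner_Integration.integrable_diff i)
    show "integrable lborel (\<lambda>z. A * (window n K z * \<bar>f z - drifted z\<bar>))"
      using integrable_mean_distance[OF n] by simp
    show "\<bar>c z * f z - c z * drifted z\<bar> \<le> A * (window n K z * \<bar>f z - drifted z\<bar>)" for z
      using mult_right_mono[OF b[of z], of "\<bar>f z - drifted z\<bar>"]
      by (simp add: right_diff_distrib[symmetric] abs_mult mult.assoc)
  qed
  finally show ?thesis by (simp add: mean_distance_def)
qed

lemma weighted_density_bound:
  fixes c :: "real \<times> R3 \<times> R3 \<Rightarrow> real"
  assumes n: "n > 0" and m: "c \<in> borel_measurable borel"
    and b: "\<And>z. \<bar>c z\<bar> \<le> A * window n K z" and A: "A \<ge> 0"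
  shows "\<bar>LINT z|lborel. c z * drifted z\<bar> \<le> A * (LINT w|lborel. \<bar>g w\<bar>)"
    and "\<bar>LINT z|lborel. c z * f z\<bar> \<le> A * (mean_distance n K + (LINT w|lborel. \<bar>g w\<bar>))"
proof -
  have b': "\<bar>c (t, x, v)\<bar> \<le> A * log_window n t" for t x v
    by (rule order_trans[OF b mult_left_mono[OF window_le(2) A]])
  have il: "integrable lborel (\<lambda>z. log_window n (fst z) * \<bar>g (snd z)\<bar>)"
    by (rule integrable_lborel_mult[OF log_window_integral(1)[OF n] integrable_abs[OF gint]])
  have "\<bar>LINT z|lborel. c (free_flow \<mu> z) * g (snd z)\<bar> \<le> (LINT z|lborel. A * (log_window n (fst z) * \<bar>g (snd z)\<bar>))"
  proof (intro order_trans[OF integral_abs_bound] integral_mono)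
    show "integrable lborel (\<lambda>z. \<bar>c (free_flow \<mu> z) * g (snd z)\<bar>)"
      by (intro integrable_abs weighted_drifted(1)[OF n m b'])
    show "integrable lborel (\<lambda>z. A * (log_window n (fst z) * \<bar>g (snd z)\<bar>))" using il by simp
    show "\<bar>c (free_flow \<mu> z) * g (snd z)\<bar> \<le> A * (log_window n (fst z) * \<bar>g (snd z)\<bar>)" for z
      using mult_right_mono[OF b'[of "fst z" "fst (snd z) + fst z *\<^sub>R velocity \<mu> (snd (snd z))" "snd (snd z)"], of "\<bar>g (snd z)\<bar>"]
      by (simp add: free_flow_def case_prod_beta abs_mult mult.assoc)
  qed
  also have "\<dots> = A * (LINT w|lborel. \<bar>g w\<bar>)"
    using integral_lborel_fst[OF il] log_window_integral(2)[OF n] by simp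
  finally show 1: "\<bar>LINT z|lborel. c z * drifted z\<bar> \<le> A * (LINT w|lborel. \<bar>g w\<bar>)"
    by (simp add: weighted_drifted(3)[OF n m b'])
  show "\<bar>LINT z|lborel. c z * f z\<bar> \<le> A * (mean_distance n K + (LINT w|lborel. \<bar>g w\<bar>))"
    using replace_by_drifted[OF n m b A] 1 by (simp add: distrib_left)
qed

lemma density_slice:
  assumes t: "t \<ge> 0" and m: "\<psi> \<in> borel_measurable borel" and b: "\<And>w. \<bar>\<psi> w\<bar> \<le> A"
  shows "integrable lborel (\<lambda>w. \<psi> w * f (t, w))"
proof -
  have c: "continuous_on UNIV (\<lambda>w. f (t, w))"
    by (rule continuous_on_compose2[OF contf]) (auto intro!: continuous_intros)
  have i: "integrable lborel (\<lambda>w. f (t, w))"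
  proof (rule integrable_continuous_compact_support[OF c])
    show "compact (cball 0 (t + k) \<times> cball 0 (vmax t) :: (R3 \<times> R3) set)"
      by (intro compact_Times compact_cball)
    show "f (t, w) = 0" if "w \<notin> cball 0 (t + k) \<times> cball 0 (vmax t)" for w
      using that zero_outside_slab[OF t order_refl, of "fst w" "snd w"] t
      by (cases w) (auto simp: slab_def)
  qed
  show ?thesis by (rule integrable_bounded_mult[OF i m b])
qed

lemma log_average_density:
  fixes b :: "real \<times> R3 \<times> R3 \<Rightarrow> real"
  assumes n: "n > 0" and m: "b \<in> borel_measurable borel" and b: "\<And>z. \<bar>b z\<bar> \<le> A"
  shows "integrable lborel (\<lambda>z. log_weight n (fst z) * b z * f z)"
    and "(LINT z|lborel. log_weight n (fst z) * b z * f z)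
       = (LINT t|lborel. log_weight n t * (LINT w|lborel. b (t, w) * f (t, w)))"
    and "(LINT z|lborel. log_weight n (fst z) * b z * drifted z)
       = (LINT t|lborel. log_weight n t * (LINT w|lborel. b (free_flow \<mu> (t, w)) * g w))"
    and "integrable lborel (\<lambda>t. log_weight n t * (LINT w|lborel. b (t, w) * f (t, w)))"
proof -
  have [measurable]: "b \<in> borel_measurable (borel \<Otimes>\<^sub>M (borel \<Otimes>\<^sub>M borel))" using m by (simp add: borel_prod)
  have m': "(\<lambda>z. log_weight n (fst z) * b z) \<in> borel_measurable borel"
    unfolding borel_prod[symmetric] by measurable
  have b': "\<bar>log_weight n (fst (t, x, v)) * b (t, x, v)\<bar> \<le> (2 * \<bar>A\<bar>) * log_window n t" for t x v
  proof -
    have "log_weight n t * \<bar>b (t, x, v)\<bar> \<le> (2 * log_window n t) * \<bar>A\<bar>"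
      using time_weights_le[OF n, of t] b[of "(t, x, v)"] log_window_nonneg[of n t]
      by (intro mult_mono) auto
    then show ?thesis using time_weights_le(1)[OF n, of t] by (simp add: abs_mult mult.commute mult.left_commute)
  qed
  show i: "integrable lborel (\<lambda>z. log_weight n (fst z) * b z * f z)"
    by (rule integrable_weighted_density[OF n m' b'])
  show "(LINT z|lborel. log_weight n (fst z) * b z * f z)
       = (LINT t|lborel. log_weight n t * (LINT w|lborel. b (t, w) * f (t, w)))"
    using integral_lborel_fst[OF i] by (simp add: mult.assoc)
  have "integrable lborel (\<lambda>t. LINT w|lborel. log_weight n (fst (t, w)) * b (t, w) * f (t, w))"
    using lborel_pair.integrable_fst'[of "\<lambda>z. log_weight n (fst z) * b z * f z"] i by (simp add: lborel_prod)
  then show "integrable lborel (\<lambda>t. log_weight n t * (LINT w|lborel. b (t, w) * f (t, w)))"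
    by (simp add: mult.assoc)
  have "(LINT z|lborel. log_weight n (fst z) * b z * drifted z)
      = (LINT z|lborel. log_weight n (fst (free_flow \<mu> z)) * b (free_flow \<mu> z) * g (snd z))"
    by (rule weighted_drifted(3)[OF n m' b'])
  also have "\<dots> = (LINT t|lborel. LINT w|lborel. log_weight n (fst (free_flow \<mu> (t, w))) * b (free_flow \<mu> (t, w)) * g (snd (t, w)))"
    by (rule integral_lborel_fst[OF weighted_drifted(1)[OF n m' b']])
  also have "\<dots> = (LINT t|lborel. log_weight n t * (LINT w|lborel. b (free_flow \<mu> (t, w)) * g w))"
    by (simp add: free_flow_def case_prod_beta mult.assoc)
  finally show "(LINT z|lborel. log_weight n (fst z) * b z * drifted z)
       = (LINT t|lborel. log_weight n t * (LINT w|lborel. b (free_flow \<mu> (t, w)) * g w))" .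
qed

lemma slice_momentum:
  assumes t: "t \<ge> 0" and m: "\<psi> \<in> borel_measurable borel" and b: "\<And>v. \<bar>\<psi> v\<bar> \<le> A"
  shows "integrable lborel (\<lambda>v. \<psi> v * (LINT x|lborel. f (t, x, v)))"
    and "(LINT w|lborel. \<psi> (snd w) * f (t, w)) = (LINT v|lborel. \<psi> v * (LINT x|lborel. f (t, x, v)))"
proof -
  have m': "(\<lambda>w :: R3 \<times> R3. \<psi> (snd w)) \<in> borel_measurable borel"
    using m unfolding borel_prod[symmetric] by measurable
  note i = density_slice[OF t m', OF b]
  show "(LINT w|lborel. \<psi> (snd w) * f (t, w)) = (LINT v|lborel. \<psi> v * (LINT x|lborel. f (t, x, v)))"
    using integral_lborel_snd[OF i] by simp
  have "integrable lborel (\<lambda>v. LINT x|lborel. \<psi> (snd (x, v)) * f (t, x, v))"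
  proof -
    have "integrable (lborel \<Otimes>\<^sub>M lborel) (\<lambda>(x, v). \<psi> (snd (x, v)) * f (t, x, v))"
      using i by (simp add: lborel_prod case_prod_beta')
    then show ?thesis by (rule lborel_pair.integrable_snd)
  qed
  then show "integrable lborel (\<lambda>v. \<psi> v * (LINT x|lborel. f (t, x, v)))" by simp
qed

lemma integrable_q:
  assumes m: "\<psi> \<in> borel_measurable borel" and b: "\<And>v. \<bar>\<psi> v\<bar> \<le> A"
  shows "integrable lborel (\<lambda>v. \<psi> v * q v)"
proof (rule integrable_bounded_mult[OF _ m b])
  show "integrable lborel q"
    by (rule integrable_continuous_compact_support[OF contq compact_cball[of 0 K0]]) (auto simp: q_supp)
qed

text \<open>
  For bounded momenta the uniform convergence to the asymptotic charge may be integrated over \<open>v\<close>.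
\<close>
lemma charge_against_bounded:
  assumes m: "\<psi> \<in> borel_measurable borel" and b: "\<And>v. \<bar>\<psi> v\<bar> \<le> A"
    and supp: "\<And>v. norm v > K \<Longrightarrow> \<psi> v = 0" and K: "K \<ge> 0"
  shows "((\<lambda>t. LINT w|lborel. \<psi> (snd w) * f (t, w)) \<longlongrightarrow> (LINT v|lborel. \<psi> v * q v)) at_top"
proof -
  define V where "V = measure lborel (cball 0 K :: R3 set)"
  have bd: "\<bar>(LINT w|lborel. \<psi> (snd w) * f (t, w)) - (LINT v|lborel. \<psi> v * q v)\<bar>
      \<le> (\<bar>A\<bar> * C1 * V) * ((ln (2 + t)) ^ 5 / (2 + t))" if t: "t \<ge> 0" for t
  proof -
    note i1 = slice_momentum[OF t m b] and i2 = integrable_q[OF m b]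
    define \<delta> where "\<delta> = C1 * (ln (2 + t)) ^ 5 / (2 + t)"
    have \<delta>: "\<delta> \<ge> 0" using charge[OF t, of 0] unfolding \<delta>_def by linarith
    have "(LINT w|lborel. \<psi> (snd w) * f (t, w)) - (LINT v|lborel. \<psi> v * q v)
      = (LINT v|lborel. \<psi> v * (LINT x|lborel. f (t, x, v)) - \<psi> v * q v)"
      using i1 i2 by simp
    also have "\<bar>\<dots>\<bar> \<le> (LINT v|lborel. indicator (cball (0::R3) K) v *\<^sub>R (\<bar>A\<bar> * \<delta>))"
    proof (intro order_trans[OF integral_abs_bound] integral_mono)
      show "integrable lborel (\<lambda>v. \<bar>\<psi> v * (LINT x|lborel. f (t, x, v)) - \<psi> v * q v\<bar>)"
        using i1 i2 by (intro integrable_abs Bochner_Integration.integrable_diff)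
      show "integrable lborel (\<lambda>v::R3. indicator (cball 0 K) v *\<^sub>R (\<bar>A\<bar> * \<delta>))"
        by (rule borel_integrable_compact) auto
      show "\<bar>\<psi> v * (LINT x|lborel. f (t, x, v)) - \<psi> v * q v\<bar> \<le> indicator (cball 0 K) v *\<^sub>R (\<bar>A\<bar> * \<delta>)" for v
      proof (cases "norm v \<le> K")
        case True
        have "\<bar>\<psi> v\<bar> * \<bar>(LINT x|lborel. f (t, x, v)) - q v\<bar> \<le> \<bar>A\<bar> * \<delta>"
          using b[of v] charge[OF t, of v] by (intro mult_mono) (auto simp: \<delta>_def)
        then show ?thesis using True by (simp add: right_diff_distrib[symmetric] abs_mult)
      next
        case False
        then show ?thesis using supp[of v] \<delta> by simp
      qed
    qed
    also have "\<dots> = \<bar>A\<bar> * \<delta> * V" by (simp add: V_def)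
    also have "\<dots> = (\<bar>A\<bar> * C1 * V) * ((ln (2 + t)) ^ 5 / (2 + t))" by (simp add: \<delta>_def)
    finally show ?thesis .
  qed
  have "((\<lambda>t::real. (ln (2 + t)) ^ 5 / (2 + t)) \<longlongrightarrow> 0) at_top" by real_asymp
  then have "((\<lambda>t. (\<bar>A\<bar> * C1 * V) * ((ln (2 + t)) ^ 5 / (2 + t))) \<longlongrightarrow> 0) at_top"
    by (rule tendsto_mult_right_zero)
  then have "((\<lambda>t. (LINT w|lborel. \<psi> (snd w) * f (t, w)) - (LINT v|lborel. \<psi> v * q v)) \<longlongrightarrow> 0) at_top"
    by (rule Lim_null_comparison[rotated])
       (use bd in \<open>auto simp: eventually_at_top_linorder intro!: exI[of _ 0]\<close>)
  then show ?thesis by (simp add: LIM_zero_iff)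
qed

text \<open>
  The momentum marginal of the scattering state is the asymptotic charge: both sides are limits of the same
  logarithmic averages, because free flow does not change momenta.
\<close>
lemma charge_of_limit:
  assumes m: "\<psi> \<in> borel_measurable borel" and b: "\<And>v. \<bar>\<psi> v\<bar> \<le> A"
    and supp: "\<And>v. norm v > K \<Longrightarrow> \<psi> v = 0" and K: "K \<ge> 0"
  shows "(LINT w|lborel. \<psi> (snd w) * g w) = (LINT v|lborel. \<psi> v * q v)"
proof -
  have A: "A \<ge> 0" using b[of 0] by linarith
  define \<psi>' where "\<psi>' z = \<psi> (snd (snd z))" for z :: "real \<times> R3 \<times> R3"
  have [measurable]: "\<psi> \<in> borel_measurable borel" by (rule m)
  have m': "\<psi>' \<in> borel_measurable borel"
    unfolding \<psi>'_def[abs_def] borel_prod[symmetric] by measurable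
  have mw: "(\<lambda>z. log_weight n (fst z) * \<psi>' z) \<in> borel_measurable borel" for n
    unfolding \<psi>'_def[abs_def] borel_prod[symmetric] by measurable
  have b': "\<bar>\<psi>' z\<bar> \<le> A" for z by (simp add: \<psi>'_def b)
  have mf: "(\<lambda>z. \<psi>' z * f z) \<in> borel_measurable borel"
    using m' borel_measurable_continuous_onI[OF contf] by measurable
  have "(\<lambda>n. LINT t|lborel. log_weight n t * (LINT w|lborel. \<psi>' (t, w) * f (t, w))) \<longlonglongrightarrow> (LINT v|lborel. \<psi> v * q v)"
    by (intro log_average_tendsto measurable_slice_integral[OF mf])
       (use charge_against_bounded[OF m b supp K] in \<open>simp add: \<psi>'_def\<close>)
  then have l1: "(\<lambda>n. LINT z|lborel. log_weight n (fst z) * \<psi>' z * f z) \<longlonglongrightarrow> (LINT v|lborel. \<psi> v * q v)"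
    by (rule Lim_transform_eventually)
       (use log_average_density(2)[OF _ m' b'] in \<open>auto simp: eventually_sequentially intro!: exI[of _ 1]\<close>)
  have "\<bar>(LINT z|lborel. log_weight n (fst z) * \<psi>' z * f z) - (LINT w|lborel. \<psi> (snd w) * g w)\<bar>
     \<le> (2 * A) * mean_distance n K" if n: "n > 0" for n
  proof -
    have c: "\<bar>log_weight n (fst z) * \<psi>' z\<bar> \<le> (2 * A) * window n K z" for z
    proof (cases "norm (snd (snd z)) \<le> K")
      case True
      have "log_weight n (fst z) * \<bar>\<psi>' z\<bar> \<le> (2 * log_window n (fst z)) * A"
        using time_weights_le[OF n] b' log_window_nonneg by (intro mult_mono) auto
      then show ?thesis using True time_weights_le(1)[OF n, of "fst z"]
        by (simp add: window_def abs_mult mult.commute mult.left_commute)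
    next
      case False
      then show ?thesis using supp by (simp add: \<psi>'_def window_def)
    qed
    have "(LINT z|lborel. log_weight n (fst z) * \<psi>' z * drifted z) = (LINT w|lborel. \<psi> (snd w) * g w)"
      using log_average_density(3)[OF n m' b'] log_weight_integral(2)[OF n]
      by (simp add: \<psi>'_def free_flow_def case_prod_beta)
    then show ?thesis using replace_by_drifted[OF n mw c] A by simp
  qed
  then have "(\<lambda>n. (LINT z|lborel. log_weight n (fst z) * \<psi>' z * f z) - (LINT w|lborel. \<psi> (snd w) * g w)) \<longlonglongrightarrow> 0"
    by (intro Lim_null_comparison[OF _ tendsto_mult_right_zero[OF mean_distance_tendsto[OF K], of "2 * A"]])
       (auto simp: eventually_sequentially intro!: exI[of _ 1])
  then have "(\<lambda>n. LINT z|lborel. log_weight n (fst z) * \<psi>' z * f z) \<longlonglongrightarrow> (LINT w|lborel. \<psi> (snd w) * g w)"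
    by (simp add: LIM_zero_iff)
  then show ?thesis using l1 LIMSEQ_unique by blast
qed

text \<open>
  For \<open>norm v > K0\<close> the asymptotic charge is 0, so the marginal of \<open>f\<close> is at most \<open>O(log\<^sup>5 t / t)\<close>; it is integrated
  over the ball of radius \<open>vmax t = O(log t)\<close>.
\<close>
lemma tail_tendsto:
  "((\<lambda>t. LINT w|lborel. (if norm (snd w) > K0 then 1 else 0) * f (t, w)) \<longlongrightarrow> 0) at_top"
proof -
  define \<psi> :: "R3 \<Rightarrow> real" where "\<psi> v = (if norm v > K0 then 1 else 0)" for v
  have m: "\<psi> \<in> borel_measurable borel" unfolding \<psi>_def[abs_def] by measurable
  have b: "\<bar>\<psi> v\<bar> \<le> 1" for v by (simp add: \<psi>_def)
  \<comment> \<open>A constant for which \<open>vmax t \<le> M * (1 + ln (2 + t + 2 * k))\<close>.\<close>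
  define M where "M = k + 2 * \<bar>e\<bar> * C * (1 + \<bar>ln (2 * k)\<bar>)"
  have vmax0: "0 \<le> vmax t" if "t \<ge> 0" for t using vmax_mono[OF order_refl that] k by (simp add: vmax_def)
  have vmaxM: "vmax t \<le> M * (1 + ln (2 + t + 2 * k))" if t: "t \<ge> 0" for t
  proof -
    have l: "ln (t + 2 * k) \<le> ln (2 + t + 2 * k)" "0 \<le> ln (2 + t + 2 * k)" using t k by auto
    have "ln (t + 2 * k) - ln (2 * k) \<le> (1 + \<bar>ln (2 * k)\<bar>) * (1 + ln (2 + t + 2 * k))"
      using l by (simp add: algebra_simps) (smt (verit) mult_nonneg_nonneg)
    then have "2 * \<bar>e\<bar> * C * (ln (t + 2 * k) - ln (2 * k))
       \<le> 2 * \<bar>e\<bar> * C * ((1 + \<bar>ln (2 * k)\<bar>) * (1 + ln (2 + t + 2 * k)))"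
      using C by (intro mult_left_mono) auto
    moreover have "k \<le> k * (1 + ln (2 + t + 2 * k))" using l k by simp
    ultimately show ?thesis by (simp add: vmax_def M_def algebra_simps)
  qed
  have bd: "norm (LINT w|lborel. \<psi> (snd w) * f (t, w))
     \<le> (unit_ball_vol 3 * C1 * M ^ 3) * ((1 + ln (2 + t + 2 * k)) ^ 3 * (ln (2 + t)) ^ 5 / (2 + t))" if t: "t \<ge> 0" for t
  proof -
    define \<delta> where "\<delta> = C1 * (ln (2 + t)) ^ 5 / (2 + t)"
    have \<delta>: "\<delta> \<ge> 0" using charge[OF t, of 0] unfolding \<delta>_def by linarith
    have "norm (LINT w|lborel. \<psi> (snd w) * f (t, w)) = \<bar>LINT v|lborel. \<psi> v * (LINT x|lborel. f (t, x, v))\<bar>"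
      using slice_momentum(2)[OF t m b] by simp
    also have "\<dots> \<le> (LINT v|lborel. indicator (cball (0::R3) (vmax t)) v *\<^sub>R \<delta>)"
    proof (intro order_trans[OF integral_abs_bound] integral_mono)
      show "integrable lborel (\<lambda>v. \<bar>\<psi> v * (LINT x|lborel. f (t, x, v))\<bar>)"
        by (intro integrable_abs slice_momentum[OF t m b])
      show "integrable lborel (\<lambda>v::R3. indicator (cball 0 (vmax t)) v *\<^sub>R \<delta>)"
        by (rule borel_integrable_compact) auto
      show "\<bar>\<psi> v * (LINT x|lborel. f (t, x, v))\<bar> \<le> indicator (cball 0 (vmax t)) v *\<^sub>R \<delta>" for v
      proof (cases "norm v \<le> vmax t")
        case True
        have "\<bar>LINT x|lborel. f (t, x, v)\<bar> \<le> \<delta>" if "norm v > K0"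
          using charge[OF t, of v] q_supp[OF that] by (simp add: \<delta>_def)
        then show ?thesis using True \<delta> by (simp add: \<psi>_def)
      next
        case False
        then have "f (t, x, v) = 0" for x using support_momentum[OF t, of x v] by auto
        then show ?thesis using \<delta> by simp
      qed
    qed
    also have "\<dots> = (unit_ball_vol 3 * vmax t ^ 3) * \<delta>"
      using content_cball[OF vmax0[OF t], of "0 :: R3"] by simp
    also have "\<dots> \<le> (unit_ball_vol 3 * (M * (1 + ln (2 + t + 2 * k))) ^ 3) * \<delta>"
      using \<delta> vmaxM[OF t] vmax0[OF t] by (intro mult_right_mono mult_left_mono power_mono) auto
    also have "\<dots> = (unit_ball_vol 3 * C1 * M ^ 3) * ((1 + ln (2 + t + 2 * k)) ^ 3 * (ln (2 + t)) ^ 5 / (2 + t))"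
      by (simp add: \<delta>_def power_mult_distrib)
    finally show ?thesis .
  qed
  have "((\<lambda>t::real. (1 + ln (2 + t + 2 * k)) ^ 3 * (ln (2 + t)) ^ 5 / (2 + t)) \<longlongrightarrow> 0) at_top"
    using k by real_asymp
  then have "((\<lambda>t. (unit_ball_vol 3 * C1 * M ^ 3) * ((1 + ln (2 + t + 2 * k)) ^ 3 * (ln (2 + t)) ^ 5 / (2 + t))) \<longlongrightarrow> 0) at_top"
    by (rule tendsto_mult_right_zero)
  then have "((\<lambda>t. LINT w|lborel. \<psi> (snd w) * f (t, w)) \<longlongrightarrow> 0) at_top"
    by (rule Lim_null_comparison[rotated])
       (use bd in \<open>auto simp: eventually_at_top_linorder intro!: exI[of _ 0]\<close>)
  then show ?thesis by (simp add: \<psi>_def)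
qed

text \<open>
  Along the free flow \<open>x/t\<close> tends to the velocity, so the kernel tends to its value at \<open>u = velocity \<mu> v\<close>. For momenta
  bounded by \<open>K\<close> the density is replaced by the free solution, and the remaining ones are negligible by
  \<open>tail_tendsto\<close>.
\<close>
lemma charge_current_limit:
  fixes \<eta> :: "R3 \<Rightarrow> real"
  assumes c\<eta>: "continuous_on UNIV \<eta>" and b\<eta>: "\<And>u. \<bar>\<eta> u\<bar> \<le> A" and s\<eta>: "\<And>u. \<eta> u \<noteq> 0 \<Longrightarrow> norm u \<le> 1"
  shows "(\<lambda>n. LINT z|lborel. log_weight n (fst z) * current_kernel \<mu> \<eta> z * f z)
    \<longlonglongrightarrow> (LINT v|lborel. ((1 - velocity \<mu> v \<bullet> velocity \<mu> v) * \<eta> (velocity \<mu> v)) * q v)"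
proof -
  define h where "h u v = (1 - u \<bullet> velocity \<mu> v) * \<eta> u" for u v
  define K where "K = max K0 0"
  have K: "K \<ge> 0" "K0 \<le> K" by (auto simp: K_def)
  have A: "A \<ge> 0" using b\<eta>[of 0] by linarith
  have [measurable]: "\<eta> \<in> borel_measurable borel" by (rule borel_measurable_continuous_onI[OF c\<eta>])
  have hb: "\<bar>h u v\<bar> \<le> 2 * A" for u v
    using current_kernel_bound[OF \<mu> b\<eta> s\<eta>, where z = "(1, u, v)"] by (simp add: current_kernel_def h_def)
  define b where "b z = h ((1 / fst z) *\<^sub>R fst (snd z)) (snd (snd z))" for z :: "real \<times> R3 \<times> R3"
  have b_eq: "b = current_kernel \<mu> \<eta>" by (simp add: b_def h_def current_kernel_def fun_eq_iff)
  define b1 where "b1 z = (if norm (snd (snd z)) \<le> K then 1 else 0) * b z" for z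
  define b2 where "b2 z = (if norm (snd (snd z)) \<le> K then 0 else 1) * b z" for z
  have m: "b \<in> borel_measurable borel" "b1 \<in> borel_measurable borel" "b2 \<in> borel_measurable borel"
    unfolding b_def[abs_def] b1_def[abs_def] b2_def[abs_def] h_def borel_prod[symmetric] by measurable
  have bb: "\<bar>b z\<bar> \<le> 2 * A" "\<bar>b1 z\<bar> \<le> 2 * A" "\<bar>b2 z\<bar> \<le> 2 * A" for z
    using hb A by (auto simp: b_def b1_def b2_def)
  \<comment> \<open>For bounded momenta \<open>\<psi>\<close> is the limit of the kernel along the free flow.\<close>
  define \<psi> where "\<psi> v = (if norm v \<le> K then h (velocity \<mu> v) v else 0)" for v
  have m\<psi>: "\<psi> \<in> borel_measurable borel" unfolding \<psi>_def[abs_def] h_def by measurable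
  have lim1: "((\<lambda>t. LINT w|lborel. b1 (free_flow \<mu> (t, w)) * g w) \<longlongrightarrow> (LINT w|lborel. \<psi> (snd w) * g w)) at_top"
  proof (rule integral_dominated_convergence_at_top[where w = "\<lambda>w. 2 * A * \<bar>g w\<bar>"])
    have mb: "(\<lambda>z. b1 (free_flow \<mu> z)) \<in> borel_measurable borel"
      using measurable_compose[OF measurable_free_flow m(2)] by simp
    have "(\<lambda>w. b1 (free_flow \<mu> (t, w))) \<in> borel_measurable borel" for t
      by (rule measurable_compose[OF _ mb]) (intro borel_measurable_continuous_onI continuous_intros)
    then show "(\<lambda>w. b1 (free_flow \<mu> (t, w)) * g w) \<in> borel_measurable lborel" for t
      using gint by (intro borel_measurable_times) auto
    have "(\<lambda>w :: R3 \<times> R3. \<psi> (snd w)) \<in> borel_measurable borel"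
      using m\<psi> unfolding borel_prod[symmetric] by measurable
    then show "(\<lambda>w. \<psi> (snd w) * g w) \<in> borel_measurable lborel"
      using gint by (intro borel_measurable_times) auto
    show "integrable lborel (\<lambda>w. 2 * A * \<bar>g w\<bar>)" using gint by simp
    have "norm (b1 (free_flow \<mu> (t, w)) * g w) \<le> 2 * A * \<bar>g w\<bar>" for t w
      using mult_right_mono[OF bb(2)[of "free_flow \<mu> (t, w)"], of "\<bar>g w\<bar>"] by (simp add: abs_mult)
    then show "\<forall>\<^sub>F t in at_top. AE w in lborel. norm (b1 (free_flow \<mu> (t, w)) * g w) \<le> 2 * A * \<bar>g w\<bar>" by simp
    have "((\<lambda>t. b1 (free_flow \<mu> (t, w)) * g w) \<longlongrightarrow> \<psi> (snd w) * g w) at_top" for w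
    proof (intro tendsto_mult tendsto_const)
      obtain y v where w: "w = (y, v)" by (cases w)
      have "((\<lambda>t::real. 1 / t) \<longlongrightarrow> 0) at_top" by real_asymp
      then have "((\<lambda>t::real. (1 / t) *\<^sub>R y + velocity \<mu> v) \<longlongrightarrow> 0 *\<^sub>R y + velocity \<mu> v) at_top"
        by (intro tendsto_intros)
      then have l: "((\<lambda>t::real. (1 / t) *\<^sub>R y + velocity \<mu> v) \<longlongrightarrow> velocity \<mu> v) at_top" by simp
      have "isCont \<eta> (velocity \<mu> v)" using c\<eta> by (simp add: continuous_on_eq_continuous_at)
      then have "((\<lambda>t. h ((1 / t) *\<^sub>R y + velocity \<mu> v) v) \<longlongrightarrow> h (velocity \<mu> v) v) at_top"
        unfolding h_def by (intro tendsto_intros l isCont_tendsto_compose[OF _ l])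
      then have "((\<lambda>t. (if norm v \<le> K then 1 else 0) * h ((1 / t) *\<^sub>R y + velocity \<mu> v) v) \<longlongrightarrow> (if norm v \<le> K then 1 else 0) * h (velocity \<mu> v) v) at_top"
        by (intro tendsto_intros)
      moreover have "\<forall>\<^sub>F t in at_top. (if norm v \<le> K then 1 else 0) * h ((1 / t) *\<^sub>R y + velocity \<mu> v) v = b1 (free_flow \<mu> (t, w))"
        using eventually_gt_at_top[of "0::real"]
        by eventually_elim (simp add: b1_def b_def free_flow_def w scaleR_add_right)
      ultimately have "((\<lambda>t. b1 (free_flow \<mu> (t, w))) \<longlongrightarrow> (if norm v \<le> K then 1 else 0) * h (velocity \<mu> v) v) at_top"
        by (rule Lim_transform_eventually)
      then show "((\<lambda>t. b1 (free_flow \<mu> (t, w))) \<longlongrightarrow> \<psi> (snd w)) at_top"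
        by (simp add: \<psi>_def w split: if_splits)
    qed
    then show "AE w in lborel. ((\<lambda>t. b1 (free_flow \<mu> (t, w)) * g w) \<longlongrightarrow> \<psi> (snd w) * g w) at_top" by simp
  qed
  have mg: "(\<lambda>t. LINT w|lborel. b1 (free_flow \<mu> (t, w)) * g w) \<in> borel_measurable borel"
  proof -
    have mb: "(\<lambda>z. b1 (free_flow \<mu> z)) \<in> borel_measurable borel"
      using measurable_compose[OF measurable_free_flow m(2)] by simp
    have "(\<lambda>z. b1 (free_flow \<mu> z) * g (snd z)) \<in> borel_measurable borel"
    proof (intro borel_measurable_times mb)
      show "(\<lambda>z :: real \<times> R3 \<times> R3. g (snd z)) \<in> borel_measurable borel"
        unfolding borel_prod[symmetric] by measurable
    qed
    from measurable_slice_integral[OF this] show ?thesis by simp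
  qed
  have L1: "(\<lambda>n. LINT z|lborel. log_weight n (fst z) * b1 z * drifted z) \<longlonglongrightarrow> (LINT w|lborel. \<psi> (snd w) * g w)"
    by (rule Lim_transform_eventually[OF log_average_tendsto[OF mg lim1]])
       (use log_average_density(3)[OF _ m(2) bb(2)] in \<open>auto simp: eventually_sequentially intro!: exI[of _ 1]\<close>)
  have "\<bar>(LINT z|lborel. log_weight n (fst z) * b1 z * f z) - (LINT z|lborel. log_weight n (fst z) * b1 z * drifted z)\<bar>
     \<le> (4 * A) * mean_distance n K" if n: "n > 0" for n
  proof (rule replace_by_drifted[OF n])
    show "(\<lambda>z. log_weight n (fst z) * b1 z) \<in> borel_measurable borel"
    proof (intro borel_measurable_times m)
      show "(\<lambda>z :: real \<times> R3 \<times> R3. log_weight n (fst z)) \<in> borel_measurable borel"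
        unfolding borel_prod[symmetric] by measurable
    qed
    show "\<bar>log_weight n (fst z) * b1 z\<bar> \<le> (4 * A) * window n K z" for z
    proof (cases "norm (snd (snd z)) \<le> K")
      case True
      have "log_weight n (fst z) * \<bar>b1 z\<bar> \<le> (2 * log_window n (fst z)) * (2 * A)"
        using time_weights_le[OF n] bb log_window_nonneg by (intro mult_mono) auto
      then show ?thesis using True time_weights_le(1)[OF n, of "fst z"]
        by (simp add: window_def abs_mult mult.commute mult.left_commute)
    next
      case False
      then show ?thesis by (simp add: b1_def window_def)
    qed
  qed (use A in simp)
  then have "(\<lambda>n. (LINT z|lborel. log_weight n (fst z) * b1 z * f z) - (LINT z|lborel. log_weight n (fst z) * b1 z * drifted z)) \<longlonglongrightarrow> 0"
    by (intro Lim_null_comparison[OF _ tendsto_mult_right_zero[OF mean_distance_tendsto[OF K(1)], of "4 * A"]])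
       (auto simp: eventually_sequentially intro!: exI[of _ 1])
  from tendsto_add[OF this L1]
  have L2: "(\<lambda>n. LINT z|lborel. log_weight n (fst z) * b1 z * f z) \<longlonglongrightarrow> (LINT w|lborel. \<psi> (snd w) * g w)" by simp
  have e1: "(LINT w|lborel. \<psi> (snd w) * g w) = (LINT v|lborel. \<psi> v * q v)"
    by (rule charge_of_limit[OF m\<psi>, of "2 * A" K]) (use hb A K in \<open>auto simp: \<psi>_def\<close>)
  have "\<psi> v * q v = h (velocity \<mu> v) v * q v" for v
    using q_supp[of v] K by (auto simp: \<psi>_def)
  then have e2: "(LINT v|lborel. \<psi> v * q v) = (LINT v|lborel. h (velocity \<mu> v) v * q v)" by presburger
  \<comment> \<open>The density is nonnegative, so large momenta contribute at most the averaged tail \<open>Tl\<close>.\<close>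
  define Tl where "Tl t = (LINT w|lborel. (if norm (snd w) > K0 then 1 else 0) * f (t, w))" for t
  have mTl: "Tl \<in> borel_measurable borel"
  proof -
    have "(\<lambda>z. (if norm (snd (snd z)) > K0 then 1 else 0) * f z) \<in> borel_measurable borel"
      unfolding borel_prod[symmetric] by measurable
    from measurable_slice_integral[OF this] show ?thesis by (simp add: Tl_def[abs_def])
  qed
  have T0: "(\<lambda>n. (2 * A) * (LINT t|lborel. log_weight n t * Tl t)) \<longlonglongrightarrow> 0"
    by (intro tendsto_mult_right_zero log_average_tendsto mTl) (use tail_tendsto in \<open>simp add: Tl_def[abs_def]\<close>)
  have "norm (LINT z|lborel. log_weight n (fst z) * b2 z * f z) \<le> (2 * A) * (LINT t|lborel. log_weight n t * Tl t)"
    if n: "n > 0" for n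
  proof -
    define b3 :: "real \<times> R3 \<times> R3 \<Rightarrow> real" where "b3 z = (if norm (snd (snd z)) > K0 then 1 else 0)" for z
    have m3: "b3 \<in> borel_measurable borel"
      unfolding b3_def[abs_def] borel_prod[symmetric] by measurable
    have b3: "\<bar>b3 z\<bar> \<le> 1" for z by (simp add: b3_def)
    have "norm (LINT z|lborel. log_weight n (fst z) * b2 z * f z) \<le> (LINT z|lborel. (2 * A) * (log_weight n (fst z) * b3 z * f z))"
      unfolding real_norm_def
    proof (intro order_trans[OF integral_abs_bound] integral_mono)
      show "integrable lborel (\<lambda>z. \<bar>log_weight n (fst z) * b2 z * f z\<bar>)"
        by (intro integrable_abs log_average_density(1)[OF n m(3) bb(3)])
      show "integrable lborel (\<lambda>z. (2 * A) * (log_weight n (fst z) * b3 z * f z))"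
        using log_average_density(1)[OF n m3 b3] by simp
      show "\<bar>log_weight n (fst z) * b2 z * f z\<bar> \<le> (2 * A) * (log_weight n (fst z) * b3 z * f z)" for z
      proof (cases "fst z \<in> log_interval n")
        case False
        then show ?thesis using time_cutoff_zero[OF n False] by simp
      next
        case True
        then have "fst z \<ge> 0" using exp_n_gt_1[OF n, of "fst z"] by simp
        then have f0: "f z \<ge> 0" using nonneg[of "fst z" "fst (snd z)" "snd (snd z)"] by simp
        have "\<bar>b2 z\<bar> \<le> 2 * A * b3 z" using bb(3)[of z] K A by (auto simp: b2_def b3_def)
        then have "(log_weight n (fst z) * f z) * \<bar>b2 z\<bar> \<le> (log_weight n (fst z) * f z) * (2 * A * b3 z)"
          using f0 time_weights_le(1)[OF n] by (intro mult_left_mono) auto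
        then show ?thesis using f0 time_weights_le(1)[OF n, of "fst z"]
          by (simp add: abs_mult mult.commute mult.left_commute)
      qed
    qed
    also have "\<dots> = (2 * A) * (LINT t|lborel. log_weight n t * Tl t)"
      using log_average_density(2)[OF n m3 b3] by (simp add: Tl_def b3_def)
    finally show ?thesis .
  qed
  then have L3: "(\<lambda>n. LINT z|lborel. log_weight n (fst z) * b2 z * f z) \<longlonglongrightarrow> 0"
    by (intro Lim_null_comparison[OF _ T0]) (auto simp: eventually_sequentially intro!: exI[of _ 1])
  have "(LINT z|lborel. log_weight n (fst z) * b1 z * f z) + (LINT z|lborel. log_weight n (fst z) * b2 z * f z)
      = (LINT z|lborel. log_weight n (fst z) * b z * f z)" if n: "n > 0" for n
  proof -
    have "log_weight n (fst z) * b z * f z = log_weight n (fst z) * b1 z * f z + log_weight n (fst z) * b2 z * f z" for z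
      by (simp add: b1_def b2_def)
    then show ?thesis
      using log_average_density(1)[OF n m(2) bb(2)] log_average_density(1)[OF n m(3) bb(3)] by simp
  qed
  then have "(\<lambda>n. LINT z|lborel. log_weight n (fst z) * b z * f z) \<longlonglongrightarrow> (LINT w|lborel. \<psi> (snd w) * g w) + 0"
    by (intro Lim_transform_eventually[OF tendsto_add[OF L2 L3]])
       (auto simp: eventually_sequentially intro!: exI[of _ 1])
  then show ?thesis by (simp add: e1 e2 b_eq h_def)
qed

lemma density_moments:
  assumes t: "t \<ge> 0"
  shows "integrable lborel (\<lambda>v. f (t, x, v))" "integrable lborel (\<lambda>v. f (t, x, v) *\<^sub>R velocity \<mu> v)"
proof -
  have c: "continuous_on UNIV (\<lambda>v. f (t, x, v))"
    by (rule continuous_on_compose2[OF contf]) (auto intro!: continuous_intros)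
  have z: "f (t, x, v) = 0" if "v \<notin> cball 0 (vmax t)" for v
    using support_momentum[OF t, of x v] that by auto
  show "integrable lborel (\<lambda>v. f (t, x, v))"
    by (rule integrable_continuous_compact_support[OF c compact_cball z])
  show "integrable lborel (\<lambda>v. f (t, x, v) *\<^sub>R velocity \<mu> v)"
    by (rule integrable_continuous_compact_support[OF _ compact_cball[of 0 "vmax t"]])
       (use c z \<mu> in \<open>auto intro!: continuous_intros\<close>)
qed

lemma current_slice:
  assumes c\<eta>: "continuous_on UNIV \<eta>" and b\<eta>: "\<And>u. \<bar>\<eta> u\<bar> \<le> A"
    and s\<eta>: "\<And>u. \<eta> u \<noteq> 0 \<Longrightarrow> norm u \<le> 1" and t: "t > 0"
  shows "integrable lborel (\<lambda>x. \<eta> ((1 / t) *\<^sub>R x) *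
      ((LINT v|lborel. f (t, x, v)) - ((1 / t) *\<^sub>R x) \<bullet> (LINT v|lborel. f (t, x, v) *\<^sub>R velocity \<mu> v)))" (is "integrable lborel ?h")
    and "(LINT x|lborel. \<eta> ((1 / t) *\<^sub>R x) *
      ((LINT v|lborel. f (t, x, v)) - ((1 / t) *\<^sub>R x) \<bullet> (LINT v|lborel. f (t, x, v) *\<^sub>R velocity \<mu> v)))
      = (LINT w|lborel. current_kernel \<mu> \<eta> (t, w) * f (t, w))"
proof -
  have t0: "t \<ge> 0" using t by simp
  have mw: "(\<lambda>w. current_kernel \<mu> \<eta> (t, w)) \<in> borel_measurable borel"
    by (rule measurable_compose[OF _ measurable_current_kernel[OF c\<eta>]]) (intro borel_measurable_continuous_onI continuous_intros)
  have i: "integrable lborel (\<lambda>w. current_kernel \<mu> \<eta> (t, w) * f (t, w))"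
    by (rule density_slice[OF t0 mw current_kernel_bound[OF \<mu> b\<eta> s\<eta>]])
  have eq: "(LINT v|lborel. current_kernel \<mu> \<eta> (t, x, v) * f (t, x, v)) = ?h x" for x
  proof -
    note m = density_moments[OF t0, of x]
    define u where "u = (1 / t) *\<^sub>R x"
    have mi: "integrable lborel (\<lambda>v. u \<bullet> (f (t, x, v) *\<^sub>R velocity \<mu> v))" using m(2) by (rule integrable_inner_right)
    have "(LINT v|lborel. current_kernel \<mu> \<eta> (t, x, v) * f (t, x, v))
       = (LINT v|lborel. \<eta> u * (f (t, x, v) - u \<bullet> (f (t, x, v) *\<^sub>R velocity \<mu> v)))"
      by (intro Bochner_Integration.integral_cong refl) (simp add: current_kernel_def u_def algebra_simps)
    also have "\<dots> = \<eta> u * ((LINT v|lborel. f (t, x, v)) - (LINT v|lborel. u \<bullet> (f (t, x, v) *\<^sub>R velocity \<mu> v)))"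
      using Bochner_Integration.integral_diff[OF m(1) mi] by (simp only: integral_mult_right_zero)
    also have "(LINT v|lborel. u \<bullet> (f (t, x, v) *\<^sub>R velocity \<mu> v)) = u \<bullet> (LINT v|lborel. f (t, x, v) *\<^sub>R velocity \<mu> v)"
      by (rule integral_inner_right) (rule m(2))
    finally show ?thesis by (simp add: u_def)
  qed
  have "integrable lborel (\<lambda>x. LINT v|lborel. current_kernel \<mu> \<eta> (t, x, v) * f (t, x, v))"
    using lborel_pair.integrable_fst'[of "\<lambda>w. current_kernel \<mu> \<eta> (t, w) * f (t, w)"] i by (simp add: lborel_prod)
  then show "integrable lborel ?h" by (simp only: eq)
  show "(LINT x|lborel. ?h x) = (LINT w|lborel. current_kernel \<mu> \<eta> (t, w) * f (t, w))"
    unfolding integral_lborel_fst[OF i] by (simp only: eq)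
qed

end

section \<open>Cutoffs and differentiable polynomials\<close>

text \<open>
  A cutoff of class \<open>C\<^sup>1\<close> to the ball of radius \<open>R\<close>, tending to 1 pointwise as \<open>R\<close> grows.
\<close>
definition plateau :: "real \<Rightarrow> R3 \<Rightarrow> real" where
  "plateau R y = (max 0 (1 - (y \<bullet> y) / R\<^sup>2))\<^sup>2"

definition plateau_grad :: "real \<Rightarrow> R3 \<Rightarrow> R3" where
  "plateau_grad R y = (- 4 / R\<^sup>2 * max 0 (1 - (y \<bullet> y) / R\<^sup>2)) *\<^sub>R y"

lemma plateau_has_derivative:
  "(plateau R has_derivative (\<lambda>h. plateau_grad R y \<bullet> h)) (at y)"
proof -
  have "((\<lambda>y. 1 - (y \<bullet> y) * c) has_derivative (\<lambda>h. - (2 * (y \<bullet> h)) * c)) (at y)" for c :: real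
    by (auto intro!: derivative_eq_intros simp: inner_commute fun_eq_iff algebra_simps)
  from this[of "inverse (R\<^sup>2)"]
  have i: "((\<lambda>y. 1 - (y \<bullet> y) / R\<^sup>2) has_derivative (\<lambda>h. - (2 * (y \<bullet> h)) / R\<^sup>2)) (at y)"
    by (simp only: divide_inverse)
  have "((\<lambda>y. (max 0 (1 - (y \<bullet> y) / R\<^sup>2))\<^sup>2) has_derivative
      (\<lambda>h. (2 * max 0 (1 - (y \<bullet> y) / R\<^sup>2)) * (- (2 * (y \<bullet> h)) / R\<^sup>2))) (at y)"
    using has_derivative_compose[OF i, of "\<lambda>x. (max 0 x)\<^sup>2" "(*) (2 * max 0 (1 - (y \<bullet> y) / R\<^sup>2))"]
      max0_power2_has_derivative by (simp add: has_field_derivative_def)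
  moreover have "(2 * max 0 (1 - (y \<bullet> y) / R\<^sup>2)) * (- (2 * (y \<bullet> h)) / R\<^sup>2) = plateau_grad R y \<bullet> h" for h
    by (simp add: plateau_grad_def)
  ultimately show ?thesis by (simp add: plateau_def[abs_def])
qed

lemma plateau_bounds: "0 \<le> plateau R y" "plateau R y \<le> 1"
proof -
  show "0 \<le> plateau R y" by (simp add: plateau_def)
  have "(max 0 (1 - (y \<bullet> y) / R\<^sup>2))\<^sup>2 \<le> 1\<^sup>2" by (intro power_mono) auto
  then show "plateau R y \<le> 1" by (simp add: plateau_def)
qed

lemma plateau_eq_0:
  assumes "R > 0" "norm y > R"
  shows "plateau R y = 0" "plateau_grad R y = 0"
proof -
  have "R\<^sup>2 \<le> (norm y)\<^sup>2" using assms by (intro power_mono) auto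
  then have "1 - (y \<bullet> y) / R\<^sup>2 \<le> 0" using assms by (simp add: dot_square_norm)
  then show "plateau R y = 0" "plateau_grad R y = 0" by (auto simp: plateau_def plateau_grad_def)
qed

text \<open>
  The bound does not depend on \<open>R\<close>, so truncated moments have derivatives bounded uniformly in \<open>R\<close>.
\<close>
lemma norm_plateau_grad:
  assumes R: "R > 0"
  shows "norm y * norm (plateau_grad R y) \<le> 4"
proof (cases "norm y > R")
  case True
  then show ?thesis using plateau_eq_0[OF R True] by simp
next
  case False
  define m where "m = max 0 (1 - (y \<bullet> y) / R\<^sup>2)"
  have m: "0 \<le> m" "m \<le> 1" by (auto simp: m_def)
  have "norm y * norm (plateau_grad R y) = 4 * m * ((norm y)\<^sup>2 / R\<^sup>2)"
    unfolding plateau_grad_def m_def[symmetric] using m by (simp add: power2_eq_square)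
  also have "\<dots> \<le> 4 * 1 * 1"
    using m False R by (intro mult_mono) (auto simp: power_mono)
  finally show ?thesis by simp
qed

lemma continuous_plateau [continuous_intros]:
  "continuous_on S g \<Longrightarrow> continuous_on S (\<lambda>x. plateau R (g x))"
  "continuous_on S g \<Longrightarrow> continuous_on S (\<lambda>x. plateau_grad R (g x))"
  unfolding plateau_def plateau_grad_def divide_inverse by (intro continuous_intros; assumption)+

lemma real_polynomial_function_C1:
  fixes p :: "R3 \<Rightarrow> real"
  assumes "real_polynomial_function p"
  shows "\<exists>p'. (\<forall>v. (p has_derivative p' v) (at v)) \<and> (\<forall>k. continuous_on UNIV (\<lambda>v. p' v k))"
  using assms
proof induction
  case (linear p)
  then show ?case
    by (intro exI[of _ "\<lambda>v. p"]) (auto intro: bounded_linear_imp_has_derivative)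
next
  case (const c)
  then show ?case by (intro exI[of _ "\<lambda>v k. 0"]) auto
next
  case (add p q)
  then obtain p' q' where "\<forall>v. (p has_derivative p' v) (at v)" "\<forall>k. continuous_on UNIV (\<lambda>v. p' v k)"
    "\<forall>v. (q has_derivative q' v) (at v)" "\<forall>k. continuous_on UNIV (\<lambda>v. q' v k)" by blast
  then show ?case
    by (intro exI[of _ "\<lambda>v k. p' v k + q' v k"]) (auto intro!: has_derivative_add continuous_intros)
next
  case (mult p q)
  then obtain p' q' where *: "\<And>v. (p has_derivative p' v) (at v)" "\<And>k. continuous_on UNIV (\<lambda>v. p' v k)"
    "\<And>v. (q has_derivative q' v) (at v)" "\<And>k. continuous_on UNIV (\<lambda>v. q' v k)" by blast
  have "continuous_on UNIV p" "continuous_on UNIV q"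
    by (intro continuous_at_imp_continuous_on ballI has_derivative_continuous[OF *(1)]
        has_derivative_continuous[OF *(3)])+
  then show ?case
    by (intro exI[of _ "\<lambda>v k. p v * q' v k + p' v k * q v"] conjI allI has_derivative_mult continuous_intros *)
qed

lemma polynomial_function_C1:
  fixes p :: "R3 \<Rightarrow> R3"
  assumes "polynomial_function p"
  shows "\<exists>p'. (\<forall>v. (p has_derivative p' v) (at v)) \<and> (\<forall>k. continuous_on UNIV (\<lambda>v. p' v k))"
proof -
  have "\<exists>p'. (\<forall>v. ((\<lambda>x. p x \<bullet> b) has_derivative p' v) (at v)) \<and> (\<forall>k. continuous_on UNIV (\<lambda>v. p' v k))"
    if "b \<in> Basis" for b
    using assms that by (intro real_polynomial_function_C1) (simp add: polynomial_function_iff_Basis_inner)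
  then obtain P where P: "\<And>b v. b \<in> Basis \<Longrightarrow> ((\<lambda>x. p x \<bullet> b) has_derivative P b v) (at v)"
    "\<And>b k. b \<in> Basis \<Longrightarrow> continuous_on UNIV (\<lambda>v. P b v k)" by metis
  have "((\<lambda>x. \<Sum>b\<in>Basis. (p x \<bullet> b) *\<^sub>R b) has_derivative (\<lambda>k. \<Sum>b\<in>Basis. P b v k *\<^sub>R b)) (at v)" for v
    by (intro has_derivative_sum has_derivative_scaleR_left P)
  then show ?thesis
    by (intro exI[of _ "\<lambda>v k. \<Sum>b\<in>Basis. P b v k *\<^sub>R b"])
       (auto simp: euclidean_representation intro!: continuous_intros P)
qed

section \<open>The Lorentz field inside the light cone\<close>

text \<open>
  The last assumption describes any smaller cone \<open>norm x \<le> (1 - \<delta>) t\<close>. There the fields are \<open>O(t\<^sup>-\<^sup>2)\<close>, and their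
  Lipschitz constants are \<open>o(t\<^sup>-\<^sup>2)\<close>, so that bounded shifts of \<open>x\<close> do not change the limit of \<open>t\<^sup>2 L\<close>.
\<close>
locale decaying_fields =
  fixes E B :: "real \<times> R3 \<Rightarrow> R3" and E' B' :: "real \<times> R3 \<Rightarrow> real \<times> R3 \<Rightarrow> R3"
  assumes E_cont: "continuous_on UNIV E" and B_cont: "continuous_on UNIV B"
    and dE: "\<And>t x. t > 0 \<Longrightarrow> (E has_derivative E' (t, x)) (at (t, x))"
    and dB: "\<And>t x. t > 0 \<Longrightarrow> (B has_derivative B' (t, x)) (at (t, x))"
    and cE': "\<And>h. continuous_on ({0<..} \<times> UNIV) (\<lambda>z. E' z h)"
    and cB': "\<And>h. continuous_on ({0<..} \<times> UNIV) (\<lambda>z. B' z h)"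
    and decay: "\<And>\<delta>. 0 < \<delta> \<Longrightarrow> \<delta> < 1 \<Longrightarrow> \<exists>CF \<tau>. (\<tau> \<longlongrightarrow> (0::real)) at_top \<and>
       (\<forall>t x. t \<ge> 1 \<longrightarrow> norm x \<le> (1 - \<delta>) * t \<longrightarrow> norm (E (t, x)) \<le> CF / t\<^sup>2 \<and> norm (B (t, x)) \<le> CF / t\<^sup>2) \<and>
       (\<forall>t x x'. t \<ge> 1 \<longrightarrow> norm x \<le> (1 - \<delta>) * t \<longrightarrow> norm x' \<le> (1 - \<delta>) * t \<longrightarrow>
          t\<^sup>2 * norm (E (t, x) - E (t, x')) \<le> \<tau> t * norm (x - x') \<and>
          t\<^sup>2 * norm (B (t, x) - B (t, x')) \<le> \<tau> t * norm (x - x'))"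
begin

definition lorentz :: "real \<Rightarrow> R3 \<Rightarrow> R3 \<Rightarrow> R3" where
  "lorentz t x u = E (t, x) + cross3 u (B (t, x))"

text \<open>
  The logarithmic average of the rescaled Lorentz field along the ray of velocity \<open>u\<close>, as felt by a particle on
  this ray.
\<close>
definition avg_lorentz :: "nat \<Rightarrow> R3 \<Rightarrow> R3" where
  "avg_lorentz n u = (LINT t|lborel. (log_weight n t * t\<^sup>2) *\<^sub>R lorentz t (t *\<^sub>R u) u)"

lemma norm_add_cross3_le:
  assumes "norm u \<le> 1" "norm a \<le> A" "norm b \<le> A"
  shows "norm (a + cross3 u b) \<le> 2 * A"
proof -
  have "norm (cross3 u b) \<le> 1 * A"
    using assms by (intro order_trans[OF norm_cross3_le] mult_mono) auto
  then show ?thesis using norm_triangle_ineq[of a "cross3 u b"] assms by simp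
qed

lemma lorentz_decay:
  assumes \<delta>: "0 < \<delta>" "\<delta> < 1"
  obtains CF \<tau> where "(\<tau> \<longlongrightarrow> (0::real)) at_top" "CF \<ge> 0"
    "\<And>t x u. t \<ge> 1 \<Longrightarrow> norm x \<le> (1 - \<delta>) * t \<Longrightarrow> norm u \<le> 1 \<Longrightarrow> t\<^sup>2 * norm (lorentz t x u) \<le> CF"
    "\<And>t x x' u. t \<ge> 1 \<Longrightarrow> norm x \<le> (1 - \<delta>) * t \<Longrightarrow> norm x' \<le> (1 - \<delta>) * t \<Longrightarrow> norm u \<le> 1 \<Longrightarrow>
       t\<^sup>2 * norm (lorentz t x u - lorentz t x' u) \<le> \<tau> t * norm (x - x')"
proof -
  obtain CF \<tau> where \<tau>: "(\<tau> \<longlongrightarrow> (0::real)) at_top"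
    and b: "\<And>t x. t \<ge> 1 \<Longrightarrow> norm x \<le> (1 - \<delta>) * t \<Longrightarrow> norm (E (t, x)) \<le> CF / t\<^sup>2 \<and> norm (B (t, x)) \<le> CF / t\<^sup>2"
    and l: "\<And>t x x'. t \<ge> 1 \<Longrightarrow> norm x \<le> (1 - \<delta>) * t \<Longrightarrow> norm x' \<le> (1 - \<delta>) * t \<Longrightarrow>
          t\<^sup>2 * norm (E (t, x) - E (t, x')) \<le> \<tau> t * norm (x - x') \<and>
          t\<^sup>2 * norm (B (t, x) - B (t, x')) \<le> \<tau> t * norm (x - x')"
    using decay[OF \<delta>] by blast
  show ?thesis
  proof (rule that[of "\<lambda>t. 2 * \<tau> t" "2 * CF"])
    show "((\<lambda>t. 2 * \<tau> t) \<longlongrightarrow> 0) at_top" using tendsto_mult_right_zero[OF \<tau>, of 2] .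
    have "norm (E (1, 0)) \<le> CF / 1\<^sup>2" using b[of 1 0] \<delta> by simp
    from order_trans[OF norm_ge_zero this] show "0 \<le> 2 * CF" by simp
    fix t :: real and x u :: R3 assume a: "1 \<le> t" "norm x \<le> (1 - \<delta>) * t" "norm u \<le> 1"
    have "norm (lorentz t x u) \<le> 2 * (CF / t\<^sup>2)"
      unfolding lorentz_def using b[OF a(1,2)] a(3) by (intro norm_add_cross3_le) auto
    then show "t\<^sup>2 * norm (lorentz t x u) \<le> 2 * CF" using a by (simp add: field_simps)
    fix x' :: R3 assume a': "norm x' \<le> (1 - \<delta>) * t"
    have t2: "t\<^sup>2 > 0" using a by simp
    have "lorentz t x u - lorentz t x' u = (E (t, x) - E (t, x')) + cross3 u (B (t, x) - B (t, x'))"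
      by (simp add: lorentz_def bounded_bilinear.diff_right[OF bounded_bilinear_cross3])
    also have "norm \<dots> \<le> 2 * (\<tau> t * norm (x - x') / t\<^sup>2)"
      using l[OF a(1,2) a'] a(3) t2 by (intro norm_add_cross3_le) (auto simp: field_simps)
    finally show "t\<^sup>2 * norm (lorentz t x u - lorentz t x' u) \<le> 2 * \<tau> t * norm (x - x')"
      using t2 by (simp add: field_simps)
  qed
qed

lemma continuous_on_lorentz:
  assumes "continuous_on S a" "continuous_on S b" "continuous_on S c"
  shows "continuous_on S (\<lambda>x. lorentz (a x) (b x) (c x))"
  unfolding lorentz_def
  by (intro continuous_intros bounded_bilinear.continuous_on[OF bounded_bilinear_cross3] assms
      continuous_on_compose2[OF E_cont] continuous_on_compose2[OF B_cont]) auto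

lemma integrable_avg_lorentz:
  assumes n: "n > 0"
  shows "integrable lborel (\<lambda>t. (log_weight n t * t\<^sup>2) *\<^sub>R lorentz t (t *\<^sub>R u) u)"
proof (rule integrable_continuous_compact_support[OF _ compact_Icc[of "exp (real n)" "exp (2 * real n)"]])
  show "continuous_on UNIV (\<lambda>t. (log_weight n t * t\<^sup>2) *\<^sub>R lorentz t (t *\<^sub>R u) u)"
    by (intro continuous_intros continuous_on_lorentz continuous_time_weights n)
qed (use time_cutoff_zero[OF n] in simp)

lemma measurable_avg_lorentz:
  assumes n: "n > 0"
  shows "avg_lorentz n \<in> borel_measurable borel"
proof -
  have "continuous_on UNIV (\<lambda>z :: R3 \<times> real. (log_weight n (snd z) * (snd z)\<^sup>2) *\<^sub>R lorentz (snd z) (snd z *\<^sub>R fst z) (fst z))"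
    by (intro continuous_intros continuous_on_lorentz
        continuous_on_compose2[OF continuous_time_weights(3)[OF n]]) auto
  then have "(\<lambda>z :: R3 \<times> real. (log_weight n (snd z) * (snd z)\<^sup>2) *\<^sub>R lorentz (snd z) (snd z *\<^sub>R fst z) (fst z)) \<in> borel_measurable (borel \<Otimes>\<^sub>M borel)"
    by (simp add: borel_prod borel_measurable_continuous_onI)
  then have "(\<lambda>(u, t). (log_weight n t * t\<^sup>2) *\<^sub>R lorentz t (t *\<^sub>R u) u) \<in> borel_measurable (borel \<Otimes>\<^sub>M lborel)"
    by (simp add: case_prod_beta')
  from lborel.borel_measurable_lebesgue_integral[OF this]
  show ?thesis by (simp add: avg_lorentz_def[abs_def])
qed

lemma avg_lorentz_bound:
  assumes \<delta>: "0 < \<delta>" "\<delta> < 1"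
  obtains CF where "CF \<ge> 0" "\<And>n u. n > 0 \<Longrightarrow> norm u \<le> 1 - \<delta> \<Longrightarrow> norm (avg_lorentz n u) \<le> CF"
proof -
  obtain CF \<tau> where CF: "CF \<ge> 0"
    "\<And>t x u. t \<ge> 1 \<Longrightarrow> norm x \<le> (1 - \<delta>) * t \<Longrightarrow> norm u \<le> 1 \<Longrightarrow> t\<^sup>2 * norm (lorentz t x u) \<le> CF"
    using lorentz_decay[OF \<delta>] by metis
  have "norm (avg_lorentz n u) \<le> CF" if n: "n > 0" and u: "norm u \<le> 1 - \<delta>" for n u
  proof -
    have "norm (avg_lorentz n u) \<le> (LINT t|lborel. log_weight n t * CF)"
      unfolding avg_lorentz_def
    proof (rule Bochner_Integration.integral_norm_bound_integral)
      show "integrable lborel (\<lambda>t. log_weight n t * CF)" using log_weight_integral[OF n] by simp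
      show "norm ((log_weight n t * t\<^sup>2) *\<^sub>R lorentz t (t *\<^sub>R u) u) \<le> log_weight n t * CF" for t
      proof (cases "t \<in> log_interval n")
        case True
        then have t: "t \<ge> 1" using exp_n_gt_1[OF n, of t] by simp
        have "norm (t *\<^sub>R u) \<le> (1 - \<delta>) * t" using t u by (simp add: mult.commute)
        then have "log_weight n t * (t\<^sup>2 * norm (lorentz t (t *\<^sub>R u) u)) \<le> log_weight n t * CF"
          using t u \<delta> time_weights_le(1)[OF n] by (intro mult_left_mono CF) auto
        then show ?thesis using time_weights_le(1)[OF n, of t] by (simp add: abs_mult mult.assoc)
      qed (use time_cutoff_zero[OF n] in simp)
    qed (rule integrable_avg_lorentz[OF n])
    then show ?thesis using log_weight_integral(2)[OF n] by simp
  qed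
  then show ?thesis using that CF by blast
qed

end

section \<open>Scattering forces the mean Lorentz force to vanish\<close>

locale particles_in_fields = scattering_density + decaying_fields +
  assumes cf': "\<And>h. continuous_on ({0<..} \<times> UNIV) (\<lambda>z. f' z h)" and e: "e \<noteq> 0"
begin

lemma force_eq: "force t x v = e *\<^sub>R lorentz t x (velocity \<mu> v)"
  by (simp add: lorentz_def)

text \<open>
  The transport field \<open>(1, velocity, force)\<close> is divergence free, so the Vlasov equation may be integrated by parts
  without lower order terms.
\<close>
lemma weak_vlasov:
  fixes \<Psi> :: "real \<times> R3 \<times> R3 \<Rightarrow> real"
  assumes S: "compact S" "S \<subseteq> {0<..} \<times> UNIV"
    and d\<Psi>: "\<And>z. (\<Psi> has_derivative \<Psi>' z) (at z)"
    and c\<Psi>': "\<And>h. continuous_on UNIV (\<lambda>z. \<Psi>' z h)"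
    and \<Psi>0: "\<And>z. z \<notin> S \<Longrightarrow> \<Psi> z = 0" "\<And>z h. z \<notin> S \<Longrightarrow> \<Psi>' z h = 0"
  defines "a \<equiv> \<lambda>z. (1, velocity \<mu> (snd (snd z)), force (fst z) (fst (snd z)) (snd (snd z)))"
  shows "integrable lborel (\<lambda>z. f z * \<Psi>' z (a z))" "(LINT z|lborel. f z * \<Psi>' z (a z)) = 0"
proof -
  define a' where "a' z h = (0 :: real, velocity_deriv \<mu> (snd (snd z)) (snd (snd h)),
      e *\<^sub>R (E' (fst z, fst (snd z)) (fst h, fst (snd h)) +
        (cross3 (velocity \<mu> (snd (snd z))) (B' (fst z, fst (snd z)) (fst h, fst (snd h)))
         + cross3 (velocity_deriv \<mu> (snd (snd z)) (snd (snd h))) (B (fst z, fst (snd z))))))"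
    for z h :: "real \<times> R3 \<times> R3"
  define U :: "(real \<times> R3 \<times> R3) set" where "U = {0<..} \<times> UNIV"
  have U: "open U" unfolding U_def by (intro open_Times) auto
  have da: "(a has_derivative a' z) (at z)" if "z \<in> U" for z
  proof -
    obtain t x v where z: "z = (t, x, v)" by (cases z) auto
    have t: "t > 0" using that by (simp add: U_def z)
    have 1: "((\<lambda>z :: real \<times> R3 \<times> R3. (fst z, fst (snd z))) has_derivative (\<lambda>h. (fst h, fst (snd h)))) (at z)"
      by (auto intro!: derivative_eq_intros)
    have 2: "((\<lambda>z :: real \<times> R3 \<times> R3. snd (snd z)) has_derivative (\<lambda>h. snd (snd h))) (at z)"
      by (auto intro!: derivative_eq_intros)
    have dE1: "((\<lambda>z :: real \<times> R3 \<times> R3. E (fst z, fst (snd z))) has_derivative (\<lambda>h. E' (t, x) (fst h, fst (snd h)))) (at z)"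
      by (rule has_derivative_compose[OF 1]) (use dE[OF t] in \<open>simp add: z\<close>)
    have dB1: "((\<lambda>z :: real \<times> R3 \<times> R3. B (fst z, fst (snd z))) has_derivative (\<lambda>h. B' (t, x) (fst h, fst (snd h)))) (at z)"
      by (rule has_derivative_compose[OF 1]) (use dB[OF t] in \<open>simp add: z\<close>)
    have dv: "((\<lambda>z :: real \<times> R3 \<times> R3. velocity \<mu> (snd (snd z))) has_derivative (\<lambda>h. velocity_deriv \<mu> v (snd (snd h)))) (at z)"
      by (rule has_derivative_compose[OF 2]) (use velocity_has_derivative[OF \<mu>] in \<open>simp add: z\<close>)
    have "(a has_derivative (\<lambda>h. (0, velocity_deriv \<mu> v (snd (snd h)),
       e *\<^sub>R (E' (t, x) (fst h, fst (snd h)) +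
        (cross3 (velocity \<mu> (snd (snd z))) (B' (t, x) (fst h, fst (snd h)))
         + cross3 (velocity_deriv \<mu> v (snd (snd h))) (B (fst z, fst (snd z)))))))) (at z)"
      unfolding a_def
      by (intro has_derivative_Pair has_derivative_const dv has_derivative_scaleR_right
          has_derivative_add dE1 bounded_bilinear.FDERIV[OF bounded_bilinear_cross3 dv dB1])
    then show ?thesis unfolding a'_def[abs_def] z by simp
  qed
  \<comment> \<open>\<open>E\<close> does not depend on \<open>v\<close>, and the velocity does not depend on \<open>x\<close>; only the magnetic force remains.\<close>
  have div0: "(\<Sum>b\<in>Basis. a' z b \<bullet> b) = 0" if "z \<in> U" for z
  proof -
    obtain t x v where z: "z = (t, x, v)" by (cases z) auto
    have t: "t > 0" using that by (simp add: U_def z)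
    have 0: "E' (t, x) (0, 0) = 0" "B' (t, x) (0, 0) = 0" "velocity_deriv \<mu> v 0 = 0"
      using linear_0[OF has_derivative_linear[OF dE[OF t]]] linear_0[OF has_derivative_linear[OF dB[OF t]]]
        linear_0[OF linear_velocity_deriv] by (auto simp: zero_prod_def)
    have c0: "cross3 u 0 = 0" "cross3 0 u = 0" for u by (simp_all add: cross3_simps)
    have "(\<Sum>b\<in>Basis. a' z b \<bullet> b) = (\<Sum>i\<in>Basis. e * (cross3 (velocity_deriv \<mu> v i) (B (t, x)) \<bullet> i))"
      by (simp add: sum_Basis_prod a'_def z 0 c0)
    also have "\<dots> = 0" using sum_velocity_deriv_cross3 by (simp add: sum_distrib_left[symmetric])
    finally show ?thesis .
  qed
  \<comment> \<open>For \<open>t \<le> 0\<close> nothing is known about \<open>f'\<close>, so \<open>\<phi>'\<close> is set to 0 outside of \<open>S\<close>.\<close>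
  define \<phi>' where "\<phi>' z h = (if z \<in> S then f z * \<Psi>' z h + f' z h * \<Psi> z else 0)" for z h
  have d\<phi>: "((\<lambda>z. f z * \<Psi> z) has_derivative \<phi>' z) (at z)" if "z \<in> U" for z
  proof -
    have "(f has_derivative f' z) (at z)" using df that by (cases z) (auto simp: U_def)
    from has_derivative_mult[OF this d\<Psi>[of z]]
    show ?thesis using \<Psi>0[of z] by (cases "z \<in> S") (simp_all add: \<phi>'_def[abs_def])
  qed
  have cf0: "continuous_on U f" using contf continuous_on_subset by blast
  have c\<Psi>0: "continuous_on U \<Psi>"
    by (intro continuous_at_imp_continuous_on ballI has_derivative_continuous[OF d\<Psi>])
  have c\<phi>': "continuous_on U (\<lambda>z. \<phi>' z b)" for b
  proof -
    have "continuous_on U (\<lambda>z. f z * \<Psi>' z b + f' z b * \<Psi> z)"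
      by (intro continuous_intros cf0 c\<Psi>0 continuous_on_subset[OF c\<Psi>'] cf'[folded U_def]) auto
    moreover have "f z * \<Psi>' z b + f' z b * \<Psi> z = \<phi>' z b" for z
      using \<Psi>0[of z] by (simp add: \<phi>'_def)
    ultimately show ?thesis by simp
  qed
  have cpair: "continuous_on U (\<lambda>z. F (fst z, fst (snd z)))"
    if "continuous_on ({0<..} \<times> UNIV) F" for F :: "real \<times> R3 \<Rightarrow> R3"
    by (rule continuous_on_compose2[OF that]) (auto simp: U_def intro!: continuous_intros)
  have ca': "continuous_on U (\<lambda>z. a' z b)" for b
    unfolding a'_def
    by (intro continuous_intros continuous_on_cross cpair cE' cB' \<mu> continuous_on_subset[OF contB]) auto
  have supp: "f z * \<Psi> z = 0" "\<phi>' z h = 0" if "z \<notin> S" for z h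
    using that \<Psi>0 by (auto simp: \<phi>'_def)
  have \<phi>'a: "\<phi>' z (a z) + f z * \<Psi> z * (\<Sum>b\<in>Basis. a' z b \<bullet> b) = f z * \<Psi>' z (a z)" for z
  proof (cases "z \<in> S")
    case False
    then show ?thesis using \<Psi>0 by (simp add: \<phi>'_def)
  next
    case True
    then have zU: "z \<in> U" using S by (auto simp: U_def)
    have "f' z (a z) = 0"
      using vlasov[of "fst z" "fst (snd z)" "snd (snd z)"] zU by (auto simp: U_def a_def)
    then show ?thesis using True div0[OF zU] by (simp add: \<phi>'_def)
  qed
  have SU: "S \<subseteq> U" using S by (simp add: U_def)
  note I = integral_divergence_eq_0[OF U S(1) SU d\<phi> da c\<phi>' ca' supp, unfolded \<phi>'a]
  show "integrable lborel (\<lambda>z. f z * \<Psi>' z (a z))" by (rule I(1))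
  show "(LINT z|lborel. f z * \<Psi>' z (a z)) = 0" by (rule I(2))
qed

text \<open>
  Bounded momenta stay uniformly below the speed of light. The factor 2 leaves room for a bounded displacement from the ray.
\<close>
lemma velocity_gap:
  obtains \<delta> where "0 < \<delta>" "\<delta> < 1" "\<And>v. norm v \<le> K \<Longrightarrow> norm (velocity \<mu> v) \<le> 1 - 2 * \<delta>"
proof (cases "K \<ge> 0")
  case True
  have "continuous_on (cball 0 K) (\<lambda>v. norm (velocity \<mu> v))"
    by (intro continuous_intros \<mu>)
  then obtain v0 where v0: "\<And>v. norm v \<le> K \<Longrightarrow> norm (velocity \<mu> v) \<le> norm (velocity \<mu> v0)"
    using continuous_attains_sup[OF compact_cball[of "0::R3" K]] True by fastforce
  define r where "r = norm (velocity \<mu> v0)"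
  have r: "0 \<le> r" "r < 1" unfolding r_def using norm_velocity_less_1[OF \<mu>, of v0] by auto
  have e: "1 - 2 * ((1 - r) / 2) = r" by (simp add: field_simps)
  show ?thesis
  proof (rule that[of "(1 - r) / 2"])
    show "norm (velocity \<mu> v) \<le> 1 - 2 * ((1 - r) / 2)" if "norm v \<le> K" for v
      unfolding e unfolding r_def by (rule v0[OF that])
  qed (use r in auto)
next
  case False
  then show ?thesis by (intro that[of "1/2"]) (auto simp: order_trans[OF norm_ge_zero])
qed

text \<open>
  The gradient with respect to \<open>y\<close> of the truncated first moment \<open>(y \<bullet> \<theta> v) * plateau R y\<close>.
\<close>
definition moment_grad :: "real \<Rightarrow> (R3 \<Rightarrow> R3) \<Rightarrow> R3 \<Rightarrow> R3 \<Rightarrow> R3" where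
  "moment_grad R \<theta> y v = plateau R y *\<^sub>R \<theta> v + (y \<bullet> \<theta> v) *\<^sub>R plateau_grad R y"

lemma norm_moment_grad:
  assumes "R > 0"
  shows "norm (moment_grad R \<theta> y v) \<le> 5 * norm (\<theta> v)"
proof -
  have "\<bar>y \<bullet> \<theta> v\<bar> * norm (plateau_grad R y) \<le> (norm y * norm (\<theta> v)) * norm (plateau_grad R y)"
    by (intro mult_right_mono Cauchy_Schwarz_ineq2) auto
  also have "\<dots> = (norm y * norm (plateau_grad R y)) * norm (\<theta> v)" by simp
  also have "\<dots> \<le> 4 * norm (\<theta> v)" by (intro mult_right_mono norm_plateau_grad assms) auto
  finally have 1: "norm ((y \<bullet> \<theta> v) *\<^sub>R plateau_grad R y) \<le> 4 * norm (\<theta> v)" by simp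
  have "plateau R y * norm (\<theta> v) \<le> 1 * norm (\<theta> v)" by (intro mult_right_mono plateau_bounds) auto
  then have 2: "norm (plateau R y *\<^sub>R \<theta> v) \<le> norm (\<theta> v)" using plateau_bounds by simp
  show ?thesis unfolding moment_grad_def using 1 2 by (intro order_trans[OF norm_triangle_ineq]) simp
qed

definition mean_force :: "nat \<Rightarrow> R3 \<Rightarrow> R3" where
  "mean_force n v = velocity_deriv \<mu> v (avg_lorentz n (velocity \<mu> v))"

lemma measurable_mean_force:
  assumes n: "n > 0"
  shows "mean_force n \<in> borel_measurable borel"
proof -
  have 1: "(\<lambda>p. velocity_deriv \<mu> (fst p) (snd p)) \<in> borel_measurable (borel \<Otimes>\<^sub>M borel)"
    unfolding borel_prod by (intro borel_measurable_continuous_onI continuous_intros \<mu>)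
  have 2: "(\<lambda>v. (v, avg_lorentz n (velocity \<mu> v))) \<in> borel \<rightarrow>\<^sub>M borel \<Otimes>\<^sub>M borel"
    using measurable_avg_lorentz[OF n] by measurable
  show ?thesis using measurable_compose[OF 2 1] by (simp add: mean_force_def[abs_def])
qed

lemma mean_force_bound:
  obtains M where "M \<ge> 0" "\<And>n v. n > 0 \<Longrightarrow> norm v \<le> K \<Longrightarrow> norm (mean_force n v) \<le> M"
proof -
  obtain \<delta> where \<delta>: "0 < \<delta>" "\<delta> < 1" "\<And>v. norm v \<le> K \<Longrightarrow> norm (velocity \<mu> v) \<le> 1 - 2 * \<delta>"
    using velocity_gap by blast
  obtain CF where CF: "CF \<ge> 0" "\<And>n u. n > 0 \<Longrightarrow> norm u \<le> 1 - \<delta> \<Longrightarrow> norm (avg_lorentz n u) \<le> CF"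
    using avg_lorentz_bound[OF \<delta>(1,2)] by blast
  have "norm (mean_force n v) \<le> (2 / \<mu>) * CF" if "n > 0" "norm v \<le> K" for n v
  proof -
    have "norm (velocity \<mu> v) \<le> 1 - \<delta>" using \<delta>(3)[OF that(2)] \<delta>(1) by linarith
    then have "(2 / \<mu>) * norm (avg_lorentz n (velocity \<mu> v)) \<le> (2 / \<mu>) * CF"
      using CF(2)[OF that(1)] \<mu> by (intro mult_left_mono) auto
    then show ?thesis unfolding mean_force_def by (intro order_trans[OF norm_velocity_deriv_le[OF \<mu>]])
  qed
  then show ?thesis using that[of "(2 / \<mu>) * CF"] CF \<mu> by simp
qed

lemma integrable_g_mult:
  assumes m: "h \<in> borel_measurable borel" and b: "\<And>w. \<bar>h w\<bar> \<le> A"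
  shows "integrable lborel (\<lambda>w. g w * h w)"
  using integrable_bounded_mult[OF gint m b] by (simp add: mult.commute)

text \<open>
  The weight \<open>\<theta>\<close> of the first moment is a \<open>C\<^sup>1\<close> vector field of compact support in momentum space.
\<close>
context
  fixes \<theta> :: "R3 \<Rightarrow> R3" and \<theta>' :: "R3 \<Rightarrow> R3 \<Rightarrow> R3" and K :: real
  assumes K: "K > 0"
    and d\<theta>: "\<And>v. (\<theta> has_derivative \<theta>' v) (at v)"
    and c\<theta>': "\<And>h. continuous_on UNIV (\<lambda>v. \<theta>' v h)"
    and \<theta>0: "\<And>v. norm v > K \<Longrightarrow> \<theta> v = 0" "\<And>v h. norm v > K \<Longrightarrow> \<theta>' v h = 0"
begin

lemma continuous_\<theta>: "continuous_on S \<theta>"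
  by (intro continuous_at_imp_continuous_on ballI has_derivative_continuous[OF d\<theta>])

lemma \<theta>_bound: obtains \<Theta> where "\<Theta> \<ge> 0" "\<And>v. norm (\<theta> v) \<le> \<Theta>"
proof -
  have "bounded (\<theta> ` cball 0 K)"
    by (intro compact_imp_bounded compact_continuous_image continuous_\<theta> compact_cball)
  then obtain M where "\<forall>y\<in>\<theta> ` cball 0 K. norm y \<le> M" unfolding bounded_iff by blast
  then have "norm (\<theta> v) \<le> M" if "norm v \<le> K" for v using that by simp
  then have "norm (\<theta> v) \<le> max M 0" for v
    using \<theta>0(1)[of v] by (cases "norm v \<le> K") (auto simp: le_max_iff_disj)
  then show ?thesis using that[of "max M 0"] by simp
qed

lemma \<theta>'_bound: obtains \<Theta> where "\<Theta> \<ge> 0" "\<And>v h. norm (\<theta>' v h) \<le> \<Theta> * norm h"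
proof -
  have "\<exists>M\<ge>0. \<forall>v. norm (\<theta>' v b) \<le> M" for b
  proof -
    have "bounded ((\<lambda>v. \<theta>' v b) ` cball 0 K)"
      by (intro compact_imp_bounded compact_continuous_image continuous_on_subset[OF c\<theta>'] compact_cball) auto
    then obtain M where "\<forall>y\<in>(\<lambda>v. \<theta>' v b) ` cball 0 K. norm y \<le> M" unfolding bounded_iff by blast
    then have "norm (\<theta>' v b) \<le> M" if "norm v \<le> K" for v using that by simp
    then have "norm (\<theta>' v b) \<le> max M 0" for v
      using \<theta>0(2)[of v b] by (cases "norm v \<le> K") (auto simp: le_max_iff_disj)
    then show ?thesis by (intro exI[of _ "max M 0"]) simp
  qed
  then obtain M where M: "\<And>b. M b \<ge> 0" "\<And>b v. norm (\<theta>' v b) \<le> M b" by metis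
  have "norm (\<theta>' v h) \<le> (\<Sum>b\<in>Basis. M b) * norm h" for v h
  proof -
    have "\<theta>' v h = (\<Sum>b\<in>Basis. (h \<bullet> b) *\<^sub>R \<theta>' v b)"
      by (rule linear_eq_sum_Basis[OF has_derivative_linear[OF d\<theta>]])
    also have "norm \<dots> \<le> (\<Sum>b\<in>Basis. norm h * M b)"
    proof (intro order_trans[OF norm_sum] sum_mono)
      fix b :: R3 assume "b \<in> Basis"
      then show "norm ((h \<bullet> b) *\<^sub>R \<theta>' v b) \<le> norm h * M b"
        using mult_mono[OF Basis_le_norm[of b h] M(2)[where b = b]] M(1)[of b] by simp
    qed
    also have "\<dots> = (\<Sum>b\<in>Basis. M b) * norm h" by (subst sum_distrib_right) (simp add: mult.commute)
    finally show ?thesis .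
  qed
  then show ?thesis using that[of "\<Sum>b\<in>Basis. M b"] M(1) by (simp add: sum_nonneg)
qed

lemma moment_grad_eq_0:
  assumes "R > 0" "norm y > R \<or> norm v > K"
  shows "moment_grad R \<theta> y v = 0"
  using assms plateau_eq_0[OF assms(1), of y] \<theta>0(1)[of v] by (auto simp: moment_grad_def)

text \<open>
  The Vlasov equation is tested with \<open>time_cutoff n t\<close> times the truncated moment \<open>(y \<bullet> \<theta> v) * plateau R y\<close>
  at \<open>y = x - t velocity\<close>. Free transport leaves \<open>y\<close> unchanged, so three terms remain: the derivative of the
  time cutoff, the derivative of \<open>\<theta>\<close> along the force, and the drift of \<open>y\<close> under the force. The first two are
  \<open>O(1/n)\<close>. In the drift term the density is replaced by the free solution, and the field at \<open>x\<close> by the field on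
  the ray; what remains is the mean force.
\<close>
lemma mean_force_test_function:
  assumes R: "R > 0"
  shows "(\<lambda>n. LINT w|lborel. g w * (mean_force n (snd w) \<bullet> moment_grad R \<theta> (fst w) (snd w))) \<longlonglongrightarrow> 0"
proof -
  obtain \<delta> where \<delta>: "0 < \<delta>" "\<delta> < 1" "\<And>v. norm v \<le> K \<Longrightarrow> norm (velocity \<mu> v) \<le> 1 - 2 * \<delta>"
    using velocity_gap by blast
  obtain CF \<tau> where \<tau>: "(\<tau> \<longlongrightarrow> (0::real)) at_top" and CF: "CF \<ge> 0"
    "\<And>t x u. t \<ge> 1 \<Longrightarrow> norm x \<le> (1 - \<delta>) * t \<Longrightarrow> norm u \<le> 1 \<Longrightarrow> t\<^sup>2 * norm (lorentz t x u) \<le> CF"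
    and Lip: "\<And>t x x' u. t \<ge> 1 \<Longrightarrow> norm x \<le> (1 - \<delta>) * t \<Longrightarrow> norm x' \<le> (1 - \<delta>) * t \<Longrightarrow> norm u \<le> 1 \<Longrightarrow>
       t\<^sup>2 * norm (lorentz t x u - lorentz t x' u) \<le> \<tau> t * norm (x - x')"
    by (rule lorentz_decay[OF \<delta>(1,2)], rule that)
  obtain \<Theta> where \<Theta>: "\<Theta> \<ge> 0" "\<And>v. norm (\<theta> v) \<le> \<Theta>" using \<theta>_bound by blast
  obtain \<Theta>' where \<Theta>': "\<Theta>' \<ge> 0" "\<And>v h. norm (\<theta>' v h) \<le> \<Theta>' * norm h" using \<theta>'_bound by blast
  define mom where "mom z = snd (snd z)" for z :: "real \<times> R3 \<times> R3"
  define vel where "vel z = velocity \<mu> (mom z)" for z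
  define off where "off z = fst (snd z) - fst z *\<^sub>R vel z" for z
  define lor where "lor z = lorentz (fst z) (fst (snd z)) (vel z)" for z
  define lor0 where "lor0 z = lorentz (fst z) (fst z *\<^sub>R vel z) (vel z)" for z
  define N where "N z = moment_grad R \<theta> (off z) (mom z)" for z
  have cv: "continuous_on S mom" "continuous_on S vel" "continuous_on S off" for S
    unfolding mom_def[abs_def] vel_def[abs_def] off_def[abs_def]
    by (intro continuous_intros \<mu>)+
  have cl: "continuous_on S lor" "continuous_on S lor0" for S
    unfolding lor_def[abs_def] lor0_def[abs_def]
    by (intro continuous_on_lorentz continuous_intros cv)+
  have c\<theta>m: "continuous_on S (\<lambda>z. \<theta> (mom z))" for S
    by (rule continuous_on_compose2[OF continuous_\<theta>[of UNIV] cv(1)]) simp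
  have c\<theta>'m: "continuous_on S (\<lambda>z. \<theta>' (mom z) h)" for S h
    by (rule continuous_on_compose2[OF c\<theta>' cv(1)]) simp
  have cN: "continuous_on S N" for S
    unfolding N_def[abs_def] moment_grad_def by (intro continuous_intros cv c\<theta>m)
  define D where "D z h = fst (snd h) - (fst z *\<^sub>R velocity_deriv \<mu> (mom z) (snd (snd h)) + fst h *\<^sub>R vel z)"
    for z h :: "real \<times> R3 \<times> R3"
  have doff: "(off has_derivative D z) (at z)" for z
  proof -
    have 2: "(mom has_derivative (\<lambda>h. snd (snd h))) (at z)"
      unfolding mom_def[abs_def] by (auto intro!: derivative_eq_intros)
    have dv: "(vel has_derivative (\<lambda>h. velocity_deriv \<mu> (mom z) (snd (snd h)))) (at z)"
      unfolding vel_def[abs_def] by (rule has_derivative_compose[OF 2 velocity_has_derivative[OF \<mu>]])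
    have df: "(fst has_derivative fst) (at z)" and dx: "((\<lambda>z. fst (snd z)) has_derivative (\<lambda>h. fst (snd h))) (at z)"
      by (auto intro!: derivative_eq_intros)
    show ?thesis unfolding off_def[abs_def] D_def[abs_def]
      by (intro has_derivative_diff dx has_derivative_scaleR[OF df dv])
  qed
  have d\<theta>m: "((\<lambda>z. \<theta> (mom z)) has_derivative (\<lambda>h. \<theta>' (mom z) (snd (snd h)))) (at z)" for z
    by (rule has_derivative_compose[OF _ d\<theta>]) (auto simp: mom_def[abs_def] intro!: derivative_eq_intros)
  have dp: "((\<lambda>z. plateau R (off z)) has_derivative (\<lambda>h. plateau_grad R (off z) \<bullet> D z h)) (at z)" for z
    by (rule has_derivative_compose[OF doff plateau_has_derivative])
  define \<psi> where "\<psi> z = (off z \<bullet> \<theta> (mom z)) * plateau R (off z)" for z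
  define \<psi>' where "\<psi>' z h = (off z \<bullet> \<theta> (mom z)) * (plateau_grad R (off z) \<bullet> D z h)
     + (off z \<bullet> \<theta>' (mom z) (snd (snd h)) + D z h \<bullet> \<theta> (mom z)) * plateau R (off z)" for z h
  have d\<psi>: "(\<psi> has_derivative \<psi>' z) (at z)" for z
    unfolding \<psi>_def[abs_def] \<psi>'_def[abs_def]
    by (intro has_derivative_mult has_derivative_inner doff d\<theta>m dp)
  define \<Psi> where "\<Psi> n z = time_cutoff n (fst z) * \<psi> z" for n z
  define \<Psi>' where "\<Psi>' n z h = time_cutoff n (fst z) * \<psi>' z h + (time_cutoff' n (fst z) * fst h) * \<psi> z" for n z h
  \<comment> \<open>The derivative of the test function along the transport field is \<open>n * (c1 n + c2 n - e * c0 n)\<close>, with \<open>c1\<close> from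
    the time cutoff, \<open>c2\<close> from \<open>\<theta>\<close> and \<open>c0\<close> from the drift of \<open>off\<close>.
    In \<open>d0\<close> the field is evaluated on the ray instead of at \<open>x\<close>.\<close>
  define c1 where "c1 n z = (1 / real n) * (time_cutoff' n (fst z) * \<psi> z)" for n z
  define c2 where "c2 n z = log_weight n (fst z) * fst z * ((off z \<bullet> \<theta>' (mom z) (e *\<^sub>R lor z)) * plateau R (off z))" for n z
  define c0 where "c0 n z = log_weight n (fst z) * (fst z)\<^sup>2 * (velocity_deriv \<mu> (mom z) (lor z) \<bullet> N z)" for n z
  define d0 where "d0 n z = log_weight n (fst z) * (fst z)\<^sup>2 * (velocity_deriv \<mu> (mom z) (lor0 z) \<bullet> N z)" for n z
  have ct: "continuous_on UNIV (\<lambda>z :: real \<times> R3 \<times> R3. log_weight n (fst z))"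
    "continuous_on UNIV (\<lambda>z :: real \<times> R3 \<times> R3. time_cutoff n (fst z))"
    "continuous_on UNIV (\<lambda>z :: real \<times> R3 \<times> R3. time_cutoff' n (fst z))" if "n > 0" for n
    by (rule continuous_on_compose2[OF continuous_time_weights(3)[OF that]]
          continuous_on_compose2[OF continuous_time_weights(1)[OF that]]
          continuous_on_compose2[OF continuous_time_weights(2)[OF that]];
        auto intro!: continuous_intros)+
  have c\<psi>: "continuous_on UNIV \<psi>"
    unfolding \<psi>_def[abs_def] by (intro continuous_intros cv c\<theta>m)
  have c\<psi>': "continuous_on UNIV (\<lambda>z. \<psi>' z h)" for h
    unfolding \<psi>'_def D_def by (intro continuous_intros cv c\<theta>m c\<theta>'m \<mu>)
  have cc: "continuous_on UNIV (c1 n)" "continuous_on UNIV (c2 n)" "continuous_on UNIV (c0 n)" "continuous_on UNIV (d0 n)"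
    if n: "n > 0" for n
  proof -
    have eq: "(\<lambda>z. \<theta>' (mom z) (e *\<^sub>R lor z)) = (\<lambda>z. \<Sum>b\<in>Basis. ((e *\<^sub>R lor z) \<bullet> b) *\<^sub>R \<theta>' (mom z) b)"
      by (intro ext) (rule linear_eq_sum_Basis[OF has_derivative_linear[OF d\<theta>]])
    have "continuous_on UNIV (\<lambda>z. \<theta>' (mom z) (e *\<^sub>R lor z))"
      unfolding eq by (intro continuous_intros cl c\<theta>'m)
    then show "continuous_on UNIV (c2 n)"
      unfolding c2_def[abs_def] by (intro continuous_intros ct n cv)
    show "continuous_on UNIV (c1 n)" "continuous_on UNIV (c0 n)" "continuous_on UNIV (d0 n)"
      unfolding c1_def[abs_def] c0_def[abs_def] d0_def[abs_def]
      by (intro continuous_intros ct n cv cl cN c\<psi> \<mu>)+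
  qed
  have cm: "c1 n \<in> borel_measurable borel" "c2 n \<in> borel_measurable borel" "c0 n \<in> borel_measurable borel" "d0 n \<in> borel_measurable borel"
    if n: "n > 0" for n
    using cc[OF n] by (auto intro: borel_measurable_continuous_onI)
  have out: "\<psi> z = 0" "\<psi>' z h = 0" "N z = 0" "(off z \<bullet> \<theta>' (mom z) h2) * plateau R (off z) = 0"
    if "\<not> (norm (off z) \<le> R \<and> norm (mom z) \<le> K)" for z h h2
  proof -
    consider "norm (off z) > R" | "norm (mom z) > K" using \<open>\<not> _\<close> by linarith
    then have "\<psi> z = 0 \<and> \<psi>' z h = 0 \<and> N z = 0 \<and> (off z \<bullet> \<theta>' (mom z) h2) * plateau R (off z) = 0"
    proof cases
      case 1
      then show ?thesis using plateau_eq_0[OF R 1]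
        by (simp add: \<psi>_def \<psi>'_def N_def moment_grad_eq_0[OF R])
    next
      case 2
      then show ?thesis using \<theta>0[OF 2]
        by (simp add: \<psi>_def \<psi>'_def N_def moment_grad_eq_0[OF R])
    qed
    then show "\<psi> z = 0" "\<psi>' z h = 0" "N z = 0" "(off z \<bullet> \<theta>' (mom z) h2) * plateau R (off z) = 0" by auto
  qed
  have vel1: "norm (vel z) \<le> 1" for z using norm_velocity_less_1[OF \<mu>, of "mom z"] by (simp add: vel_def)
  have xoff: "norm (fst (snd z)) \<le> norm (off z) + \<bar>fst z\<bar> * norm (vel z)" for z
    using norm_triangle_ineq[of "off z" "fst z *\<^sub>R vel z"] by (simp add: off_def)
  have lv: "velocity_deriv \<mu> v (r *\<^sub>R h) = r *\<^sub>R velocity_deriv \<mu> v h" for v r h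
    using linear_scale[OF linear_velocity_deriv] .
  \<comment> \<open>The transport field annihilates \<open>off\<close> except for the force, so that \<open>D z (a z)\<close> is \<open>- t e\<close> times the derivative of
    the velocity along the Lorentz field.\<close>
  have ident: "e * (LINT z|lborel. c0 n z * f z) = (LINT z|lborel. c1 n z * f z) + (LINT z|lborel. c2 n z * f z)"
    if n: "n > 0"
      and i: "integrable lborel (\<lambda>z. c0 n z * f z)" "integrable lborel (\<lambda>z. c1 n z * f z)" "integrable lborel (\<lambda>z. c2 n z * f z)"
    for n
  proof -
    define S where "S = log_interval n \<times> cball (0::R3) (R + exp (2 * real n)) \<times> cball (0::R3) K"
    define a where "a z = (1::real, velocity \<mu> (snd (snd z)), force (fst z) (fst (snd z)) (snd (snd z)))" for z :: "real \<times> R3 \<times> R3"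
    have S0: "\<Psi> n z = 0 \<and> \<Psi>' n z h = 0" if "z \<notin> S" for z h
    proof (cases "fst z \<in> log_interval n \<and> norm (off z) \<le> R \<and> norm (mom z) \<le> K")
      case True
      then have t: "0 \<le> fst z" using exp_n_gt_1[OF n, of "fst z"] by simp
      have "\<bar>fst z\<bar> * norm (vel z) \<le> exp (2 * real n) * 1"
        using True t vel1[of z] by (intro mult_mono) auto
      then have "norm (fst (snd z)) \<le> R + exp (2 * real n)" using True xoff[of z] by linarith
      then have "z \<in> S" using True by (cases z) (auto simp: S_def mom_def)
      then show ?thesis using that by simp
    next
      case False
      then show ?thesis using time_cutoff_zero[OF n, of "fst z"] out[of z]
        by (cases "fst z \<in> log_interval n") (simp_all add: \<Psi>_def \<Psi>'_def)
    qed
    have S: "compact S" "S \<subseteq> {0<..} \<times> UNIV"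
    proof -
      show "compact S" unfolding S_def by (intro compact_Times compact_Icc compact_cball)
      show "S \<subseteq> {0<..} \<times> UNIV" using less_le_trans[OF exp_gt_zero[of "real n"]] by (auto simp: S_def)
    qed
    have d\<Psi>: "(\<Psi> n has_derivative \<Psi>' n z) (at z)" for z
    proof -
      have "((\<lambda>z. time_cutoff n (fst z)) has_derivative (\<lambda>h. time_cutoff' n (fst z) * fst h)) (at z)"
        by (rule has_derivative_compose[of fst fst, OF _ time_cutoff_has_derivative[OF n, unfolded has_field_derivative_def]])
           (auto intro!: derivative_eq_intros)
      from has_derivative_mult[OF this d\<psi>] show ?thesis unfolding \<Psi>_def[abs_def] \<Psi>'_def[abs_def] .
    qed
    have c\<Psi>': "continuous_on UNIV (\<lambda>z. \<Psi>' n z h)" for h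
      unfolding \<Psi>'_def by (intro continuous_intros ct n c\<psi> c\<psi>')
    have W: "(LINT z|lborel. f z * \<Psi>' n z (a z)) = 0"
      unfolding a_def by (rule weak_vlasov(2)[OF S d\<Psi> c\<Psi>']) (use S0 in auto)
    have "f z * \<Psi>' n z (a z) = n * (c1 n z * f z + c2 n z * f z - e * (c0 n z * f z))" for z
    proof -
      have F: "force (fst z) (fst (snd z)) (snd (snd z)) = e *\<^sub>R lor z"
        by (simp add: force_eq lor_def vel_def mom_def)
      have Da: "D z (a z) = (- (fst z * e)) *\<^sub>R velocity_deriv \<mu> (mom z) (lor z)"
        by (simp add: D_def a_def F lv vel_def mom_def)
      have DN: "D z (a z) \<bullet> N z = (off z \<bullet> \<theta> (mom z)) * (plateau_grad R (off z) \<bullet> D z (a z)) + (D z (a z) \<bullet> \<theta> (mom z)) * plateau R (off z)"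
        by (simp add: N_def moment_grad_def inner_add_right inner_commute[of _ "D z (a z)"])
      have \<psi>'a: "\<psi>' z (a z) = (off z \<bullet> \<theta>' (mom z) (e *\<^sub>R lor z)) * plateau R (off z) - fst z * e * (velocity_deriv \<mu> (mom z) (lor z) \<bullet> N z)"
      proof -
        have "\<psi>' z (a z) = (off z \<bullet> \<theta>' (mom z) (e *\<^sub>R lor z)) * plateau R (off z) + D z (a z) \<bullet> N z"
          unfolding DN by (simp add: \<psi>'_def a_def F distrib_right)
        then show ?thesis by (simp add: Da)
      qed
      have tc: "time_cutoff n (fst z) = n * fst z * log_weight n (fst z)"
        using n by (cases "fst z = 0") (auto simp: log_weight_def time_cutoff_def)
      have "\<Psi>' n z (a z) = time_cutoff n (fst z) * \<psi>' z (a z) + time_cutoff' n (fst z) * \<psi> z"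
        by (simp add: \<Psi>'_def a_def)
      also have "\<dots> = n * (c1 n z + c2 n z - e * c0 n z)"
        unfolding \<psi>'a tc c1_def c2_def c0_def using n by (simp add: algebra_simps power2_eq_square)
      finally have "f z * \<Psi>' n z (a z) = f z * (n * (c1 n z + c2 n z - e * c0 n z))" by simp
      then show ?thesis by (simp add: algebra_simps)
    qed
    then have "0 = (LINT z|lborel. n * (c1 n z * f z + c2 n z * f z - e * (c0 n z * f z)))"
      using W by simp
    also have "\<dots> = n * ((LINT z|lborel. c1 n z * f z) + (LINT z|lborel. c2 n z * f z) - e * (LINT z|lborel. c0 n z * f z))"
      using i by simp
    finally show ?thesis using n by simp
  qed
  \<comment> \<open>From \<open>n1\<close> on, the points within distance \<open>R\<close> of the rays with momentum at most \<open>K\<close> lie in the smaller cone.\<close>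
  define n1 :: nat where "n1 = Suc (nat \<lceil>R / \<delta>\<rceil>)"
  have n1: "n > 0" "R \<le> \<delta> * real n" if "n \<ge> n1" for n
  proof -
    show "n > 0" using that by (simp add: n1_def)
    have "R / \<delta> \<le> real n" using that by (simp add: n1_def) linarith
    then show "R \<le> \<delta> * real n" using \<delta> by (simp add: field_simps)
  qed
  have zone: "fst z \<ge> 1" "fst z \<ge> real n" "norm (fst (snd z)) \<le> (1 - \<delta>) * fst z" "norm (fst z *\<^sub>R vel z) \<le> (1 - \<delta>) * fst z"
    if n: "n \<ge> n1" and z: "fst z \<in> log_interval n" "norm (off z) \<le> R" "norm (mom z) \<le> K" for n z
  proof -
    show t: "fst z \<ge> 1" using exp_n_gt_1[OF n1(1)[OF n], of "fst z"] z by simp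
    have "1 + real n \<le> exp (real n)" by (rule exp_ge_add_one_self)
    then have "real n \<le> exp (real n)" by linarith
    moreover have "exp (real n) \<le> fst z" using z by simp
    ultimately show tn: "fst z \<ge> real n" by (rule order_trans)
    have R\<delta>: "R \<le> \<delta> * fst z"
      using n1(2)[OF n] mult_left_mono[OF tn, of \<delta>] \<delta> by linarith
    have v: "\<bar>fst z\<bar> * norm (vel z) \<le> fst z * (1 - 2 * \<delta>)"
      using t \<delta>(3)[OF z(3)] by (simp add: vel_def)
    have e1: "(1 - \<delta>) * fst z = \<delta> * fst z + fst z * (1 - 2 * \<delta>)" by (simp add: algebra_simps)
    show "norm (fst (snd z)) \<le> (1 - \<delta>) * fst z"
      using xoff[of z] v z(2) R\<delta> e1 by linarith
    show "norm (fst z *\<^sub>R vel z) \<le> (1 - \<delta>) * fst z"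
      using v e1 R\<delta> R by simp
  qed
  have win: "window n K z = log_window n (fst z)" if "norm (mom z) \<le> K" for n z
    using that by (simp add: window_def mom_def)
  have Nb: "norm (N z) \<le> 5 * \<Theta>" for z
    unfolding N_def using norm_moment_grad[OF R, of \<theta> "off z" "mom z"] \<Theta>(2)[of "mom z"] by linarith
  \<comment> \<open>All kernels vanish outside this zone, so it is enough to estimate them there.\<close>
  have red: "\<bar>c z\<bar> \<le> A * window n K z"
    if n: "n \<ge> n1" and A: "A \<ge> 0"
      and z0: "fst z \<notin> log_interval n \<or> \<not> (norm (off z) \<le> R \<and> norm (mom z) \<le> K) \<Longrightarrow> c z = 0"
      and z1: "fst z \<in> log_interval n \<Longrightarrow> norm (off z) \<le> R \<Longrightarrow> norm (mom z) \<le> K \<Longrightarrow>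
          \<bar>c z\<bar> \<le> A * log_window n (fst z)" for c :: "real \<times> R3 \<times> R3 \<Rightarrow> real" and A n z
  proof (cases "fst z \<in> log_interval n \<and> norm (off z) \<le> R \<and> norm (mom z) \<le> K")
    case True
    then show ?thesis using z1 win[of z n] by simp
  next
    case False
    then have "c z = 0" using z0 by blast
    then show ?thesis using A window_le(1)[of n K z] by simp
  qed
  have b1: "\<bar>c1 n z\<bar> \<le> (15 * R * \<Theta> / n) * window n K z" if n: "n \<ge> n1" for n z
  proof (rule red[OF n])
    show "0 \<le> 15 * R * \<Theta> / n" using R \<Theta> by simp
    show "c1 n z = 0" if "fst z \<notin> log_interval n \<or> \<not> (norm (off z) \<le> R \<and> norm (mom z) \<le> K)"
      using that time_cutoff_zero[OF n1(1)[OF n], of "fst z"] out(1)[of z] by (auto simp: c1_def)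
    assume z: "fst z \<in> log_interval n" "norm (off z) \<le> R" "norm (mom z) \<le> K"
    have "\<bar>off z \<bullet> \<theta> (mom z)\<bar> \<le> R * \<Theta>"
      using z \<Theta> R by (intro order_trans[OF Cauchy_Schwarz_ineq2] mult_mono) auto
    then have "\<bar>off z \<bullet> \<theta> (mom z)\<bar> * plateau R (off z) \<le> (R * \<Theta>) * 1"
      using plateau_bounds R \<Theta> by (intro mult_mono) auto
    then have "\<bar>\<psi> z\<bar> \<le> R * \<Theta>" using plateau_bounds by (simp add: \<psi>_def abs_mult)
    then have "\<bar>time_cutoff' n (fst z)\<bar> * \<bar>\<psi> z\<bar> \<le> (15 * log_window n (fst z)) * (R * \<Theta>)"
      using time_weights_le(3)[OF n1(1)[OF n]] log_window_nonneg by (intro mult_mono) auto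
    then have "(1 / real n) * (\<bar>time_cutoff' n (fst z)\<bar> * \<bar>\<psi> z\<bar>) \<le> (1 / real n) * ((15 * log_window n (fst z)) * (R * \<Theta>))"
      by (intro mult_left_mono) auto
    then show "\<bar>c1 n z\<bar> \<le> (15 * R * \<Theta> / n) * log_window n (fst z)"
      by (simp add: c1_def abs_mult ac_simps)
  qed
  have b2: "\<bar>c2 n z\<bar> \<le> (2 * R * \<Theta>' * \<bar>e\<bar> * CF / n) * window n K z" if n: "n \<ge> n1" for n z
  proof (rule red[OF n])
    show "0 \<le> 2 * R * \<Theta>' * \<bar>e\<bar> * CF / n" using R \<Theta>' CF by simp
    show "c2 n z = 0" if "fst z \<notin> log_interval n \<or> \<not> (norm (off z) \<le> R \<and> norm (mom z) \<le> K)"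
      using that time_cutoff_zero[OF n1(1)[OF n], of "fst z"] out(4)[of z] by (auto simp: c2_def)
    assume z: "fst z \<in> log_interval n" "norm (off z) \<le> R" "norm (mom z) \<le> K"
    note zz = zone[OF n z]
    have n0: "real n > 0" using n1(1)[OF n] by simp
    have l: "fst z * norm (lor z) \<le> CF / n"
    proof -
      have "(fst z)\<^sup>2 * norm (lor z) \<le> CF" unfolding lor_def by (rule CF(2)[OF zz(1,3) vel1])
      then have "fst z * (fst z * norm (lor z)) \<le> CF" by (simp add: power2_eq_square mult.assoc)
      moreover have "real n * (fst z * norm (lor z)) \<le> fst z * (fst z * norm (lor z))"
        using zz(1,2) by (intro mult_right_mono) auto
      ultimately show ?thesis using n0 by (simp add: field_simps)
    qed
    have "\<bar>off z \<bullet> \<theta>' (mom z) (e *\<^sub>R lor z)\<bar> \<le> R * (\<Theta>' * norm (e *\<^sub>R lor z))"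
      using z \<Theta>'(1) R by (intro order_trans[OF Cauchy_Schwarz_ineq2] mult_mono \<Theta>'(2)) auto
    then have "\<bar>off z \<bullet> \<theta>' (mom z) (e *\<^sub>R lor z)\<bar> * plateau R (off z) \<le> (R * (\<Theta>' * norm (e *\<^sub>R lor z))) * 1"
      using plateau_bounds R \<Theta>'(1) by (intro mult_mono) auto
    then have "fst z * (\<bar>off z \<bullet> \<theta>' (mom z) (e *\<^sub>R lor z)\<bar> * plateau R (off z)) \<le> fst z * (R * \<Theta>' * \<bar>e\<bar> * norm (lor z))"
      using zz(1) by (intro mult_left_mono) (auto simp: mult.assoc)
    also have "\<dots> = (R * \<Theta>' * \<bar>e\<bar>) * (fst z * norm (lor z))" by simp
    also have "\<dots> \<le> (R * \<Theta>' * \<bar>e\<bar>) * (CF / n)" using l R \<Theta>' by (intro mult_left_mono) auto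
    finally have h: "fst z * (\<bar>off z \<bullet> \<theta>' (mom z) (e *\<^sub>R lor z)\<bar> * plateau R (off z)) \<le> (R * \<Theta>' * \<bar>e\<bar>) * (CF / n)" .
    have "log_weight n (fst z) * (fst z * (\<bar>off z \<bullet> \<theta>' (mom z) (e *\<^sub>R lor z)\<bar> * plateau R (off z)))
        \<le> (2 * log_window n (fst z)) * ((R * \<Theta>' * \<bar>e\<bar>) * (CF / n))"
      by (rule mult_mono[OF time_weights_le(2)[OF n1(1)[OF n]] h])
         (use log_window_nonneg[of n "fst z"] zz(1) plateau_bounds(1) in auto)
    moreover have "\<bar>c2 n z\<bar> = log_weight n (fst z) * (fst z * (\<bar>off z \<bullet> \<theta>' (mom z) (e *\<^sub>R lor z)\<bar> * plateau R (off z)))"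
      using time_weights_le(1)[OF n1(1)[OF n], of "fst z"] zz(1) plateau_bounds(1)[of R "off z"]
      by (simp add: c2_def abs_mult mult.assoc)
    ultimately show "\<bar>c2 n z\<bar> \<le> (2 * R * \<Theta>' * \<bar>e\<bar> * CF / n) * log_window n (fst z)"
      by (simp add: field_simps)
  qed
  have vN: "\<bar>velocity_deriv \<mu> v x \<bullet> N z\<bar> \<le> (2 / \<mu> * 5 * \<Theta>) * norm x" for v x z
  proof -
    have "\<bar>velocity_deriv \<mu> v x \<bullet> N z\<bar> \<le> (2 / \<mu> * norm x) * (5 * \<Theta>)"
      using norm_velocity_deriv_le[OF \<mu>] Nb \<mu> by (intro order_trans[OF Cauchy_Schwarz_ineq2] mult_mono) auto
    then show ?thesis by (simp add: ac_simps)
  qed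
  define A0 where "A0 = 2 * (2 / \<mu> * 5 * \<Theta>)"
  have A0: "A0 \<ge> 0" using \<mu> \<Theta> by (simp add: A0_def)
  have wt: "\<bar>log_weight n (fst z) * (fst z)\<^sup>2 * (velocity_deriv \<mu> v x \<bullet> N z)\<bar> \<le> (A0 * B) * log_window n (fst z)"
    if n: "n > 0" and B: "(fst z)\<^sup>2 * norm x \<le> B" for n z v x B
  proof -
    have "(fst z)\<^sup>2 * \<bar>velocity_deriv \<mu> v x \<bullet> N z\<bar> \<le> (fst z)\<^sup>2 * ((2 / \<mu> * 5 * \<Theta>) * norm x)"
      by (intro mult_left_mono vN) auto
    also have "\<dots> = (2 / \<mu> * 5 * \<Theta>) * ((fst z)\<^sup>2 * norm x)" by simp
    also have "\<dots> \<le> (2 / \<mu> * 5 * \<Theta>) * B" using B \<mu> \<Theta> by (intro mult_left_mono) auto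
    finally have h: "(fst z)\<^sup>2 * \<bar>velocity_deriv \<mu> v x \<bullet> N z\<bar> \<le> (2 / \<mu> * 5 * \<Theta>) * B" .
    have "log_weight n (fst z) * ((fst z)\<^sup>2 * \<bar>velocity_deriv \<mu> v x \<bullet> N z\<bar>) \<le> (2 * log_window n (fst z)) * ((2 / \<mu> * 5 * \<Theta>) * B)"
      by (rule mult_mono[OF time_weights_le(2)[OF n] h]) (use log_window_nonneg[of n "fst z"] in auto)
    moreover have "\<bar>log_weight n (fst z) * (fst z)\<^sup>2 * (velocity_deriv \<mu> v x \<bullet> N z)\<bar>
        = log_weight n (fst z) * ((fst z)\<^sup>2 * \<bar>velocity_deriv \<mu> v x \<bullet> N z\<bar>)"
      using time_weights_le(1)[OF n, of "fst z"] by (simp add: abs_mult mult.assoc)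
    ultimately show ?thesis by (simp add: A0_def ac_simps)
  qed
  have b0: "\<bar>c0 n z\<bar> \<le> (A0 * CF) * window n K z" if n: "n \<ge> n1" for n z
  proof (rule red[OF n])
    show "0 \<le> A0 * CF" using A0 CF by simp
    show "c0 n z = 0" if "fst z \<notin> log_interval n \<or> \<not> (norm (off z) \<le> R \<and> norm (mom z) \<le> K)"
      using that time_cutoff_zero[OF n1(1)[OF n], of "fst z"] out(3)[of z] by (auto simp: c0_def)
    assume z: "fst z \<in> log_interval n" "norm (off z) \<le> R" "norm (mom z) \<le> K"
    note zz = zone[OF n z]
    show "\<bar>c0 n z\<bar> \<le> (A0 * CF) * log_window n (fst z)" unfolding c0_def
      by (intro wt n1(1)[OF n]) (unfold lor_def, rule CF(2)[OF zz(1,3) vel1])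
  qed
  have bd0: "\<bar>d0 n z\<bar> \<le> (A0 * CF) * window n K z" if n: "n \<ge> n1" for n z
  proof (rule red[OF n])
    show "0 \<le> A0 * CF" using A0 CF by simp
    show "d0 n z = 0" if "fst z \<notin> log_interval n \<or> \<not> (norm (off z) \<le> R \<and> norm (mom z) \<le> K)"
      using that time_cutoff_zero[OF n1(1)[OF n], of "fst z"] out(3)[of z] by (auto simp: d0_def)
    assume z: "fst z \<in> log_interval n" "norm (off z) \<le> R" "norm (mom z) \<le> K"
    note zz = zone[OF n z]
    show "\<bar>d0 n z\<bar> \<le> (A0 * CF) * log_window n (fst z)" unfolding d0_def
      by (intro wt n1(1)[OF n]) (unfold lor0_def, rule CF(2)[OF zz(1,4) vel1])
  qed
  have bdiff: "\<bar>c0 n z - d0 n z\<bar> \<le> (A0 * (\<epsilon> * R)) * window n K z"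
    if n: "n \<ge> n1" and \<epsilon>: "\<epsilon> \<ge> 0" "\<And>t. t \<ge> real n \<Longrightarrow> \<tau> t \<le> \<epsilon>" for n z \<epsilon>
  proof (rule red[OF n, where c = "\<lambda>z. c0 n z - d0 n z"])
    show "0 \<le> A0 * (\<epsilon> * R)" using A0 \<epsilon> R by simp
    show "c0 n z - d0 n z = 0" if "fst z \<notin> log_interval n \<or> \<not> (norm (off z) \<le> R \<and> norm (mom z) \<le> K)"
      using that time_cutoff_zero[OF n1(1)[OF n], of "fst z"] out(3)[of z] by (auto simp: d0_def c0_def)
    assume z: "fst z \<in> log_interval n" "norm (off z) \<le> R" "norm (mom z) \<le> K"
    note zz = zone[OF n z]
    have "(fst z)\<^sup>2 * norm (lor z - lor0 z) \<le> \<tau> (fst z) * norm (off z)"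
      using Lip[OF zz(1,3,4) vel1] by (simp add: lor_def lor0_def off_def)
    also have "\<dots> \<le> \<epsilon> * R" using \<epsilon> zz z by (intro mult_mono) auto
    finally have l: "(fst z)\<^sup>2 * norm (lor z - lor0 z) \<le> \<epsilon> * R" .
    have "c0 n z - d0 n z = log_weight n (fst z) * (fst z)\<^sup>2 * (velocity_deriv \<mu> (mom z) (lor z - lor0 z) \<bullet> N z)"
      by (simp add: c0_def d0_def linear_diff[OF linear_velocity_deriv] inner_diff_left algebra_simps)
    then show "\<bar>c0 n z - d0 n z\<bar> \<le> (A0 * (\<epsilon> * R)) * log_window n (fst z)"
      using wt[OF n1(1)[OF n] l] by simp
  qed
  define G where "G = (LINT w|lborel. \<bar>g w\<bar>)"
  have G: "G \<ge> 0" unfolding G_def by (rule integral_nonneg_AE) simp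
  have lw: "A * window n K (t, x, v) \<le> A * log_window n t" if "A \<ge> 0" for A n t x v
    by (intro mult_left_mono window_le that)
  define A4 where "A4 = 15 * R * \<Theta> + 2 * R * \<Theta>' * \<bar>e\<bar> * CF"
  have c0f: "norm (LINT z|lborel. c0 n z * f z) \<le> (A4 / \<bar>e\<bar>) * (1 / n) * (mean_distance n K + G)" if n: "n \<ge> n1" for n
  proof -
    note n0 = n1(1)[OF n]
    have p: "0 \<le> 15 * R * \<Theta> / n" "0 \<le> 2 * R * \<Theta>' * \<bar>e\<bar> * CF / n" "0 \<le> A0 * CF"
      using R \<Theta> \<Theta>' CF A0 by auto
    note i = integrable_weighted_density[OF n0 cm(1)[OF n0] order_trans[OF b1[OF n] lw[OF p(1)]]]
      integrable_weighted_density[OF n0 cm(2)[OF n0] order_trans[OF b2[OF n] lw[OF p(2)]]]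
      integrable_weighted_density[OF n0 cm(3)[OF n0] order_trans[OF b0[OF n] lw[OF p(3)]]]
    have "\<bar>e * (LINT z|lborel. c0 n z * f z)\<bar> \<le> \<bar>LINT z|lborel. c1 n z * f z\<bar> + \<bar>LINT z|lborel. c2 n z * f z\<bar>"
      unfolding ident[OF n0 i(3,1,2)] by (rule abs_triangle_ineq)
    also have "\<dots> \<le> (15 * R * \<Theta> / n) * (mean_distance n K + G) + (2 * R * \<Theta>' * \<bar>e\<bar> * CF / n) * (mean_distance n K + G)"
      unfolding G_def
      by (intro add_mono weighted_density_bound(2)[OF n0 cm(1)[OF n0] b1[OF n] p(1)]
          weighted_density_bound(2)[OF n0 cm(2)[OF n0] b2[OF n] p(2)])
    also have "\<dots> = A4 * (1 / n) * (mean_distance n K + G)"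
      by (simp add: A4_def add_divide_distrib distrib_right)
    finally have "\<bar>e\<bar> * \<bar>LINT z|lborel. c0 n z * f z\<bar> \<le> A4 * (1 / n) * (mean_distance n K + G)" by (simp only: abs_mult)
    then have "\<bar>LINT z|lborel. c0 n z * f z\<bar> \<le> (A4 * (1 / n) * (mean_distance n K + G)) / \<bar>e\<bar>"
      using e by (subst pos_le_divide_eq) (auto simp: mult.commute)
    then show ?thesis by (simp add: mult.commute)
  qed
  \<comment> \<open>By the identity the drift term is \<open>O(1/n)\<close>. Then the free solution replaces \<open>f\<close> by scattering, and \<open>d0\<close> replaces
    \<open>c0\<close> by the Lipschitz bound.\<close>
  have "(\<lambda>n. (A4 / \<bar>e\<bar>) * (1 / n) * (mean_distance n K + G)) \<longlonglongrightarrow> (A4 / \<bar>e\<bar>) * 0 * (0 + G)"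
    using K by (intro tendsto_mult tendsto_add tendsto_const mean_distance_tendsto lim_1_over_n) simp
  then have lim0: "(\<lambda>n. (A4 / \<bar>e\<bar>) * (1 / n) * (mean_distance n K + G)) \<longlonglongrightarrow> 0" by simp
  have "\<forall>\<^sub>F n in sequentially. norm (LINT z|lborel. c0 n z * f z) \<le> (A4 / \<bar>e\<bar>) * (1 / n) * (mean_distance n K + G)"
    unfolding eventually_sequentially using c0f by blast
  then have L1: "(\<lambda>n. LINT z|lborel. c0 n z * f z) \<longlonglongrightarrow> 0"
    by (rule Lim_null_comparison[OF _ lim0])
  have c0d: "norm ((LINT z|lborel. c0 n z * f z) - (LINT z|lborel. c0 n z * drifted z)) \<le> (A0 * CF) * mean_distance n K" if n: "n \<ge> n1" for n
    using replace_by_drifted[OF n1(1)[OF n] cm(3)[OF n1(1)[OF n]] b0[OF n]] A0 CF by simp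
  have "\<forall>\<^sub>F n in sequentially. norm ((LINT z|lborel. c0 n z * f z) - (LINT z|lborel. c0 n z * drifted z)) \<le> (A0 * CF) * mean_distance n K"
    unfolding eventually_sequentially using c0d by blast
  then have L2: "(\<lambda>n. (LINT z|lborel. c0 n z * f z) - (LINT z|lborel. c0 n z * drifted z)) \<longlonglongrightarrow> 0"
    using K by (intro Lim_null_comparison[OF _ tendsto_mult_right_zero[OF mean_distance_tendsto[of K], of "A0 * CF"]]) simp_all
  have L3: "(\<lambda>n. (LINT z|lborel. c0 n z * drifted z) - (LINT z|lborel. d0 n z * drifted z)) \<longlonglongrightarrow> 0"
  proof (rule LIMSEQ_I)
    fix r :: real assume r: "r > 0"
    define \<epsilon> where "\<epsilon> = r / (2 * (A0 * R * G + 1))"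
    have pos: "A0 * R * G \<ge> 0" using A0 R G by simp
    have \<epsilon>: "\<epsilon> > 0" using r pos by (simp add: \<epsilon>_def)
    have "\<forall>\<^sub>F t in at_top. \<tau> t < \<epsilon>" using \<tau> \<epsilon> by (rule order_tendstoD)
    then obtain T where T: "\<And>t. t \<ge> T \<Longrightarrow> \<tau> t < \<epsilon>" by (auto simp: eventually_at_top_linorder)
    obtain n2 :: nat where n2: "real n2 \<ge> T" using real_arch_simple by blast
    show "\<exists>no. \<forall>n\<ge>no. norm ((LINT z|lborel. c0 n z * drifted z) - (LINT z|lborel. d0 n z * drifted z) - 0) < r"
    proof (intro exI allI impI)
      fix n assume "max n1 n2 \<le> n"
      then have n: "n \<ge> n1" "real n \<ge> T" using n2 by auto
      note n0 = n1(1)[OF n(1)]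
      have p: "0 \<le> A0 * CF" using CF A0 by auto
      have bb: "\<bar>c0 n z - d0 n z\<bar> \<le> (A0 * (\<epsilon> * R)) * window n K z" for z
        by (rule bdiff[OF n(1)]) (use \<epsilon> T n(2) in \<open>auto intro!: less_imp_le\<close>)
      have "(LINT z|lborel. c0 n z * drifted z) - (LINT z|lborel. d0 n z * drifted z) = (LINT z|lborel. (c0 n z - d0 n z) * drifted z)"
        using weighted_drifted(2)[OF n0 cm(3)[OF n0] order_trans[OF b0[OF n(1)] lw[OF p]]]
          weighted_drifted(2)[OF n0 cm(4)[OF n0] order_trans[OF bd0[OF n(1)] lw[OF p]]]
        by (simp add: left_diff_distrib)
      also have "norm \<dots> \<le> (A0 * (\<epsilon> * R)) * G"
        unfolding G_def real_norm_def
        by (rule weighted_density_bound(1)[OF n0 _ bb]) (use cm[OF n0] A0 R \<epsilon> in auto)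
      also have "\<dots> = \<epsilon> * (A0 * R * G)" by simp
      also have "\<dots> < r"
      proof -
        have "\<epsilon> * (A0 * R * G) \<le> \<epsilon> * (A0 * R * G + 1)" using \<epsilon> by (intro mult_left_mono) auto
        also have "\<dots> = r / 2" using pos by (simp add: \<epsilon>_def field_simps)
        finally show ?thesis using r by simp
      qed
      finally show "norm ((LINT z|lborel. c0 n z * drifted z) - (LINT z|lborel. d0 n z * drifted z) - 0) < r" by simp
    qed
  qed
  have L4: "(\<lambda>n. LINT z|lborel. d0 n z * drifted z) \<longlonglongrightarrow> 0"
  proof -
    have "(\<lambda>n. (LINT z|lborel. c0 n z * f z) - ((LINT z|lborel. c0 n z * f z) - (LINT z|lborel. c0 n z * drifted z))
        - ((LINT z|lborel. c0 n z * drifted z) - (LINT z|lborel. d0 n z * drifted z))) \<longlonglongrightarrow> 0 - 0 - 0"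
      by (intro tendsto_diff L1 L2 L3)
    then show ?thesis by simp
  qed
  have final: "(LINT z|lborel. d0 n z * drifted z)
      = (LINT w|lborel. g w * (mean_force n (snd w) \<bullet> moment_grad R \<theta> (fst w) (snd w)))" if n: "n \<ge> n1" for n
  proof -
    note n0 = n1(1)[OF n]
    have p: "0 \<le> A0 * CF" using CF A0 by auto
    note wd = weighted_drifted[OF n0 cm(4)[OF n0] order_trans[OF bd0[OF n] lw[OF p]]]
    \<comment> \<open>Along the free flow \<open>off\<close> and the momentum are constant, and only the field is averaged in time.\<close>
    have eqw: "(LINT t|lborel. d0 n (free_flow \<mu> (t, w)) * g w) = g w * (mean_force n (snd w) \<bullet> moment_grad R \<theta> (fst w) (snd w))" for w
    proof -
      define M where "M = moment_grad R \<theta> (fst w) (snd w)"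
      define v where "v = snd w"
      have bl: "bounded_linear (\<lambda>x. velocity_deriv \<mu> v x \<bullet> M)"
        by (intro linear_conv_bounded_linear[THEN iffD1] linearI)
           (simp_all add: linear_add[OF linear_velocity_deriv] linear_scale[OF linear_velocity_deriv] inner_add_left)
      have "d0 n (free_flow \<mu> (t, w)) = velocity_deriv \<mu> v ((log_weight n t * t\<^sup>2) *\<^sub>R lorentz t (t *\<^sub>R velocity \<mu> v) (velocity \<mu> v)) \<bullet> M" for t
        by (simp add: d0_def free_flow_def case_prod_beta mom_def vel_def lor0_def N_def off_def M_def v_def lv)
      then have "(LINT t|lborel. d0 n (free_flow \<mu> (t, w)) * g w)
         = (LINT t|lborel. velocity_deriv \<mu> v ((log_weight n t * t\<^sup>2) *\<^sub>R lorentz t (t *\<^sub>R velocity \<mu> v) (velocity \<mu> v)) \<bullet> M) * g w"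
        by simp
      also have "(LINT t|lborel. velocity_deriv \<mu> v ((log_weight n t * t\<^sup>2) *\<^sub>R lorentz t (t *\<^sub>R velocity \<mu> v) (velocity \<mu> v)) \<bullet> M)
         = velocity_deriv \<mu> v (avg_lorentz n (velocity \<mu> v)) \<bullet> M"
        unfolding avg_lorentz_def by (rule integral_bounded_linear[OF bl integrable_avg_lorentz[OF n0]])
      finally show ?thesis by (simp add: mean_force_def v_def M_def)
    qed
    have "(LINT z|lborel. d0 n z * drifted z) = (LINT w|lborel. LINT t|lborel. d0 n (free_flow \<mu> (t, w)) * g w)"
      unfolding wd(3) using integral_lborel_snd[OF wd(1)] by (simp only: snd_conv)
    then show ?thesis by (simp only: eqw)
  qed
  show ?thesis
  proof (rule Lim_transform_eventually[OF L4])
    show "\<forall>\<^sub>F n in sequentially. (LINT z|lborel. d0 n z * drifted z)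
        = (LINT w|lborel. g w * (mean_force n (snd w) \<bullet> moment_grad R \<theta> (fst w) (snd w)))"
      unfolding eventually_sequentially using final by blast
  qed
qed

text \<open>
  As \<open>R\<close> grows, \<open>moment_grad\<close> tends boundedly to \<open>\<theta>\<close>, uniformly in \<open>n\<close> after integration against \<open>g\<close>, and the
  momentum marginal of \<open>g\<close> is \<open>q\<close>.
\<close>
lemma mean_force_vanishes_C1:
  "(\<lambda>n. LINT v|lborel. (mean_force n v \<bullet> \<theta> v) * q v) \<longlonglongrightarrow> 0"
proof -
  obtain M where M: "M \<ge> 0" "\<And>n v. n > 0 \<Longrightarrow> norm v \<le> K \<Longrightarrow> norm (mean_force n v) \<le> M"
    using mean_force_bound by blast
  obtain \<Theta> where \<Theta>: "\<Theta> \<ge> 0" "\<And>v. norm (\<theta> v) \<le> \<Theta>" using \<theta>_bound by blast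
  have mp: "\<theta> \<in> borel_measurable borel" by (intro borel_measurable_continuous_onI continuous_\<theta>)
  have msnd: "(\<lambda>w :: R3 \<times> R3. h (snd w)) \<in> borel_measurable borel" if "h \<in> borel_measurable borel" for h :: "R3 \<Rightarrow> R3"
    using that unfolding borel_prod[symmetric] by measurable
  have cmg: "continuous_on UNIV (\<lambda>w. moment_grad R \<theta> (fst w) (snd w))" for R
    unfolding moment_grad_def
    by (intro continuous_intros continuous_on_compose2[OF continuous_\<theta>[of UNIV]]) auto
  have mmg: "(\<lambda>w. moment_grad R \<theta> (fst w) (snd w)) \<in> borel_measurable borel" for R
    by (intro borel_measurable_continuous_onI cmg)
  define a where "a n = (LINT w|lborel. g w * (mean_force n (snd w) \<bullet> \<theta> (snd w)))" for n
  define b where "b n R = (LINT w|lborel. g w * (mean_force n (snd w) \<bullet> moment_grad R \<theta> (fst w) (snd w)))" for n R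
  define \<rho> where "\<rho> R = (LINT w|lborel. \<bar>g w\<bar> * norm (\<theta> (snd w) - moment_grad R \<theta> (fst w) (snd w)))" for R
  have md: "(\<lambda>w. norm (\<theta> (snd w) - moment_grad R \<theta> (fst w) (snd w))) \<in> borel_measurable borel" for R
    using msnd[OF mp] mmg by measurable
  have bd: "norm (\<theta> v - moment_grad R \<theta> y v) \<le> 6 * \<Theta>" if "R > 0" for R y v
    using norm_triangle_ineq4[of "\<theta> v" "moment_grad R \<theta> y v"] norm_moment_grad[OF that, of \<theta> y v] \<Theta>(2)[of v] by linarith
  have i\<rho>: "integrable lborel (\<lambda>w. \<bar>g w\<bar> * norm (\<theta> (snd w) - moment_grad R \<theta> (fst w) (snd w)))" if R: "R > 0" for R
  proof -
    have "integrable lborel (\<lambda>w. \<bar>g w * norm (\<theta> (snd w) - moment_grad R \<theta> (fst w) (snd w))\<bar>)"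
      by (intro integrable_abs integrable_g_mult[OF md, of _ "6 * \<Theta>"]) (use bd[OF R] in auto)
    then show ?thesis by (simp add: abs_mult)
  qed
  have zero: "\<theta> (snd w) = 0" "moment_grad R \<theta> (fst w) (snd w) = 0" if "norm (snd w) > K" "R > 0" for w R
    using that \<theta>0(1) moment_grad_eq_0 by auto
  have ab: "\<bar>a n - b n R\<bar> \<le> M * \<rho> R" if n: "n > 0" and R: "R > 0" for n R
  proof -
    have ia: "integrable lborel (\<lambda>w. g w * (mean_force n (snd w) \<bullet> \<theta> (snd w)))"
    proof (rule integrable_g_mult)
      show "(\<lambda>w :: R3 \<times> R3. mean_force n (snd w) \<bullet> \<theta> (snd w)) \<in> borel_measurable borel"
        by (intro borel_measurable_inner msnd[OF measurable_mean_force[OF n]] msnd[OF mp])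
      show "\<bar>mean_force n (snd w) \<bullet> \<theta> (snd w)\<bar> \<le> M * \<Theta>" for w :: "R3 \<times> R3"
        using M n \<Theta> zero[of w 1]
        by (cases "norm (snd w) \<le> K") (auto intro!: order_trans[OF Cauchy_Schwarz_ineq2] mult_mono)
    qed
    have ib: "integrable lborel (\<lambda>w. g w * (mean_force n (snd w) \<bullet> moment_grad R \<theta> (fst w) (snd w)))"
    proof (rule integrable_g_mult)
      show "(\<lambda>w. mean_force n (snd w) \<bullet> moment_grad R \<theta> (fst w) (snd w)) \<in> borel_measurable borel"
        by (intro borel_measurable_inner msnd[OF measurable_mean_force[OF n]] mmg)
      show "\<bar>mean_force n (snd w) \<bullet> moment_grad R \<theta> (fst w) (snd w)\<bar> \<le> M * (5 * \<Theta>)" for w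
      proof (cases "norm (snd w) \<le> K")
        case True
        have "norm (moment_grad R \<theta> (fst w) (snd w)) \<le> 5 * \<Theta>"
          using norm_moment_grad[OF R, of \<theta> "fst w" "snd w"] \<Theta>(2)[of "snd w"] by linarith
        then show ?thesis using M n True by (intro order_trans[OF Cauchy_Schwarz_ineq2] mult_mono) auto
      next
        case False
        then show ?thesis using zero[of w R] R M \<Theta> by simp
      qed
    qed
    have "a n - b n R = (LINT w|lborel. g w * (mean_force n (snd w) \<bullet> (\<theta> (snd w) - moment_grad R \<theta> (fst w) (snd w))))"
      unfolding a_def b_def using Bochner_Integration.integral_diff[OF ia ib]
      by (simp add: inner_diff_right right_diff_distrib)
    also have "\<bar>\<dots>\<bar> \<le> (LINT w|lborel. M * (\<bar>g w\<bar> * norm (\<theta> (snd w) - moment_grad R \<theta> (fst w) (snd w))))"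
    proof (intro order_trans[OF integral_abs_bound] integral_mono)
      have "integrable lborel (\<lambda>w. g w * (mean_force n (snd w) \<bullet> \<theta> (snd w)) - g w * (mean_force n (snd w) \<bullet> moment_grad R \<theta> (fst w) (snd w)))"
        using ia ib by (rule Bochner_Integration.integrable_diff)
      then show "integrable lborel (\<lambda>w. \<bar>g w * (mean_force n (snd w) \<bullet> (\<theta> (snd w) - moment_grad R \<theta> (fst w) (snd w)))\<bar>)"
        by (intro integrable_abs) (simp add: inner_diff_right right_diff_distrib)
      show "integrable lborel (\<lambda>w. M * (\<bar>g w\<bar> * norm (\<theta> (snd w) - moment_grad R \<theta> (fst w) (snd w))))"
        using i\<rho>[OF R] by simp
      show "\<bar>g w * (mean_force n (snd w) \<bullet> (\<theta> (snd w) - moment_grad R \<theta> (fst w) (snd w)))\<bar>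
         \<le> M * (\<bar>g w\<bar> * norm (\<theta> (snd w) - moment_grad R \<theta> (fst w) (snd w)))" for w
      proof (cases "norm (snd w) \<le> K")
        case True
        have "\<bar>mean_force n (snd w) \<bullet> (\<theta> (snd w) - moment_grad R \<theta> (fst w) (snd w))\<bar> \<le> M * norm (\<theta> (snd w) - moment_grad R \<theta> (fst w) (snd w))"
          using M n True by (intro order_trans[OF Cauchy_Schwarz_ineq2] mult_right_mono) auto
        from mult_left_mono[OF this, of "\<bar>g w\<bar>"] show ?thesis by (simp add: abs_mult ac_simps)
      next
        case False
        then show ?thesis using zero[of w R] R by simp
      qed
    qed
    finally show ?thesis by (simp add: \<rho>_def)
  qed
  have \<rho>0: "(\<lambda>j. \<rho> (real (Suc j))) \<longlonglongrightarrow> 0"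
  proof -
    have "(\<lambda>j. LINT w|lborel. \<bar>g w\<bar> * norm (\<theta> (snd w) - moment_grad (real (Suc j)) \<theta> (fst w) (snd w)))
        \<longlonglongrightarrow> (LINT w|(lborel :: (R3 \<times> R3) measure). (0::real))"
    proof (rule integral_dominated_convergence[where w = "\<lambda>w. \<bar>g w\<bar> * (6 * \<Theta>)"])
      show "integrable lborel (\<lambda>w. \<bar>g w\<bar> * (6 * \<Theta>))" using gint by simp
      show "(\<lambda>w. \<bar>g w\<bar> * norm (\<theta> (snd w) - moment_grad (real (Suc j)) \<theta> (fst w) (snd w))) \<in> borel_measurable lborel" for j
        by (rule borel_measurable_integrable[OF i\<rho>]) simp
      have "norm (\<bar>g w\<bar> * norm (\<theta> (snd w) - moment_grad (real (Suc j)) \<theta> (fst w) (snd w))) \<le> \<bar>g w\<bar> * (6 * \<Theta>)" for w j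
        using mult_left_mono[OF bd[of "real (Suc j)" "snd w" "fst w"], of "\<bar>g w\<bar>"] by (simp add: abs_mult)
      then show "AE w in lborel. norm (\<bar>g w\<bar> * norm (\<theta> (snd w) - moment_grad (real (Suc j)) \<theta> (fst w) (snd w))) \<le> \<bar>g w\<bar> * (6 * \<Theta>)" for j
        by simp
      have "(\<lambda>j. \<bar>g w\<bar> * norm (\<theta> (snd w) - moment_grad (real (Suc j)) \<theta> (fst w) (snd w))) \<longlonglongrightarrow> 0" for w
      proof -
        define y where "y = fst w"
        define v where "v = snd w"
        have s0: "(\<lambda>j. c / (real (Suc j))\<^sup>2) \<longlonglongrightarrow> 0" for c :: real by real_asymp
        have m: "(\<lambda>j. max 0 (1 - (y \<bullet> y) / (real (Suc j))\<^sup>2)) \<longlonglongrightarrow> max 0 (1 - 0)"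
          by (intro tendsto_max tendsto_intros s0)
        have p: "(\<lambda>j. plateau (real (Suc j)) y) \<longlonglongrightarrow> (max 0 (1 - 0))\<^sup>2"
          unfolding plateau_def by (intro tendsto_intros m)
        have pg: "(\<lambda>j. plateau_grad (real (Suc j)) y) \<longlonglongrightarrow> (0 * max 0 (1 - 0)) *\<^sub>R y"
          unfolding plateau_grad_def by (intro tendsto_intros m s0)
        have "(\<lambda>j. \<bar>g w\<bar> * norm (\<theta> v - (plateau (real (Suc j)) y *\<^sub>R \<theta> v + (y \<bullet> \<theta> v) *\<^sub>R plateau_grad (real (Suc j)) y)))
          \<longlonglongrightarrow> \<bar>g w\<bar> * norm (\<theta> v - ((max 0 (1 - 0))\<^sup>2 *\<^sub>R \<theta> v + (y \<bullet> \<theta> v) *\<^sub>R ((0 * max 0 (1 - 0)) *\<^sub>R y)))"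
          by (intro tendsto_intros p pg)
        then show ?thesis by (simp add: moment_grad_def y_def v_def)
      qed
      then show "AE w in lborel. (\<lambda>j. \<bar>g w\<bar> * norm (\<theta> (snd w) - moment_grad (real (Suc j)) \<theta> (fst w) (snd w))) \<longlonglongrightarrow> 0" by simp
    qed simp
    then show ?thesis by (simp add: \<rho>_def)
  qed
  have a0: "a \<longlonglongrightarrow> 0"
  proof (rule LIMSEQ_I)
    fix r :: real assume r: "r > 0"
    have "(\<lambda>j. M * \<rho> (real (Suc j))) \<longlonglongrightarrow> 0" by (rule tendsto_mult_right_zero[OF \<rho>0])
    then have "\<forall>\<^sub>F j in sequentially. M * \<rho> (real (Suc j)) < r / 2" using r by (intro order_tendstoD(2)) auto
    then obtain j where j: "M * \<rho> (real (Suc j)) < r / 2" by (auto simp: eventually_sequentially)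
    have "(\<lambda>n. b n (real (Suc j))) \<longlonglongrightarrow> 0"
      unfolding b_def by (rule mean_force_test_function) simp
    from LIMSEQ_D[OF this, of "r / 2"] r
    obtain n0 where n0: "\<And>n. n \<ge> n0 \<Longrightarrow> \<bar>b n (real (Suc j))\<bar> < r / 2" by auto
    show "\<exists>no. \<forall>n\<ge>no. norm (a n - 0) < r"
    proof (intro exI allI impI)
      fix n assume "max 1 n0 \<le> n"
      then have "n > 0" "n \<ge> n0" by auto
      then have "\<bar>a n - b n (real (Suc j))\<bar> < r / 2" "\<bar>b n (real (Suc j))\<bar> < r / 2"
        using ab[of n "real (Suc j)"] j n0[of n] by auto
      then show "norm (a n - 0) < r" unfolding real_norm_def by linarith
    qed
  qed
  have eq: "a n = (LINT v|lborel. (mean_force n v \<bullet> \<theta> v) * q v)" if n: "n > 0" for n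
  proof -
    have "(LINT w|lborel. (mean_force n (snd w) \<bullet> \<theta> (snd w)) * g w) = (LINT v|lborel. (mean_force n v \<bullet> \<theta> v) * q v)"
    proof (rule charge_of_limit[where A = "M * \<Theta>" and K = K])
      show "(\<lambda>v. mean_force n v \<bullet> \<theta> v) \<in> borel_measurable borel"
        using measurable_mean_force[OF n] mp by measurable
      show "\<bar>mean_force n v \<bullet> \<theta> v\<bar> \<le> M * \<Theta>" for v
        using M n \<Theta> \<theta>0(1)[of v]
        by (cases "norm v \<le> K") (auto intro!: order_trans[OF Cauchy_Schwarz_ineq2] mult_mono)
      show "mean_force n v \<bullet> \<theta> v = 0" if "norm v > K" for v using \<theta>0(1)[OF that] by simp
    qed (use K in simp)
    then show ?thesis by (simp add: a_def mult.commute)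
  qed
  show ?thesis
    by (rule Lim_transform_eventually[OF a0]) (use eq in \<open>auto simp: eventually_sequentially intro!: exI[of _ 1]\<close>)
qed

end

text \<open>
  Density of polynomials: the mean forces are bounded on compact sets uniformly in \<open>n\<close>, so uniform approximation of
  \<open>\<theta>\<close> suffices.
\<close>
lemma mean_force_vanishes:
  assumes K: "K > 0" and c\<theta>: "continuous_on UNIV \<theta>" and \<theta>0: "\<And>v. norm v > K \<Longrightarrow> \<theta> v = 0"
  shows "(\<lambda>n. LINT v|lborel. (mean_force n v \<bullet> \<theta> v) * q v) \<longlonglongrightarrow> 0"
proof (rule LIMSEQ_I)
  fix r :: real assume r: "r > 0"
  define K2 where "K2 = 2 * K"
  have K2: "K2 > 0" "K \<le> K2" using K by (auto simp: K2_def)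
  obtain M where M: "M \<ge> 0" "\<And>n v. n > 0 \<Longrightarrow> norm v \<le> K2 \<Longrightarrow> norm (mean_force n v) \<le> M"
    using mean_force_bound by blast
  define G where "G = (LINT v|lborel. \<bar>q v\<bar>)"
  have G: "G \<ge> 0" unfolding G_def by (rule integral_nonneg_AE) simp
  define \<epsilon> where "\<epsilon> = r / (2 * (M * G + 1))"
  have MG: "M * G \<ge> 0" using M G by simp
  have \<epsilon>: "\<epsilon> > 0" using r MG by (simp add: \<epsilon>_def)
  \<comment> \<open>A polynomial close to \<open>h\<close> yields a field close to \<open>\<theta>\<close> after multiplication with the plateau. On the support of \<open>\<theta>\<close>
    the plateau is at least \<open>9/16\<close>; the maximum keeps the quotient continuous elsewhere.\<close>
  define h where "h v = (1 / max (1/2) (plateau K2 v)) *\<^sub>R \<theta> v" for v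
  have ch: "continuous_on (cball 0 K2) h" unfolding h_def
    by (intro continuous_intros continuous_on_subset[OF c\<theta>]) auto
  obtain p where p: "polynomial_function p" "\<And>v. norm v \<le> K2 \<Longrightarrow> norm (h v - p v) < \<epsilon>"
    using Stone_Weierstrass_polynomial_function[OF compact_cball ch \<epsilon>] by auto
  obtain p' where dp: "\<And>v. (p has_derivative p' v) (at v)" and cp': "\<And>k. continuous_on UNIV (\<lambda>v. p' v k)"
    using polynomial_function_C1[OF p(1)] by blast
  define \<theta>2 where "\<theta>2 v = plateau K2 v *\<^sub>R p v" for v
  define \<theta>2' where "\<theta>2' v k = plateau K2 v *\<^sub>R p' v k + (plateau_grad K2 v \<bullet> k) *\<^sub>R p v" for v k
  have cp: "continuous_on UNIV p"
    by (intro continuous_at_imp_continuous_on ballI has_derivative_continuous[OF dp])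
  have d\<theta>2: "(\<theta>2 has_derivative \<theta>2' v) (at v)" for v
    unfolding \<theta>2_def[abs_def] \<theta>2'_def[abs_def]
    by (rule has_derivative_scaleR[OF plateau_has_derivative dp])
  have c\<theta>2': "continuous_on UNIV (\<lambda>v. \<theta>2' v k)" for k
    unfolding \<theta>2'_def by (intro continuous_intros cp cp')
  have \<theta>20: "\<theta>2 v = 0" "\<theta>2' v k = 0" if "norm v > K2" for v k
    using plateau_eq_0[OF K2(1) that] by (auto simp: \<theta>2_def \<theta>2'_def)
  have L: "(\<lambda>n. LINT v|lborel. (mean_force n v \<bullet> \<theta>2 v) * q v) \<longlonglongrightarrow> 0"
    by (rule mean_force_vanishes_C1[OF K2(1) d\<theta>2 c\<theta>2' \<theta>20])
  have close: "norm (\<theta> v - \<theta>2 v) \<le> \<epsilon>" for v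
  proof (cases "norm v \<le> K2")
    case True
    have "\<theta> v = plateau K2 v *\<^sub>R h v"
    proof (cases "norm v \<le> K")
      case True
      have "(norm v)\<^sup>2 \<le> K\<^sup>2" using True by (intro power_mono) auto
      then have "(v \<bullet> v) / K2\<^sup>2 \<le> 1 / 4" using K by (simp add: K2_def dot_square_norm power_mult_distrib divide_simps)
      then have "3 / 4 \<le> 1 - (v \<bullet> v) / K2\<^sup>2" by linarith
      then have "3 / 4 \<le> max 0 (1 - (v \<bullet> v) / K2\<^sup>2)" by (rule max.coboundedI2)
      then have "(3 / 4)\<^sup>2 \<le> plateau K2 v" unfolding plateau_def by (rule power_mono) simp
      then have "1 / 2 \<le> plateau K2 v" by (simp add: power2_eq_square)
      then show ?thesis by (simp add: h_def max_def)
    next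
      case False
      then show ?thesis using \<theta>0[of v] by (simp add: h_def)
    qed
    then have "\<theta> v - \<theta>2 v = plateau K2 v *\<^sub>R (h v - p v)" by (simp add: \<theta>2_def scaleR_diff_right)
    then have "norm (\<theta> v - \<theta>2 v) = plateau K2 v * norm (h v - p v)" using plateau_bounds(1)[of K2 v] by simp
    also have "\<dots> \<le> 1 * \<epsilon>" using p(2)[OF True] plateau_bounds by (intro mult_mono) auto
    finally show ?thesis by simp
  next
    case False
    then show ?thesis using \<theta>20(1)[of v] \<theta>0[of v] K2 \<epsilon> by simp
  qed
  have diff: "\<bar>(LINT v|lborel. (mean_force n v \<bullet> \<theta> v) * q v) - (LINT v|lborel. (mean_force n v \<bullet> \<theta>2 v) * q v)\<bar> \<le> \<epsilon> * (M * G)"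
    if n: "n > 0" for n
  proof -
    have i: "integrable lborel (\<lambda>v. (mean_force n v \<bullet> t v) * q v)"
      if ct: "continuous_on UNIV t" and t0: "\<And>v. norm v > K2 \<Longrightarrow> t v = 0" for t
    proof -
      have "bounded (t ` cball 0 K2)"
        by (intro compact_imp_bounded compact_continuous_image continuous_on_subset[OF ct] compact_cball) auto
      then obtain T where "\<forall>y\<in>t ` cball 0 K2. norm y \<le> T" unfolding bounded_iff by blast
      then have T: "norm (t v) \<le> \<bar>T\<bar>" for v
        using t0[of v] by (cases "norm v \<le> K2") (auto simp: order_trans[OF _ abs_ge_self])
      show ?thesis
      proof (rule integrable_q[of _ "M * \<bar>T\<bar>"])
        show "(\<lambda>v. mean_force n v \<bullet> t v) \<in> borel_measurable borel"
          using measurable_mean_force[OF n] borel_measurable_continuous_onI[OF ct] by measurable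
        show "\<bar>mean_force n v \<bullet> t v\<bar> \<le> M * \<bar>T\<bar>" for v
          using M n T t0[of v]
          by (cases "norm v \<le> K2") (auto intro!: order_trans[OF Cauchy_Schwarz_ineq2] mult_mono)
      qed
    qed
    have c2: "continuous_on UNIV \<theta>2" unfolding \<theta>2_def[abs_def] by (intro continuous_intros cp)
    have i1: "integrable lborel (\<lambda>v. (mean_force n v \<bullet> \<theta> v) * q v)" by (rule i[OF c\<theta>]) (use \<theta>0 K2 in auto)
    have i2: "integrable lborel (\<lambda>v. (mean_force n v \<bullet> \<theta>2 v) * q v)" by (rule i[OF c2 \<theta>20(1)])
    have "(LINT v|lborel. (mean_force n v \<bullet> \<theta> v) * q v) - (LINT v|lborel. (mean_force n v \<bullet> \<theta>2 v) * q v)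
        = (LINT v|lborel. (mean_force n v \<bullet> \<theta> v) * q v - (mean_force n v \<bullet> \<theta>2 v) * q v)"
      using i1 i2 by simp
    also have "\<bar>\<dots>\<bar> \<le> (LINT v|lborel. (\<epsilon> * M) * \<bar>q v\<bar>)"
    proof (intro order_trans[OF integral_abs_bound] integral_mono)
      show "integrable lborel (\<lambda>v. \<bar>(mean_force n v \<bullet> \<theta> v) * q v - (mean_force n v \<bullet> \<theta>2 v) * q v\<bar>)"
        by (intro integrable_abs Bochner_Integration.integrable_diff i1 i2)
      have "integrable lborel (\<lambda>v. \<bar>1 * q v\<bar>)" by (intro integrable_abs integrable_q[of _ 1]) auto
      then show "integrable lborel (\<lambda>v. (\<epsilon> * M) * \<bar>q v\<bar>)" by simp
      show "\<bar>(mean_force n v \<bullet> \<theta> v) * q v - (mean_force n v \<bullet> \<theta>2 v) * q v\<bar> \<le> (\<epsilon> * M) * \<bar>q v\<bar>" for v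
      proof (cases "norm v \<le> K2")
        case True
        have "\<bar>mean_force n v \<bullet> (\<theta> v - \<theta>2 v)\<bar> \<le> M * \<epsilon>"
          using M n True close \<epsilon> by (intro order_trans[OF Cauchy_Schwarz_ineq2] mult_mono) auto
        then have "\<bar>mean_force n v \<bullet> (\<theta> v - \<theta>2 v)\<bar> \<le> \<epsilon> * M" by (simp only: mult.commute)
        from mult_right_mono[OF this, of "\<bar>q v\<bar>"]
        have "\<bar>(mean_force n v \<bullet> (\<theta> v - \<theta>2 v)) * q v\<bar> \<le> (\<epsilon> * M) * \<bar>q v\<bar>" by (simp only: abs_mult abs_ge_zero)
        then show ?thesis by (simp only: inner_diff_right left_diff_distrib)
      next
        case False
        then show ?thesis using \<theta>20(1)[of v] \<theta>0[of v] K2 \<epsilon> M by simp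
      qed
    qed
    finally show ?thesis by (simp add: G_def mult.assoc)
  qed
  from LIMSEQ_D[OF L, of "r / 2"] r
  obtain n0 where n0: "\<And>n. n \<ge> n0 \<Longrightarrow> \<bar>LINT v|lborel. (mean_force n v \<bullet> \<theta>2 v) * q v\<bar> < r / 2" by auto
  have \<epsilon>2: "\<epsilon> * (M * G) \<le> r / 2"
  proof -
    have "\<epsilon> * (M * G) \<le> \<epsilon> * (M * G + 1)" using \<epsilon> by (intro mult_left_mono) auto
    also have "\<dots> = r / 2" using MG by (simp add: \<epsilon>_def field_simps)
    finally show ?thesis .
  qed
  show "\<exists>no. \<forall>n\<ge>no. norm ((LINT v|lborel. (mean_force n v \<bullet> \<theta> v) * q v) - 0) < r"
  proof (intro exI allI impI)
    fix n assume "max 1 n0 \<le> n"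
    then have "n > 0" "n \<ge> n0" by auto
    from diff[OF this(1)] n0[OF this(2)] \<epsilon>2
    show "norm ((LINT v|lborel. (mean_force n v \<bullet> \<theta> v) * q v) - 0) < r" unfolding real_norm_def by linarith
  qed
qed

end

section \<open>An averaged Gauss law in similarity coordinates\<close>

locale maxwell_fields = decaying_fields +
  fixes \<rho> :: "real \<Rightarrow> R3 \<Rightarrow> real" and j :: "real \<Rightarrow> R3 \<Rightarrow> R3"
  assumes gauss: "\<And>t x. t > 0 \<Longrightarrow> (\<Sum>i\<in>Basis. E' (t, x) (0, i) \<bullet> i) = 4 * pi * \<rho> t x"
    and ampere: "\<And>t x. t > 0 \<Longrightarrow>
      E' (t, x) (1, 0) = (\<Sum>i\<in>Basis. cross3 i (B' (t, x) (0, i))) - (4 * pi) *\<^sub>R j t x"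
begin

text \<open>
  The contraction of the electromagnetic field tensor with the generator \<open>t \<partial>\<^sub>t + x \<bullet> \<nabla>\<close> of the dilations.
\<close>
definition contraction :: "real \<times> R3 \<Rightarrow> real \<times> R3" where
  "contraction z = (snd z \<bullet> E z, fst z *\<^sub>R E z + cross3 (snd z) (B z))"

text \<open>
  The divergence of the contraction is \<open>x \<bullet> (\<partial>\<^sub>t E - \<nabla> \<times> B) + t \<nabla> \<bullet> E\<close>, which the inhomogeneous Maxwell equations
  turn into charge and current.
\<close>
lemma weak_maxwell:
  fixes \<Phi> :: "real \<times> R3 \<Rightarrow> real"
  assumes S: "compact S" "S \<subseteq> {0<..} \<times> UNIV"
    and d\<Phi>: "\<And>z. z \<in> {0<..} \<times> UNIV \<Longrightarrow> (\<Phi> has_derivative \<Phi>' z) (at z)"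
    and c\<Phi>': "\<And>h. continuous_on ({0<..} \<times> UNIV) (\<lambda>z. \<Phi>' z h)"
    and \<Phi>0: "\<And>z. z \<notin> S \<Longrightarrow> \<Phi> z = 0" "\<And>z h. z \<notin> S \<Longrightarrow> \<Phi>' z h = 0"
  shows "integrable lborel (\<lambda>z. \<Phi>' z (contraction z) + \<Phi> z * (4 * pi * (fst z * \<rho> (fst z) (snd z) - snd z \<bullet> j (fst z) (snd z))))"
    and "(LINT z|lborel. \<Phi>' z (contraction z) + \<Phi> z * (4 * pi * (fst z * \<rho> (fst z) (snd z) - snd z \<bullet> j (fst z) (snd z)))) = 0"
proof -
  define U :: "(real \<times> R3) set" where "U = {0<..} \<times> UNIV"
  have U: "open U" unfolding U_def by (intro open_Times) auto
  define a' where "a' z h = (snd z \<bullet> E' z h + snd h \<bullet> E z,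
      (fst z *\<^sub>R E' z h + fst h *\<^sub>R E z) + (cross3 (snd z) (B' z h) + cross3 (snd h) (B z)))" for z h :: "real \<times> R3"
  have da: "(contraction has_derivative a' z) (at z)" if "z \<in> U" for z
  proof -
    have t: "fst z > 0" using that by (auto simp: U_def)
    have E1: "(E has_derivative E' z) (at z)" and B1: "(B has_derivative B' z) (at z)"
      using dE[OF t, of "snd z"] dB[OF t, of "snd z"] by auto
    have f: "(fst has_derivative fst) (at z)" and s: "(snd has_derivative snd) (at z)"
      by (auto intro!: derivative_eq_intros)
    show ?thesis unfolding contraction_def[abs_def] a'_def[abs_def]
      by (intro has_derivative_Pair has_derivative_inner has_derivative_add has_derivative_scaleR
          bounded_bilinear.FDERIV[OF bounded_bilinear_cross3] E1 B1 f s)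
  qed
  have div: "(\<Sum>b\<in>Basis. a' z b \<bullet> b) = 4 * pi * (fst z * \<rho> (fst z) (snd z) - snd z \<bullet> j (fst z) (snd z))"
    if "z \<in> U" for z
  proof -
    obtain t x where z: "z = (t, x)" by (cases z)
    have t: "t > 0" using that by (auto simp: U_def z)
    have tr: "cross3 x b \<bullet> i = - (x \<bullet> cross3 i b)" for b i :: R3
      by (simp add: cross3_simps)
    have ii: "cross3 i b \<bullet> i = 0" for b i :: R3 by (simp add: inner_commute dot_cross_self)
    have "(\<Sum>b\<in>Basis. a' z b \<bullet> b) = x \<bullet> E' (t, x) (1, 0)
      + (\<Sum>i\<in>Basis. t * (E' (t, x) (0, i) \<bullet> i) - x \<bullet> cross3 i (B' (t, x) (0, i)))"
      by (simp add: sum_Basis_prod a'_def z inner_add_left tr ii)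
    also have "\<dots> = x \<bullet> E' (t, x) (1, 0) + t * (\<Sum>i\<in>Basis. E' (t, x) (0, i) \<bullet> i)
        - x \<bullet> (\<Sum>i\<in>Basis. cross3 i (B' (t, x) (0, i)))"
      by (simp add: sum_subtractf sum_distrib_left inner_sum_right)
    finally show ?thesis
      by (simp add: gauss[OF t] ampere[OF t] z inner_diff_right algebra_simps)
  qed
  have cE: "continuous_on S' E" and cB: "continuous_on S' B" for S'
    using E_cont B_cont continuous_on_subset by blast+
  have ca': "continuous_on U (\<lambda>z. a' z b)" for b
    unfolding a'_def U_def
    by (intro continuous_intros bounded_bilinear.continuous_on[OF bounded_bilinear_cross3] cE' cB' cE cB)
  have SU: "S \<subseteq> U" using S by (simp add: U_def)
  have eq: "\<Phi>' z (contraction z) + \<Phi> z * (\<Sum>b\<in>Basis. a' z b \<bullet> b)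
     = \<Phi>' z (contraction z) + \<Phi> z * (4 * pi * (fst z * \<rho> (fst z) (snd z) - snd z \<bullet> j (fst z) (snd z)))" for z
    using div[of z] SU \<Phi>0(1)[of z] by (cases "z \<in> S") auto
  note I = integral_divergence_eq_0[OF U S(1) SU d\<Phi>[folded U_def] da c\<Phi>'[folded U_def] ca' \<Phi>0, unfolded eq]
  show "integrable lborel (\<lambda>z. \<Phi>' z (contraction z) + \<Phi> z * (4 * pi * (fst z * \<rho> (fst z) (snd z) - snd z \<bullet> j (fst z) (snd z))))"
    by (rule I(1))
  show "(LINT z|lborel. \<Phi>' z (contraction z) + \<Phi> z * (4 * pi * (fst z * \<rho> (fst z) (snd z) - snd z \<bullet> j (fst z) (snd z)))) = 0"
    by (rule I(2))
qed

text \<open>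
  The test function is \<open>log_weight n t / t * \<eta> (x/t)\<close>. At \<open>x = t u\<close> the contraction is \<open>t (u \<bullet> L, L)\<close>,
  so its derivative pairs \<open>L\<close> with \<open>\<eta>' u - (u \<bullet> \<eta>' u) u\<close>. The factor \<open>t\<^sup>-\<^sup>2\<close> in
  \<open>log_weight n t / t = time_cutoff n t / (n t\<^sup>2)\<close> contributes \<open>- 2 \<eta> u\<close> in the direction of \<open>u\<close>, and the
  derivative of the cutoff an error \<open>O(1/n)\<close>.
\<close>
lemma averaged_gauss_law:
  fixes \<eta> :: "R3 \<Rightarrow> real" and \<eta>' :: "R3 \<Rightarrow> R3"
  assumes \<delta>: "0 < \<delta>" "\<delta> < 1"
    and d\<eta>: "\<And>u. (\<eta> has_derivative (\<lambda>h. \<eta>' u \<bullet> h)) (at u)"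
    and c\<eta>': "continuous_on UNIV \<eta>'"
    and \<eta>0: "\<And>u. norm u > 1 - \<delta> \<Longrightarrow> \<eta> u = 0" "\<And>u. norm u > 1 - \<delta> \<Longrightarrow> \<eta>' u = 0"
  shows "(\<lambda>n. (LINT u|lborel. avg_lorentz n u \<bullet> (\<eta>' u - (u \<bullet> \<eta>' u) *\<^sub>R u - (2 * \<eta> u) *\<^sub>R u))
      + 4 * pi * (LINT t|lborel. LINT x|lborel. log_weight n t * \<eta> ((1 / t) *\<^sub>R x) *
          (\<rho> t x - ((1 / t) *\<^sub>R x) \<bullet> j t x))) \<longlonglongrightarrow> 0"
proof -
  obtain CF \<tau> where CF: "CF \<ge> 0"
    "\<And>t x u. t \<ge> 1 \<Longrightarrow> norm x \<le> (1 - \<delta>) * t \<Longrightarrow> norm u \<le> 1 \<Longrightarrow> t\<^sup>2 * norm (lorentz t x u) \<le> CF"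
    using lorentz_decay[OF \<delta>] by metis
  have c\<eta>: "continuous_on UNIV \<eta>"
    by (intro continuous_at_imp_continuous_on ballI has_derivative_continuous[OF d\<eta>])
  define V where "V u = \<eta>' u - (u \<bullet> \<eta>' u) *\<^sub>R u - (2 * \<eta> u) *\<^sub>R u" for u
  have cV: "continuous_on UNIV V" unfolding V_def[abs_def] by (intro continuous_intros c\<eta> c\<eta>')
  have V0: "V u = 0" if "norm u > 1 - \<delta>" for u using \<eta>0[OF that] by (simp add: V_def)
  define err where "err n = (LINT t|lborel. LINT u|lborel. (time_cutoff' n t / n) * (t\<^sup>2 * (u \<bullet> lorentz t (t *\<^sub>R u) u)) * \<eta> u)" for n
  define A where "A = (LINT u|lborel. \<bar>\<eta> u\<bar>)"
  have i\<eta>: "integrable lborel \<eta>"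
    by (rule integrable_continuous_compact_support[OF c\<eta> compact_cball[of 0 "1 - \<delta>"]]) (use \<eta>0 in auto)
  have A: "A \<ge> 0" unfolding A_def by (rule integral_nonneg_AE) simp
  have main: "(LINT u|lborel. avg_lorentz n u \<bullet> V u)
      + 4 * pi * (LINT t|lborel. LINT x|lborel. log_weight n t * \<eta> ((1 / t) *\<^sub>R x) *
          (\<rho> t x - ((1 / t) *\<^sub>R x) \<bullet> j t x)) = - err n"
    and err: "norm (err n) \<le> (15 * CF * A) * (1 / n)" if n: "n > 0" for n
  proof -
    define u where "u z = (1 / fst z) *\<^sub>R snd z" for z :: "real \<times> R3"
    define S where "S = log_interval n \<times> cball (0::R3) (exp (2 * real n))"
    have S: "compact S" "S \<subseteq> {0<..} \<times> UNIV"
    proof -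
      show "compact S" unfolding S_def by (intro compact_Times compact_Icc compact_cball)
      show "S \<subseteq> {0<..} \<times> UNIV" using less_le_trans[OF exp_gt_zero[of "real n"]] by (auto simp: S_def)
    qed
    have zS: "fst z \<notin> log_interval n \<or> norm (u z) > 1 - \<delta>" if "z \<notin> S" for z
    proof (rule ccontr)
      assume "\<not> ?thesis"
      then have z: "fst z \<in> log_interval n" "norm (u z) \<le> 1" using \<delta> by auto
      then have t: "fst z > 1" using exp_n_gt_1[OF n, of "fst z"] by simp
      have "norm (snd z) = fst z * norm (u z)" using t by (simp add: u_def)
      also have "\<dots> \<le> exp (2 * real n) * 1" using z t by (intro mult_mono) auto
      finally have "z \<in> S" using z by (cases z) (auto simp: S_def)
      then show False using that by simp
    qed
    define \<Phi> where "\<Phi> z = (log_weight n (fst z) / fst z) * \<eta> (u z)" for z :: "real \<times> R3"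
    \<comment> \<open>The derivative of \<open>log_weight n t / t\<close>.\<close>
    define w' where "w' t = time_cutoff' n t / (n * t\<^sup>2) - 2 * log_weight n t / t\<^sup>2" for t :: real
    define \<Phi>' where "\<Phi>' z h = (log_weight n (fst z) / fst z) * (\<eta>' (u z) \<bullet> ((1 / fst z) *\<^sub>R (snd h - fst h *\<^sub>R u z)))
        + w' (fst z) * fst h * \<eta> (u z)" for z h :: "real \<times> R3"
    have d\<Phi>: "(\<Phi> has_derivative \<Phi>' z) (at z)" if "z \<in> {0<..} \<times> UNIV" for z
    proof -
      have t: "fst z > 0" using that by auto
      have dlw: "((\<lambda>t. log_weight n t / t) has_real_derivative w' (fst z)) (at (fst z))"
      proof -
        have "((\<lambda>t::real. time_cutoff n t / (real n * t\<^sup>2)) has_real_derivative w' (fst z)) (at (fst z))"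
          unfolding w'_def log_weight_def using t n
          by (auto intro!: derivative_eq_intros time_cutoff_has_derivative[OF n] simp: field_simps power2_eq_square)
        moreover have "(\<lambda>t::real. time_cutoff n t / (real n * t\<^sup>2)) = (\<lambda>t. log_weight n t / t)"
          by (simp add: log_weight_def power2_eq_square fun_eq_iff)
        ultimately show ?thesis by simp
      qed
      have 1: "((\<lambda>z. log_weight n (fst z) / fst z) has_derivative (\<lambda>h. w' (fst z) * fst h)) (at z)"
        by (rule has_derivative_compose[of fst fst, OF _ dlw[unfolded has_field_derivative_def]])
           (auto intro!: derivative_eq_intros)
      have di: "((\<lambda>z :: real \<times> R3. 1 / fst z) has_derivative (\<lambda>h. - (fst h / (fst z)\<^sup>2))) (at z)"
        using t by (auto intro!: derivative_eq_intros simp: power2_eq_square)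
      have "(u has_derivative (\<lambda>h. (1 / fst z) *\<^sub>R snd h + (- (fst h / (fst z)\<^sup>2)) *\<^sub>R snd z)) (at z)"
        unfolding u_def[abs_def] by (intro has_derivative_scaleR di) (auto intro!: derivative_eq_intros)
      moreover have "(1 / fst z) *\<^sub>R snd h + (- (fst h / (fst z)\<^sup>2)) *\<^sub>R snd z = (1 / fst z) *\<^sub>R (snd h - fst h *\<^sub>R u z)" for h
        by (simp add: u_def algebra_simps power2_eq_square)
      ultimately have du: "(u has_derivative (\<lambda>h. (1 / fst z) *\<^sub>R (snd h - fst h *\<^sub>R u z))) (at z)" by simp
      have 2: "((\<lambda>z. \<eta> (u z)) has_derivative (\<lambda>h. \<eta>' (u z) \<bullet> ((1 / fst z) *\<^sub>R (snd h - fst h *\<^sub>R u z)))) (at z)"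
        by (rule has_derivative_compose[OF du d\<eta>])
      show ?thesis unfolding \<Phi>_def[abs_def] \<Phi>'_def[abs_def] by (rule has_derivative_mult[OF 1 2])
    qed
    have c\<Phi>': "continuous_on ({0<..} \<times> UNIV) (\<lambda>z. \<Phi>' z h)" for h
    proof -
      have cu: "continuous_on ({0<..} \<times> UNIV) u" unfolding u_def[abs_def] by (intro continuous_intros) auto
      have c1: "continuous_on ({0<..} \<times> UNIV) (\<lambda>z :: real \<times> R3. log_weight n (fst z))"
        "continuous_on ({0<..} \<times> UNIV) (\<lambda>z :: real \<times> R3. time_cutoff' n (fst z))"
        by (rule continuous_on_compose2[OF continuous_time_weights(3)[OF n]]
              continuous_on_compose2[OF continuous_time_weights(2)[OF n]];
            auto intro!: continuous_intros)+
      have c2: "continuous_on ({0<..} \<times> UNIV) (\<lambda>z. \<eta> (u z))" "continuous_on ({0<..} \<times> UNIV) (\<lambda>z. \<eta>' (u z))"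
        by (rule continuous_on_compose2[OF c\<eta> cu] continuous_on_compose2[OF c\<eta>' cu]; simp)+
      show ?thesis unfolding \<Phi>'_def w'_def
        by (intro continuous_intros cu c1 c2) (use n in auto)
    qed
    have \<Phi>0: "\<Phi> z = 0" "\<Phi>' z h = 0" if "z \<notin> S" for z h
    proof -
      have "\<Phi> z = 0 \<and> \<Phi>' z h = 0"
        using zS[OF that]
      proof
        assume t: "fst z \<notin> log_interval n"
        show ?thesis using time_cutoff_zero[OF n t] by (simp add: \<Phi>_def \<Phi>'_def w'_def)
      next
        assume "norm (u z) > 1 - \<delta>"
        then show ?thesis using \<eta>0 by (simp add: \<Phi>_def \<Phi>'_def)
      qed
      then show "\<Phi> z = 0" "\<Phi>' z h = 0" by auto
    qed
    note W = weak_maxwell[OF S d\<Phi> c\<Phi>' \<Phi>0]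
    \<comment> \<open>\<open>K1\<close> becomes the field term, \<open>K2\<close> the error from the time cutoff, and \<open>K3\<close> the charge term.\<close>
    define K1 where "K1 z = (log_weight n (fst z) / fst z) * (lorentz (fst z) (snd z) (u z) \<bullet> V (u z))" for z :: "real \<times> R3"
    define K2 where "K2 z = (time_cutoff' n (fst z) / n) * ((u z \<bullet> lorentz (fst z) (snd z) (u z)) / fst z) * \<eta> (u z)" for z :: "real \<times> R3"
    define K3 where "K3 z = log_weight n (fst z) * \<eta> (u z) * (\<rho> (fst z) (snd z) - u z \<bullet> j (fst z) (snd z))" for z :: "real \<times> R3"
    have split: "\<Phi>' z (contraction z) = K1 z + K2 z" for z
    proof (cases "fst z \<in> log_interval n")
      case False
      show ?thesis using time_cutoff_zero[OF n False] by (simp add: \<Phi>'_def w'_def K1_def K2_def)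
    next
      case True
      then have t: "fst z > 0" using exp_n_gt_1[OF n, of "fst z"] by simp
      define L where "L = lorentz (fst z) (snd z) (u z)"
      have x: "snd z = fst z *\<^sub>R u z" using t by (simp add: u_def)
      have L: "L = E z + cross3 (u z) (B z)" by (simp add: L_def lorentz_def)
      have uL: "u z \<bullet> E z = u z \<bullet> L" by (simp add: L inner_add_right dot_cross_self)
      have c1: "fst (contraction z) = fst z * (u z \<bullet> L)"
        by (simp add: contraction_def x uL[symmetric])
      have "cross3 (snd z) (B z) = fst z *\<^sub>R cross3 (u z) (B z)"
        by (subst x) (simp add: bounded_bilinear.scaleR_left[OF bounded_bilinear_cross3])
      then have c2: "snd (contraction z) = fst z *\<^sub>R L" by (simp add: contraction_def L scaleR_add_right)
      have "\<Phi>' z (contraction z) = (log_weight n (fst z) / fst z) * (\<eta>' (u z) \<bullet> (L - (u z \<bullet> L) *\<^sub>R u z))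
        + (time_cutoff' n (fst z) / n - 2 * log_weight n (fst z)) * ((u z \<bullet> L) / fst z) * \<eta> (u z)"
      proof -
        have "(1 / fst z) *\<^sub>R (fst z *\<^sub>R L - (fst z * (u z \<bullet> L)) *\<^sub>R u z) = L - (u z \<bullet> L) *\<^sub>R u z"
          using t by (simp add: scaleR_diff_right)
        moreover have "w' (fst z) * (fst z * (u z \<bullet> L)) = (time_cutoff' n (fst z) / n - 2 * log_weight n (fst z)) * ((u z \<bullet> L) / fst z)"
          using t n by (simp add: w'_def power2_eq_square field_simps)
        ultimately show ?thesis unfolding \<Phi>'_def c1 c2 by simp
      qed
      also have "\<dots> = K1 z + K2 z"
        unfolding K1_def K2_def V_def L_def[symmetric]
        using t by (simp add: inner_diff_right inner_diff_left inner_add_right inner_commute field_simps)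
      finally show ?thesis .
    qed
    have chg: "\<Phi> z * (4 * pi * (fst z * \<rho> (fst z) (snd z) - snd z \<bullet> j (fst z) (snd z))) = 4 * pi * K3 z" for z
    proof (cases "fst z \<in> log_interval n")
      case False
      show ?thesis using time_cutoff_zero[OF n False] by (simp add: \<Phi>_def K3_def)
    next
      case True
      then have t: "fst z > 0" using exp_n_gt_1[OF n, of "fst z"] by simp
      have x: "snd z = fst z *\<^sub>R u z" using t by (simp add: u_def)
      have "snd z \<bullet> j (fst z) (snd z) = fst z * (u z \<bullet> j (fst z) (snd z))"
        by (metis x inner_scaleR_left)
      then have "fst z * \<rho> (fst z) (snd z) - snd z \<bullet> j (fst z) (snd z) = fst z * (\<rho> (fst z) (snd z) - u z \<bullet> j (fst z) (snd z))"
        by (simp add: right_diff_distrib)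
      then show ?thesis using t by (simp add: \<Phi>_def K3_def)
    qed
    \<comment> \<open>The kernels in the coordinate \<open>u = x/t\<close>, including the Jacobian \<open>t ^ 3\<close>.\<close>
    define H1 where "H1 z = (log_weight n (fst z) * (fst z)\<^sup>2) * (lorentz (fst z) (fst z *\<^sub>R snd z) (snd z) \<bullet> V (snd z))" for z :: "real \<times> R3"
    define H2 where "H2 z = (time_cutoff' n (fst z) / n) * ((fst z)\<^sup>2 * (snd z \<bullet> lorentz (fst z) (fst z *\<^sub>R snd z) (snd z))) * \<eta> (snd z)" for z :: "real \<times> R3"
    have cl: "continuous_on UNIV (\<lambda>z :: real \<times> R3. log_weight n (fst z))"
        "continuous_on UNIV (\<lambda>z :: real \<times> R3. time_cutoff' n (fst z))"
      by (rule continuous_on_compose2[OF continuous_time_weights(3)[OF n]]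
            continuous_on_compose2[OF continuous_time_weights(2)[OF n]];
          auto intro!: continuous_intros)+
    have cs: "continuous_on UNIV (\<lambda>z :: real \<times> R3. V (snd z))" "continuous_on UNIV (\<lambda>z :: real \<times> R3. \<eta> (snd z))"
      by (rule continuous_on_compose2[OF cV] continuous_on_compose2[OF c\<eta>]; auto intro!: continuous_intros)+
    have cH: "continuous_on UNIV H1" "continuous_on UNIV H2"
      unfolding H1_def[abs_def] H2_def[abs_def]
      by (intro continuous_intros cl cs continuous_on_lorentz; use n in simp)+
    define S' where "S' = log_interval n \<times> cball (0::R3) (1 - \<delta>)"
    have S': "compact S'" unfolding S'_def by (intro compact_Times compact_Icc compact_cball)
    have H0: "H1 z = 0" "H2 z = 0" if "z \<notin> S'" for z
    proof -
      have "fst z \<notin> log_interval n \<or> norm (snd z) > 1 - \<delta>"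
        using that by (cases z) (auto simp: S'_def)
      then have "H1 z = 0 \<and> H2 z = 0"
      proof
        assume t: "fst z \<notin> log_interval n"
        show ?thesis using time_cutoff_zero[OF n t] by (simp add: H1_def H2_def)
      next
        assume "norm (snd z) > 1 - \<delta>"
        then show ?thesis using \<eta>0(1) V0 by (simp add: H1_def H2_def)
      qed
      then show "H1 z = 0" "H2 z = 0" by auto
    qed
    have iH: "integrable lborel H1" "integrable lborel H2"
      by (rule integrable_continuous_compact_support[OF cH(1) S'] integrable_continuous_compact_support[OF cH(2) S'];
          use H0 in blast)+
    have sc: "(LINT x|lborel. K1 (t, x)) = (LINT v|lborel. H1 (t, v))" "(LINT x|lborel. K2 (t, x)) = (LINT v|lborel. H2 (t, v))" for t
    proof -
      have "(LINT x|lborel. K1 (t, x)) = (LINT v|lborel. H1 (t, v)) \<and> (LINT x|lborel. K2 (t, x)) = (LINT v|lborel. H2 (t, v))"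
      proof (cases "t \<in> log_interval n")
        case False
        show ?thesis using time_cutoff_zero[OF n False] by (simp add: K1_def K2_def H1_def H2_def)
      next
        case True
        then have t: "t > 0" using exp_n_gt_1[OF n, of t] by simp
        have cu: "continuous_on UNIV (\<lambda>x::R3. (1 / t) *\<^sub>R x)" by (intro continuous_intros)
        have "continuous_on UNIV (\<lambda>x. V ((1 / t) *\<^sub>R x))" "continuous_on UNIV (\<lambda>x. \<eta> ((1 / t) *\<^sub>R x))"
          by (rule continuous_on_compose2[OF cV cu] continuous_on_compose2[OF c\<eta> cu]; simp)+
        then have m: "(\<lambda>x. K1 (t, x)) \<in> borel_measurable borel" "(\<lambda>x. K2 (t, x)) \<in> borel_measurable borel"
          unfolding K1_def K2_def u_def
          by (intro borel_measurable_continuous_onI continuous_intros continuous_on_lorentz; use n t in simp)+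
        have e: "t ^ 3 * K1 (t, t *\<^sub>R v) = H1 (t, v)" "t ^ 3 * K2 (t, t *\<^sub>R v) = H2 (t, v)" for v
          using t by (simp_all add: K1_def K2_def H1_def H2_def u_def power2_eq_square power3_eq_cube)
        show ?thesis
          unfolding lborel_integral_scale[OF m(1) t] lborel_integral_scale[OF m(2) t]
            integral_mult_right_zero[symmetric] e by simp
      qed
      then show "(LINT x|lborel. K1 (t, x)) = (LINT v|lborel. H1 (t, v))" "(LINT x|lborel. K2 (t, x)) = (LINT v|lborel. H2 (t, v))" by auto
    qed
    have iK: "integrable lborel K1" "integrable lborel K2"
    proof -
      have cu: "continuous_on ({0<..} \<times> UNIV) u" unfolding u_def[abs_def] by (intro continuous_intros) auto
      have cK: "continuous_on ({0<..} \<times> UNIV) K1" "continuous_on ({0<..} \<times> UNIV) K2"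
        unfolding K1_def[abs_def] K2_def[abs_def]
        by (intro continuous_intros cu continuous_on_lorentz continuous_on_subset[OF cl(1)] continuous_on_subset[OF cl(2)]
              continuous_on_compose2[OF cV cu] continuous_on_compose2[OF c\<eta> cu]; use n in force)+
      have K0: "K1 z = 0" "K2 z = 0" if "z \<notin> S" for z
      proof -
        have "K1 z = 0 \<and> K2 z = 0" using zS[OF that]
        proof
          assume t: "fst z \<notin> log_interval n"
          show ?thesis using time_cutoff_zero[OF n t] by (simp add: K1_def K2_def)
        next
          assume "norm (u z) > 1 - \<delta>"
          then show ?thesis using \<eta>0(1) V0 by (simp add: K1_def K2_def)
        qed
        then show "K1 z = 0" "K2 z = 0" by auto
      qed
      have "(\<lambda>z. indicator S z *\<^sub>R K1 z) = K1" "(\<lambda>z. indicator S z *\<^sub>R K2 z) = K2"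
        using K0 by (auto simp: indicator_def fun_eq_iff)
      then show "integrable lborel K1" "integrable lborel K2"
        using borel_integrable_compact[OF S(1) continuous_on_subset[OF cK(1) S(2)]]
          borel_integrable_compact[OF S(1) continuous_on_subset[OF cK(2) S(2)]] by simp_all
    qed
    have iK3: "integrable lborel K3"
    proof -
      have "integrable lborel (\<lambda>z. (K1 z + K2 z + 4 * pi * K3 z) - K1 z - K2 z)"
        using W(1) iK unfolding split chg by (intro Bochner_Integration.integrable_diff)
      then have "integrable lborel (\<lambda>z. (1 / (4 * pi)) * (4 * pi * K3 z))"
        by (intro integrable_mult_right) simp
      then show ?thesis by simp
    qed
    have sum0: "(LINT z|lborel. K1 z) + (LINT z|lborel. K2 z) + 4 * pi * (LINT z|lborel. K3 z) = 0"
      using W(2) iK iK3 unfolding split chg by simp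
    have I1: "(LINT z|lborel. K1 z) = (LINT v|lborel. avg_lorentz n v \<bullet> V v)"
    proof -
      have "(LINT z|lborel. K1 z) = (LINT t|lborel. LINT v|lborel. H1 (t, v))"
        by (simp add: integral_lborel_fst[OF iK(1)] sc)
      also have "\<dots> = (LINT v|lborel. LINT t|lborel. H1 (t, v))"
        using integral_lborel_fst[OF iH(1)] integral_lborel_snd[OF iH(1)] by simp
      also have "(\<lambda>v. LINT t|lborel. H1 (t, v)) = (\<lambda>v. avg_lorentz n v \<bullet> V v)"
        unfolding avg_lorentz_def
        by (simp add: H1_def inner_scaleR_left[symmetric] integrable_avg_lorentz[OF n] del: inner_scaleR_left)
      finally show ?thesis .
    qed
    have I2: "(LINT z|lborel. K2 z) = err n"
      by (simp add: integral_lborel_fst[OF iK(2)] sc) (simp add: H2_def err_def)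
    have I3: "(LINT z|lborel. K3 z) = (LINT t|lborel. LINT x|lborel. log_weight n t * \<eta> ((1 / t) *\<^sub>R x) *
          (\<rho> t x - ((1 / t) *\<^sub>R x) \<bullet> j t x))"
      by (simp add: integral_lborel_fst[OF iK3]) (simp add: K3_def u_def)
    show "(LINT u|lborel. avg_lorentz n u \<bullet> V u)
      + 4 * pi * (LINT t|lborel. LINT x|lborel. log_weight n t * \<eta> ((1 / t) *\<^sub>R x) *
          (\<rho> t x - ((1 / t) *\<^sub>R x) \<bullet> j t x)) = - err n"
      using sum0 unfolding I1 I2 I3 by linarith
    have il: "integrable lborel (\<lambda>z. log_window n (fst z) * \<bar>\<eta> (snd z)\<bar>)"
      by (rule integrable_lborel_mult[OF log_window_integral(1)[OF n] integrable_abs[OF i\<eta>]])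
    have "err n = (LINT z|lborel. H2 z)"
      by (simp add: integral_lborel_fst[OF iH(2)]) (simp add: H2_def err_def)
    also have "\<bar>\<dots>\<bar> \<le> (LINT z|lborel. (15 * CF / n) * (log_window n (fst z) * \<bar>\<eta> (snd z)\<bar>))"
    proof (intro order_trans[OF integral_abs_bound] integral_mono)
      show "integrable lborel (\<lambda>z. \<bar>H2 z\<bar>)" using iH by simp
      show "integrable lborel (\<lambda>z. (15 * CF / n) * (log_window n (fst z) * \<bar>\<eta> (snd z)\<bar>))" using il by simp
      show "\<bar>H2 z\<bar> \<le> (15 * CF / n) * (log_window n (fst z) * \<bar>\<eta> (snd z)\<bar>)" for z
      proof (cases "z \<in> S'")
        case False
        then show ?thesis using H0(2)[of z] CF log_window_nonneg[of n "fst z"] by simp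
      next
        case True
        obtain t v where z: "z = (t, v)" by (cases z)
        have tv: "t \<in> log_interval n" "norm v \<le> 1 - \<delta>" using True by (auto simp: S'_def z)
        have t: "t \<ge> 1" using exp_n_gt_1[OF n, of t] tv by simp
        have "norm (t *\<^sub>R v) \<le> (1 - \<delta>) * t" using t tv by (simp add: mult.commute)
        then have l: "t\<^sup>2 * norm (lorentz t (t *\<^sub>R v) v) \<le> CF" using tv \<delta> t by (intro CF) auto
        have "\<bar>v \<bullet> lorentz t (t *\<^sub>R v) v\<bar> \<le> 1 * norm (lorentz t (t *\<^sub>R v) v)"
          using tv \<delta> by (intro order_trans[OF Cauchy_Schwarz_ineq2] mult_right_mono) auto
        then have "t\<^sup>2 * \<bar>v \<bullet> lorentz t (t *\<^sub>R v) v\<bar> \<le> t\<^sup>2 * norm (lorentz t (t *\<^sub>R v) v)"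
          by (intro mult_left_mono) auto
        then have h: "t\<^sup>2 * \<bar>v \<bullet> lorentz t (t *\<^sub>R v) v\<bar> \<le> CF" using l by linarith
        have "\<bar>time_cutoff' n t\<bar> * (t\<^sup>2 * \<bar>v \<bullet> lorentz t (t *\<^sub>R v) v\<bar>) \<le> (15 * log_window n t) * CF"
          by (rule mult_mono[OF time_weights_le(3)[OF n] h]) (use log_window_nonneg[of n t] in auto)
        then have "(\<bar>time_cutoff' n t\<bar> * (t\<^sup>2 * \<bar>v \<bullet> lorentz t (t *\<^sub>R v) v\<bar>)) * (\<bar>\<eta> v\<bar> / n) \<le> ((15 * log_window n t) * CF) * (\<bar>\<eta> v\<bar> / n)"
          by (rule mult_right_mono) simp
        then show ?thesis by (simp add: H2_def z abs_mult ac_simps)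
      qed
    qed
    also have "\<dots> = (15 * CF / n) * A"
      using integral_lborel_fst[OF il] log_window_integral(2)[OF n] by (simp add: A_def)
    finally show "norm (err n) \<le> (15 * CF * A) * (1 / n)" by simp
  qed
  have l0: "(\<lambda>n. (15 * CF * A) * (1 / real n)) \<longlonglongrightarrow> 0"
    by (rule tendsto_mult_right_zero[OF lim_1_over_n])
  have "\<forall>n\<ge>1. norm (err n) \<le> (15 * CF * A) * (1 / real n)" using err by simp
  then have "\<forall>\<^sub>F n in sequentially. norm (err n) \<le> (15 * CF * A) * (1 / real n)"
    unfolding eventually_sequentially by blast
  then have "err \<longlonglongrightarrow> 0" by (rule Lim_null_comparison[OF _ l0])
  from tendsto_minus[OF this] have m0: "(\<lambda>n. - err n) \<longlonglongrightarrow> 0" by simp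
  have "\<forall>n\<ge>1. - err n = (LINT u|lborel. avg_lorentz n u \<bullet> V u)
      + 4 * pi * (LINT t|lborel. LINT x|lborel. log_weight n t * \<eta> ((1 / t) *\<^sub>R x) *
          (\<rho> t x - ((1 / t) *\<^sub>R x) \<bullet> j t x))"
    using main by simp
  then have "\<forall>\<^sub>F n in sequentially. - err n = (LINT u|lborel. avg_lorentz n u \<bullet> V u)
      + 4 * pi * (LINT t|lborel. LINT x|lborel. log_weight n t * \<eta> ((1 / t) *\<^sub>R x) *
          (\<rho> t x - ((1 / t) *\<^sub>R x) \<bullet> j t x))"
    unfolding eventually_sequentially by blast
  from Lim_transform_eventually[OF m0 this] show ?thesis unfolding V_def .
qed

end

section \<open>The asymptotic charge of scattering species\<close>

text \<open>
  Each species contributes two facts: its charge enters the averaged Gauss law, and on the set where its own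
  charge is nonzero the averaged Lorentz field tends to 0 weakly. A point where the total charge is nonzero has a
  neighbourhood in which one species has nonzero charge, and there both facts contradict each other.
\<close>
lemma asymptotic_charge_zero_if_scattering:
  fixes N :: nat and m e :: "nat \<Rightarrow> real" and Q q :: "nat \<Rightarrow> R3 \<Rightarrow> real"
    and E B :: "real \<times> R3 \<Rightarrow> R3" and E' B' :: "real \<times> R3 \<Rightarrow> real \<times> R3 \<Rightarrow> R3"
    and \<rho> :: "real \<Rightarrow> R3 \<Rightarrow> real" and j :: "real \<Rightarrow> R3 \<Rightarrow> R3"
    and f :: "nat \<Rightarrow> real \<times> R3 \<times> R3 \<Rightarrow> real"
  assumes fields: "maxwell_fields E B E' B' \<rho> j"
    and species: "\<And>\<alpha>. \<alpha> \<in> {1..N} \<Longrightarrow>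
      particles_in_fields (m \<alpha>) (e \<alpha>) k (C \<alpha>) E B (f \<alpha>) (f' \<alpha>) (g \<alpha>) (q \<alpha>) (K0 \<alpha>) (C1 \<alpha>) E' B'"
    and \<rho>: "\<And>t x. t > 0 \<Longrightarrow> \<rho> t x = (\<Sum>\<alpha>=1..N. e \<alpha> * (LINT v|lborel. f \<alpha> (t, x, v)))"
    and j: "\<And>t x. t > 0 \<Longrightarrow> j t x = (\<Sum>\<alpha>=1..N. e \<alpha> *\<^sub>R (LINT v|lborel. f \<alpha> (t, x, v) *\<^sub>R velocity (m \<alpha>) v))"
    and Q: "\<And>\<alpha>. \<alpha> \<in> {1..N} \<Longrightarrow> continuous_on UNIV (Q \<alpha>)"
    and q: "\<And>\<alpha> v. \<alpha> \<in> {1..N} \<Longrightarrow> q \<alpha> v = Q \<alpha> (v /\<^sub>R m \<alpha>)"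
  shows "(\<Sum>\<alpha>=1..N. e \<alpha> * m \<alpha> ^ 3 * Q \<alpha> w0) = 0"
proof (rule ccontr)
  interpret maxwell_fields E B E' B' \<rho> j by (rule fields)
  define Qt where "Qt w = (\<Sum>\<alpha>=1..N. e \<alpha> * m \<alpha> ^ 3 * Q \<alpha> w)" for w
  assume "\<not> ?thesis"
  then have Qt0: "Qt w0 \<noteq> 0" by (simp add: Qt_def)
  have "\<exists>\<alpha>\<in>{1..N}. Q \<alpha> w0 \<noteq> 0"
  proof (rule ccontr)
    assume "\<not> ?thesis"
    then have "Qt w0 = 0" unfolding Qt_def by (intro sum.neutral) auto
    then show False using Qt0 by simp
  qed
  then obtain a where a: "a \<in> {1..N}" "Q a w0 \<noteq> 0" by blast
  interpret pa: particles_in_fields "m a" "e a" k "C a" E B "f a" "f' a" "g a" "q a" "K0 a" "C1 a" E' B'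
    by (rule species[OF a(1)])
  note ma = pa.\<mu>
  have mpos: "m \<alpha> > 0" if "\<alpha> \<in> {1..N}" for \<alpha>
  proof -
    interpret p: particles_in_fields "m \<alpha>" "e \<alpha>" k "C \<alpha>" E B "f \<alpha>" "f' \<alpha>" "g \<alpha>" "q \<alpha>" "K0 \<alpha>" "C1 \<alpha>" E' B'
      by (rule species[OF that])
    show ?thesis by (rule p.\<mu>)
  qed
  have cQt: "continuous_on UNIV Qt" unfolding Qt_def[abs_def] by (intro continuous_intros Q) auto
  \<comment> \<open>The inverse of the velocity at mass 1. Momenta per mass are functions of the velocity alone, which allows the comparison of
    species of different masses.\<close>
  define \<Lambda> where "\<Lambda> u = (1 / sqrt (1 - u \<bullet> u)) *\<^sub>R u" for u :: R3
  define u0 where "u0 = velocity 1 w0"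
  have u0: "norm u0 < 1" unfolding u0_def by (rule norm_velocity_less_1) simp
  have \<Lambda>u0: "\<Lambda> u0 = w0" unfolding \<Lambda>_def u0_def by (rule velocity_inverse) simp
  have c\<Lambda>: "isCont \<Lambda> u0"
  proof -
    have "u0 \<bullet> u0 < 1" using u0 by (simp add: dot_square_norm abs_square_less_1)
    then show ?thesis unfolding \<Lambda>_def by (intro continuous_intros) auto
  qed
  have near: "\<forall>\<^sub>F u in nhds u0. Q a (\<Lambda> u) \<noteq> 0 \<and> Qt w0 * Qt (\<Lambda> u) > 0"
  proof (rule eventually_conj)
    have "isCont (Q a) (\<Lambda> u0)" using Q[OF a(1)] by (simp add: continuous_on_eq_continuous_at)
    then have "isCont (\<lambda>u. Q a (\<Lambda> u)) u0" by (rule isCont_o2[OF c\<Lambda>])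
    then have "((\<lambda>u. Q a (\<Lambda> u)) \<longlongrightarrow> Q a (\<Lambda> u0)) (nhds u0)"
      using tendsto_at_iff_tendsto_nhds[of "\<lambda>u. Q a (\<Lambda> u)" u0] by (simp add: isCont_def)
    then show "\<forall>\<^sub>F u in nhds u0. Q a (\<Lambda> u) \<noteq> 0" using a(2) unfolding \<Lambda>u0 by (rule tendsto_imp_eventually_ne)
    have "isCont Qt (\<Lambda> u0)" using cQt by (simp add: continuous_on_eq_continuous_at)
    then have "isCont (\<lambda>u. Qt w0 * Qt (\<Lambda> u)) u0" by (intro continuous_intros isCont_o2[OF c\<Lambda>])
    then have "((\<lambda>u. Qt w0 * Qt (\<Lambda> u)) \<longlongrightarrow> Qt w0 * Qt (\<Lambda> u0)) (nhds u0)"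
      using tendsto_at_iff_tendsto_nhds[of "\<lambda>u. Qt w0 * Qt (\<Lambda> u)" u0] by (simp add: isCont_def)
    then show "\<forall>\<^sub>F u in nhds u0. Qt w0 * Qt (\<Lambda> u) > 0"
      unfolding \<Lambda>u0 using Qt0 by (intro order_tendstoD(1)[of _ "Qt w0 * Qt w0"]) (auto simp: zero_less_mult_iff)
  qed
  then obtain d where d: "d > 0" "\<And>u. dist u u0 < d \<Longrightarrow> Q a (\<Lambda> u) \<noteq> 0 \<and> Qt w0 * Qt (\<Lambda> u) > 0"
    by (auto simp: eventually_nhds_metric)
  define r0 where "r0 = min (d / 2) ((1 - norm u0) / 2)"
  have r0: "r0 > 0" "r0 < d" "norm u0 + r0 < 1"
  proof -
    have "r0 \<le> d / 2" "r0 \<le> (1 - norm u0) / 2" unfolding r0_def by (rule min.cobounded1 min.cobounded2)+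
    moreover show "r0 > 0" using d(1) u0 by (simp add: r0_def)
    ultimately show "r0 < d" "norm u0 + r0 < 1" using d(1) u0 by (auto simp: field_simps)
  qed
  define \<delta> where "\<delta> = 1 - norm u0 - r0"
  have \<delta>: "0 < \<delta>" "\<delta> < 1" using r0 norm_ge_zero[of u0] unfolding \<delta>_def by linarith+
  define \<eta> where "\<eta> u = plateau r0 (u - u0)" for u
  define \<eta>' where "\<eta>' u = plateau_grad r0 (u - u0)" for u
  have far: "\<eta> u = 0" "\<eta>' u = 0" if "norm (u - u0) > r0" for u
    using plateau_eq_0[OF r0(1) that] by (auto simp: \<eta>_def \<eta>'_def)
  have farn: "norm (u - u0) > r0" if "norm u > 1 - \<delta>" for u
    using that norm_triangle_ineq2[of u u0] by (simp add: \<delta>_def)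
  have d\<eta>: "(\<eta> has_derivative (\<lambda>h. \<eta>' u \<bullet> h)) (at u)" for u
  proof -
    have "((\<lambda>u. u - u0) has_derivative (\<lambda>h. h)) (at u)" by (auto intro!: derivative_eq_intros)
    from has_derivative_compose[OF this plateau_has_derivative]
    show ?thesis unfolding \<eta>_def[abs_def] \<eta>'_def .
  qed
  have c\<eta>: "continuous_on UNIV \<eta>" and c\<eta>': "continuous_on UNIV \<eta>'"
    unfolding \<eta>_def[abs_def] \<eta>'_def[abs_def] by (intro continuous_intros)+
  have \<eta>b: "\<bar>\<eta> u\<bar> \<le> 1" and \<eta>nn: "\<eta> u \<ge> 0" for u using plateau_bounds by (auto simp: \<eta>_def)
  have \<eta>s: "norm u \<le> 1" if "\<eta> u \<noteq> 0" for u
    using that far(1)[of u] farn[of u] \<delta> by force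
  define V where "V u = \<eta>' u - (u \<bullet> \<eta>' u) *\<^sub>R u - (2 * \<eta> u) *\<^sub>R u" for u
  have cV: "continuous_on UNIV V" unfolding V_def[abs_def] by (intro continuous_intros c\<eta> c\<eta>')
  have V0: "V u = 0" if "norm (u - u0) > r0" for u using far[OF that] by (simp add: V_def)
  have gauss0: "(\<lambda>n. (LINT u|lborel. avg_lorentz n u \<bullet> V u)
      + 4 * pi * (LINT t|lborel. LINT x|lborel. log_weight n t * \<eta> ((1 / t) *\<^sub>R x) *
          (\<rho> t x - ((1 / t) *\<^sub>R x) \<bullet> j t x))) \<longlonglongrightarrow> 0"
    unfolding V_def by (rule averaged_gauss_law[OF \<delta> d\<eta> c\<eta>']) (use far farn in auto)
  \<comment> \<open>\<open>Y\<close> is the limit of the averaged charge, summed over the species.\<close>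
  define Y where "Y = (\<Sum>\<alpha>=1..N. e \<alpha> * (LINT v|lborel. ((1 - velocity (m \<alpha>) v \<bullet> velocity (m \<alpha>) v) * \<eta> (velocity (m \<alpha>) v)) * q \<alpha> v))"
  define ck where "ck \<alpha> = current_kernel (m \<alpha>) \<eta>" for \<alpha>
  have Yn: "(LINT t|lborel. LINT x|lborel. log_weight n t * \<eta> ((1 / t) *\<^sub>R x) * (\<rho> t x - ((1 / t) *\<^sub>R x) \<bullet> j t x))
      = (\<Sum>\<alpha>=1..N. e \<alpha> * (LINT z|lborel. log_weight n (fst z) * ck \<alpha> z * f \<alpha> z))" if n: "n > 0" for n
  proof -
    define I where "I \<alpha> t = (LINT w|lborel. ck \<alpha> (t, w) * f \<alpha> (t, w))" for \<alpha> t
    have sp: "integrable lborel (\<lambda>t. log_weight n t * I \<alpha> t)"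
      "(LINT z|lborel. log_weight n (fst z) * ck \<alpha> z * f \<alpha> z) = (LINT t|lborel. log_weight n t * I \<alpha> t)"
      if al: "\<alpha> \<in> {1..N}" for \<alpha>
    proof -
      interpret p: particles_in_fields "m \<alpha>" "e \<alpha>" k "C \<alpha>" E B "f \<alpha>" "f' \<alpha>" "g \<alpha>" "q \<alpha>" "K0 \<alpha>" "C1 \<alpha>" E' B'
        by (rule species[OF al])
      show "integrable lborel (\<lambda>t. log_weight n t * I \<alpha> t)"
        "(LINT z|lborel. log_weight n (fst z) * ck \<alpha> z * f \<alpha> z) = (LINT t|lborel. log_weight n t * I \<alpha> t)"
        unfolding I_def ck_def
        using p.log_average_density[OF n measurable_current_kernel[OF c\<eta>] current_kernel_bound[OF p.\<mu> \<eta>b \<eta>s]] by auto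
    qed
    have sl: "(LINT x|lborel. log_weight n t * \<eta> ((1 / t) *\<^sub>R x) * (\<rho> t x - ((1 / t) *\<^sub>R x) \<bullet> j t x))
        = (\<Sum>\<alpha>=1..N. e \<alpha> * (log_weight n t * I \<alpha> t))" for t
    proof (cases "t \<in> log_interval n")
      case False
      show ?thesis using time_cutoff_zero[OF n False] by simp
    next
      case True
      then have t: "t > 0" using exp_n_gt_1[OF n, of t] by simp
      define h where "h \<alpha> x = \<eta> ((1 / t) *\<^sub>R x) *
         ((LINT v|lborel. f \<alpha> (t, x, v)) - ((1 / t) *\<^sub>R x) \<bullet> (LINT v|lborel. f \<alpha> (t, x, v) *\<^sub>R velocity (m \<alpha>) v))" for \<alpha> x
      have h: "integrable lborel (h \<alpha>)" "(LINT x|lborel. h \<alpha> x) = I \<alpha> t" if al: "\<alpha> \<in> {1..N}" for \<alpha>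
      proof -
        interpret p: particles_in_fields "m \<alpha>" "e \<alpha>" k "C \<alpha>" E B "f \<alpha>" "f' \<alpha>" "g \<alpha>" "q \<alpha>" "K0 \<alpha>" "C1 \<alpha>" E' B'
          by (rule species[OF al])
        show "integrable lborel (h \<alpha>)" "(LINT x|lborel. h \<alpha> x) = I \<alpha> t"
          unfolding I_def ck_def h_def[abs_def]
          using p.current_slice[OF c\<eta> \<eta>b \<eta>s t] by auto
      qed
      have "log_weight n t * \<eta> ((1 / t) *\<^sub>R x) * (\<rho> t x - ((1 / t) *\<^sub>R x) \<bullet> j t x)
          = (\<Sum>\<alpha>=1..N. (e \<alpha> * log_weight n t) * h \<alpha> x)" for x
        unfolding \<rho>[OF t] j[OF t] h_def
        by (simp add: inner_sum_right sum_subtractf[symmetric] sum_distrib_left algebra_simps)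
      then have "(LINT x|lborel. log_weight n t * \<eta> ((1 / t) *\<^sub>R x) * (\<rho> t x - ((1 / t) *\<^sub>R x) \<bullet> j t x))
          = (LINT x|lborel. (\<Sum>\<alpha>=1..N. (e \<alpha> * log_weight n t) * h \<alpha> x))" by (simp only:)
      also have "\<dots> = (\<Sum>\<alpha>=1..N. (LINT x|lborel. (e \<alpha> * log_weight n t) * h \<alpha> x))"
        by (rule Bochner_Integration.integral_sum) (use h in auto)
      also have "\<dots> = (\<Sum>\<alpha>=1..N. e \<alpha> * (log_weight n t * I \<alpha> t))"
        by (rule sum.cong) (use h in \<open>auto simp: mult.assoc\<close>)
      finally show ?thesis .
    qed
    have "(LINT t|lborel. LINT x|lborel. log_weight n t * \<eta> ((1 / t) *\<^sub>R x) * (\<rho> t x - ((1 / t) *\<^sub>R x) \<bullet> j t x))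
       = (LINT t|lborel. (\<Sum>\<alpha>=1..N. e \<alpha> * (log_weight n t * I \<alpha> t)))" by (simp only: sl)
    also have "\<dots> = (\<Sum>\<alpha>=1..N. (LINT t|lborel. e \<alpha> * (log_weight n t * I \<alpha> t)))"
      by (rule Bochner_Integration.integral_sum) (use sp in auto)
    also have "\<dots> = (\<Sum>\<alpha>=1..N. e \<alpha> * (LINT z|lborel. log_weight n (fst z) * ck \<alpha> z * f \<alpha> z))"
      by (rule sum.cong) (use sp in auto)
    finally show ?thesis .
  qed
  have "(\<lambda>n. \<Sum>\<alpha>=1..N. e \<alpha> * (LINT z|lborel. log_weight n (fst z) * ck \<alpha> z * f \<alpha> z)) \<longlonglongrightarrow> Y"
    unfolding Y_def
  proof (intro tendsto_sum tendsto_mult tendsto_const)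
    fix \<alpha> assume al: "\<alpha> \<in> {1..N}"
    interpret p: particles_in_fields "m \<alpha>" "e \<alpha>" k "C \<alpha>" E B "f \<alpha>" "f' \<alpha>" "g \<alpha>" "q \<alpha>" "K0 \<alpha>" "C1 \<alpha>" E' B'
      by (rule species[OF al])
    show "(\<lambda>n. LINT z|lborel. log_weight n (fst z) * ck \<alpha> z * f \<alpha> z)
      \<longlonglongrightarrow> (LINT v|lborel. ((1 - velocity (m \<alpha>) v \<bullet> velocity (m \<alpha>) v) * \<eta> (velocity (m \<alpha>) v)) * q \<alpha> v)"
      unfolding ck_def by (rule p.charge_current_limit[OF c\<eta> \<eta>b \<eta>s])
  qed
  moreover have "\<forall>n\<ge>1. (\<Sum>\<alpha>=1..N. e \<alpha> * (LINT z|lborel. log_weight n (fst z) * ck \<alpha> z * f \<alpha> z))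
     = (LINT t|lborel. LINT x|lborel. log_weight n t * \<eta> ((1 / t) *\<^sub>R x) * (\<rho> t x - ((1 / t) *\<^sub>R x) \<bullet> j t x))"
    using Yn by simp
  then have "\<forall>\<^sub>F n in sequentially. (\<Sum>\<alpha>=1..N. e \<alpha> * (LINT z|lborel. log_weight n (fst z) * ck \<alpha> z * f \<alpha> z))
     = (LINT t|lborel. LINT x|lborel. log_weight n t * \<eta> ((1 / t) *\<^sub>R x) * (\<rho> t x - ((1 / t) *\<^sub>R x) \<bullet> j t x))"
    unfolding eventually_sequentially by blast
  ultimately have LY: "(\<lambda>n. LINT t|lborel. LINT x|lborel. log_weight n t * \<eta> ((1 / t) *\<^sub>R x) * (\<rho> t x - ((1 / t) *\<^sub>R x) \<bullet> j t x)) \<longlonglongrightarrow> Y"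
    by (rule Lim_transform_eventually)
  \<comment> \<open>\<open>\<theta>\<close> is chosen such that its pairing with the mean force of species \<open>a\<close> is the field term in the coordinate \<open>u\<close>.
    The division by \<open>q a\<close> is harmless because \<open>q a\<close> has no zero on the support of \<open>h\<close>.\<close>
  define J where "J = velocity_jacobian (m a)"
  define h where "h v = J v *\<^sub>R V (velocity (m a) v)" for v
  define \<theta> where "\<theta> v = (1 / q a v) *\<^sub>R velocity_deriv_inv (m a) v (h v)" for v
  have inv\<Lambda>: "\<Lambda> (velocity (m a) v) = v /\<^sub>R m a" for v
  proof -
    have "m a *\<^sub>R \<Lambda> (velocity (m a) v) = (m a / sqrt (1 - velocity (m a) v \<bullet> velocity (m a) v)) *\<^sub>R velocity (m a) v"
      by (simp add: \<Lambda>_def)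
    also have "\<dots> = v" by (rule velocity_inverse[OF ma])
    finally have "v /\<^sub>R m a = (m a *\<^sub>R \<Lambda> (velocity (m a) v)) /\<^sub>R m a" by simp
    then show ?thesis using ma by simp
  qed
  have qn: "q a v \<noteq> 0" if "norm (velocity (m a) v - u0) \<le> r0" for v
  proof -
    have "dist (velocity (m a) v) u0 < d" using that r0 by (simp add: dist_norm)
    from d(2)[OF this] have "Q a (\<Lambda> (velocity (m a) v)) \<noteq> 0" by simp
    then show ?thesis unfolding inv\<Lambda> q[OF a(1)] .
  qed
  have ch: "continuous_on UNIV h"
    unfolding h_def[abs_def] J_def
    by (intro continuous_intros continuous_velocity_jacobian ma continuous_on_compose2[OF cV]) auto
  have c\<theta>: "continuous_on UNIV \<theta>"
  proof -
    define U1 where "U1 = {v. q a v \<noteq> 0}"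
    define U2 where "U2 = {v. norm (velocity (m a) v - u0) > r0}"
    have o1: "open U1" unfolding U1_def by (intro open_Collect_neq continuous_intros pa.contq)
    have o2: "open U2" unfolding U2_def by (intro open_Collect_less continuous_intros ma)
    have 1: "continuous_on U1 \<theta>" unfolding \<theta>_def[abs_def]
      by (intro continuous_intros continuous_on_subset[OF pa.contq] continuous_on_subset[OF ch]) (auto simp: U1_def)
    have 2: "continuous_on U2 \<theta>"
      by (rule continuous_on_eq[of _ "\<lambda>_. 0"])
         (auto simp: U2_def \<theta>_def h_def V0 velocity_deriv_inv_def)
    have "U1 \<union> U2 = UNIV" using qn by (auto simp: U1_def U2_def not_less)
    then show ?thesis using continuous_on_open_Un[OF o1 o2 1 2] by simp
  qed
  define K where "K = max (K0 a) 0 + 1"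
  have K: "K > 0" "K0 a < K" by (auto simp: K_def)
  have \<theta>0: "\<theta> v = 0" if "norm v > K" for v
  proof -
    have "q a v = 0" using pa.q_supp[of v] that K by simp
    then show ?thesis by (simp add: \<theta>_def)
  qed
  have Lf: "(\<lambda>n. LINT v|lborel. (pa.mean_force n v \<bullet> \<theta> v) * q a v) \<longlonglongrightarrow> 0"
    by (rule pa.mean_force_vanishes[OF K(1) c\<theta> \<theta>0])
  have eqf: "(pa.mean_force n v \<bullet> \<theta> v) * q a v = J v * (avg_lorentz n (velocity (m a) v) \<bullet> V (velocity (m a) v))" for n v
  proof (cases "q a v = 0")
    case True
    then have "V (velocity (m a) v) = 0" using qn[of v] V0 by force
    then show ?thesis using True by simp
  next
    case False
    then have "(pa.mean_force n v \<bullet> \<theta> v) * q a v = pa.mean_force n v \<bullet> velocity_deriv_inv (m a) v (h v)"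
      by (simp add: \<theta>_def)
    also have "\<dots> = avg_lorentz n (velocity (m a) v) \<bullet> h v"
      unfolding pa.mean_force_def by (rule velocity_deriv_inner_inverse[OF ma])
    finally show ?thesis by (simp add: h_def)
  qed
  obtain CF where CF: "CF \<ge> 0" "\<And>n u. n > 0 \<Longrightarrow> norm u \<le> 1 - \<delta> \<Longrightarrow> norm (avg_lorentz n u) \<le> CF"
    using avg_lorentz_bound[OF \<delta>] by blast
  have cov: "(LINT v|lborel. (pa.mean_force n v \<bullet> \<theta> v) * q a v) = (LINT u|lborel. avg_lorentz n u \<bullet> V u)" if n: "n > 0" for n
  proof -
    have iV: "integrable lborel (\<lambda>u. norm (V u))"
      by (rule integrable_continuous_compact_support[OF _ compact_cball[of 0 "1 - \<delta>"]])
         (use cV V0 farn in \<open>auto intro!: continuous_intros\<close>)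
    have i: "integrable lborel (\<lambda>u. avg_lorentz n u \<bullet> V u)"
    proof (rule Bochner_Integration.integrable_bound[of _ "\<lambda>u. CF * norm (V u)"])
      show "integrable lborel (\<lambda>u. CF * norm (V u))" using iV by simp
      show "(\<lambda>u. avg_lorentz n u \<bullet> V u) \<in> borel_measurable lborel"
        using measurable_avg_lorentz[OF n] borel_measurable_continuous_onI[OF cV] by measurable
      have "\<bar>avg_lorentz n u \<bullet> V u\<bar> \<le> CF * norm (V u)" for u
      proof (cases "norm u \<le> 1 - \<delta>")
        case True
        then show ?thesis using CF(2)[OF n True] by (intro order_trans[OF Cauchy_Schwarz_ineq2] mult_right_mono) auto
      next
        case False
        then show ?thesis using V0[of u] farn[of u] by simp
      qed
      then show "AE u in lborel. norm (avg_lorentz n u \<bullet> V u) \<le> norm (CF * norm (V u))"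
        using CF(1) by simp
    qed
    have z: "avg_lorentz n u \<bullet> V u = 0" if "norm u \<ge> 1" for u
      using V0[of u] farn[of u] that \<delta> by simp
    show ?thesis unfolding eqf J_def
      by (rule velocity_change_of_variables[OF ma i z, symmetric])
  qed
  have "\<forall>n\<ge>1. (LINT v|lborel. (pa.mean_force n v \<bullet> \<theta> v) * q a v) = (LINT u|lborel. avg_lorentz n u \<bullet> V u)"
    using cov by simp
  then have "\<forall>\<^sub>F n in sequentially. (LINT v|lborel. (pa.mean_force n v \<bullet> \<theta> v) * q a v) = (LINT u|lborel. avg_lorentz n u \<bullet> V u)"
    unfolding eventually_sequentially by blast
  from Lim_transform_eventually[OF Lf this] have LX: "(\<lambda>n. LINT u|lborel. avg_lorentz n u \<bullet> V u) \<longlonglongrightarrow> 0" .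
  have "(\<lambda>n. (LINT u|lborel. avg_lorentz n u \<bullet> V u)
      + 4 * pi * (LINT t|lborel. LINT x|lborel. log_weight n t * \<eta> ((1 / t) *\<^sub>R x) *
          (\<rho> t x - ((1 / t) *\<^sub>R x) \<bullet> j t x))) \<longlonglongrightarrow> 0 + 4 * pi * Y"
    by (intro tendsto_add tendsto_mult tendsto_const LX LY)
  from LIMSEQ_unique[OF this gauss0] have Y0: "Y = 0" by simp
  \<comment> \<open>Rescaling the momenta by the masses turns \<open>Y\<close> into an integral of the total charge, whose sign near \<open>w0\<close> is that of
    \<open>Qt w0\<close>.\<close>
  define H where "H w = ((1 - velocity 1 w \<bullet> velocity 1 w) * \<eta> (velocity 1 w))" for w
  have cH: "continuous_on UNIV H"
    unfolding H_def[abs_def] by (intro continuous_intros continuous_on_compose2[OF c\<eta>]) auto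
  have scale: "(LINT v|lborel. ((1 - velocity (m \<alpha>) v \<bullet> velocity (m \<alpha>) v) * \<eta> (velocity (m \<alpha>) v)) * q \<alpha> v)
      = m \<alpha> ^ 3 * (LINT w|lborel. H w * Q \<alpha> w)" and iHQ: "integrable lborel (\<lambda>w. H w * Q \<alpha> w)" if al: "\<alpha> \<in> {1..N}" for \<alpha>
  proof -
    interpret p: particles_in_fields "m \<alpha>" "e \<alpha>" k "C \<alpha>" E B "f \<alpha>" "f' \<alpha>" "g \<alpha>" "q \<alpha>" "K0 \<alpha>" "C1 \<alpha>" E' B'
      by (rule species[OF al])
    have mp: "m \<alpha> > 0" by (rule mpos[OF al])
    have c: "continuous_on UNIV (\<lambda>v. ((1 - velocity (m \<alpha>) v \<bullet> velocity (m \<alpha>) v) * \<eta> (velocity (m \<alpha>) v)) * q \<alpha> v)"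
      by (intro continuous_intros continuous_on_compose2[OF c\<eta>] p.contq mp) auto
    have en: "energy (m \<alpha>) (m \<alpha> *\<^sub>R w) = m \<alpha> * energy 1 w" for w
    proof -
      have "(m \<alpha>)\<^sup>2 + (norm (m \<alpha> *\<^sub>R w))\<^sup>2 = (m \<alpha>)\<^sup>2 * (1\<^sup>2 + (norm w)\<^sup>2)"
        by (simp add: power_mult_distrib distrib_left)
      then show ?thesis using mp by (simp add: energy_def real_sqrt_mult)
    qed
    have ve: "velocity (m \<alpha>) (m \<alpha> *\<^sub>R w) = velocity 1 w" for w
      using mp by (simp add: velocity_def en)
    have qe: "q \<alpha> (m \<alpha> *\<^sub>R w) = Q \<alpha> w" for w using q[OF al, of "m \<alpha> *\<^sub>R w"] mp by simp
    show "(LINT v|lborel. ((1 - velocity (m \<alpha>) v \<bullet> velocity (m \<alpha>) v) * \<eta> (velocity (m \<alpha>) v)) * q \<alpha> v)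
      = m \<alpha> ^ 3 * (LINT w|lborel. H w * Q \<alpha> w)"
      using lborel_integral_scale[OF borel_measurable_continuous_onI[OF c] mp] by (simp add: ve qe H_def)
    have "Q \<alpha> w = 0" if "norm w > K0 \<alpha> / m \<alpha>" for w
    proof -
      have "norm (m \<alpha> *\<^sub>R w) > K0 \<alpha>" using that mp by (simp add: divide_less_eq mult.commute)
      then show ?thesis using p.q_supp qe by metis
    qed
    then show "integrable lborel (\<lambda>w. H w * Q \<alpha> w)"
      by (intro integrable_continuous_compact_support[OF _ compact_cball[of 0 "K0 \<alpha> / m \<alpha>"]])
         (auto intro!: continuous_intros cH Q[OF al])
  qed
  have "Y = (\<Sum>\<alpha>=1..N. (LINT w|lborel. H w * (e \<alpha> * m \<alpha> ^ 3 * Q \<alpha> w)))"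
    unfolding Y_def
  proof (rule sum.cong)
    fix \<alpha> assume al: "\<alpha> \<in> {1..N}"
    have "(LINT w|lborel. H w * (e \<alpha> * m \<alpha> ^ 3 * Q \<alpha> w)) = (LINT w|lborel. (e \<alpha> * m \<alpha> ^ 3) * (H w * Q \<alpha> w))"
      by (simp only: ac_simps)
    then show "e \<alpha> * (LINT v|lborel. ((1 - velocity (m \<alpha>) v \<bullet> velocity (m \<alpha>) v) * \<eta> (velocity (m \<alpha>) v)) * q \<alpha> v)
       = (LINT w|lborel. H w * (e \<alpha> * m \<alpha> ^ 3 * Q \<alpha> w))"
      unfolding scale[OF al] by simp
  qed simp
  also have "\<dots> = (LINT w|lborel. (\<Sum>\<alpha>=1..N. H w * (e \<alpha> * m \<alpha> ^ 3 * Q \<alpha> w)))"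
  proof (rule Bochner_Integration.integral_sum[symmetric])
    fix \<alpha> assume al: "\<alpha> \<in> {1..N}"
    have "integrable lborel (\<lambda>w. (e \<alpha> * m \<alpha> ^ 3) * (H w * Q \<alpha> w))" using iHQ[OF al] by simp
    then show "integrable lborel (\<lambda>w. H w * (e \<alpha> * m \<alpha> ^ 3 * Q \<alpha> w))" by (simp only: ac_simps)
  qed
  also have "\<dots> = (LINT w|lborel. H w * Qt w)" by (simp add: Qt_def sum_distrib_left)
  finally have YH: "Y = (LINT w|lborel. H w * Qt w)" .
  have iQt: "integrable lborel (\<lambda>w. H w * Qt w)"
  proof -
    have "integrable lborel (\<lambda>w. \<Sum>\<alpha>=1..N. (e \<alpha> * m \<alpha> ^ 3) * (H w * Q \<alpha> w))"
      by (intro Bochner_Integration.integrable_sum integrable_mult_right iHQ)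
    moreover have "(\<Sum>\<alpha>=1..N. (e \<alpha> * m \<alpha> ^ 3) * (H w * Q \<alpha> w)) = H w * Qt w" for w
      by (simp add: Qt_def sum_distrib_left ac_simps)
    ultimately show ?thesis by simp
  qed
  have g1: "1 - velocity 1 w \<bullet> velocity 1 w > 0" for w
    using norm_velocity_less_1[of 1 w] by (simp add: dot_square_norm abs_square_less_1)
  have "0 < (LINT w|lborel. Qt w0 * (H w * Qt w))"
  proof (rule continuous_integral_pos[where ?x0.0 = w0])
    show "integrable lborel (\<lambda>w. Qt w0 * (H w * Qt w))" using iQt by simp
    show "continuous_on UNIV (\<lambda>w. Qt w0 * (H w * Qt w))" by (intro continuous_intros cH cQt)
    show "0 \<le> Qt w0 * (H w * Qt w)" for w
    proof (cases "norm (velocity 1 w - u0) \<le> r0")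
      case True
      then have "dist (velocity 1 w) u0 < d" using r0 by (simp add: dist_norm)
      moreover have "\<Lambda> (velocity 1 w) = w" unfolding \<Lambda>_def by (rule velocity_inverse) simp
      ultimately have "Qt w0 * Qt w > 0" using d(2)[of "velocity 1 w"] by simp
      moreover have "H w \<ge> 0" unfolding H_def using g1[of w] \<eta>nn by (intro mult_nonneg_nonneg) auto
      ultimately have "0 \<le> H w * (Qt w0 * Qt w)" by simp
      then show ?thesis by (simp only: ac_simps)
    next
      case False
      then show ?thesis using far(1)[of "velocity 1 w"] by (simp add: H_def)
    qed
    have "H w0 > 0"
    proof -
      have "\<eta> u0 = 1" by (simp add: \<eta>_def plateau_def)
      then show ?thesis unfolding H_def u0_def[symmetric] using g1[of w0] by (simp add: u0_def)
    qed
    moreover have "0 < Qt w0 * Qt w0" using Qt0 by (auto simp: zero_less_mult_iff)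
    ultimately have "0 < H w0 * (Qt w0 * Qt w0)" by (rule mult_pos_pos)
    then show "0 < Qt w0 * (H w0 * Qt w0)" by (simp only: ac_simps)
  qed
  then show False using Y0 YH by simp
qed

section \<open>Classical solutions\<close>

lemma sum_Basis_R3:
  fixes h :: "R3 \<Rightarrow> 'c::comm_monoid_add"
  shows "(\<Sum>b\<in>Basis. h b) = h (axis 1 1) + h (axis 2 1) + h (axis 3 1)"
proof -
  have B: "(Basis :: R3 set) = (\<lambda>i. axis i 1) ` UNIV" by (auto simp: Basis_vec_def)
  have "inj (\<lambda>i::3. axis i (1::real))" by (auto intro!: injI simp: axis_eq_axis)
  then have "(\<Sum>b\<in>Basis. h b) = (\<Sum>i\<in>UNIV. h (axis i 1))" unfolding B by (subst sum.reindex) auto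
  then show ?thesis by (simp add: sum_3)
qed

lemma R3_axis_expansion: "(V :: R3) = V $ 1 *\<^sub>R axis 1 1 + V $ 2 *\<^sub>R axis 2 1 + V $ 3 *\<^sub>R axis 3 1"
  by (simp add: vec_eq_iff forall_3 axis_def)

lemma inner_grad:
  assumes d: "(h has_derivative h') (at x)"
  shows "V \<bullet> grad h x = h' V"
proof -
  have lin: "linear h'" using d has_derivative_linear by blast
  have f: "frechet_derivative h (at x) = h'" using frechet_derivative_at[OF d] by simp
  have "h' V = h' (V $ 1 *\<^sub>R axis 1 1 + V $ 2 *\<^sub>R axis 2 1 + V $ 3 *\<^sub>R axis 3 1)"
    by (rule arg_cong[OF R3_axis_expansion])
  also have "\<dots> = V $ 1 * h' (axis 1 1) + V $ 2 * h' (axis 2 1) + V $ 3 * h' (axis 3 1)"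
    by (simp add: linear_add[OF lin] linear_scale[OF lin])
  finally show ?thesis by (simp add: grad_def f inner_vec_def sum_3)
qed

lemma jacobian_eq_matrix:
  assumes d: "(F has_derivative F') (at x)"
  shows "jacobian F (at x) = matrix F'"
  using frechet_derivative_at[OF d] by (simp add: jacobian_def)

lemma divergence_eq:
  assumes d: "(F has_derivative F') (at x)"
  shows "divergence F x = (\<Sum>b\<in>Basis. F' b \<bullet> b)"
  by (simp add: divergence_def jacobian_eq_matrix[OF d] trace_def matrix_def sum_3 sum_Basis_R3 inner_axis)

lemma curl_eq:
  assumes d: "(F has_derivative F') (at x)"
  shows "curl F x = (\<Sum>b\<in>Basis. cross3 b (F' b))"
proof -
  have a: "cross3 (axis 1 1) x = vector [0, - x $ 3, x $ 2]" "cross3 (axis 2 1) x = vector [x $ 3, 0, - x $ 1]"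
    "cross3 (axis 3 1) x = vector [- x $ 2, x $ 1, 0]" for x :: R3
    by (simp_all add: cross3_def axis_def)
  have "curl F x = vector [F' (axis 2 1) $ 3 - F' (axis 3 1) $ 2, F' (axis 3 1) $ 1 - F' (axis 1 1) $ 3,
      F' (axis 1 1) $ 2 - F' (axis 2 1) $ 1]"
    by (simp add: curl_def Let_def jacobian_eq_matrix[OF d] matrix_def)
  also have "\<dots> = (\<Sum>b\<in>Basis. cross3 b (F' b))"
    unfolding sum_Basis_R3 a by (simp add: vec_eq_iff forall_3)
  finally show ?thesis .
qed

lemma norm_matrix_vector_le: "norm (J *v h) \<le> norm J * norm (h :: R3)" for J :: "real^3^3"
proof -
  have "norm (J *v h) = L2_set (\<lambda>i. norm ((J *v h) $ i)) UNIV" by (simp add: norm_vec_def)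
  also have "\<dots> \<le> L2_set (\<lambda>i. norm (J $ i) * norm h) UNIV"
    by (intro L2_set_mono) (auto simp: matrix_vector_mul_component intro: Cauchy_Schwarz_ineq2)
  also have "\<dots> = L2_set (\<lambda>i. norm (J $ i)) UNIV * norm h" by (rule L2_set_left_distrib[symmetric]) simp
  finally show ?thesis by (simp add: norm_vec_def)
qed

text \<open>
  Constant continuation to negative times; it makes continuity and measurability available on the whole space.
\<close>
definition extend :: "(real \<times> 'a \<Rightarrow> 'b) \<Rightarrow> real \<times> 'a \<Rightarrow> 'b" where
  "extend F z = F (max 0 (fst z), snd z)"

lemma extend_eq: "t \<ge> 0 \<Longrightarrow> extend F (t, y) = F (t, y)"
  by (simp add: extend_def max_def)

lemma C1_on_half_space:
  fixes F :: "real \<times> 'a::real_normed_vector \<Rightarrow> 'b::real_normed_vector"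
  assumes "C1_on ({0..} \<times> UNIV) F"
  obtains F' where "\<And>t y. t > 0 \<Longrightarrow> (F has_derivative F' (t, y)) (at (t, y))"
    "\<And>t y. t > 0 \<Longrightarrow> (extend F has_derivative F' (t, y)) (at (t, y))"
    "\<And>h. continuous_on ({0<..} \<times> UNIV) (\<lambda>z. F' z h)"
    "continuous_on UNIV (extend F)"
proof -
  obtain D :: "real \<times> 'a \<Rightarrow> (real \<times> 'a) \<Rightarrow>\<^sub>L 'b" where
    D: "\<And>z. z \<in> {0..} \<times> UNIV \<Longrightarrow> (F has_derivative blinfun_apply (D z)) (at z within {0..} \<times> UNIV)"
    and cD: "continuous_on ({0..} \<times> UNIV) D"
    using assms unfolding C1_on_def by blast
  have o: "open ({0<..} \<times> UNIV :: (real \<times> 'a) set)" by (intro open_Times open_greaterThan open_UNIV)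
  have d: "(F has_derivative blinfun_apply (D (t, y))) (at (t, y))" if t: "t > 0" for t y
  proof -
    have "(F has_derivative blinfun_apply (D (t, y))) (at (t, y) within {0<..} \<times> UNIV)"
      by (rule has_derivative_subset[OF D]) (use t in auto)
    moreover have "at (t, y) within {0<..} \<times> UNIV = at (t, y)" by (rule at_within_open[OF _ o]) (use t in simp)
    ultimately show ?thesis by simp
  qed
  have dx: "(extend F has_derivative blinfun_apply (D (t, y))) (at (t, y))" if t: "t > 0" for t y
    by (rule has_derivative_transform_within_open[OF d[OF t] o]) (use t in \<open>auto simp: extend_eq\<close>)
  have cF: "continuous_on ({0..} \<times> UNIV) F"
    unfolding continuous_on_eq_continuous_within by (intro ballI has_derivative_continuous[OF D])
  have "continuous_on UNIV (extend F)"
    unfolding extend_def[abs_def]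
    by (rule continuous_on_compose2[OF cF]) (auto intro!: continuous_intros)
  moreover have "continuous_on ({0<..} \<times> UNIV) (\<lambda>z. blinfun_apply (D z) h)" for h
    by (intro continuous_intros continuous_on_subset[OF cD]) auto
  ultimately show ?thesis by (intro that[of "\<lambda>z. blinfun_apply (D z)"] d dx)
qed

lemma time_deriv_eq:
  assumes d: "(F has_derivative F') (at (t, y))" and t: "t > 0"
  shows "time_deriv (\<lambda>s. F (s, y)) t = F' (1, 0)"
proof -
  have lin: "linear F'" using d has_derivative_linear by blast
  have "((\<lambda>s. (s, y)) has_derivative (\<lambda>h. (h, 0))) (at t)" by (auto intro!: derivative_eq_intros)
  from has_derivative_compose[OF this d]
  have "((\<lambda>s. F (s, y)) has_derivative (\<lambda>h. F' (h, 0))) (at t)" .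
  moreover have "(\<lambda>h. F' (h, 0)) = (\<lambda>h. h *\<^sub>R F' (1, 0))"
  proof
    fix h
    have "F' (h, 0) = F' (h *\<^sub>R (1, 0))" by simp
    also have "\<dots> = h *\<^sub>R F' (1, 0)" by (rule linear_scale[OF lin])
    finally show "F' (h, 0) = h *\<^sub>R F' (1, 0)" .
  qed
  ultimately have "((\<lambda>s. F (s, y)) has_vector_derivative F' (1, 0)) (at t)"
    unfolding has_vector_derivative_def by (simp only:)
  moreover have "at t within {0..} = at t"
    by (rule at_within_nhd[where S = "{0<..}"]) (use t in auto)
  ultimately show ?thesis unfolding time_deriv_def by (simp add: vector_derivative_at)
qed

lemma slice_has_derivative:
  assumes d: "(F has_derivative F') (at (t, x))"
  shows "((\<lambda>y. F (t, y)) has_derivative (\<lambda>h. F' (0, h))) (at x)"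
proof -
  have "((\<lambda>y. (t, y)) has_derivative (\<lambda>h. (0, h))) (at x)" by (auto intro!: derivative_eq_intros)
  from has_derivative_compose[OF this d] show ?thesis .
qed

text \<open>
  The three partial derivatives combine to the derivative in the direction of the transport field.
\<close>
lemma vlasov_transport_form:
  fixes f :: "real \<Rightarrow> R3 \<Rightarrow> R3 \<Rightarrow> real"
  assumes d: "((\<lambda>(t, x, v). f t x v) has_derivative F') (at (t, x, v))" and t: "t > 0"
    and eq: "time_deriv (\<lambda>s. f s x v) t + V \<bullet> grad (\<lambda>y. f t y v) x + e * (L \<bullet> grad (f t x) v) = 0"
  shows "F' (1, V, e *\<^sub>R L) = 0"
proof -
  have lin: "linear F'" using d has_derivative_linear by blast
  have 1: "time_deriv (\<lambda>s. f s x v) t = F' (1, 0)" using time_deriv_eq[OF d t] by simp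
  have "((\<lambda>y. (t, y, v)) has_derivative (\<lambda>h. (0, h, 0))) (at x)" by (auto intro!: derivative_eq_intros)
  from has_derivative_compose[OF this d] have "((\<lambda>y. f t y v) has_derivative (\<lambda>h. F' (0, h, 0))) (at x)" by simp
  from inner_grad[OF this] have 2: "V \<bullet> grad (\<lambda>y. f t y v) x = F' (0, V, 0)" .
  have "((\<lambda>y. (t, x, y)) has_derivative (\<lambda>h. (0, 0, h))) (at v)" by (auto intro!: derivative_eq_intros)
  from has_derivative_compose[OF this d] have "(f t x has_derivative (\<lambda>h. F' (0, 0, h))) (at v)" by simp
  from inner_grad[OF this] have 3: "L \<bullet> grad (f t x) v = F' (0, 0, L)" .
  have "F' (1, V, e *\<^sub>R L) = F' ((1, 0) + (0, V, 0) + e *\<^sub>R (0, 0, L))" by (simp add: zero_prod_def)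
  also have "\<dots> = F' (1, 0) + F' (0, V, 0) + e * F' (0, 0, L)"
    by (simp only: linear_add[OF lin] linear_scale[OF lin] real_scaleR_def)
  finally show ?thesis using eq by (simp add: 1 2 3)
qed

text \<open>
  For \<open>norm x \<le> (1 - \<delta>) t\<close> both factors \<open>t \<plusminus> norm x + 2 k\<close> are at least \<open>\<delta> t\<close>. The bound on the Jacobian becomes a
  Lipschitz bound because the ball is convex.
\<close>
lemma field_decay_interior:
  fixes E B :: "real \<Rightarrow> R3 \<Rightarrow> R3"
  assumes k: "k > 0" and C0: "C0 > 0" and fd: "field_decay k C0 E B"
    and dE: "\<And>t x. t > 0 \<Longrightarrow> (E t has_derivative E' t x) (at x)"
    and dB: "\<And>t x. t > 0 \<Longrightarrow> (B t has_derivative B' t x) (at x)"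
    and \<delta>: "0 < \<delta>" "\<delta> < 1"
  shows "\<exists>CF \<tau>. (\<tau> \<longlongrightarrow> (0::real)) at_top \<and>
       (\<forall>t x. t \<ge> 1 \<longrightarrow> norm x \<le> (1 - \<delta>) * t \<longrightarrow> norm (E t x) \<le> CF / t\<^sup>2 \<and> norm (B t x) \<le> CF / t\<^sup>2) \<and>
       (\<forall>t x x'. t \<ge> 1 \<longrightarrow> norm x \<le> (1 - \<delta>) * t \<longrightarrow> norm x' \<le> (1 - \<delta>) * t \<longrightarrow>
          t\<^sup>2 * norm (E t x - E t x') \<le> \<tau> t * norm (x - x') \<and>
          t\<^sup>2 * norm (B t x - B t x') \<le> \<tau> t * norm (x - x'))"
proof -
  have zone: "norm x \<le> t + k" "t \<le> t + norm x + 2 * k" "\<delta> * t \<le> t - norm x + 2 * k" "t + norm x + 2 * k \<le> 2 * t + 2 * k"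
    if "t \<ge> 1" "norm x \<le> (1 - \<delta>) * t" for t and x :: R3
  proof -
    have 0: "(1 - \<delta>) * t = t - \<delta> * t" by (simp add: algebra_simps)
    have p: "0 \<le> \<delta> * t" using \<delta> that by simp
    have x: "norm x \<le> t - \<delta> * t" using that(2) unfolding 0 .
    show "norm x \<le> t + k" using x p k by linarith
    show "t \<le> t + norm x + 2 * k" using k norm_ge_zero[of x] by linarith
    show "\<delta> * t \<le> t - norm x + 2 * k" using x k by linarith
    show "t + norm x + 2 * k \<le> 2 * t + 2 * k" using x p by linarith
  qed
  \<comment> \<open>A bound for the Jacobians in the smaller cone.\<close>
  define J where "J t = C0 * ln (2 * t + 2 * k) / (t * (\<delta> * t)\<^sup>2)" for t
  have b: "norm (E t x, B t x) \<le> (C0 / \<delta>) / t\<^sup>2" if t: "t \<ge> 1" "norm x \<le> (1 - \<delta>) * t" for t x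
  proof -
    have "norm (E t x, B t x) \<le> C0 / ((t + norm x + 2 * k) * (t - norm x + 2 * k))"
      using fd t(1) zone(1)[OF t] unfolding field_decay_def by auto
    also have "\<dots> \<le> C0 / (t * (\<delta> * t))"
      using zone[OF t] t \<delta> C0 order_less_le_trans[OF mult_pos_pos zone(3)[OF t]] by (intro divide_left_mono mult_mono mult_pos_pos) auto
    finally show ?thesis by (simp add: power2_eq_square ac_simps)
  qed
  have jb: "norm (jacobian (E t) (at x), jacobian (B t) (at x)) \<le> J t" if t: "t \<ge> 1" "norm x \<le> (1 - \<delta>) * t" for t x
  proof -
    have "norm (jacobian (E t) (at x), jacobian (B t) (at x))
        \<le> C0 * ln (t + norm x + 2 * k) / ((t + norm x + 2 * k) * (t - norm x + 2 * k)\<^sup>2)"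
      using fd t(1) zone(1)[OF t] unfolding field_decay_def by auto
    also have "\<dots> \<le> C0 * ln (2 * t + 2 * k) / (t * (\<delta> * t)\<^sup>2)"
    proof (rule frac_le)
      show "C0 * ln (t + norm x + 2 * k) \<le> C0 * ln (2 * t + 2 * k)"
        using zone[OF t] t C0 by (intro mult_left_mono) auto
      show "0 \<le> C0 * ln (2 * t + 2 * k)" using t k C0 by simp
      show "0 < t * (\<delta> * t)\<^sup>2" using t \<delta> by simp
      show "t * (\<delta> * t)\<^sup>2 \<le> (t + norm x + 2 * k) * (t - norm x + 2 * k)\<^sup>2"
        using zone[OF t] t \<delta> by (intro mult_mono power_mono) auto
    qed
    finally show ?thesis by (simp add: J_def)
  qed
  have lip: "norm (F x - F x') \<le> J t * norm (x - x')"
    if t: "t \<ge> 1" and dF: "\<And>x. (F has_derivative F' x) (at x)"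
      and jF: "\<And>x. norm x \<le> (1 - \<delta>) * t \<Longrightarrow> norm (jacobian F (at x)) \<le> J t"
      and x: "norm x \<le> (1 - \<delta>) * t" "norm x' \<le> (1 - \<delta>) * t" for F :: "R3 \<Rightarrow> R3" and F' t x x'
  proof (rule differentiable_bound[OF convex_cball[of 0 "(1 - \<delta>) * t"]])
    show "(F has_derivative F' y) (at y within cball 0 ((1 - \<delta>) * t))" for y
      using dF has_derivative_at_withinI by blast
    show "onorm (F' y) \<le> J t" if "y \<in> cball 0 ((1 - \<delta>) * t)" for y
    proof (rule onorm_le)
      fix h
      have "F differentiable (at y)" using dF unfolding differentiable_def by blast
      then have "(F has_derivative (\<lambda>h. jacobian F (at y) *v h)) (at y)" by (simp only: jacobian_works)
      from has_derivative_unique[OF dF this] have "F' y h = jacobian F (at y) *v h" by (rule fun_cong)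
      then have "norm (F' y h) \<le> norm (jacobian F (at y)) * norm h" by (simp add: norm_matrix_vector_le)
      also have "\<dots> \<le> J t * norm h" using that by (intro mult_right_mono jF) auto
      finally show "norm (F' y h) \<le> J t * norm h" .
    qed
  qed (use x in auto)
  define \<tau> where "\<tau> t = t\<^sup>2 * J t" for t
  have "((\<lambda>t. (C0 / \<delta>\<^sup>2) * (ln (2 * t + 2 * k) / t)) \<longlongrightarrow> 0) at_top"
    by (intro tendsto_mult_right_zero) (use k in real_asymp)
  moreover have "\<forall>\<^sub>F t in at_top. (C0 / \<delta>\<^sup>2) * (ln (2 * t + 2 * k) / t) = \<tau> t"
    using eventually_gt_at_top[of 0]
    by eventually_elim (use \<delta> in \<open>simp add: \<tau>_def J_def power_mult_distrib power2_eq_square field_simps\<close>)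
  ultimately have t0: "(\<tau> \<longlongrightarrow> 0) at_top" by (rule Lim_transform_eventually)
  have "norm (E t x) \<le> (C0 / \<delta>) / t\<^sup>2 \<and> norm (B t x) \<le> (C0 / \<delta>) / t\<^sup>2"
    if "t \<ge> 1" "norm x \<le> (1 - \<delta>) * t" for t x
    using b[OF that] norm_fst_le[of "E t x" "B t x"] norm_snd_le[of "B t x" "E t x"] by auto
  moreover have "t\<^sup>2 * norm (E t x - E t x') \<le> \<tau> t * norm (x - x') \<and> t\<^sup>2 * norm (B t x - B t x') \<le> \<tau> t * norm (x - x')"
    if t: "t \<ge> 1" and x: "norm x \<le> (1 - \<delta>) * t" "norm x' \<le> (1 - \<delta>) * t" for t x x'
  proof -
    have tp: "t > 0" using t by simp
    have j1: "norm (jacobian (E t) (at y)) \<le> J t" "norm (jacobian (B t) (at y)) \<le> J t" if "norm y \<le> (1 - \<delta>) * t" for y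
      using jb[OF t that] norm_fst_le[of "jacobian (E t) (at y)" "jacobian (B t) (at y)"]
        norm_snd_le[of "jacobian (B t) (at y)" "jacobian (E t) (at y)"] by auto
    have "norm (E t x - E t x') \<le> J t * norm (x - x')" by (rule lip[OF t dE[OF tp] j1(1) x])
    moreover have "norm (B t x - B t x') \<le> J t * norm (x - x')" by (rule lip[OF t dB[OF tp] j1(2) x])
    ultimately show ?thesis unfolding \<tau>_def by (auto simp: mult.assoc intro!: mult_left_mono)
  qed
  ultimately show ?thesis using t0 by (intro exI[of _ "C0 / \<delta>"] exI[of _ \<tau>]) auto
qed

text \<open>
  Continued to negative times, a solution all of whose species scatter satisfies the assumptions under which the
  asymptotic charge vanishes.
\<close>
theorem theorem1p5:
  fixes N :: nat
    and m e :: "nat \<Rightarrow> real"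
    and f :: "nat \<Rightarrow> real \<Rightarrow> real^3 \<Rightarrow> real^3 \<Rightarrow> real"
    and E B :: "real \<Rightarrow> real^3 \<Rightarrow> real^3"
    and Q :: "nat \<Rightarrow> real^3 \<Rightarrow> real"
  assumes "N \<ge> 2"
    and "\<forall>\<alpha>\<in>{1..N}. m \<alpha> > 0"
    and "\<forall>\<alpha>\<in>{1..N}. e \<alpha> \<noteq> 0"
    and "admissible_solution N m e f E B"
    and "\<forall>\<alpha>\<in>{1..N}. is_asymptotic_charge (m \<alpha>) (f \<alpha>) (Q \<alpha>)"
    and "\<exists>u. total_asymptotic_charge N m e Q u \<noteq> 0"
  shows "\<exists>\<alpha>\<in>{1..N}. \<not> linear_scattering (m \<alpha>) (f \<alpha>)"
proof (rule ccontr)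
  assume "\<not> ?thesis"
  then have scat: "linear_scattering (m \<alpha>) (f \<alpha>)" if "\<alpha> \<in> {1..N}" for \<alpha> using that by blast
  have mpos: "m \<alpha> > 0" and e0: "e \<alpha> \<noteq> 0" and asy: "is_asymptotic_charge (m \<alpha>) (f \<alpha>) (Q \<alpha>)"
    if "\<alpha> \<in> {1..N}" for \<alpha> using assms that by auto
  obtain w where w: "total_asymptotic_charge N m e Q w \<noteq> 0" using assms(6) by blast
  obtain k C0 where k: "k > 0" and C0: "C0 > 0" and data: "admissible_data N e k f E B"
    and fd: "field_decay k C0 E B" and sol: "vlasov_maxwell_solution N m e f E B"
    using assms(4) unfolding admissible_solution_def by blast
  define Ee where "Ee = extend (\<lambda>(t, x). E t x)"
  define Be where "Be = extend (\<lambda>(t, x). B t x)"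
  define fe where "fe \<alpha> = extend (\<lambda>(t, x, v). f \<alpha> t x v)" for \<alpha>
  have C1E: "C1_on ({0..} \<times> UNIV) (\<lambda>(t, x). E t x)" and C1B: "C1_on ({0..} \<times> UNIV) (\<lambda>(t, x). B t x)"
    and C1f: "\<And>\<alpha>. \<alpha> \<in> {1..N} \<Longrightarrow> C1_on ({0..} \<times> UNIV) (\<lambda>(t, x, v). f \<alpha> t x v)"
    using sol unfolding vlasov_maxwell_solution_def by blast+
  have vl: "time_deriv (\<lambda>s. f \<alpha> s x v) t + velocity (m \<alpha>) v \<bullet> grad (\<lambda>y. f \<alpha> t y v) x
        + e \<alpha> * ((E t x + cross3 (velocity (m \<alpha>) v) (B t x)) \<bullet> grad (f \<alpha> t x) v) = 0"
    if "\<alpha> \<in> {1..N}" "t \<ge> 0" for \<alpha> t x v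
    using sol that unfolding vlasov_maxwell_solution_def by blast
  have mx: "time_deriv (\<lambda>s. E s x) t = curl (B t) x - (4 * pi) *\<^sub>R current_density N m e f t x"
    "divergence (E t) x = 4 * pi * charge_density N e f t x" if "t \<ge> 0" for t x
    using sol that unfolding vlasov_maxwell_solution_def by blast+
  obtain E' where E': "\<And>t x. t > 0 \<Longrightarrow> ((\<lambda>(t, x). E t x) has_derivative E' (t, x)) (at (t, x))"
      "\<And>t x. t > 0 \<Longrightarrow> (Ee has_derivative E' (t, x)) (at (t, x))"
      "\<And>h. continuous_on ({0<..} \<times> UNIV) (\<lambda>z. E' z h)" "continuous_on UNIV Ee"
    using C1_on_half_space[OF C1E] unfolding Ee_def by metis
  obtain B' where B': "\<And>t x. t > 0 \<Longrightarrow> ((\<lambda>(t, x). B t x) has_derivative B' (t, x)) (at (t, x))"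
      "\<And>t x. t > 0 \<Longrightarrow> (Be has_derivative B' (t, x)) (at (t, x))"
      "\<And>h. continuous_on ({0<..} \<times> UNIV) (\<lambda>z. B' z h)" "continuous_on UNIV Be"
    using C1_on_half_space[OF C1B] unfolding Be_def by metis
  have Ee: "Ee (t, x) = E t x" and Be: "Be (t, x) = B t x" if "t \<ge> 0" for t x
    using that by (simp_all add: Ee_def Be_def extend_eq)
  have fe: "fe \<alpha> (t, x, v) = f \<alpha> t x v" if "t \<ge> 0" for \<alpha> t x v
    using that by (simp add: fe_def extend_eq)
  have dE: "(E t has_derivative (\<lambda>h. E' (t, x) (0, h))) (at x)" if "t > 0" for t x
    using slice_has_derivative[OF E'(1)[OF that]] by simp
  have dB: "(B t has_derivative (\<lambda>h. B' (t, x) (0, h))) (at x)" if "t > 0" for t x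
    using slice_has_derivative[OF B'(1)[OF that]] by simp
  have fields: "decaying_fields Ee Be E' B'"
  proof
    fix \<delta> :: real assume \<delta>: "0 < \<delta>" "\<delta> < 1"
    from field_decay_interior[OF k C0 fd dE dB \<delta>]
    obtain CF \<tau> where D: "(\<tau> \<longlongrightarrow> (0::real)) at_top"
       "\<forall>t x. t \<ge> 1 \<longrightarrow> norm x \<le> (1 - \<delta>) * t \<longrightarrow> norm (E t x) \<le> CF / t\<^sup>2 \<and> norm (B t x) \<le> CF / t\<^sup>2"
       "\<forall>t x x'. t \<ge> 1 \<longrightarrow> norm x \<le> (1 - \<delta>) * t \<longrightarrow> norm x' \<le> (1 - \<delta>) * t \<longrightarrow>
          t\<^sup>2 * norm (E t x - E t x') \<le> \<tau> t * norm (x - x') \<and>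
          t\<^sup>2 * norm (B t x - B t x') \<le> \<tau> t * norm (x - x')" by blast
    show "\<exists>CF \<tau>. (\<tau> \<longlongrightarrow> (0::real)) at_top \<and>
       (\<forall>t x. t \<ge> 1 \<longrightarrow> norm x \<le> (1 - \<delta>) * t \<longrightarrow> norm (Ee (t, x)) \<le> CF / t\<^sup>2 \<and> norm (Be (t, x)) \<le> CF / t\<^sup>2) \<and>
       (\<forall>t x x'. t \<ge> 1 \<longrightarrow> norm x \<le> (1 - \<delta>) * t \<longrightarrow> norm x' \<le> (1 - \<delta>) * t \<longrightarrow>
          t\<^sup>2 * norm (Ee (t, x) - Ee (t, x')) \<le> \<tau> t * norm (x - x') \<and>
          t\<^sup>2 * norm (Be (t, x) - Be (t, x')) \<le> \<tau> t * norm (x - x'))"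
      by (intro exI[of _ CF] exI[of _ \<tau>] conjI D(1)) (use D(2,3) in \<open>auto simp: Ee Be\<close>)
  qed (use E' B' in auto)
  define \<rho> where "\<rho> = charge_density N e f"
  define j where "j = current_density N m e f"
  have maxwell: "maxwell_fields Ee Be E' B' \<rho> j"
  proof (intro maxwell_fields.intro fields maxwell_fields_axioms.intro)
    fix t :: real and x :: R3 assume t: "t > 0"
    show "(\<Sum>i\<in>Basis. E' (t, x) (0, i) \<bullet> i) = 4 * pi * \<rho> t x"
      using mx(2)[of t x] divergence_eq[OF dE[OF t]] t by (simp add: \<rho>_def)
    show "E' (t, x) (1, 0) = (\<Sum>i\<in>Basis. cross3 i (B' (t, x) (0, i))) - (4 * pi) *\<^sub>R j t x"
      using mx(1)[of t x] curl_eq[OF dB[OF t]] time_deriv_eq[OF E'(1)[OF t] t] t by (simp add: j_def)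
  qed
  define q where "q \<alpha> v = Q \<alpha> (v /\<^sub>R m \<alpha>)" for \<alpha> v
  \<comment> \<open>For \<open>norm x \<le> t + k\<close> the factor \<open>t - norm x + 2 * k\<close> is at least \<open>k\<close>.\<close>
  define C where "C = C0 / k"
  have fb: "norm (Ee (t, x)) \<le> C / (t + 2 * k) \<and> norm (Be (t, x)) \<le> C / (t + 2 * k)"
    if t: "t \<ge> 0" "norm x \<le> t + k" for t x
  proof -
    have "norm (E t x, B t x) \<le> C0 / ((t + norm x + 2 * k) * (t - norm x + 2 * k))"
      using fd t unfolding field_decay_def by auto
    also have "\<dots> \<le> C0 / ((t + 2 * k) * k)"
      using t k C0 norm_ge_zero[of x] by (intro divide_left_mono mult_mono mult_pos_pos) linarith+
    also have "\<dots> = C / (t + 2 * k)" by (simp add: C_def)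
    finally show ?thesis
      using norm_fst_le[of "E t x" "B t x"] norm_snd_le[of "B t x" "E t x"] by (simp add: Ee Be t)
  qed
  have "\<exists>f' g K0 C1. particles_in_fields (m \<alpha>) (e \<alpha>) k C Ee Be (fe \<alpha>) f' g (q \<alpha>) K0 C1 E' B'"
    if al: "\<alpha> \<in> {1..N}" for \<alpha>
  proof -
    obtain f' where f': "\<And>t y. t > 0 \<Longrightarrow> ((\<lambda>(t, x, v). f \<alpha> t x v) has_derivative f' (t, y)) (at (t, y))"
      "\<And>t y. t > 0 \<Longrightarrow> (fe \<alpha> has_derivative f' (t, y)) (at (t, y))"
      "\<And>h. continuous_on ({0<..} \<times> UNIV) (\<lambda>z. f' z h)" "continuous_on UNIV (fe \<alpha>)"
      using C1_on_half_space[OF C1f[OF al]] unfolding fe_def by metis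
    obtain g where g: "integrable lborel g"
      "((\<lambda>t. \<integral>\<^sup>+ (x, v). ennreal \<bar>f \<alpha> (t * energy (m \<alpha>) v) (x + t *\<^sub>R v) v - g (x, v)\<bar> \<partial>lborel) \<longlongrightarrow> 0) at_top"
      using scat[OF al] unfolding linear_scattering_def by blast
    obtain C1 where Q: "continuous_on UNIV (Q \<alpha>)" "compact (closure {u. Q \<alpha> u \<noteq> 0})"
      "\<forall>t\<ge>0. \<forall>v. \<bar>(LINT x|lborel. f \<alpha> t x v) - Q \<alpha> (v /\<^sub>R m \<alpha>)\<bar> \<le> C1 * (ln (2 + t)) ^ 5 / (2 + t)"
      using asy[OF al] unfolding is_asymptotic_charge_def by blast
    have "bounded {u. Q \<alpha> u \<noteq> 0}" using compact_imp_bounded[OF Q(2)] bounded_subset closure_subset by blast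
    then obtain K where K: "\<And>u. Q \<alpha> u \<noteq> 0 \<Longrightarrow> norm u \<le> K" unfolding bounded_iff by blast
    note mp = mpos[OF al]
    have "particles_in_fields (m \<alpha>) (e \<alpha>) k C Ee Be (fe \<alpha>) f' g (q \<alpha>) (m \<alpha> * K) C1 E' B'"
    proof (intro particles_in_fields.intro scattering_density.intro transported_density.intro
          scattering_density_axioms.intro particles_in_fields_axioms.intro fields)
      show "m \<alpha> > 0" "k > 0" "e \<alpha> \<noteq> 0" using mp k e0[OF al] by auto
      show "0 \<le> C" using C0 k by (simp add: C_def)
      show "continuous_on UNIV Ee" "continuous_on UNIV Be" "continuous_on UNIV (fe \<alpha>)" by (rule E' B' f')+
      show "integrable lborel g" by (rule g)
      show "(fe \<alpha> has_derivative f' (t, x, v)) (at (t, x, v))" if "t > 0" for t x v by (rule f'(2)[OF that])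
      show "f' (t, x, v) (1, velocity (m \<alpha>) v, e \<alpha> *\<^sub>R (Ee (t, x) + cross3 (velocity (m \<alpha>) v) (Be (t, x)))) = 0"
        if t: "t > 0" for t x v
        using vlasov_transport_form[OF f'(1)[OF t] t vl[OF al]] t by (simp add: Ee Be)
      show "0 \<le> fe \<alpha> (0, x, v)" for x v
        using data al unfolding admissible_data_def by (simp add: fe)
      show "norm x \<le> k \<and> norm v \<le> k" if "fe \<alpha> (0, x, v) \<noteq> 0" for x v
        using data al that unfolding admissible_data_def by (simp add: fe)
      show "norm (Ee (t, x)) \<le> C / (t + 2 * k) \<and> norm (Be (t, x)) \<le> C / (t + 2 * k)"
        if "t \<ge> 0" "norm x \<le> t + k" for t x by (rule fb[OF that])
      show "continuous_on UNIV (q \<alpha>)" unfolding q_def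
        by (rule continuous_on_compose2[OF Q(1)]) (auto intro!: continuous_intros)
      show "q \<alpha> v = 0" if "norm v > m \<alpha> * K" for v
      proof (rule ccontr)
        assume "q \<alpha> v \<noteq> 0"
        then have "norm (v /\<^sub>R m \<alpha>) \<le> K" unfolding q_def by (rule K)
        then have "norm v \<le> m \<alpha> * K" using mp by (simp add: field_simps)
        then show False using that by simp
      qed
      show "\<bar>(LINT x|lborel. fe \<alpha> (t, x, v)) - q \<alpha> v\<bar> \<le> C1 * (ln (2 + t)) ^ 5 / (2 + t)" if "t \<ge> 0" for t v
        using Q(3) that by (simp add: fe q_def)
      show "continuous_on ({0<..} \<times> UNIV) (\<lambda>z. f' z h)" for h by (rule f'(3))
      have "\<forall>\<^sub>F s in at_top. (\<integral>\<^sup>+ (x, v). ennreal \<bar>f \<alpha> (s * energy (m \<alpha>) v) (x + s *\<^sub>R v) v - g (x, v)\<bar> \<partial>lborel)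
          = (\<integral>\<^sup>+ (x, v). ennreal \<bar>fe \<alpha> (s * energy (m \<alpha>) v, x + s *\<^sub>R v, v) - g (x, v)\<bar> \<partial>lborel)"
        using eventually_ge_at_top[of 0]
      proof eventually_elim
        case (elim s)
        then have "fe \<alpha> (s * energy (m \<alpha>) v, x + s *\<^sub>R v, v) = f \<alpha> (s * energy (m \<alpha>) v) (x + s *\<^sub>R v) v" for x v
          using energy_pos[OF mp, of v] by (intro fe) auto
        then show ?case by simp
      qed
      from Lim_transform_eventually[OF g(2) this]
      show "((\<lambda>s. \<integral>\<^sup>+ (x, v). ennreal \<bar>fe \<alpha> (s * energy (m \<alpha>) v, x + s *\<^sub>R v, v) - g (x, v)\<bar> \<partial>lborel) \<longlongrightarrow> 0) at_top" .
    qed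
    then show ?thesis by blast
  qed
  then obtain f' g K0 C1 where species: "\<And>\<alpha>. \<alpha> \<in> {1..N} \<Longrightarrow>
      particles_in_fields (m \<alpha>) (e \<alpha>) k C Ee Be (fe \<alpha>) (f' \<alpha>) (g \<alpha>) (q \<alpha>) (K0 \<alpha>) (C1 \<alpha>) E' B'"
    by metis
  have "(\<Sum>\<alpha>=1..N. e \<alpha> * m \<alpha> ^ 3 * Q \<alpha> w) = 0"
  proof (rule asymptotic_charge_zero_if_scattering[OF maxwell species])
    show "\<rho> t x = (\<Sum>\<alpha>=1..N. e \<alpha> * (LINT v|lborel. fe \<alpha> (t, x, v)))" if "t > 0" for t x
      using that by (simp add: \<rho>_def charge_density_def fe)
    show "j t x = (\<Sum>\<alpha>=1..N. e \<alpha> *\<^sub>R (LINT v|lborel. fe \<alpha> (t, x, v) *\<^sub>R velocity (m \<alpha>) v))" if "t > 0" for t x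
      using that by (simp add: j_def current_density_def fe)
    show "continuous_on UNIV (Q \<alpha>)" if "\<alpha> \<in> {1..N}" for \<alpha>
      using asy[OF that] unfolding is_asymptotic_charge_def by blast
    show "q \<alpha> v = Q \<alpha> (v /\<^sub>R m \<alpha>)" for \<alpha> v by (simp add: q_def)
  qed
  then show False using w by (simp add: total_asymptotic_charge_def)
qed

end
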